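(* Let $\{\epsilon_{i,j}:i,j\in\mathbb Z\}$ be independent real random variables with mean zero and variance one satisfying the Pastur condition $$\lim_{n\to\infty}\frac1{n^2}\sum_{i,j=1}^nE\big[\epsilon_{i,j}^2\mathbf 1(|\epsilon_{i,j}|>\varepsilon\sqrt n)\big]=0\quad\text{for all }\varepsilon>0.$$ Let $\{c_{k,l}:k,l\in\mathbb Z\}$ be deterministic real numbers such that $0<\sum_{k,l\in\mathbb Z}|c_{k,l}|<\infty$ and $c_{k,l}=c_{l,k}$ for all $k,l\in\mathbb Z$. Define $$Z_{i,j}:=\sum_{k,l\in\mathbb Z}c_{k,l}\,\epsilon_{i-k,j-l},\quad i,j\in\mathbb Z,$$ the sum converging in $L^2$. For $n\ge1$ let $A_n$ be the $n\times n$ symmetric matrix whose $(i,j)$-th entry is $Z_{i\wedge j,\,i\vee j}$, let $\lambda_1\le\dots\le\lambda_n$ be its eigenvalues, and let $\mu_n:=\frac1n\sum_{i=1}^n\delta_{\lambda_i/\sqrt n}$. Set $R(u,v):=\sum_{k,l\in\mathbb Z}c_{k,l}c_{k-u,l+v}$ for $u,v\in\mathbb Z$, and let $\mu$ be the unique probability measure on $\mathbb R$ whose odd moments are all zero and whose $2m$-th moment is $\beta_{2m}$ for every $m\ge1$, where $\beta_{2m}$ is the number defined from $R$ in the context. Then, as $n\to\infty$, $\mu_n$ converges weakly in probability to $\mu$.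
   Context: Notation: $a\wedge b=\min(a,b)$, $a\vee b=\max(a,b)$. One has $R(u,v)=E(Z_{i,j}Z_{i-u,j+v})$ for all $i,j,u,v\in\mathbb Z$, $R(u,v)=R(v,u)$, and $\sum_{u,v}|R(u,v)|<\infty$. For $m\ge1$, $NC_2(2m)$ is the set of non-crossing pair partitions of $\{1,\dots,2m\}$. For $\sigma\in NC_2(2m)$, its Kreweras complement is the maximal (coarsest) partition $\overline\sigma$ of $\{\overline1,\dots,\overline{2m}\}$ such that $\sigma\cup\overline\sigma$ is a non-crossing partition of the ordered set $1<\overline1<2<\overline2<\dots<2m<\overline{2m}$. It has $m+1$ blocks $V_1,\dots,V_{m+1}$, regarded (dropping bars) as subsets of $\{1,\dots,2m\}$. Define $$S(\sigma):=\Big\{(k_1,\dots,k_{2m})\in\mathbb Z^{2m}:\ \sum_{j\in V_s}k_j=0,\ s=1,\dots,m+1\Big\},$$ $$\beta_{2m}:=\sum_{\sigma\in NC_2(2m)}\ \sum_{k\in S(\sigma)}\ \prod_{(u,v)\in\sigma}R(k_u,k_v),\quad m\ge1,$$ an absolutely convergent sum. "$\mu_n$ converges weakly in probability to $\mu$" means $L(\mu_n,\mu)\to0$ in probability, where $L$ is the Lévy distance: $L(\nu_1,\nu_2):=\inf\{\varepsilon>0:\nu_1((-\infty,x-\varepsilon])-\varepsilon\le\nu_2((-\infty,x])\le\nu_1((-\infty,x+\varepsilon])+\varepsilon\text{ for all }x\in\mathbb R\}$. *)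

theory Defs
  imports
    "HOL-Probability.Probability"
    "HOL-Library.Disjoint_Sets"
    "Jordan_Normal_Form.Char_Poly"
begin

section \<open>Non-crossing pair partitions and the moments of the limit law\<close>

definition noncrossing :: "nat set set \<Rightarrow> bool" where
  "noncrossing P \<longleftrightarrow>
     (\<forall>B\<in>P. \<forall>C\<in>P. \<forall>a b c d. a < b \<and> b < c \<and> c < d \<and> a \<in> B \<and> c \<in> B \<and> b \<in> C \<and> d \<in> C \<longrightarrow> B = C)"

definition NC2 :: "nat \<Rightarrow> nat set set set" where
  "NC2 N = {\<sigma>. partition_on {1..N} \<sigma> \<and> (\<forall>B\<in>\<sigma>. card B = 2) \<and> noncrossing \<sigma>}"

text \<open>
  The ordered set consisting of 1, 1-bar, 2, 2-bar, and so on is encoded in the natural numbers,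
  with i represented by 2i and i-bar by 2i+1. The second argument is a partition of the barred
  points, written without bars.
\<close>

definition interleave :: "nat set set \<Rightarrow> nat set set \<Rightarrow> nat set set" where
  "interleave \<sigma> \<tau> = (\<lambda>B. (\<lambda>i. 2 * i) ` B) ` \<sigma> \<union> (\<lambda>B. (\<lambda>i. 2 * i + 1) ` B) ` \<tau>"

definition kreweras :: "nat \<Rightarrow> nat set set \<Rightarrow> nat set set" where
  "kreweras N \<sigma> = (THE \<tau>. partition_on {1..N} \<tau> \<and> noncrossing (interleave \<sigma> \<tau>) \<and>
     (\<forall>\<tau>'. partition_on {1..N} \<tau>' \<and> noncrossing (interleave \<sigma> \<tau>') \<longrightarrow> refines {1..N} \<tau>' \<tau>))"

text \<open>Tuples of N integers are functions that are \<^const>\<open>undefined\<close> outside of 1, ..., N.\<close>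

definition S_set :: "nat \<Rightarrow> nat set set \<Rightarrow> (nat \<Rightarrow> int) set" where
  "S_set N \<sigma> = {k \<in> {1..N} \<rightarrow>\<^sub>E UNIV. \<forall>V\<in>kreweras N \<sigma>. (\<Sum>j\<in>V. k j) = 0}"

definition corr :: "(int \<Rightarrow> int \<Rightarrow> real) \<Rightarrow> int \<Rightarrow> int \<Rightarrow> real" where
  "corr c u v = (\<Sum>\<^sub>\<infinity>(k, l)\<in>UNIV. c k l * c (k - u) (l + v))"

text \<open>
  The argument \<open>m\<close> gives the moment of order 2m. A pair of \<open>\<sigma>\<close> is listed in increasing
  order; the order is immaterial because \<open>R\<close> is symmetric for symmetric coefficients.
\<close>

definition beta :: "(int \<Rightarrow> int \<Rightarrow> real) \<Rightarrow> nat \<Rightarrow> real" where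
  "beta R m = (\<Sum>\<sigma>\<in>NC2 (2 * m). \<Sum>\<^sub>\<infinity>k\<in>S_set (2 * m) \<sigma>. \<Prod>B\<in>\<sigma>. R (k (Min B)) (k (Max B)))"

definition is_limit_law :: "(int \<Rightarrow> int \<Rightarrow> real) \<Rightarrow> real measure \<Rightarrow> bool" where
  "is_limit_law R \<mu> \<longleftrightarrow> prob_space \<mu> \<and> sets \<mu> = sets borel \<and>
     (\<forall>p. integrable \<mu> (\<lambda>x. x ^ p)) \<and>
     (\<forall>p. odd p \<longrightarrow> (\<integral>x. x ^ p \<partial>\<mu>) = 0) \<and>
     (\<forall>m\<ge>1. (\<integral>x. x ^ (2 * m) \<partial>\<mu>) = beta R m)"

section \<open>The random matrices\<close>

text \<open>
  \<open>Y\<close> is a version of the unordered sum of the family \<open>X\<close> in the space of square integrable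
  random variables. The nonnegative integral makes a difference that is not square integrable
  count as infinitely large.
\<close>

definition has_L2_sum :: "'a measure \<Rightarrow> ('i \<Rightarrow> 'a \<Rightarrow> real) \<Rightarrow> ('a \<Rightarrow> real) \<Rightarrow> bool" where
  "has_L2_sum M X Y \<longleftrightarrow> Y \<in> borel_measurable M \<and>
     ((\<lambda>F. \<integral>\<^sup>+\<omega>. ennreal ((Y \<omega> - (\<Sum>i\<in>F. X i \<omega>))\<^sup>2) \<partial>M) \<longlongrightarrow> 0) (finite_subsets_at_top UNIV)"

text \<open>Rows and columns of \<^typ>\<open>real mat\<close> are numbered from 0.\<close>

definition sym_matrix :: "(int \<Rightarrow> int \<Rightarrow> real) \<Rightarrow> nat \<Rightarrow> real mat" where
  "sym_matrix z n = mat n n (\<lambda>(i, j).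
     z (min (int (i + 1)) (int (j + 1))) (max (int (i + 1)) (int (j + 1))))"

text \<open>
  The real eigenvalues in increasing order, repeated according to their multiplicity. For a
  symmetric matrix of dimension \<open>n\<close> this list has length \<open>n\<close>.
\<close>

definition eigenvalue_list :: "real mat \<Rightarrow> real list" where
  "eigenvalue_list A = sorted_list_of_multiset (proots (char_poly A))"

definition scaled_esd :: "real mat \<Rightarrow> real measure" where
  "scaled_esd A = (let n = dim_row A in
     distr (uniform_count_measure {..<n}) borel (\<lambda>i. eigenvalue_list A ! i / sqrt (real n)))"

section \<open>Weak convergence in probability\<close>

definition levy_dist :: "real measure \<Rightarrow> real measure \<Rightarrow> real" where
  "levy_dist \<nu>\<^sub>1 \<nu>\<^sub>2 = Inf {\<epsilon>. 0 < \<epsilon> \<and>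
     (\<forall>x. measure \<nu>\<^sub>1 {..x - \<epsilon>} - \<epsilon> \<le> measure \<nu>\<^sub>2 {..x} \<and>
          measure \<nu>\<^sub>2 {..x} \<le> measure \<nu>\<^sub>1 {..x + \<epsilon>} + \<epsilon>)}"

text \<open>
  Measurability is part of the notion: \<^const>\<open>measure\<close> is 0 on sets that are not measurable, so
  without it the limit could hold for the wrong reason.
\<close>

definition converges_in_prob :: "'a measure \<Rightarrow> (nat \<Rightarrow> 'a \<Rightarrow> real) \<Rightarrow> real \<Rightarrow> bool" where
  "converges_in_prob M X a \<longleftrightarrow> (\<forall>n. X n \<in> borel_measurable M) \<and>
     (\<forall>\<delta>>0. (\<lambda>n. measure M {\<omega> \<in> space M. \<delta> < \<bar>X n \<omega> - a\<bar>}) \<longlonglongrightarrow> 0)"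

definition weakly_converges_in_prob ::
    "'a measure \<Rightarrow> (nat \<Rightarrow> 'a \<Rightarrow> real measure) \<Rightarrow> real measure \<Rightarrow> bool" where
  "weakly_converges_in_prob M \<mu>s \<mu> \<longleftrightarrow>
     converges_in_prob M (\<lambda>n \<omega>. levy_dist (\<mu>s n \<omega>) \<mu>) 0"

end

theory Submission
  imports Defs "HOL-Real_Asymp.Real_Asymp"
begin

text \<open>
  The proof works with the resolvent \<open>G = (A / \<surd>n - \<i> y)\<^sup>-\<^sup>1\<close> for large real \<open>y\<close>. Truncating the
  filter and wrapping the indices around changes the normalized trace of \<open>G\<close> by little, and makes
  the averages \<open>g k = n\<^sup>-\<^sup>1 \<Sum>i. G i (i + k)\<close> invariant under shifts. A second order
  expansion of \<open>G\<close> in each single noise variable shows that, in mean square,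
  \<open>\<i> y g k + \<delta> k + \<Sum>u v. R u v * g (- u) * g (k - v)\<close> tends to 0. For large \<open>y\<close> the exact
  equation is a contraction. Its solution is the generating series of the sums over
  non-crossing pairings with the Kreweras block of the last point constrained to sum \<open>k\<close>: these
  sums obey the same convolution recursion, obtained by removing the pair of the first point.
  Finally, convergence of Stieltjes transforms at all large \<open>\<i> N\<close> to a series of geometrically bounded
  coefficients forces tightness and identifies the moments. It also yields the existence of the
  limit law, as a limit of sampled spectral distributions.
\<close>

section \<open>The moment problem via Stieltjes transforms\<close>

text \<open>The noise has only two moments, so moments of the matrix itself are out of reach without
  truncating the variables; resolvents at \<open>\<i> y\<close> are bounded by \<open>1 / y\<close>
  for every sample. Correlated entries prevent the equation from closing on the trace alone: each
  shift by the filter moves off the diagonal, which forces the whole family \<open>g k\<close>. No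
  separate variance estimate is made, because the conjugate of the residual serves as test function
  in the expansion and the second moment of the residual comes out directly. Cyclic indexing makes
  the Kronecker delta periodic in \<open>k\<close>, while the limit equation has the plain delta.
  Every round of the contraction shifts indices by at most \<open>2 K\<close>, so a fixed number of
  rounds stays below \<open>n\<close>; a fixed number suffices, since the starting error is bounded
  and its contribution halves each time. The order of choices is therefore the filter box
  \<open>K\<close>, the number of rounds \<open>J\<close>, and last \<open>n\<close>. The limit law
  is not known in advance to exist, so the moment problem is posed for a sequence of numbers of
  geometric growth rather than for a given measure.\<close>

text \<open>
  Up to powers of \<open>N\<close>, the parts of order 0 and 1 are the imaginary and the real part of the
  Stieltjes transform at \<open>\<i> N\<close>.
\<close>

definition mass_part :: "real measure \<Rightarrow> nat \<Rightarrow> real \<Rightarrow> real" where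
  "mass_part \<nu> q N = (\<integral>x. x ^ q * (N\<^sup>2 / (x\<^sup>2 + N\<^sup>2)) \<partial>\<nu>)"

lemma kernel_le_1: "N\<^sup>2 / (x\<^sup>2 + N\<^sup>2) \<le> (1::real)" and kernel_nonneg: "0 \<le> N\<^sup>2 / (x\<^sup>2 + N\<^sup>2)" for N x :: real
  by (auto simp: divide_le_eq_1 sum_power2_gt_zero_iff add_pos_nonneg order.strict_iff_order)

lemma kernel_measurable [measurable]: "(\<lambda>x::real. x ^ q * (N\<^sup>2 / (x\<^sup>2 + N\<^sup>2))) \<in> borel_measurable borel"
  by measurable

lemma kernel_tendsto: "(\<lambda>N. (real N)\<^sup>2 / (x\<^sup>2 + (real N)\<^sup>2)) \<longlonglongrightarrow> 1"
  by real_asymp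

lemma kernel_mono: assumes "0 \<le> M" "M \<le> N" shows "M\<^sup>2 / (x\<^sup>2 + M\<^sup>2) \<le> N\<^sup>2 / (x\<^sup>2 + (N::real)\<^sup>2)"
proof (cases "M = 0")
  case False
  have "M\<^sup>2 \<le> N\<^sup>2" using assms by (simp add: power_mono)
  moreover have "x\<^sup>2 + M\<^sup>2 > 0" "x\<^sup>2 + N\<^sup>2 > 0" using assms False by (auto simp: add_nonneg_pos)
  ultimately show ?thesis by (simp add: field_simps mult_right_mono)
qed (simp add: kernel_nonneg)

lemma norm_kernel_le: "norm (x ^ q * (N\<^sup>2 / (x\<^sup>2 + N\<^sup>2))) \<le> norm (x ^ q)" for x N :: real
  using mult_left_le[OF kernel_le_1[of N x], of "\<bar>x ^ q\<bar>"] kernel_nonneg[of N x]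
  by (simp only: real_norm_def abs_mult) simp

lemma (in real_distribution) kernel_integrable:
  assumes "integrable M (\<lambda>x. x ^ q)"
  shows "integrable M (\<lambda>x. x ^ q * (N\<^sup>2 / (x\<^sup>2 + N\<^sup>2)))"
proof (rule Bochner_Integration.integrable_bound[OF assms])
  show "AE x in M. norm (x ^ q * (N\<^sup>2 / (x\<^sup>2 + N\<^sup>2))) \<le> norm (x ^ q)"
    by (intro AE_I2 norm_kernel_le)
qed (simp add: kernel_measurable)

text \<open>Under geometric growth the terms are dominated by a geometric series of ratio
  \<open>C\<^sup>2 / N\<^sup>2\<close>; splitting off the term \<open>j = 0\<close> leaves that
  ratio as a factor of the rest.\<close>

lemma alternating_series_bound:
  fixes d :: "nat \<Rightarrow> real"
  assumes d: "\<And>p. \<bar>d p\<bar> \<le> B * C ^ p" and C: "0 \<le> C" and N: "C < N"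
  shows "summable (\<lambda>j. (-1) ^ j * d (q + 2 * j) / N ^ (2 * j))"
    and "\<bar>(\<Sum>j. (-1) ^ j * d (q + 2 * j) / N ^ (2 * j)) - d q\<bar> \<le> B * C ^ q * (C\<^sup>2 / (N\<^sup>2 - C\<^sup>2))"
proof -
  define r where "r = C\<^sup>2 / N\<^sup>2"
  have N0: "N > 0" using assms by linarith
  have CN: "C\<^sup>2 < N\<^sup>2" using C N by (simp add: power_strict_mono)
  have r: "0 \<le> r" "r < 1" unfolding r_def using CN N0 by auto
  have b: "norm ((-1) ^ j * d (q + 2 * j) / N ^ (2 * j)) \<le> B * C ^ q * r ^ j" for j
  proof -
    have "norm ((-1) ^ j * d (q + 2 * j) / N ^ (2 * j)) = \<bar>d (q + 2 * j)\<bar> / N ^ (2 * j)"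
      using N0 by (simp add: abs_mult)
    also have "\<dots> \<le> B * C ^ (q + 2 * j) / N ^ (2 * j)"
      using d N0 by (intro divide_right_mono) auto
    also have "\<dots> = B * C ^ q * r ^ j" unfolding r_def by (simp add: power_add power_mult power_divide)
    finally show ?thesis .
  qed
  have sg: "summable (\<lambda>j. B * C ^ q * r ^ j)" using r by (intro summable_mult summable_geometric) auto
  show s: "summable (\<lambda>j. (-1) ^ j * d (q + 2 * j) / N ^ (2 * j))"
    by (rule summable_comparison_test'[OF sg, of 0]) (use b in auto)
  have "(\<Sum>j. (-1) ^ j * d (q + 2 * j) / N ^ (2 * j)) - d q
     = (\<Sum>j. (-1) ^ Suc j * d (q + 2 * Suc j) / N ^ (2 * Suc j))"
    using suminf_split_head[OF s] by simp
  also have "norm \<dots> \<le> (\<Sum>j. B * C ^ q * r ^ Suc j)"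
  proof (rule norm_suminf_le)
    show "summable (\<lambda>j. B * C ^ q * r ^ Suc j)" using sg summable_Suc_iff[of "\<lambda>j. B * C ^ q * r ^ j"] by simp
    show "norm ((-1) ^ Suc j * d (q + 2 * Suc j) / N ^ (2 * Suc j)) \<le> B * C ^ q * r ^ Suc j" for j
      by (rule b)
  qed
  also have "\<dots> = (\<Sum>j. (B * C ^ q * r) * r ^ j)" by (simp add: mult_ac)
  also have "\<dots> = B * C ^ q * r * (1 / (1 - r))"
    using r by (subst suminf_mult) (auto intro!: summable_geometric simp: suminf_geometric)
  also have "B * C ^ q * r * (1 / (1 - r)) = B * C ^ q * (r * (1 / (1 - r)))" by simp
  also have "r * (1 / (1 - r)) = C\<^sup>2 / (N\<^sup>2 - C\<^sup>2)"
    unfolding r_def using N0 CN by (simp add: field_simps)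
  finally show "\<bar>(\<Sum>j. (-1) ^ j * d (q + 2 * j) / N ^ (2 * j)) - d q\<bar> \<le> B * C ^ q * (C\<^sup>2 / (N\<^sup>2 - C\<^sup>2))"
    by simp
qed

lemma alternating_series_tendsto:
  fixes d :: "nat \<Rightarrow> real"
  assumes d: "\<And>p. \<bar>d p\<bar> \<le> B * C ^ p" and C: "0 \<le> C"
  shows "(\<lambda>N. \<Sum>j. (-1) ^ j * d (q + 2 * j) / real N ^ (2 * j)) \<longlonglongrightarrow> d q"
proof -
  have "(\<lambda>N. B * C ^ q * (C\<^sup>2 / ((real N)\<^sup>2 - C\<^sup>2))) \<longlonglongrightarrow> 0" by real_asymp
  moreover have "eventually (\<lambda>N. norm ((\<Sum>j. (-1) ^ j * d (q + 2 * j) / real N ^ (2 * j)) - d q)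
     \<le> B * C ^ q * (C\<^sup>2 / ((real N)\<^sup>2 - C\<^sup>2))) sequentially"
    using eventually_gt_at_top[of "nat \<lceil>C\<rceil>"]
  proof eventually_elim
    case (elim N)
    then have "C < real N" by linarith
    then show ?case using alternating_series_bound(2)[OF d C] by simp
  qed
  ultimately have "(\<lambda>N. (\<Sum>j. (-1) ^ j * d (q + 2 * j) / real N ^ (2 * j)) - d q) \<longlonglongrightarrow> 0"
    by (rule Lim_null_comparison[rotated])
  then show ?thesis by (simp add: LIM_zero_iff)
qed

text \<open>
  The recursion \<open>x\<^sup>q\<^sup>+\<^sup>2 K = N\<^sup>2 (x\<^sup>q - x\<^sup>q K)\<close> for the kernel \<open>K = N\<^sup>2 / (x\<^sup>2 + N\<^sup>2)\<close> turns an
  expansion at order \<open>q\<close> into one at order \<open>q + 2\<close> as soon as the \<open>q\<close>-th moment is known.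
\<close>

lemma (in real_distribution) mass_part_expansion:
  fixes d :: "nat \<Rightarrow> real"
  assumes d: "\<And>p. \<bar>d p\<bar> \<le> B * C ^ p" and C: "0 \<le> C" and N0: "C < real N0"
    and m0: "\<And>N. N0 \<le> N \<Longrightarrow> mass_part M 0 (real N) = (\<Sum>j. (-1) ^ j * d (2 * j) / real N ^ (2 * j))"
    and m1: "\<And>N. N0 \<le> N \<Longrightarrow> mass_part M 1 (real N) = (\<Sum>j. (-1) ^ j * d (1 + 2 * j) / real N ^ (2 * j))"
  shows "integrable M (\<lambda>x. x ^ p) \<and> (\<integral>x. x ^ p \<partial>M) = d p"
proof -
  define S where "S q N = (\<Sum>j. (-1) ^ j * d (q + 2 * j) / real N ^ (2 * j))" for q N
  have Slim: "S q \<longlonglongrightarrow> d q" for q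
    unfolding S_def[abs_def] by (rule alternating_series_tendsto[OF d C])
  \<comment> \<open>Shifting the index of the series mirrors the recursion of the kernel, so both
    sides advance from \<open>q\<close> to \<open>q + 2\<close> by the same rule.\<close>
  have Sstep: "S (q + 2) N = (real N)\<^sup>2 * (d q - S q N)" if "N0 \<le> N" for q N
  proof -
    have N: "C < real N" "real N > 0" using N0 that C by auto
    note s = alternating_series_bound(1)[OF d C N(1)]
    have "S q N - d q = (\<Sum>j. (-1) ^ Suc j * d (q + 2 * Suc j) / real N ^ (2 * Suc j))"
      using suminf_split_head[OF s[of q]] by (simp add: S_def)
    also have "\<dots> = (\<Sum>j. (- 1 / (real N)\<^sup>2) * ((-1) ^ j * d (q + 2 + 2 * j) / real N ^ (2 * j)))"
      by (rule suminf_cong) (simp add: power2_eq_square)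
    also have "\<dots> = (- 1 / (real N)\<^sup>2) * S (q + 2) N"
      unfolding S_def by (rule suminf_mult[OF s])
    finally show ?thesis using N(2) by (simp add: field_simps)
  qed
  have step: "mass_part M (q + 2) (real N) = S (q + 2) N"
    if "integrable M (\<lambda>x. x ^ q)" "(\<integral>x. x ^ q \<partial>M) = d q" "mass_part M q (real N) = S q N" "N0 \<le> N" for q N
  proof -
    have N: "real N > 0" using N0 C that by auto
    have "mass_part M (q + 2) (real N) = (\<integral>x. (real N)\<^sup>2 * (x ^ q - x ^ q * ((real N)\<^sup>2 / (x\<^sup>2 + (real N)\<^sup>2))) \<partial>M)"
      unfolding mass_part_def
    proof (rule Bochner_Integration.integral_cong[OF refl])
      fix x :: real
      have "x\<^sup>2 + (real N)\<^sup>2 > 0" using N by (simp add: add_nonneg_pos)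
      then show "x ^ (q + 2) * ((real N)\<^sup>2 / (x\<^sup>2 + (real N)\<^sup>2)) = (real N)\<^sup>2 * (x ^ q - x ^ q * ((real N)\<^sup>2 / (x\<^sup>2 + (real N)\<^sup>2)))"
        by (simp add: divide_simps power_add) (simp add: algebra_simps power2_eq_square)
    qed
    also have "\<dots> = (real N)\<^sup>2 * (d q - mass_part M q (real N))"
      using that kernel_integrable[OF that(1)] by (simp add: mass_part_def)
    finally show ?thesis using Sstep[OF that(4)] that(3) by simp
  qed
  \<comment> \<open>For even exponents the integrands increase with \<open>N\<close>, so monotone
    convergence yields integrability and the value of the moment at once.\<close>
  have even_moment: "integrable M (\<lambda>x. x ^ (2 * k)) \<and> (\<integral>x. x ^ (2 * k) \<partial>M) = d (2 * k)"
    if "\<And>N. N0 \<le> N \<Longrightarrow> mass_part M (2 * k) (real N) = S (2 * k) N"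
      and "\<And>N. integrable M (\<lambda>x. x ^ (2 * k) * (N\<^sup>2 / (x\<^sup>2 + N\<^sup>2)))" for k
  proof -
    have "has_bochner_integral M (\<lambda>x. x ^ (2 * k)) (d (2 * k))"
    proof (rule has_bochner_integral_monotone_convergence)
      show "integrable M (\<lambda>x. x ^ (2 * k) * ((real i)\<^sup>2 / (x\<^sup>2 + (real i)\<^sup>2)))" for i by (rule that)
      show "AE x in M. mono (\<lambda>n. x ^ (2 * k) * ((real n)\<^sup>2 / (x\<^sup>2 + (real n)\<^sup>2)))"
        by (intro AE_I2 monoI mult_left_mono kernel_mono) (auto simp: zero_le_even_power)
      show "AE x in M. (\<lambda>i. x ^ (2 * k) * ((real i)\<^sup>2 / (x\<^sup>2 + (real i)\<^sup>2))) \<longlonglongrightarrow> x ^ (2 * k)"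
        using tendsto_mult_left[OF kernel_tendsto] by (intro AE_I2) fastforce
      have "eventually (\<lambda>N. S (2 * k) N = mass_part M (2 * k) (real N)) sequentially"
        using eventually_ge_at_top[of N0] by eventually_elim (rule that(1)[symmetric])
      then have "(\<lambda>N. mass_part M (2 * k) (real N)) \<longlonglongrightarrow> d (2 * k)"
        by (rule Lim_transform_eventually[OF Slim])
      then show "(\<lambda>i. \<integral>x. x ^ (2 * k) * ((real i)\<^sup>2 / (x\<^sup>2 + (real i)\<^sup>2)) \<partial>M) \<longlonglongrightarrow> d (2 * k)"
        by (simp add: mass_part_def)
    qed simp
    then show ?thesis by (auto simp: has_bochner_integral_iff)
  qed
  have evens: "(integrable M (\<lambda>x. x ^ (2 * k)) \<and> (\<integral>x. x ^ (2 * k) \<partial>M) = d (2 * k)) \<and>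
      (\<forall>N\<ge>N0. mass_part M (2 * k) (real N) = S (2 * k) N)" for k
  proof (induction k)
    case 0
    have "\<forall>N\<ge>N0. mass_part M (2 * 0) (real N) = S (2 * 0) N" using m0 by (simp add: S_def)
    moreover have "integrable M (\<lambda>x. x ^ (2 * 0) * (N\<^sup>2 / (x\<^sup>2 + N\<^sup>2)))" for N
      by (rule kernel_integrable) simp
    ultimately show ?case using even_moment[of 0] by blast
  next
    case (Suc k)
    have mp: "\<forall>N\<ge>N0. mass_part M (2 * Suc k) (real N) = S (2 * Suc k) N" using step[of "2 * k"] Suc by simp
    moreover have "integrable M (\<lambda>x. x ^ (2 * Suc k) * (N\<^sup>2 / (x\<^sup>2 + N\<^sup>2)))" for N :: real
    proof (rule Bochner_Integration.integrable_bound[where f = "\<lambda>x. N\<^sup>2 * x ^ (2 * k)"])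
      show "integrable M (\<lambda>x. N\<^sup>2 * x ^ (2 * k))" using Suc by simp
      have "norm (x ^ (2 * Suc k) * (N\<^sup>2 / (x\<^sup>2 + N\<^sup>2))) \<le> norm (N\<^sup>2 * x ^ (2 * k))" for x :: real
      proof -
        have "x\<^sup>2 / (x\<^sup>2 + N\<^sup>2) \<le> 1" using kernel_le_1[of x N] by (simp add: add.commute)
        then have "N\<^sup>2 * x ^ (2 * k) * (x\<^sup>2 / (x\<^sup>2 + N\<^sup>2)) \<le> N\<^sup>2 * x ^ (2 * k)"
          by (intro mult_left_le) (auto simp: zero_le_even_power)
        then show ?thesis by (simp add: power2_eq_square power_add algebra_simps abs_mult zero_le_even_power)
      qed
      then show "AE x in M. norm (x ^ (2 * Suc k) * (N\<^sup>2 / (x\<^sup>2 + N\<^sup>2))) \<le> norm (N\<^sup>2 * x ^ (2 * k))" by simp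
    qed (simp add: kernel_measurable)
    ultimately show ?case using even_moment[of "Suc k"] by blast
  qed
  \<comment> \<open>Odd powers are dominated by the two neighbouring even ones; once integrability
    is known, dominated convergence takes the place of monotone convergence.\<close>
  have odd_int: "integrable M (\<lambda>x. x ^ (1 + 2 * k))" for k
  proof (rule Bochner_Integration.integrable_bound[where f = "\<lambda>x. x ^ (2 * k) + x ^ (2 * Suc k)"])
    show "integrable M (\<lambda>x. x ^ (2 * k) + x ^ (2 * Suc k))" using evens by (intro Bochner_Integration.integrable_add) blast+
    have "norm (x ^ (1 + 2 * k)) \<le> norm (x ^ (2 * k) + x ^ (2 * Suc k))" for x :: real
    proof -
      have "\<bar>x\<bar> \<le> 1 + x\<^sup>2" using zero_le_power2[of "\<bar>x\<bar> - 1"] by (simp add: power2_diff)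
      then have "\<bar>x\<bar> * x ^ (2 * k) \<le> (1 + x\<^sup>2) * x ^ (2 * k)" by (rule mult_right_mono) (simp add: zero_le_even_power)
      moreover have "\<bar>x ^ (2*k)\<bar> = x ^ (2*k)" by (simp add: zero_le_even_power)
      ultimately show ?thesis by (simp add: abs_mult power_add power2_eq_square algebra_simps zero_le_even_power)
    qed
    then show "AE x in M. norm (x ^ (1 + 2 * k)) \<le> norm (x ^ (2 * k) + x ^ (2 * Suc k))" by simp
  qed simp
  have odd_moment: "(\<integral>x. x ^ (1 + 2 * k) \<partial>M) = d (1 + 2 * k)"
    if "\<And>N. N0 \<le> N \<Longrightarrow> mass_part M (1 + 2 * k) (real N) = S (1 + 2 * k) N" for k
  proof -
    have "(\<lambda>i. \<integral>x. x ^ (1 + 2 * k) * ((real i)\<^sup>2 / (x\<^sup>2 + (real i)\<^sup>2)) \<partial>M) \<longlonglongrightarrow> (\<integral>x. x ^ (1 + 2 * k) \<partial>M)"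
    proof (rule integral_dominated_convergence[where w = "\<lambda>x. \<bar>x ^ (1 + 2 * k)\<bar>"])
      show "integrable M (\<lambda>x. \<bar>x ^ (1 + 2 * k)\<bar>)" using odd_int by (rule integrable_abs)
      show "AE x in M. (\<lambda>i. x ^ (1 + 2 * k) * ((real i)\<^sup>2 / (x\<^sup>2 + (real i)\<^sup>2))) \<longlonglongrightarrow> x ^ (1 + 2 * k)"
        using tendsto_mult_left[OF kernel_tendsto] by (intro AE_I2) fastforce
      show "AE x in M. norm (x ^ (1 + 2 * k) * ((real i)\<^sup>2 / (x\<^sup>2 + (real i)\<^sup>2))) \<le> \<bar>x ^ (1 + 2 * k)\<bar>" for i
        using norm_kernel_le[of _ "1 + 2 * k" "real i"] by (intro AE_I2) simp
    qed (simp_all add: kernel_measurable)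
    moreover have "eventually (\<lambda>N. S (1 + 2 * k) N = mass_part M (1 + 2 * k) (real N)) sequentially"
      using eventually_ge_at_top[of N0] by eventually_elim (rule that(1)[symmetric])
    then have "(\<lambda>N. mass_part M (1 + 2 * k) (real N)) \<longlonglongrightarrow> d (1 + 2 * k)"
      by (rule Lim_transform_eventually[OF Slim])
    ultimately show ?thesis unfolding mass_part_def by (rule LIMSEQ_unique)
  qed
  have odds: "(\<integral>x. x ^ (1 + 2 * k) \<partial>M) = d (1 + 2 * k) \<and>
      (\<forall>N\<ge>N0. mass_part M (1 + 2 * k) (real N) = S (1 + 2 * k) N)" for k
  proof (induction k)
    case 0
    have "\<forall>N\<ge>N0. mass_part M (1 + 2 * 0) (real N) = S (1 + 2 * 0) N" using m1 by (simp add: S_def)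
    then show ?case using odd_moment[of 0] by blast
  next
    case (Suc k)
    have "\<forall>N\<ge>N0. mass_part M (1 + 2 * k + 2) (real N) = S (1 + 2 * k + 2) N"
      using step[OF odd_int] Suc by blast
    moreover have "1 + 2 * k + 2 = 1 + 2 * Suc k" by simp
    ultimately have "\<forall>N\<ge>N0. mass_part M (1 + 2 * Suc k) (real N) = S (1 + 2 * Suc k) N" by metis
    then show ?case using odd_moment[of "Suc k"] by blast
  qed
  show ?thesis
  proof (cases "even p")
    case True then show ?thesis using evens by (auto elim!: evenE)
  next
    case False then show ?thesis using odds odd_int by (auto elim!: oddE simp: add.commute)
  qed
qed

text \<open>Geometric growth of the moments is beaten by the factorials, so the Taylor polynomials
  of the characteristic function converge to it on the whole line. Only even orders are used: there
  the absolute moment in the remainder is the moment itself.\<close>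

lemma moments_unique:
  assumes M: "real_distribution M" and M': "real_distribution M'"
    and m: "\<And>p. integrable M (\<lambda>x. x ^ p)" "\<And>p. (\<integral>x. x ^ p \<partial>M) = d p"
    and m': "\<And>p. integrable M' (\<lambda>x. x ^ p)" "\<And>p. (\<integral>x. x ^ p \<partial>M') = d p"
    and d: "\<And>p. \<bar>d p\<bar> \<le> B * C ^ p"
  shows "M = M'"
proof (rule Levy_uniqueness[OF M M'])
  have key: "(\<lambda>n. \<Sum>k\<le>2 * n. ((\<i> * t) ^ k / fact k) * complex_of_real (d k)) \<longlonglongrightarrow> char L t"
    if L: "real_distribution L" and i: "\<And>p. integrable L (\<lambda>x. x ^ p)" and e: "\<And>p. (\<integral>x. x ^ p \<partial>L) = d p" for L t
  proof -
    interpret real_distribution L by fact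
    have bnd: "cmod (char L t - (\<Sum>k\<le>2 * n. ((\<i> * t) ^ k / fact k) * complex_of_real (d k)))
        \<le> 2 * B * ((\<bar>t\<bar> * C) ^ (2 * n) / fact (2 * n))" for n
    proof -
      have "cmod (char L t - (\<Sum>k\<le>2 * n. ((\<i> * t) ^ k / fact k) * complex_of_real (d k)))
          \<le> (2 * \<bar>t\<bar> ^ (2 * n) / fact (2 * n)) * expectation (\<lambda>x. \<bar>x\<bar> ^ (2 * n))"
        using char_approx1[of "2 * n" t, OF i] by (simp add: e)
      also have "expectation (\<lambda>x. \<bar>x\<bar> ^ (2 * n)) = d (2 * n)" using e[of "2 * n"] by (simp add: power_even_abs)
      also have "(2 * \<bar>t\<bar> ^ (2 * n) / fact (2 * n)) * d (2 * n) \<le> (2 * \<bar>t\<bar> ^ (2 * n) / fact (2 * n)) * (B * C ^ (2 * n))"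
        using d[of "2 * n"] by (intro mult_left_mono) auto
      finally show ?thesis by (simp add: power_mult_distrib mult_ac)
    qed
    have "(\<lambda>n. (\<bar>t\<bar> * C) ^ n / fact n) \<longlonglongrightarrow> 0"
      using summable_exp_generic[of "\<bar>t\<bar> * C"] by (intro summable_LIMSEQ_zero) (simp add: divide_inverse mult.commute)
    then have "((\<lambda>n. (\<bar>t\<bar> * C) ^ n / fact n) \<circ> (\<lambda>n. 2 * n)) \<longlonglongrightarrow> 0"
      by (rule LIMSEQ_subseq_LIMSEQ) (simp add: strict_mono_def)
    then have "(\<lambda>n. 2 * B * ((\<bar>t\<bar> * C) ^ (2 * n) / fact (2 * n))) \<longlonglongrightarrow> 0"
      using tendsto_mult_left[of "\<lambda>n. (\<bar>t\<bar> * C) ^ (2 * n) / fact (2 * n)" 0 sequentially "2 * B"] by (simp add: o_def)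
    then have "(\<lambda>n. char L t - (\<Sum>k\<le>2 * n. ((\<i> * t) ^ k / fact k) * complex_of_real (d k))) \<longlonglongrightarrow> 0"
      by (rule Lim_null_comparison[rotated]) (use bnd in auto)
    from tendsto_diff[OF tendsto_const[of "char L t"] this] show ?thesis by simp
  qed
  show "char M = char M'"
    using LIMSEQ_unique[OF key[OF M m] key[OF M' m']] by (intro ext) simp
qed

text \<open>The factor 2 comes from the kernel being at most 1/2 wherever
  \<open>N \<le> \<bar>x\<bar>\<close>.\<close>

lemma (in real_distribution) tail_le_mass_part:
  assumes "0 < N"
  shows "measure M {..-N} + measure M {N..} \<le> 2 * (1 - mass_part M 0 N)"
proof -
  have i: "integrable M (\<lambda>x. x ^ 0 * (N\<^sup>2 / (x\<^sup>2 + N\<^sup>2)))" by (rule kernel_integrable) simp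
  have "measure M {..-N} + measure M {N..} = measure M ({..-N} \<union> {N..})"
    by (rule finite_measure_Union[symmetric]) (use assms in auto)
  also have "\<dots> = (\<integral>x. indicator ({..-N} \<union> {N..}) x \<partial>M)" by simp
  also have "\<dots> \<le> (\<integral>x. 2 * (1 - x ^ 0 * (N\<^sup>2 / (x\<^sup>2 + N\<^sup>2))) \<partial>M)"
  proof (rule integral_mono)
    show "integrable M (indicat_real ({..-N} \<union> {N..}))" by (rule integrable_const_bound[of _ 1]) auto
    show "integrable M (\<lambda>x. 2 * (1 - x ^ 0 * (N\<^sup>2 / (x\<^sup>2 + N\<^sup>2))))"
      by (intro Bochner_Integration.integrable_mult_right Bochner_Integration.integrable_diff i) simp
    fix x :: real
    show "indicator ({..-N} \<union> {N..}) x \<le> 2 * (1 - x ^ 0 * (N\<^sup>2 / (x\<^sup>2 + N\<^sup>2)))"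
    proof (cases "x \<in> {..-N} \<union> {N..}")
      case True
      then have "\<bar>N\<bar> \<le> \<bar>x\<bar>" using assms by auto
      then have "N\<^sup>2 \<le> x\<^sup>2" using abs_le_square_iff by blast
      moreover have "x\<^sup>2 + N\<^sup>2 > 0" using assms by (simp add: add_nonneg_pos)
      ultimately have "N\<^sup>2 / (x\<^sup>2 + N\<^sup>2) \<le> 1 / 2" by (simp add: field_simps)
      then have "1 \<le> 2 * (1 - x ^ 0 * (N\<^sup>2 / (x\<^sup>2 + N\<^sup>2)))" unfolding power_0 mult_1 by argo
      then show ?thesis using True by (simp only: indicator_simps)
    next
      case False then show ?thesis using kernel_le_1[of N x] by simp
    qed
  qed
  also have "\<dots> = 2 * (\<integral>x. 1 - x ^ 0 * (N\<^sup>2 / (x\<^sup>2 + N\<^sup>2)) \<partial>M)" by (rule integral_mult_right_zero)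
  also have "(\<integral>x. 1 - x ^ 0 * (N\<^sup>2 / (x\<^sup>2 + N\<^sup>2)) \<partial>M) = 1 - mass_part M 0 N"
    using Bochner_Integration.integral_diff[OF integrable_const[of 1] i] prob_space by (simp add: mass_part_def)
  finally show ?thesis .
qed

lemma (in real_distribution) mass_part_0_tendsto: "(\<lambda>N. mass_part M 0 (real N)) \<longlonglongrightarrow> 1"
proof -
  have "(\<lambda>N. mass_part M 0 (real N)) \<longlonglongrightarrow> (\<integral>x. x ^ 0 \<partial>M)"
    unfolding mass_part_def
  proof (rule integral_dominated_convergence[where w = "\<lambda>x. 1"])
    show "AE x in M. (\<lambda>i. x ^ 0 * ((real i)\<^sup>2 / (x\<^sup>2 + (real i)\<^sup>2))) \<longlonglongrightarrow> x ^ 0"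
      using kernel_tendsto by simp
    show "AE x in M. norm (x ^ 0 * ((real i)\<^sup>2 / (x\<^sup>2 + (real i)\<^sup>2))) \<le> 1" for i
      using norm_kernel_le[of _ 0 "real i"] by (intro AE_I2) simp
  qed simp_all
  then show ?thesis using prob_space by simp
qed

text \<open>Convergence at one large height controls all but finitely many members of the sequence.
  Each remaining member is handled on its own by \<open>mass_part_0_tendsto\<close>, and the largest
  of the finitely many heights serves all.\<close>

lemma tight_if_mass_part_tendsto:
  assumes \<nu>: "\<And>j. real_distribution (\<nu> j)"
    and lim: "\<And>N. N0 \<le> N \<Longrightarrow> (\<lambda>j. mass_part (\<nu> j) 0 (real N)) \<longlonglongrightarrow> t N"
    and t: "t \<longlonglongrightarrow> 1"
  shows "tight \<nu>"
  unfolding tight_def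
proof (intro conjI allI impI)
  fix e :: real assume e: "0 < e"
  obtain N1 where N1: "\<And>N. N1 \<le> N \<Longrightarrow> \<bar>t N - 1\<bar> < e / 4"
    using t e unfolding LIMSEQ_iff by (metis divide_pos_pos real_norm_def zero_less_numeral)
  define N where "N = max (max N0 N1) 1"
  obtain J where J: "\<And>j. J \<le> j \<Longrightarrow> \<bar>mass_part (\<nu> j) 0 (real N) - t N\<bar> < e / 4"
    using lim[of N] e unfolding LIMSEQ_iff N_def by (metis divide_pos_pos real_norm_def zero_less_numeral max.cobounded1 max.coboundedI1)
  have "\<exists>K. \<forall>N\<ge>K. \<bar>mass_part (\<nu> j) 0 (real N) - 1\<bar> < e / 2" for j
    using real_distribution.mass_part_0_tendsto[OF \<nu>[of j]] e unfolding LIMSEQ_iff by (metis half_gt_zero real_norm_def)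
  then obtain K where K: "\<And>j N. K j \<le> N \<Longrightarrow> \<bar>mass_part (\<nu> j) 0 (real N) - 1\<bar> < e / 2" by metis
  define L where "L = Max (insert N (K ` {..<J}))"
  have L: "N \<le> L" "\<And>j. j < J \<Longrightarrow> K j \<le> L" unfolding L_def by (auto intro!: Max_ge)
  have N1': "1 \<le> N" unfolding N_def by simp
  have small: "measure (\<nu> j) {..- real L} + measure (\<nu> j) {real L..} < e" for j
  proof (cases "j < J")
    case True
    have "measure (\<nu> j) {..- real L} + measure (\<nu> j) {real L..} \<le> 2 * (1 - mass_part (\<nu> j) 0 (real L))"
      using real_distribution.tail_le_mass_part[OF \<nu>, of "real L"] L N1' by simp
    moreover have "2 * (1 - mass_part (\<nu> j) 0 (real L)) < e"
      using K[OF L(2)[OF True]] unfolding abs_less_iff by argo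
    ultimately show ?thesis by (rule order.strict_trans1)
  next
    case False
    interpret real_distribution "\<nu> j" by (rule \<nu>)
    have "measure (\<nu> j) {..- real L} + measure (\<nu> j) {real L..} \<le> measure (\<nu> j) {..- real N} + measure (\<nu> j) {real N..}"
      using L by (intro add_mono finite_measure_mono) auto
    also have "\<dots> \<le> 2 * (1 - mass_part (\<nu> j) 0 (real N))" using tail_le_mass_part[of "real N"] N1' by simp
    also have "\<dots> < e"
    proof -
      have "N1 \<le> N" "J \<le> j" using False unfolding N_def by auto
      from J[OF this(2)] N1[OF this(1)] show ?thesis unfolding abs_less_iff by argo
    qed
    finally show ?thesis .
  qed
  show "\<exists>a b. a < b \<and> (\<forall>j. 1 - e < measure (\<nu> j) {a<..b})"
  proof (rule exI[of _ "- real L"], rule exI[of _ "real L"], intro conjI allI)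
    show "- real L < real L" using L N1' by simp
    fix j
    interpret real_distribution "\<nu> j" by (rule \<nu>)
    have "1 = measure (\<nu> j) ({..- real L} \<union> ({- real L<..real L} \<union> {real L..}))"
      using prob_space by (intro trans[OF prob_space[symmetric]] arg_cong[where f = "measure (\<nu> j)"]) auto
    also have "\<dots> \<le> measure (\<nu> j) {..- real L} + (measure (\<nu> j) {- real L<..real L} + measure (\<nu> j) {real L..})"
      by (intro order_trans[OF measure_Un_le] add_left_mono measure_Un_le) auto
    finally show "1 - e < measure (\<nu> j) {- real L<..real L}" using small[of j] by linarith
  qed
qed (rule \<nu>)

text \<open>Both integrands are continuous and bounded; at order 1 the bound comes from
  \<open>2 * (\<bar>x\<bar> * N) \<le> x\<^sup>2 + N\<^sup>2\<close>.\<close>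

lemma weak_conv_mass_part:
  assumes "\<And>n. real_distribution (\<nu> n)" "real_distribution M" "weak_conv_m \<nu> M" "q \<le> 1" "0 < N"
  shows "(\<lambda>n. mass_part (\<nu> n) q N) \<longlonglongrightarrow> mass_part M q N"
  unfolding mass_part_def
proof (rule weak_conv_imp_integral_bdd_continuous_conv[OF assms(1,2,3)])
  have pos: "x\<^sup>2 + N\<^sup>2 > 0" for x :: real using assms(5) by (simp add: add_nonneg_pos)
  then have "x\<^sup>2 + N\<^sup>2 \<noteq> 0" for x :: real by (metis less_irrefl)
  then show "isCont (\<lambda>x. x ^ q * (N\<^sup>2 / (x\<^sup>2 + N\<^sup>2))) x" for x
    by (intro continuous_intros) auto
  fix x :: real
  show "norm (x ^ q * (N\<^sup>2 / (x\<^sup>2 + N\<^sup>2))) \<le> 1 + N"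
  proof (cases "q = 0")
    case True then show ?thesis using norm_kernel_le[of x q N] assms(5) by simp
  next
    case False
    then have q: "q = 1" using assms by auto
    have "2 * (\<bar>x\<bar> * N) \<le> x\<^sup>2 + N\<^sup>2" using zero_le_power2[of "\<bar>x\<bar> - N"] by (simp add: power2_diff)
    then have "\<bar>x\<bar> * N \<le> x\<^sup>2 + N\<^sup>2" using assms(5) by (smt (verit) zero_le_mult_iff abs_ge_zero)
    then have "N * (\<bar>x\<bar> * N) \<le> N * (x\<^sup>2 + N\<^sup>2)" using assms(5) by (intro mult_left_mono) auto
    then have "\<bar>x\<bar> * N\<^sup>2 / (x\<^sup>2 + N\<^sup>2) \<le> N" using pos[of x] by (simp add: pos_divide_le_eq power2_eq_square mult_ac)
    then show ?thesis using assms(5) pos[of x] by (simp add: q abs_mult)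
  qed
qed

text \<open>The numbers \<open>d\<close> are not assumed to be moments. Tightness supplies
  subsequential limits, the expansion identifies all their moments as \<open>d\<close>, so a law
  with these moments exists, and uniqueness upgrades this to convergence of the whole
  sequence.\<close>

lemma mass_part_moment_problem:
  fixes d :: "nat \<Rightarrow> real"
  assumes \<nu>: "\<And>j. real_distribution (\<nu> j)"
    and d: "\<And>p. \<bar>d p\<bar> \<le> B * C ^ p" "d 0 = 1" and C: "0 \<le> C" and N0: "C < real N0"
    and lim: "\<And>N q. N0 \<le> N \<Longrightarrow> q \<le> 1 \<Longrightarrow>
      (\<lambda>j. mass_part (\<nu> j) q (real N)) \<longlonglongrightarrow> (\<Sum>j. (-1) ^ j * d (q + 2 * j) / real N ^ (2 * j))"
  shows "tight \<nu>"
    and "real_distribution L \<Longrightarrow> strict_mono s \<Longrightarrow> weak_conv_m (\<nu> \<circ> s) L \<Longrightarrow>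
      integrable L (\<lambda>x. x ^ p) \<and> (\<integral>x. x ^ p \<partial>L) = d p"
    and "\<exists>M. real_distribution M \<and> (\<forall>p. integrable M (\<lambda>x. x ^ p) \<and> (\<integral>x. x ^ p \<partial>M) = d p)"
    and "real_distribution M \<Longrightarrow> (\<And>p. integrable M (\<lambda>x. x ^ p)) \<Longrightarrow> (\<And>p. (\<integral>x. x ^ p \<partial>M) = d p) \<Longrightarrow> weak_conv_m \<nu> M"
proof -
  have "(\<lambda>N. \<Sum>j. (-1) ^ j * d (2 * j) / real N ^ (2 * j)) \<longlonglongrightarrow> 1"
    using alternating_series_tendsto[OF d(1) C, of 0] by (simp add: d(2))
  then show tight: "tight \<nu>"
    by (rule tight_if_mass_part_tendsto[OF \<nu>, rotated]) (use lim[of _ 0] in simp)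
  have sub: "integrable L (\<lambda>x. x ^ p) \<and> (\<integral>x. x ^ p \<partial>L) = d p"
    if L: "real_distribution L" and s: "strict_mono s" and w: "weak_conv_m (\<nu> \<circ> s) L" for L s p
  proof -
    have eq: "mass_part L q (real N) = (\<Sum>j. (-1) ^ j * d (q + 2 * j) / real N ^ (2 * j))"
      if N: "N0 \<le> N" and q: "q \<le> 1" for N q
    proof (rule LIMSEQ_unique)
      show "(\<lambda>n. mass_part ((\<nu> \<circ> s) n) q (real N)) \<longlonglongrightarrow> mass_part L q (real N)"
        using N N0 C q by (intro weak_conv_mass_part[OF _ L w]) (auto intro: \<nu>)
      show "(\<lambda>n. mass_part ((\<nu> \<circ> s) n) q (real N)) \<longlonglongrightarrow> (\<Sum>j. (-1) ^ j * d (q + 2 * j) / real N ^ (2 * j))"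
        using LIMSEQ_subseq_LIMSEQ[OF lim[OF N q] s] by (simp add: o_def)
    qed
    show ?thesis
      using real_distribution.mass_part_expansion[OF L d(1) C N0] eq[of _ 0] eq[of _ 1] by simp
  qed
  show "real_distribution L \<Longrightarrow> strict_mono s \<Longrightarrow> weak_conv_m (\<nu> \<circ> s) L \<Longrightarrow>
      integrable L (\<lambda>x. x ^ p) \<and> (\<integral>x. x ^ p \<partial>L) = d p" by (rule sub)
  have "strict_mono (\<lambda>n::nat. n)" by (simp add: strict_mono_def)
  from tight_imp_convergent_subsubsequence[OF tight this] obtain r L where
    rL: "strict_mono (r :: nat \<Rightarrow> nat)" "real_distribution L" "weak_conv_m (\<nu> \<circ> (\<lambda>n. n) \<circ> r) L" by blast
  then have "weak_conv_m (\<nu> \<circ> r) L" by (simp add: o_def)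
  from sub[OF rL(2,1) this] rL(2) show "\<exists>M. real_distribution M \<and> (\<forall>p. integrable M (\<lambda>x. x ^ p) \<and> (\<integral>x. x ^ p \<partial>M) = d p)"
    by blast
  assume M: "real_distribution M" "\<And>p. integrable M (\<lambda>x. x ^ p)" "\<And>p. (\<integral>x. x ^ p \<partial>M) = d p"
  show "weak_conv_m \<nu> M"
  proof (rule tight_subseq_weak_converge[OF \<nu> M(1) tight])
    fix s L assume s: "strict_mono (s :: nat \<Rightarrow> nat)" and L: "real_distribution L" and w: "weak_conv_m (\<nu> \<circ> s) L"
    have "L = M"
      by (rule moments_unique[OF L M(1) _ _ M(2,3) d(1)]) (use sub[OF L s w] in auto)
    then show "weak_conv_m (\<nu> \<circ> s) M" using w by simp
  qed
qed

section \<open>The Levy distance\<close>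

definition levy_set :: "real measure \<Rightarrow> real measure \<Rightarrow> real set" where
  "levy_set \<nu>\<^sub>1 \<nu>\<^sub>2 = {\<epsilon>. 0 < \<epsilon> \<and>
     (\<forall>x. measure \<nu>\<^sub>1 {..x - \<epsilon>} - \<epsilon> \<le> measure \<nu>\<^sub>2 {..x} \<and>
          measure \<nu>\<^sub>2 {..x} \<le> measure \<nu>\<^sub>1 {..x + \<epsilon>} + \<epsilon>)}"

lemma levy_dist_Inf: "levy_dist \<nu>\<^sub>1 \<nu>\<^sub>2 = Inf (levy_set \<nu>\<^sub>1 \<nu>\<^sub>2)"
  by (simp add: levy_dist_def levy_set_def)

lemma levy_set_bdd: "bdd_below (levy_set \<nu>\<^sub>1 \<nu>\<^sub>2)"
  by (rule bdd_belowI[of _ 0]) (auto simp: levy_set_def)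

text \<open>Probabilities differ by at most 1. Nonemptiness is what makes \<open>Inf\<close> a
  genuine infimum.\<close>

lemma levy_set_nonempty: "real_distribution \<nu>\<^sub>1 \<Longrightarrow> real_distribution \<nu>\<^sub>2 \<Longrightarrow> 1 \<in> levy_set \<nu>\<^sub>1 \<nu>\<^sub>2"
proof -
  assume "real_distribution \<nu>\<^sub>1" "real_distribution \<nu>\<^sub>2"
  then have "prob_space \<nu>\<^sub>1" "prob_space \<nu>\<^sub>2" by (auto simp: real_distribution_def)
  then have "measure \<nu>\<^sub>1 A \<le> 1" "measure \<nu>\<^sub>2 A \<le> 1" for A by (auto intro: prob_space.prob_le_1)
  moreover have "0 \<le> measure \<nu>\<^sub>1 A" "0 \<le> measure \<nu>\<^sub>2 A" for A by auto
  ultimately show ?thesis unfolding levy_set_def by (smt (verit) mem_Collect_eq)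
qed

lemma levy_dist_le: "e \<in> levy_set \<nu>\<^sub>1 \<nu>\<^sub>2 \<Longrightarrow> levy_dist \<nu>\<^sub>1 \<nu>\<^sub>2 \<le> e"
  unfolding levy_dist_Inf by (rule cInf_lower[OF _ levy_set_bdd])

lemma levy_dist_nonneg: "real_distribution \<nu>\<^sub>1 \<Longrightarrow> real_distribution \<nu>\<^sub>2 \<Longrightarrow> 0 \<le> levy_dist \<nu>\<^sub>1 \<nu>\<^sub>2"
  unfolding levy_dist_Inf using levy_set_nonempty[of \<nu>\<^sub>1 \<nu>\<^sub>2] by (intro cInf_greatest) (blast, simp add: levy_set_def)

text \<open>Replacing \<open>x\<close> by \<open>x - e\<close> and by \<open>x + e\<close> exchanges
  the two inequalities.\<close>

lemma levy_set_sym: "levy_set \<nu>\<^sub>1 \<nu>\<^sub>2 \<subseteq> levy_set \<nu>\<^sub>2 \<nu>\<^sub>1"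
proof
  fix e assume e: "e \<in> levy_set \<nu>\<^sub>1 \<nu>\<^sub>2"
  have "measure \<nu>\<^sub>2 {..x - e} - e \<le> measure \<nu>\<^sub>1 {..x}" "measure \<nu>\<^sub>1 {..x} \<le> measure \<nu>\<^sub>2 {..x + e} + e" for x
    using e[unfolded levy_set_def, simplified, THEN conjunct2, rule_format, of "x - e"]
      e[unfolded levy_set_def, simplified, THEN conjunct2, rule_format, of "x + e"] by auto
  then show "e \<in> levy_set \<nu>\<^sub>2 \<nu>\<^sub>1" using e by (simp add: levy_set_def)
qed

lemma levy_dist_sym: "levy_dist \<nu>\<^sub>1 \<nu>\<^sub>2 = levy_dist \<nu>\<^sub>2 \<nu>\<^sub>1"
  unfolding levy_dist_Inf using levy_set_sym by (metis subset_antisym)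

lemma levy_dist_triangle:
  assumes "real_distribution \<nu>\<^sub>1" "real_distribution \<nu>\<^sub>2" "real_distribution \<nu>\<^sub>3"
  shows "levy_dist \<nu>\<^sub>1 \<nu>\<^sub>3 \<le> levy_dist \<nu>\<^sub>1 \<nu>\<^sub>2 + levy_dist \<nu>\<^sub>2 \<nu>\<^sub>3"
proof -
  have add: "a + b \<in> levy_set \<nu>\<^sub>1 \<nu>\<^sub>3" if a: "a \<in> levy_set \<nu>\<^sub>1 \<nu>\<^sub>2" and b: "b \<in> levy_set \<nu>\<^sub>2 \<nu>\<^sub>3" for a b
  proof -
    have "measure \<nu>\<^sub>1 {..x - (a + b)} - (a + b) \<le> measure \<nu>\<^sub>3 {..x}" for x
      using a[unfolded levy_set_def, simplified, THEN conjunct2, rule_format, of "x - b"]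
        b[unfolded levy_set_def, simplified, THEN conjunct2, rule_format, of "x"] by (auto simp: diff_diff_eq add.commute)
    moreover have "measure \<nu>\<^sub>3 {..x} \<le> measure \<nu>\<^sub>1 {..x + (a + b)} + (a + b)" for x
      using a[unfolded levy_set_def, simplified, THEN conjunct2, rule_format, of "x + b"]
        b[unfolded levy_set_def, simplified, THEN conjunct2, rule_format, of "x"] by (auto simp: add_ac)
    ultimately show ?thesis using a b by (simp add: levy_set_def)
  qed
  have "levy_dist \<nu>\<^sub>1 \<nu>\<^sub>3 - b \<le> levy_dist \<nu>\<^sub>1 \<nu>\<^sub>2" if b: "b \<in> levy_set \<nu>\<^sub>2 \<nu>\<^sub>3" for b
    unfolding levy_dist_Inf[of \<nu>\<^sub>1 \<nu>\<^sub>2]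
    using levy_set_nonempty[OF assms(1,2)] levy_dist_le[OF add[OF _ b]] by (intro cInf_greatest) force+
  then have "levy_dist \<nu>\<^sub>1 \<nu>\<^sub>3 - levy_dist \<nu>\<^sub>1 \<nu>\<^sub>2 \<le> levy_dist \<nu>\<^sub>2 \<nu>\<^sub>3"
    unfolding levy_dist_Inf[of \<nu>\<^sub>2 \<nu>\<^sub>3]
    using levy_set_nonempty[OF assms(2,3)] by (intro cInf_greatest) force+
  then show ?thesis by simp
qed

text \<open>A finite grid of continuity points, of mesh below \<open>e\<close> and with little mass
  of the limit beyond its ends, reduces the uniform comparison of distribution functions to finitely
  many pointwise limits.\<close>

lemma weak_conv_imp_levy_dist:
  assumes \<nu>: "\<And>n. real_distribution (\<nu> n)" and M: "real_distribution M" and w: "weak_conv_m \<nu> M"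
  shows "(\<lambda>n. levy_dist (\<nu> n) M) \<longlonglongrightarrow> 0"
proof (rule LIMSEQ_I)
  fix r :: real assume r: "0 < r"
  define e where "e = r / 4"
  have e: "0 < e" "e < r" using r by (auto simp: e_def)
  interpret real_distribution M by fact
  let ?F = "cdf M"
  have dense: "\<exists>x. a < x \<and> x < b \<and> isCont ?F x" if "a < b" for a b :: real
    using open_minus_countable[OF mono_ctble_discont, of ?F "{a<..<b}"] that cdf_nondecreasing
    by (force simp: mono_def)
  have "eventually (\<lambda>x. ?F x < e) at_bot" using cdf_lim_at_bot e by (auto dest: order_tendstoD)
  then obtain a where a: "\<And>x. x \<le> a \<Longrightarrow> ?F x < e" by (auto simp: eventually_at_bot_linorder)
  have "eventually (\<lambda>x. 1 - e < ?F x) at_top" using e by (intro order_tendstoD(1)[OF cdf_lim_at_top_prob]) simp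
  then obtain b where b: "\<And>x. b \<le> x \<Longrightarrow> 1 - e < ?F x" by (auto simp: eventually_at_top_linorder)
  \<comment> \<open>One continuity point is picked in each interval of length \<open>e / 2\<close>,
    so neighbours are less than \<open>e\<close> apart; starting at \<open>a - e\<close> puts
    \<open>p 0\<close> below \<open>a\<close>.\<close>
  have "\<exists>p. \<forall>i::nat. a - e + real i * (e / 2) < p i \<and> p i < a - e + (real i + 1) * (e / 2) \<and> isCont ?F (p i)"
    using e by (intro choice allI dense) (simp add: algebra_simps)
  then obtain p where p: "\<And>i::nat. a - e + real i * (e / 2) < p i" "\<And>i. p i < a - e + (real i + 1) * (e / 2)"
      "\<And>i. isCont ?F (p i)" by blast
  obtain m where m: "(b - a + 2 * e) / (e / 2) < real m" using reals_Archimedean2 by blast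
  have m': "b < p m"
  proof -
    have "b - a + 2 * e < real m * (e / 2)" using m e by (simp add: pos_divide_less_eq)
    then show ?thesis using p(1)[of m] e by linarith
  qed
  have p0: "p 0 < a" using p(2)[of 0] e by simp
  have gap: "p (Suc i) < p i + e" for i
    using p(2)[of "Suc i"] p(1)[of i] by (simp add: algebra_simps)
  have "eventually (\<lambda>n. \<forall>i\<in>{..m}. \<bar>cdf (\<nu> n) (p i) - ?F (p i)\<bar> < e) sequentially"
  proof (rule eventually_ball_finite)
    show "\<forall>i\<in>{..m}. eventually (\<lambda>n. \<bar>cdf (\<nu> n) (p i) - ?F (p i)\<bar> < e) sequentially"
    proof
      fix i
      have "(\<lambda>n. cdf (\<nu> n) (p i)) \<longlonglongrightarrow> ?F (p i)" using w p(3) by (auto simp: weak_conv_m_def weak_conv_def)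
      then show "eventually (\<lambda>n. \<bar>cdf (\<nu> n) (p i) - ?F (p i)\<bar> < e) sequentially"
        by (auto simp: dist_real_def dest!: tendstoD[OF _ e(1)])
    qed
  qed simp
  then obtain N where N: "\<And>n i. N \<le> n \<Longrightarrow> i \<le> m \<Longrightarrow> \<bar>cdf (\<nu> n) (p i) - ?F (p i)\<bar> < e"
    by (auto simp: eventually_sequentially)
  have "2 * e \<in> levy_set (\<nu> n) M" if n: "N \<le> n" for n
  proof -
    interpret \<nu>: real_distribution "\<nu> n" by (rule \<nu>)
    \<comment> \<open>Between the ends of the grid, the least \<open>i\<close> with
      \<open>x < p i + e\<close> gives a grid point at or below \<open>x\<close>: if it were above
      \<open>x\<close>, its predecessor would already qualify.\<close>
    have main: "\<exists>i. (i \<le> m \<and> x - 2 * e < p i \<and> p i \<le> x) \<or> x < p 0 \<or> p m < x" for x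
    proof (cases "x < p 0 \<or> p m < x")
      case False
      then have ex: "\<exists>i. x < p i + e \<and> i \<le> m" using e by (intro exI[of _ m]) auto
      define i where "i = (LEAST i. x < p i + e \<and> i \<le> m)"
      have i: "x < p i + e" "i \<le> m" using LeastI_ex[OF ex] by (auto simp: i_def)
      show ?thesis
      proof (cases "p i \<le> x")
        case True then show ?thesis using i e by (intro exI[of _ i]) auto
      next
        case nle: False
        then have "i \<noteq> 0" using False by (cases i) auto
        then obtain j where j: "i = Suc j" by (cases i) auto
        have "\<not> (x < p j + e \<and> j \<le> m)" unfolding i_def[symmetric] using j not_less_Least[of j "\<lambda>i. x < p i + e \<and> i \<le> m"] by (simp add: i_def[symmetric])
        then have "p j + e \<le> x" using i j by auto
        then have False using nle gap[of j] j by simp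
        then show ?thesis ..
      qed
    qed auto
    have lo: "\<nu>.prob {..x - 2 * e} - 2 * e \<le> prob {..x}" for x
    proof -
      consider i where "i \<le> m" "x - 2 * e < p i" "p i \<le> x" | "x < p 0" | "p m < x" using main by blast
      then show ?thesis
      proof cases
        case 1
        then have "cdf (\<nu> n) (x - 2 * e) \<le> cdf (\<nu> n) (p i)" "?F (p i) \<le> ?F x"
          by (auto intro: \<nu>.cdf_nondecreasing cdf_nondecreasing)
        then show ?thesis using N[OF n 1(1)] e by (simp add: cdf_def)
      next
        case 2
        then have "cdf (\<nu> n) (x - 2 * e) \<le> cdf (\<nu> n) (p 0)" using e by (intro \<nu>.cdf_nondecreasing) auto
        then have "cdf (\<nu> n) (x - 2 * e) < 2 * e" using N[OF n, of 0] a[of "p 0"] p0 unfolding abs_less_iff by simp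
        then show ?thesis using measure_nonneg[of M "{..x}"] unfolding cdf_def by linarith
      next
        case 3
        then have "1 - e < ?F x" using m' by (intro b) auto
        then show ?thesis using \<nu>.prob_le_1[of "{..x - 2 * e}"] e unfolding cdf_def by linarith
      qed
    qed
    have hi: "prob {..x} \<le> \<nu>.prob {..x + 2 * e} + 2 * e" for x
    proof -
      consider i where "i \<le> m" "x < p i" "p i \<le> x + 2 * e" | "x + 2 * e < p 0" | "p m < x + 2 * e" using main[of "x + 2 * e"] by auto
      then show ?thesis
      proof cases
        case 1
        then have "cdf (\<nu> n) (p i) \<le> cdf (\<nu> n) (x + 2 * e)" "?F x \<le> ?F (p i)"
          by (auto intro: \<nu>.cdf_nondecreasing cdf_nondecreasing)
        then show ?thesis using N[OF n 1(1)] e by (simp add: cdf_def)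
      next
        case 2
        then have "?F x < e" using p0 e by (intro a) auto
        then show ?thesis using measure_nonneg[of "\<nu> n" "{..x + 2 * e}"] e unfolding cdf_def by linarith
      next
        case 3
        then have "cdf (\<nu> n) (p m) \<le> cdf (\<nu> n) (x + 2 * e)" by (intro \<nu>.cdf_nondecreasing) auto
        then have "1 - 2 * e < cdf (\<nu> n) (x + 2 * e)" using N[OF n, of m] b[of "p m"] m' unfolding abs_less_iff by simp
        then show ?thesis using prob_le_1[of "{..x}"] unfolding cdf_def by linarith
      qed
    qed
    show ?thesis using e lo hi by (simp add: levy_set_def)
  qed
  then have "\<forall>n\<ge>N. levy_dist (\<nu> n) M \<le> 2 * e \<and> 0 \<le> levy_dist (\<nu> n) M"
    using levy_dist_le levy_dist_nonneg[OF \<nu> M] by blast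
  moreover have "2 * e < r" using r by (simp add: e_def)
  ultimately show "\<exists>no. \<forall>n\<ge>no. norm (levy_dist (\<nu> n) M - 0) < r" by fastforce
qed

section \<open>Resolvents of symmetric matrices\<close>

lemma sum_mult_delta:
  fixes f :: "'i \<Rightarrow> 'b :: semiring_1"
  assumes "finite A" "j \<in> A"
  shows "(\<Sum>b\<in>A. f b * (if b = j then 1 else 0)) = f j" "(\<Sum>b\<in>A. (if b = j then 1 else 0) * f b) = f j"
    "(\<Sum>b\<in>A. f b * (if j = b then 1 else 0)) = f j" "(\<Sum>b\<in>A. (if j = b then 1 else 0) * f b) = f j"
  using assms by (simp_all add: if_distrib[of "\<lambda>x. _ * x"] if_distrib[of "\<lambda>x. x * _"] cong: if_cong)

definition shifted :: "(int \<Rightarrow> int \<Rightarrow> real) \<Rightarrow> real \<Rightarrow> int \<Rightarrow> int \<Rightarrow> complex" where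
  "shifted H y a b = of_real (H a b) - (if a = b then \<i> * of_real y else 0)"

definition is_resolvent :: "nat \<Rightarrow> (int \<Rightarrow> int \<Rightarrow> real) \<Rightarrow> real \<Rightarrow> (int \<Rightarrow> int \<Rightarrow> complex) \<Rightarrow> bool" where
  "is_resolvent n H y G \<longleftrightarrow> (\<forall>a\<in>{0..<int n}. \<forall>j\<in>{0..<int n}.
     (\<Sum>b\<in>{0..<int n}. shifted H y a b * G b j) = (if a = j then 1 else 0))"

definition sym_on :: "nat \<Rightarrow> (int \<Rightarrow> int \<Rightarrow> real) \<Rightarrow> bool" where
  "sym_on n H \<longleftrightarrow> (\<forall>a\<in>{0..<int n}. \<forall>b\<in>{0..<int n}. H a b = H b a)"

text \<open>The resolvent is extended periodically, which makes index shifts cyclic.\<close>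

definition resolvent :: "nat \<Rightarrow> (int \<Rightarrow> int \<Rightarrow> real) \<Rightarrow> real \<Rightarrow> int \<Rightarrow> int \<Rightarrow> complex" where
  "resolvent n H y i j = (SOME G. is_resolvent n H y G) (i mod int n) (j mod int n)"

lemma shifted_sym: "sym_on n H \<Longrightarrow> a \<in> {0..<int n} \<Longrightarrow> b \<in> {0..<int n} \<Longrightarrow> shifted H y a b = shifted H y b a"
  by (auto simp: shifted_def sym_on_def)

lemma sum_Cauchy_Schwarz:
  fixes f g :: "'i \<Rightarrow> complex"
  shows "(cmod (\<Sum>i\<in>A. f i * g i))\<^sup>2 \<le> (\<Sum>i\<in>A. (cmod (f i))\<^sup>2) * (\<Sum>i\<in>A. (cmod (g i))\<^sup>2)"
proof -
  have "cmod (\<Sum>i\<in>A. f i * g i) \<le> (\<Sum>i\<in>A. \<bar>cmod (f i)\<bar> * \<bar>cmod (g i)\<bar>)"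
    by (rule order_trans[OF norm_sum]) (simp add: norm_mult)
  also have "\<dots> \<le> L2_set (\<lambda>i. cmod (f i)) A * L2_set (\<lambda>i. cmod (g i)) A" by (rule L2_set_mult_ineq)
  finally have "(cmod (\<Sum>i\<in>A. f i * g i))\<^sup>2 \<le> (L2_set (\<lambda>i. cmod (f i)) A * L2_set (\<lambda>i. cmod (g i)) A)\<^sup>2"
    by (intro power_mono) auto
  then show ?thesis by (simp add: power_mult_distrib L2_set_def sum_nonneg)
qed

text \<open>For symmetric real \<open>H\<close> the quadratic form of \<open>H\<close> at
  \<open>w\<close> is real, so the imaginary part of the pairing of \<open>w\<close> with its image
  is \<open>- y\<close> times the squared norm of \<open>w\<close>; Cauchy-Schwarz then bounds the
  image from below. Invertibility and the norm bound \<open>1 / y\<close> of the resolvent both come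
  from here.\<close>

lemma shifted_lower_bound:
  assumes H: "sym_on n H" and v: "\<And>a. a \<in> {0..<int n} \<Longrightarrow> v a = (\<Sum>b\<in>{0..<int n}. shifted H y a b * w b)"
  shows "y\<^sup>2 * (\<Sum>a\<in>{0..<int n}. (cmod (w a))\<^sup>2) \<le> (\<Sum>a\<in>{0..<int n}. (cmod (v a))\<^sup>2)"
proof -
  let ?I = "{0..<int n}"
  define q where "q = (\<Sum>a\<in>?I. \<Sum>b\<in>?I. cnj (w a) * of_real (H a b) * w b)"
  define W where "W = (\<Sum>a\<in>?I. (cmod (w a))\<^sup>2)"
  have "cnj q = (\<Sum>a\<in>?I. \<Sum>b\<in>?I. w a * of_real (H a b) * cnj (w b))" by (simp add: q_def)
  also have "\<dots> = (\<Sum>b\<in>?I. \<Sum>a\<in>?I. w a * of_real (H a b) * cnj (w b))" by (rule sum.swap)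
  also have "\<dots> = q" unfolding q_def using H by (intro sum.cong refl) (auto simp: sym_on_def)
  finally have "Im q = 0" by (metis add.inverse_inverse cnj.sel(2) neg_equal_zero)
  have "(\<Sum>a\<in>?I. cnj (w a) * v a) = (\<Sum>a\<in>?I. (\<Sum>b\<in>?I. cnj (w a) * of_real (H a b) * w b) - \<i> * y * (cnj (w a) * w a))"
  proof (rule sum.cong[OF refl])
    fix a assume a: "a \<in> ?I"
    have "v a = (\<Sum>b\<in>?I. of_real (H a b) * w b) - (\<Sum>b\<in>?I. (if a = b then \<i> * y else 0) * w b)"
      unfolding v[OF a] shifted_def by (simp add: left_diff_distrib sum_subtractf)
    also have "(\<Sum>b\<in>?I. (if a = b then \<i> * y else 0) * w b) = (\<Sum>b\<in>?I. (if a = b then \<i> * y * w b else 0))"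
      by (rule sum.cong) auto
    also have "\<dots> = \<i> * y * w a" using a by simp
    finally show "cnj (w a) * v a = (\<Sum>b\<in>?I. cnj (w a) * of_real (H a b) * w b) - \<i> * y * (cnj (w a) * w a)"
      by (simp add: right_diff_distrib sum_distrib_left mult_ac)
  qed
  also have "\<dots> = q - \<i> * y * (\<Sum>a\<in>?I. cnj (w a) * w a)"
    unfolding q_def by (simp add: sum_subtractf sum_distrib_left)
  also have "(\<Sum>a\<in>?I. cnj (w a) * w a) = of_real W"
    unfolding W_def of_real_sum by (intro sum.cong refl) (simp only: complex_norm_square mult.commute)
  finally have e: "(\<Sum>a\<in>?I. cnj (w a) * v a) = q - \<i> * y * of_real W" .
  have "\<bar>y\<bar> * W = \<bar>Im (q - \<i> * y * of_real W)\<bar>" using \<open>Im q = 0\<close> by (simp add: abs_mult W_def sum_nonneg)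
  also have "\<dots> \<le> cmod (\<Sum>a\<in>?I. cnj (w a) * v a)" unfolding e by (rule abs_Im_le_cmod)
  finally have "(\<bar>y\<bar> * W)\<^sup>2 \<le> (cmod (\<Sum>a\<in>?I. cnj (w a) * v a))\<^sup>2" by (intro power_mono) (auto simp: W_def sum_nonneg)
  also have "\<dots> \<le> W * (\<Sum>a\<in>?I. (cmod (v a))\<^sup>2)" using sum_Cauchy_Schwarz[of "\<lambda>a. cnj (w a)" v ?I] by (simp add: W_def)
  finally have *: "W * (y\<^sup>2 * W) \<le> W * (\<Sum>a\<in>?I. (cmod (v a))\<^sup>2)" by (simp add: power2_eq_square mult_ac)
  show ?thesis
  proof (cases "W = 0")
    case True then show ?thesis by (simp add: W_def[symmetric] sum_nonneg)
  next
    case False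
    then have "0 < W" by (simp add: W_def order.not_eq_order_implies_strict sum_nonneg)
    then show ?thesis using * by (simp add: W_def[symmetric])
  qed
qed

definition cmat :: "nat \<Rightarrow> (int \<Rightarrow> int \<Rightarrow> complex) \<Rightarrow> complex mat" where
  "cmat n F = mat n n (\<lambda>(i, j). F (int i) (int j))"

lemma sum_int_nat: "(\<Sum>b\<in>{0..<int n}. f b) = (\<Sum>k<n. f (int k))"
  by (rule sum.reindex_bij_witness[of _ int nat]) auto

lemma det_shifted_nonzero:
  assumes H: "sym_on n H" and y: "y \<noteq> 0"
  shows "Determinant.det (cmat n (shifted H y)) \<noteq> 0"
proof
  let ?M = "cmat n (shifted H y)"
  assume "Determinant.det ?M = 0"
  moreover have "?M \<in> carrier_mat n n" by (simp add: cmat_def)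
  ultimately obtain v where v: "v \<in> carrier_vec n" "v \<noteq> 0\<^sub>v n" "?M *\<^sub>v v = 0\<^sub>v n"
    using det_0_iff_vec_prod_zero_field by blast
  define w where "w b = v $ nat b" for b
  have "(\<Sum>b\<in>{0..<int n}. shifted H y a b * w b) = 0" if a: "a \<in> {0..<int n}" for a
  proof -
    have "nat a < n" using a by auto
    then have "(?M *\<^sub>v v) $ nat a = 0" using v(3) by simp
    moreover have "(?M *\<^sub>v v) $ nat a = (\<Sum>k<n. shifted H y a (int k) * v $ k)"
      using a v(1) by (auto simp: cmat_def mult_mat_vec_def scalar_prod_def lessThan_atLeast0 intro!: sum.cong)
    ultimately show ?thesis by (simp add: sum_int_nat w_def)
  qed
  then have "y\<^sup>2 * (\<Sum>a\<in>{0..<int n}. (cmod (w a))\<^sup>2) \<le> (\<Sum>a\<in>{0..<int n}. (cmod 0)\<^sup>2)"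
    by (intro shifted_lower_bound[OF H]) simp
  then have "(\<Sum>a\<in>{0..<int n}. (cmod (w a))\<^sup>2) \<le> 0" using y by (simp add: mult_le_0_iff)
  then have "(\<Sum>a\<in>{0..<int n}. (cmod (w a))\<^sup>2) = 0" by (simp add: order_antisym sum_nonneg)
  then have "\<forall>a\<in>{0..<int n}. w a = 0" by (simp add: sum_nonneg_eq_0_iff)
  then have "v $ k = 0" if "k < n" for k using that by (auto simp: w_def dest!: bspec[of _ _ "int k"])
  then have "v = 0\<^sub>v n" using v(1) by (intro eq_vecI) auto
  then show False using v(2) by simp
qed

text \<open>The adjugate supplies existence and later, through its diagonal cofactors, the
  trace.\<close>

lemma is_resolvent_adj:
  assumes H: "sym_on n H" and y: "y \<noteq> 0"
  shows "is_resolvent n H y (\<lambda>i j. adj_mat (cmat n (shifted H y)) $$ (nat i, nat j) / Determinant.det (cmat n (shifted H y)))"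
  unfolding is_resolvent_def
proof (intro ballI)
  let ?M = "cmat n (shifted H y)"
  fix a j assume a: "a \<in> {0..<int n}" and j: "j \<in> {0..<int n}"
  have M: "?M \<in> carrier_mat n n" by (simp add: cmat_def)
  note adj = adj_mat[OF M]
  have "(\<Sum>b\<in>{0..<int n}. shifted H y a b * (adj_mat ?M $$ (nat b, nat j) / Determinant.det ?M)) =
      (\<Sum>k<n. ?M $$ (nat a, k) * adj_mat ?M $$ (k, nat j)) / Determinant.det ?M"
    using a j by (auto simp: sum_int_nat sum_divide_distrib cmat_def intro!: sum.cong)
  also have "(\<Sum>k<n. ?M $$ (nat a, k) * adj_mat ?M $$ (k, nat j)) = (?M * adj_mat ?M) $$ (nat a, nat j)"
    using a j M adj(1) by (auto simp: scalar_prod_def lessThan_atLeast0 intro!: sum.cong)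
  also have "\<dots> = (if a = j then Determinant.det ?M else 0)" using a j by (auto simp: adj(2) nat_eq_iff2)
  finally show "(\<Sum>b\<in>{0..<int n}. shifted H y a b * (adj_mat ?M $$ (nat b, nat j) / Determinant.det ?M)) = (if a = j then 1 else 0)"
    using det_shifted_nonzero[OF H y] by simp
qed

text \<open>The product of the transpose of \<open>G'\<close>, the shifted matrix and
  \<open>G\<close> is evaluated from both sides. Taking \<open>G = G'\<close> gives symmetry;
  combining two instances gives uniqueness.\<close>

lemma is_resolvent_left:
  assumes H: "sym_on n H" and G: "is_resolvent n H y G" and G': "is_resolvent n H y G'"
    and a: "a \<in> {0..<int n}" and j: "j \<in> {0..<int n}"
  shows "G a j = G' j a"
proof -
  let ?I = "{0..<int n}"
  have "(\<Sum>b\<in>?I. \<Sum>c\<in>?I. G' b a * shifted H y b c * G c j) = (\<Sum>b\<in>?I. G' b a * (if b = j then 1 else 0))"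
    using G j by (intro sum.cong refl) (simp add: is_resolvent_def mult.assoc sum_distrib_left[symmetric])
  also have "\<dots> = G' j a" using j by (intro sum_mult_delta) auto
  finally have 1: "(\<Sum>b\<in>?I. \<Sum>c\<in>?I. G' b a * shifted H y b c * G c j) = G' j a" .
  have "(\<Sum>b\<in>?I. \<Sum>c\<in>?I. G' b a * shifted H y b c * G c j) = (\<Sum>c\<in>?I. \<Sum>b\<in>?I. G' b a * shifted H y b c * G c j)"
    by (rule sum.swap)
  also have "\<dots> = (\<Sum>c\<in>?I. (\<Sum>b\<in>?I. shifted H y c b * G' b a) * G c j)"
    by (intro sum.cong refl) (auto simp: sum_distrib_right sum_distrib_left shifted_sym[OF H, of _ _ y] mult_ac intro!: sum.cong)
  also have "\<dots> = (\<Sum>c\<in>?I. (if c = a then 1 else 0) * G c j)"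
    using G' a by (intro sum.cong refl) (simp add: is_resolvent_def)
  also have "\<dots> = G a j" using a by (intro sum_mult_delta) auto
  finally show ?thesis using 1 by simp
qed

lemma is_resolvent_unique:
  assumes "sym_on n H" "is_resolvent n H y G" "is_resolvent n H y G'" "a \<in> {0..<int n}" "j \<in> {0..<int n}"
  shows "G a j = G' a j"
  using is_resolvent_left[OF assms] is_resolvent_left[OF assms(1,3,3,5,4)] by simp

lemma resolvent_is_resolvent:
  assumes "sym_on n H" "y \<noteq> 0"
  shows "is_resolvent n H y (resolvent n H y)"
proof -
  have "is_resolvent n H y (SOME G. is_resolvent n H y G)" by (rule someI[where P = "is_resolvent n H y", OF is_resolvent_adj[OF assms]])
  then show ?thesis by (simp add: is_resolvent_def resolvent_def)
qed

lemma resolvent_periodic [simp]: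
  "resolvent n H y (i mod int n) j = resolvent n H y i j" "resolvent n H y i (j mod int n) = resolvent n H y i j"
  by (simp_all add: resolvent_def)

section \<open>Symmetry and norm bounds of a resolvent\<close>

context
  fixes n :: nat and H :: "int \<Rightarrow> int \<Rightarrow> real" and y :: real
  assumes H: "sym_on n H" and y: "0 < y"
begin

lemma resolvent_eq:
  "a \<in> {0..<int n} \<Longrightarrow> j \<in> {0..<int n} \<Longrightarrow> (\<Sum>b\<in>{0..<int n}. shifted H y a b * resolvent n H y b j) = (if a = j then 1 else 0)"
  using resolvent_is_resolvent[OF H] y by (simp add: is_resolvent_def)

lemma resolvent_sym: "0 < n \<Longrightarrow> resolvent n H y i j = resolvent n H y j i"
  using is_resolvent_left[OF H resolvent_is_resolvent resolvent_is_resolvent, of y "i mod int n" "j mod int n"] H y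
  by simp

lemma resolvent_eq_left:
  assumes a: "a \<in> {0..<int n}" and j: "j \<in> {0..<int n}"
  shows "(\<Sum>b\<in>{0..<int n}. resolvent n H y j b * shifted H y b a) = (if a = j then 1 else 0)"
proof -
  have "(\<Sum>b\<in>{0..<int n}. resolvent n H y j b * shifted H y b a) = (\<Sum>b\<in>{0..<int n}. shifted H y a b * resolvent n H y b j)"
    using a by (intro sum.cong refl) (auto simp: shifted_sym[OF H, of _ a] resolvent_sym[of j])
  then show ?thesis using resolvent_eq[OF a j] by simp
qed

lemma resolvent_op_bound:
  "(\<Sum>a\<in>{0..<int n}. (cmod (\<Sum>b\<in>{0..<int n}. resolvent n H y a b * v b))\<^sup>2) \<le> (\<Sum>a\<in>{0..<int n}. (cmod (v a))\<^sup>2) / y\<^sup>2"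
proof -
  let ?I = "{0..<int n}"
  have "y\<^sup>2 * (\<Sum>a\<in>?I. (cmod (\<Sum>b\<in>?I. resolvent n H y a b * v b))\<^sup>2) \<le> (\<Sum>a\<in>?I. (cmod (v a))\<^sup>2)"
  proof (rule shifted_lower_bound[OF H])
    fix a assume a: "a \<in> ?I"
    have "(\<Sum>c\<in>?I. shifted H y a c * (\<Sum>b\<in>?I. resolvent n H y c b * v b)) = (\<Sum>b\<in>?I. \<Sum>c\<in>?I. shifted H y a c * resolvent n H y c b * v b)"
      by (subst sum.swap) (simp add: sum_distrib_left mult.assoc)
    also have "\<dots> = (\<Sum>b\<in>?I. (if a = b then 1 else 0) * v b)"
      using a by (intro sum.cong refl) (simp only: sum_distrib_right[symmetric] resolvent_eq)
    also have "\<dots> = v a" using a by (intro sum_mult_delta) auto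
    finally show "v a = (\<Sum>b\<in>?I. shifted H y a b * (\<Sum>b'\<in>?I. resolvent n H y b b' * v b'))" by simp
  qed
  then show ?thesis using y by (simp add: field_simps)
qed

text \<open>This is the operator bound at a unit vector: a whole column in square sum costs no more
  than a single entry.\<close>

lemma resolvent_column_bound:
  assumes "0 < n"
  shows "(\<Sum>a\<in>{0..<int n}. (cmod (resolvent n H y a j))\<^sup>2) \<le> 1 / y\<^sup>2"
proof -
  let ?I = "{0..<int n}" and ?j = "j mod int n"
  have j: "?j \<in> ?I" using assms by simp
  have "(\<Sum>a\<in>?I. (cmod (\<Sum>b\<in>?I. resolvent n H y a b * (if b = ?j then 1 else 0)))\<^sup>2) \<le> (\<Sum>a\<in>?I. (cmod (if a = ?j then 1 else 0))\<^sup>2) / y\<^sup>2"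
    by (rule resolvent_op_bound)
  moreover have "(\<Sum>a\<in>?I. (cmod (if a = ?j then 1 else 0))\<^sup>2) = (1::real)"
    using j by (subst sum.cong[OF refl, of _ _ "\<lambda>a. if a = ?j then 1 else 0"]) auto
  moreover have "(\<Sum>b\<in>?I. resolvent n H y a b * (if b = ?j then 1 else 0)) = resolvent n H y a j" for a
    using sum_mult_delta(1)[OF _ j, of "resolvent n H y a"] by simp
  ultimately show ?thesis by simp
qed

lemma resolvent_row_bound: "0 < n \<Longrightarrow> (\<Sum>b\<in>{0..<int n}. (cmod (resolvent n H y a b))\<^sup>2) \<le> 1 / y\<^sup>2"
  using resolvent_column_bound[of a] by (simp add: resolvent_sym[of a])

lemma resolvent_entry_bound:
  assumes "0 < n" shows "cmod (resolvent n H y a b) \<le> 1 / y"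
proof -
  have "(cmod (resolvent n H y a (b mod int n)))\<^sup>2 \<le> (\<Sum>b\<in>{0..<int n}. (cmod (resolvent n H y a b))\<^sup>2)"
    by (rule member_le_sum) (use assms in auto)
  also have "\<dots> \<le> (1 / y)\<^sup>2" using resolvent_row_bound[OF assms] by (simp add: power_divide)
  finally show ?thesis using y by (simp add: power2_le_iff_abs_le)
qed

end

section \<open>Dependence of the resolvent on the matrix\<close>

context
  fixes n :: nat and H :: "int \<Rightarrow> int \<Rightarrow> real" and y :: real
  assumes H: "sym_on n H" and y: "0 < y"
begin

text \<open>The second resolvent identity. Both shifted matrices are placed between the two
  resolvents, and each collapses against its own inverse; periodicity extends the result to all
  indices.\<close>

lemma resolvent_difference:
  assumes H': "sym_on n H'" and n: "0 < n"
  shows "resolvent n H y a j - resolvent n H' y a j =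
    - (\<Sum>b\<in>{0..<int n}. \<Sum>c\<in>{0..<int n}. resolvent n H y a b * of_real (H b c - H' b c) * resolvent n H' y c j)"
proof -
  let ?I = "{0..<int n}" and ?G = "resolvent n H y" and ?G' = "resolvent n H' y"
  have main: "?G a j - ?G' a j = - (\<Sum>b\<in>?I. \<Sum>c\<in>?I. ?G a b * of_real (H b c - H' b c) * ?G' c j)"
    if a: "a \<in> ?I" and j: "j \<in> ?I" for a j
  proof -
    have eq': "(\<Sum>c\<in>?I. shifted H' y b c * ?G' c j) = (if b = j then 1 else 0)" if "b \<in> ?I" for b
      using resolvent_is_resolvent[OF H'] y j that by (simp add: is_resolvent_def)
    have "(\<Sum>b\<in>?I. \<Sum>c\<in>?I. ?G a b * shifted H y b c * ?G' c j) = (\<Sum>c\<in>?I. (\<Sum>b\<in>?I. ?G a b * shifted H y b c) * ?G' c j)"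
      by (subst sum.swap) (simp add: sum_distrib_right)
    also have "\<dots> = (\<Sum>c\<in>?I. (if c = a then 1 else 0) * ?G' c j)"
      by (intro sum.cong refl) (simp only: resolvent_eq_left[OF H y _ a])
    also have "\<dots> = ?G' a j" using a by (intro sum_mult_delta) auto
    finally have 1: "(\<Sum>b\<in>?I. \<Sum>c\<in>?I. ?G a b * shifted H y b c * ?G' c j) = ?G' a j" .
    have "(\<Sum>b\<in>?I. \<Sum>c\<in>?I. ?G a b * shifted H' y b c * ?G' c j) = (\<Sum>b\<in>?I. ?G a b * (\<Sum>c\<in>?I. shifted H' y b c * ?G' c j))"
      by (simp add: sum_distrib_left mult.assoc)
    also have "\<dots> = (\<Sum>b\<in>?I. ?G a b * (if b = j then 1 else 0))"
      by (intro sum.cong refl) (simp only: eq')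
    also have "\<dots> = ?G a j" using j by (intro sum_mult_delta) auto
    finally have 2: "(\<Sum>b\<in>?I. \<Sum>c\<in>?I. ?G a b * shifted H' y b c * ?G' c j) = ?G a j" .
    have "(\<Sum>b\<in>?I. \<Sum>c\<in>?I. ?G a b * of_real (H b c - H' b c) * ?G' c j) = ?G' a j - ?G a j"
      unfolding 1[symmetric] 2[symmetric] by (simp add: shifted_def sum_subtractf[symmetric] algebra_simps)
    then show ?thesis by simp
  qed
  show ?thesis using main[of "a mod int n" "j mod int n"] n by simp
qed

text \<open>A crude bound in the sum of the absolute entries, meant for continuity in the entries at
  fixed \<open>n\<close>.\<close>

lemma resolvent_entry_difference:
  assumes H': "sym_on n H'" and n: "0 < n"
  shows "cmod (resolvent n H y a j - resolvent n H' y a j) \<le> (\<Sum>b\<in>{0..<int n}. \<Sum>c\<in>{0..<int n}. \<bar>H b c - H' b c\<bar>) / y\<^sup>2"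
proof -
  let ?I = "{0..<int n}" and ?G = "resolvent n H y" and ?G' = "resolvent n H' y"
  have G': "cmod (?G' c j) \<le> 1 / y" for c
    using resolvent_entry_bound[OF H' y n] .
  have "cmod (?G a j - ?G' a j) \<le> (\<Sum>b\<in>?I. \<Sum>c\<in>?I. cmod (?G a b * of_real (H b c - H' b c) * ?G' c j))"
    unfolding resolvent_difference[OF H' n] norm_minus_cancel
    by (rule order_trans[OF norm_sum]) (intro sum_mono norm_sum)
  also have "\<dots> \<le> (\<Sum>b\<in>?I. \<Sum>c\<in>?I. 1 / y * \<bar>H b c - H' b c\<bar> * (1 / y))"
    unfolding norm_mult norm_of_real using resolvent_entry_bound[OF H y n] G' y
    by (intro sum_mono mult_mono) auto
  also have "\<dots> = (\<Sum>b\<in>?I. \<Sum>c\<in>?I. \<bar>H b c - H' b c\<bar>) / y\<^sup>2"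
    by (simp add: sum_divide_distrib power2_eq_square)
  finally show ?thesis .
qed

text \<open>Cyclicity of the trace pairs \<open>H - H'\<close> with a product of the two resolvents,
  whose squared Hilbert-Schmidt norm is at most \<open>n / y ^ 4\<close>. Hence mean square control
  of the entries is enough for the trace.\<close>

lemma resolvent_trace_difference:
  assumes H': "sym_on n H'" and n: "0 < n"
  shows "(cmod ((\<Sum>a\<in>{0..<int n}. resolvent n H y a a) - (\<Sum>a\<in>{0..<int n}. resolvent n H' y a a)))\<^sup>2
    \<le> n / y ^ 4 * (\<Sum>b\<in>{0..<int n}. \<Sum>c\<in>{0..<int n}. (H b c - H' b c)\<^sup>2)"
proof -
  let ?I = "{0..<int n}" and ?G = "resolvent n H y" and ?G' = "resolvent n H' y"
  define K where "K c b = (\<Sum>a\<in>?I. ?G' c a * ?G a b)" for c b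
  have "(\<Sum>a\<in>?I. ?G a a) - (\<Sum>a\<in>?I. ?G' a a) = - (\<Sum>a\<in>?I. \<Sum>b\<in>?I. \<Sum>c\<in>?I. ?G a b * of_real (H b c - H' b c) * ?G' c a)"
    by (simp only: sum_subtractf[symmetric] resolvent_difference[OF H' n] sum_negf)
  also have "(\<Sum>a\<in>?I. \<Sum>b\<in>?I. \<Sum>c\<in>?I. ?G a b * of_real (H b c - H' b c) * ?G' c a) =
      (\<Sum>b\<in>?I. \<Sum>a\<in>?I. \<Sum>c\<in>?I. ?G a b * of_real (H b c - H' b c) * ?G' c a)" by (rule sum.swap)
  also have "\<dots> = (\<Sum>b\<in>?I. \<Sum>c\<in>?I. \<Sum>a\<in>?I. ?G a b * of_real (H b c - H' b c) * ?G' c a)"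
    by (rule sum.cong[OF refl], rule sum.swap)
  also have "\<dots> = (\<Sum>b\<in>?I. \<Sum>c\<in>?I. of_real (H b c - H' b c) * K c b)"
    by (simp add: K_def sum_distrib_left mult_ac)
  also have "\<dots> = (\<Sum>(b, c)\<in>?I \<times> ?I. of_real (H b c - H' b c) * K c b)" by (simp add: sum.cartesian_product)
  finally have "(cmod ((\<Sum>a\<in>?I. ?G a a) - (\<Sum>a\<in>?I. ?G' a a)))\<^sup>2 = (cmod (\<Sum>(b, c)\<in>?I \<times> ?I. of_real (H b c - H' b c) * K c b))\<^sup>2" by simp
  also have "\<dots> \<le> (\<Sum>p\<in>?I \<times> ?I. (cmod (of_real (H (fst p) (snd p) - H' (fst p) (snd p))))\<^sup>2) * (\<Sum>p\<in>?I \<times> ?I. (cmod (K (snd p) (fst p)))\<^sup>2)"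
    unfolding case_prod_beta by (rule sum_Cauchy_Schwarz)
  also have "\<dots> = (\<Sum>b\<in>?I. \<Sum>c\<in>?I. (H b c - H' b c)\<^sup>2) * (\<Sum>b\<in>?I. \<Sum>c\<in>?I. (cmod (K c b))\<^sup>2)"
    by (simp only: sum.cartesian_product split_def norm_of_real power2_abs)
  finally have le: "(cmod ((\<Sum>a\<in>?I. ?G a a) - (\<Sum>a\<in>?I. ?G' a a)))\<^sup>2
      \<le> (\<Sum>b\<in>?I. \<Sum>c\<in>?I. (H b c - H' b c)\<^sup>2) * (\<Sum>b\<in>?I. \<Sum>c\<in>?I. (cmod (K c b))\<^sup>2)" .
  have "(\<Sum>b\<in>?I. \<Sum>c\<in>?I. (cmod (K c b))\<^sup>2) \<le> (\<Sum>b\<in>?I. 1 / y ^ 4)"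
  proof (rule sum_mono)
    fix b
    have "(\<Sum>c\<in>?I. (cmod (K c b))\<^sup>2) \<le> (\<Sum>a\<in>?I. (cmod (?G a b))\<^sup>2) / y\<^sup>2"
      unfolding K_def by (rule resolvent_op_bound[OF H' y])
    also have "\<dots> \<le> (1 / y\<^sup>2) / y\<^sup>2" by (intro divide_right_mono resolvent_column_bound H y n) simp
    finally show "(\<Sum>c\<in>?I. (cmod (K c b))\<^sup>2) \<le> 1 / y ^ 4" by (simp add: power2_eq_square power4_eq_xxxx mult.assoc)
  qed
  then have "(\<Sum>b\<in>?I. \<Sum>c\<in>?I. (H b c - H' b c)\<^sup>2) * (\<Sum>b\<in>?I. \<Sum>c\<in>?I. (cmod (K c b))\<^sup>2)
      \<le> (\<Sum>b\<in>?I. \<Sum>c\<in>?I. (H b c - H' b c)\<^sup>2) * (n / y ^ 4)"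
    by (intro mult_left_mono sum_nonneg) auto
  from order_trans[OF le this] show ?thesis by (simp only: mult.commute)
qed

end

section \<open>Eigenvalues\<close>

text \<open>
  The trace is computed from the adjugate and the logarithmic derivative of the characteristic
  polynomial, so no diagonalization is needed.
\<close>

lemma shifted_char_matrix:
  "cmat n (shifted H y) = char_matrix (cmat n (\<lambda>i j. of_real (H i j))) (\<i> * of_real y)"
  by (rule eq_matI) (auto simp: cmat_def shifted_def char_matrix_def)

text \<open>A root with nonzero imaginary part would make the matrix \<open>H - Re z\<close>,
  shifted by \<open>Im z\<close>, singular. This contradicts \<open>det_shifted_nonzero\<close>,
  which covers both signs of \<open>y\<close>.\<close>

lemma real_eigenvalue:
  assumes H: "sym_on n H" and e: "poly (char_poly (cmat n (\<lambda>i j. of_real (H i j)))) z = 0"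
  shows "Im z = 0"
proof (rule ccontr)
  assume z: "Im z \<noteq> 0"
  let ?A = "cmat n (\<lambda>i j. of_real (H i j))"
  let ?H = "\<lambda>i j. H i j - (if i = j then Re z else 0)"
  have "sym_on n ?H" using H by (auto simp: sym_on_def)
  from det_shifted_nonzero[OF this z] have nz: "Determinant.det (cmat n (shifted ?H (Im z))) \<noteq> 0" .
  have A: "?A \<in> carrier_mat n n" by (simp add: cmat_def)
  have "cmat n (shifted ?H (Im z)) = char_matrix ?A z"
    by (rule eq_matI) (auto simp: cmat_def shifted_def char_matrix_def complex_eq_iff)
  then have "Determinant.det (char_matrix ?A z) \<noteq> 0" using nz by simp
  moreover have "Determinant.det (- char_matrix ?A z) = 0" using e by (simp add: char_poly_matrix[OF A])
  moreover have "char_matrix ?A z \<in> carrier_mat n n" using A by simp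
  ultimately show False using det_0_negate by blast
qed

text \<open>Diagonal entries are principal minors divided by the determinant, and the derivative of
  the characteristic polynomial is the sum of the characteristic polynomials of the principal
  submatrices. The sign arises because \<open>char_poly\<close> is the determinant of
  \<open>z - A\<close>, taken in the sizes \<open>n\<close> and \<open>n - 1\<close>.\<close>

lemma resolvent_trace_log_deriv:
  assumes H: "sym_on n H" and y: "0 < y" and n: "0 < n"
  defines "cp \<equiv> char_poly (cmat n (\<lambda>i j. of_real (H i j)))"
  shows "(\<Sum>a\<in>{0..<int n}. resolvent n H y a a) = - poly (pderiv cp) (\<i> * of_real y) / poly cp (\<i> * of_real y)"
proof -
  let ?A = "cmat n (\<lambda>i j. of_real (H i j))" and ?z = "\<i> * complex_of_real y"
  let ?M = "cmat n (shifted H y)"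
  have A: "?A \<in> carrier_mat n n" and M: "?M \<in> carrier_mat n n" by (simp_all add: cmat_def)
  have neg: "Determinant.det (- B) = (-1) ^ m * Determinant.det B" if B: "B \<in> carrier_mat m m" for B :: "complex mat" and m
  proof -
    have "- B = (-1) \<cdot>\<^sub>m B" using B by (intro eq_matI) auto
    then show ?thesis using B by simp
  qed
  have chi: "poly cp ?z = (-1) ^ n * Determinant.det ?M"
    unfolding cp_def char_poly_matrix[OF A] shifted_char_matrix[symmetric] by (rule neg[OF M])
  have del: "poly (char_poly (mat_delete ?A i i)) ?z = (-1) ^ (n - 1) * Determinant.det (mat_delete ?M i i)" if i: "i < n" for i
  proof -
    have dA: "mat_delete ?A i i \<in> carrier_mat (n - 1) (n - 1)" by (rule mat_delete_carrier[OF A])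
    have "char_matrix (mat_delete ?A i i) ?z = mat_delete ?M i i"
      using i by (intro eq_matI) (auto simp: cmat_def shifted_def char_matrix_def mat_delete_def insert_index_def)
    then show ?thesis unfolding char_poly_matrix[OF dA] using neg[OF mat_delete_carrier[OF M]] by simp
  qed
  have "(\<Sum>a\<in>{0..<int n}. resolvent n H y a a) = (\<Sum>i<n. resolvent n H y (int i) (int i))" by (rule sum_int_nat)
  also have "\<dots> = (\<Sum>i<n. Determinant.det (mat_delete ?M i i) / Determinant.det ?M)"
  proof (rule sum.cong[OF refl])
    fix i assume i: "i \<in> {..<n}"
    have "resolvent n H y (int i) (int i) = adj_mat ?M $$ (i, i) / Determinant.det ?M"
      using is_resolvent_unique[OF H resolvent_is_resolvent[OF H] is_resolvent_adj[OF H], of y "int i" "int i"] i y by simp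
    then show "resolvent n H y (int i) (int i) = Determinant.det (mat_delete ?M i i) / Determinant.det ?M"
      using i M by (simp add: adj_mat_def cofactor_def)
  qed
  also have "\<dots> = (\<Sum>i<n. (-1) ^ (n - 1) * poly (char_poly (mat_delete ?A i i)) ?z) / Determinant.det ?M"
    unfolding sum_divide_distrib by (intro sum.cong refl) (simp add: del power_add[symmetric] mult.assoc[symmetric] power_mult_distrib[symmetric])
  also have "\<dots> = (-1) ^ (n - 1) * poly (pderiv cp) ?z / Determinant.det ?M"
    by (simp add: cp_def pderiv_char_poly[OF A] poly_sum sum_distrib_left)
  also have "\<dots> = - poly (pderiv cp) ?z / poly cp ?z"
    unfolding chi using n by (cases n) (auto simp: uminus_power_if)
  finally show ?thesis .
qed

lemma pderiv_linear_factors: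
  fixes z :: complex
  assumes "\<And>a. a \<in> set as \<Longrightarrow> z \<noteq> a"
  shows "poly (pderiv (\<Prod>a\<leftarrow>as. [:- a, 1:])) z = poly (\<Prod>a\<leftarrow>as. [:- a, 1:]) z * (\<Sum>a\<leftarrow>as. 1 / (z - a))"
  using assms
proof (induction as)
  case (Cons a as)
  then have "z - a \<noteq> 0" by simp
  then show ?case using Cons by (simp add: pderiv_mult pderiv_pCons field_simps del: mult_pCons_left)
qed simp

text \<open>\<open>proots\<close> of a real polynomial sees real roots only. Factoring over the
  complex numbers and using that all roots are real shows that none is lost, multiplicities
  included.\<close>

lemma eigenvalue_list_props:
  fixes A :: "real mat"
  assumes A: "A \<in> carrier_mat n n" and H: "sym_on n H" and AH: "\<And>i j. i < n \<Longrightarrow> j < n \<Longrightarrow> A $$ (i, j) = H (int i) (int j)"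
  shows "length (eigenvalue_list A) = n"
    and "char_poly (cmat n (\<lambda>i j. of_real (H i j))) = (\<Prod>a\<leftarrow>map of_real (eigenvalue_list A). [:- a, 1:])"
proof -
  let ?C = "cmat n (\<lambda>i j. complex_of_real (H i j))"
  interpret mp: map_poly_inj_comm_ring_hom complex_of_real ..
  have C: "?C \<in> carrier_mat n n" by (simp add: cmat_def)
  have CA: "?C = map_mat complex_of_real A" using A by (intro eq_matI) (auto simp: cmat_def AH)
  obtain as where as: "char_poly ?C = (\<Prod>a\<leftarrow>as. [:- a, 1:])" "length as = n" using char_poly_factorized[OF C] by blast
  have "Im a = 0" if "a \<in> set as" for a
  proof (rule real_eigenvalue[OF H])
    show "poly (char_poly ?C) a = 0" unfolding as(1) poly_prod_list using that by (simp add: prod_list_zero_iff image_image)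
  qed
  then have asr: "as = map complex_of_real (map Re as)" by (simp add: map_idI complex_eq_iff)
  have "map_poly complex_of_real (char_poly A) = map_poly complex_of_real (\<Prod>a\<leftarrow>map Re as. [:- a, 1:])"
  proof -
    have hom: "char_poly (map_mat complex_of_real A) = map_poly complex_of_real (char_poly A)"
      by (rule of_real_hom.char_poly_hom[OF A])
    have "map_poly complex_of_real (char_poly A) = (\<Prod>a\<leftarrow>map complex_of_real (map Re as). [:- a, 1:])"
      using hom as(1) unfolding asr[symmetric] CA by simp
    also have "\<dots> = map_poly complex_of_real (\<Prod>a\<leftarrow>map Re as. [:- a, 1:])"
      by (simp add: mp.hom_prod_list o_def)
    finally show ?thesis .
  qed
  then have cpA: "char_poly A = (\<Prod>a\<leftarrow>map Re as. [:- a, 1:])" by simp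
  have pr: "proots (\<Prod>a\<leftarrow>bs. [:- a, 1:]) = mset bs" for bs :: "real list"
  proof (induction bs)
    case (Cons b bs)
    have "(\<Prod>a\<leftarrow>bs. [:- a, 1:]) \<noteq> 0" by (auto simp: prod_list_zero_iff)
    then show ?case using Cons by (simp add: proots_mult del: mult_pCons_left)
  qed simp
  have ev: "mset (eigenvalue_list A) = mset (map Re as)"
    unfolding eigenvalue_list_def cpA pr by simp
  then show "length (eigenvalue_list A) = n" using as(2) by (metis length_map size_mset)
  have "mset (map of_real (eigenvalue_list A)) = mset as" using ev asr by (metis mset_map)
  then have "mset (map (\<lambda>a. [:- a, 1:]) (map of_real (eigenvalue_list A))) = mset (map (\<lambda>a. [:- a, 1:]) as)" by (metis mset_map)
  then show "char_poly ?C = (\<Prod>a\<leftarrow>map of_real (eigenvalue_list A). [:- a, 1:])"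
    unfolding as(1) by (metis prod_mset_prod_list)
qed

lemma resolvent_trace_eigenvalues:
  fixes A :: "real mat"
  assumes A: "A \<in> carrier_mat n n" and H: "sym_on n H" and AH: "\<And>i j. i < n \<Longrightarrow> j < n \<Longrightarrow> A $$ (i, j) = H (int i) (int j)"
    and y: "0 < y" and n: "0 < n"
  shows "(\<Sum>a\<in>{0..<int n}. resolvent n H y a a) = (\<Sum>i<n. 1 / (of_real (eigenvalue_list A ! i) - \<i> * of_real y))"
proof -
  let ?z = "\<i> * complex_of_real y" and ?L = "eigenvalue_list A"
  let ?as = "map complex_of_real ?L"
  have ev: "length ?L = n" "char_poly (cmat n (\<lambda>i j. of_real (H i j))) = (\<Prod>a\<leftarrow>?as. [:- a, 1:])"
    using eigenvalue_list_props[OF A H] AH by blast+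
  have ne: "?z \<noteq> a" if "a \<in> set ?as" for a using that y by (auto simp: complex_eq_iff)
  have pd: "poly (pderiv (\<Prod>a\<leftarrow>?as. [:- a, 1:])) ?z = poly (\<Prod>a\<leftarrow>?as. [:- a, 1:]) ?z * (\<Sum>a\<leftarrow>?as. 1 / (?z - a))"
    by (rule pderiv_linear_factors) (rule ne)
  have nz: "poly (\<Prod>a\<leftarrow>?as. [:- a, 1:]) ?z \<noteq> 0"
    unfolding poly_prod_list using ne y by (auto simp: prod_list_zero_iff)
  have "(\<Sum>a\<in>{0..<int n}. resolvent n H y a a) = - (\<Sum>a\<leftarrow>?as. 1 / (?z - a))"
    unfolding resolvent_trace_log_deriv[OF H y n] ev(2) pd using nz by simp
  also have "\<dots> = - (\<Sum>i<n. 1 / (?z - of_real (?L ! i)))"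
    using ev(1) by (simp add: sum_list_sum_nth lessThan_atLeast0)
  also have "\<dots> = (\<Sum>i<n. 1 / (of_real (?L ! i) - ?z))"
    unfolding sum_negf[symmetric] by (intro sum.cong refl) (metis minus_diff_eq minus_divide_right)
  finally show ?thesis .
qed

section \<open>The Kreweras complement\<close>

lemma noncrossingD:
  "noncrossing P \<Longrightarrow> B \<in> P \<Longrightarrow> C \<in> P \<Longrightarrow> a \<in> B \<Longrightarrow> c \<in> B \<Longrightarrow> b \<in> C \<Longrightarrow> d \<in> C \<Longrightarrow> a < b \<Longrightarrow> b < c \<Longrightarrow> c < d \<Longrightarrow> B = C"
  unfolding noncrossing_def by blast

text \<open>The unbarred points between the barred points of \<open>a\<close> and \<open>c\<close>
  are exactly those in this half-open interval. The two barred points may share a block of the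
  complement precisely if no block of \<open>\<sigma>\<close> has points both inside and outside of
  it. Positions are best read as gaps: \<open>a\<close> is the gap just after the point
  \<open>a\<close>.\<close>

definition closed_ivl :: "nat set set \<Rightarrow> nat \<Rightarrow> nat \<Rightarrow> bool" where
  "closed_ivl \<sigma> a c \<longleftrightarrow> (\<forall>B\<in>\<sigma>. B \<subseteq> {min a c<..max a c} \<or> B \<inter> {min a c<..max a c} = {})"

lemma closed_ivl_sym: "closed_ivl \<sigma> a c \<longleftrightarrow> closed_ivl \<sigma> c a"
  by (simp add: closed_ivl_def min.commute max.commute)

lemma closed_ivl_refl [simp]: "closed_ivl \<sigma> a a"
  by (simp add: closed_ivl_def)

text \<open>In this parity form, which records whether each gap separates two points of a block,
  transitivity becomes propositional.\<close>

lemma closed_ivl_iff: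
  "closed_ivl \<sigma> a c \<longleftrightarrow> (\<forall>B\<in>\<sigma>. \<forall>p\<in>B. \<forall>q\<in>B. (p \<le> a \<longleftrightarrow> q \<le> a) \<longleftrightarrow> (p \<le> c \<longleftrightarrow> q \<le> c))"
proof -
  have "(B \<subseteq> {min a c<..max a c} \<or> B \<inter> {min a c<..max a c} = {}) \<longleftrightarrow>
      (\<forall>p\<in>B. \<forall>q\<in>B. p \<in> {min a c<..max a c} \<longleftrightarrow> q \<in> {min a c<..max a c})" for B by blast
  moreover have "(p \<in> {min a c<..max a c} \<longleftrightarrow> q \<in> {min a c<..max a c}) \<longleftrightarrow>
      ((p \<le> a \<longleftrightarrow> q \<le> a) \<longleftrightarrow> (p \<le> c \<longleftrightarrow> q \<le> c))" for p q by (auto simp: min_def max_def)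
  ultimately show ?thesis by (simp add: closed_ivl_def)
qed

lemma closed_ivl_trans: "closed_ivl \<sigma> a b \<Longrightarrow> closed_ivl \<sigma> b c \<Longrightarrow> closed_ivl \<sigma> a c"
  unfolding closed_ivl_iff by meson

definition ivl_class :: "nat \<Rightarrow> nat set set \<Rightarrow> nat \<Rightarrow> nat set" where
  "ivl_class N \<sigma> a = {j \<in> {1..N}. closed_ivl \<sigma> j a}"

lemma ivl_class_eq: "closed_ivl \<sigma> a b \<Longrightarrow> ivl_class N \<sigma> a = ivl_class N \<sigma> b"
  unfolding ivl_class_def using closed_ivl_trans closed_ivl_sym by blast

lemma ivl_classes_partition: "partition_on {1..N} (ivl_class N \<sigma> ` {1..N})"
proof (rule partition_onI)
  show "\<Union> (ivl_class N \<sigma> ` {1..N}) = {1..N}" by (auto simp: ivl_class_def)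
  show "{} \<notin> ivl_class N \<sigma> ` {1..N}"
  proof
    assume "{} \<in> ivl_class N \<sigma> ` {1..N}"
    then obtain a where "a \<in> {1..N}" "ivl_class N \<sigma> a = {}" by auto
    moreover have "a \<in> ivl_class N \<sigma> a" using calculation by (simp add: ivl_class_def)
    ultimately show False by simp
  qed
  fix P Q assume "P \<in> ivl_class N \<sigma> ` {1..N}" "Q \<in> ivl_class N \<sigma> ` {1..N}" and ne: "P \<noteq> Q"
  then obtain a b where ab: "P = ivl_class N \<sigma> a" "Q = ivl_class N \<sigma> b" by auto
  show "disjnt P Q"
  proof (rule ccontr)
    assume "\<not> disjnt P Q"
    then obtain j where "closed_ivl \<sigma> j a" "closed_ivl \<sigma> j b" unfolding ab disjnt_def ivl_class_def by auto
    then have "closed_ivl \<sigma> a b" using closed_ivl_trans closed_ivl_sym by blast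
    then show False using ne ivl_class_eq ab by simp
  qed
qed

text \<open>A block of \<open>\<sigma>\<close> cannot cross a class, since its points are separated
  by all gaps of a class or by none, and two crossing classes turn out to be equal.\<close>

lemma noncrossing_interleave_ivl_classes:
  assumes nc: "noncrossing \<sigma>"
  shows "noncrossing (interleave \<sigma> (ivl_class N \<sigma> ` {1..N}))"
  unfolding noncrossing_def
proof (intro ballI allI impI, elim conjE)
  fix B C a b c d
  assume B: "B \<in> interleave \<sigma> (ivl_class N \<sigma> ` {1..N})" and C: "C \<in> interleave \<sigma> (ivl_class N \<sigma> ` {1..N})"
    and o: "a < b" "b < c" "c < d" and m: "a \<in> B" "c \<in> B" "b \<in> C" "d \<in> C"
  from B consider (e) B' where "B' \<in> \<sigma>" "B = (\<lambda>i. 2 * i) ` B'"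
    | (o) x where "B = (\<lambda>i. 2 * i + 1) ` ivl_class N \<sigma> x" by (auto simp: interleave_def)
  then show "B = C"
  proof cases
    case e
    then obtain a' c' where ac: "a = 2 * a'" "c = 2 * c'" "a' \<in> B'" "c' \<in> B'" using m by auto
    from C consider (e') C' where "C' \<in> \<sigma>" "C = (\<lambda>i. 2 * i) ` C'"
      | (o') x where "C = (\<lambda>i. 2 * i + 1) ` ivl_class N \<sigma> x" by (auto simp: interleave_def)
    then show ?thesis
    proof cases
      case e'
      then obtain b' d' where bd: "b = 2 * b'" "d = 2 * d'" "b' \<in> C'" "d' \<in> C'" using m by auto
      have "B' = C'" using nc e(1) e'(1) ac bd o unfolding noncrossing_def by (metis mult_less_cancel1)
      then show ?thesis using e e' by simp
    next
      case o'
      then obtain b' d' where bd: "b = 2 * b' + 1" "d = 2 * d' + 1" "closed_ivl \<sigma> b' x" "closed_ivl \<sigma> d' x"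
        using m by (auto simp: ivl_class_def)
      have "closed_ivl \<sigma> b' d'" using bd closed_ivl_trans closed_ivl_sym by blast
      then have "(a' \<le> b' \<longleftrightarrow> c' \<le> b') \<longleftrightarrow> (a' \<le> d' \<longleftrightarrow> c' \<le> d')" using e(1) ac unfolding closed_ivl_iff by blast
      then show ?thesis using o ac bd by auto
    qed
  next
    case o: o
    then obtain a' c' where ac: "a = 2 * a' + 1" "c = 2 * c' + 1" "closed_ivl \<sigma> a' x" "closed_ivl \<sigma> c' x"
      using m by (auto simp: ivl_class_def)
    have cl: "closed_ivl \<sigma> a' c'" using ac closed_ivl_trans closed_ivl_sym by blast
    from C consider (e') C' where "C' \<in> \<sigma>" "C = (\<lambda>i. 2 * i) ` C'"
      | (o') y where "C = (\<lambda>i. 2 * i + 1) ` ivl_class N \<sigma> y" by (auto simp: interleave_def)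
    then show ?thesis
    proof cases
      case e'
      then obtain b' d' where bd: "b = 2 * b'" "d = 2 * d'" "b' \<in> C'" "d' \<in> C'" using m by auto
      have "(b' \<le> a' \<longleftrightarrow> d' \<le> a') \<longleftrightarrow> (b' \<le> c' \<longleftrightarrow> d' \<le> c')" using e'(1) bd cl unfolding closed_ivl_iff by blast
      then show ?thesis using \<open>a < b\<close> \<open>b < c\<close> \<open>c < d\<close> ac bd by auto
    next
      case o'
      then obtain b' d' where bd: "b = 2 * b' + 1" "d = 2 * d' + 1" "closed_ivl \<sigma> b' y" "closed_ivl \<sigma> d' y"
        using m by (auto simp: ivl_class_def)
      have cl2: "closed_ivl \<sigma> b' d'" using bd closed_ivl_trans closed_ivl_sym by blast
      have lt: "a' < b'" "b' < c'" "c' < d'" using \<open>a < b\<close> \<open>b < c\<close> \<open>c < d\<close> ac bd by auto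
      \<comment> \<open>Two points split by the gap \<open>a'\<close> are split by \<open>c'\<close>
        as well, hence by \<open>b'\<close> in between. Conversely, being split by \<open>b'\<close>
        implies being split by \<open>d'\<close>, hence by \<open>c'\<close>, hence by
        \<open>a'\<close>.\<close>
      have "closed_ivl \<sigma> a' b'"
        unfolding closed_ivl_iff
      proof (intro ballI)
        fix B p q assume B: "B \<in> \<sigma>" "p \<in> B" "q \<in> B"
        have 1: "(p \<le> a' \<longleftrightarrow> q \<le> a') \<longleftrightarrow> (p \<le> c' \<longleftrightarrow> q \<le> c')" using cl B unfolding closed_ivl_iff by blast
        have 2: "(p \<le> b' \<longleftrightarrow> q \<le> b') \<longleftrightarrow> (p \<le> d' \<longleftrightarrow> q \<le> d')" using cl2 B unfolding closed_ivl_iff by blast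
        show "(p \<le> a' \<longleftrightarrow> q \<le> a') \<longleftrightarrow> (p \<le> b' \<longleftrightarrow> q \<le> b')" using 1 2 lt by linarith
      qed
      then have "closed_ivl \<sigma> x y" using ac bd closed_ivl_trans closed_ivl_sym by blast
      then show ?thesis using o o' ivl_class_eq by simp
    qed
  qed
qed

text \<open>If two points of one block of \<open>\<tau>\<close> were inequivalent, a block of
  \<open>\<sigma>\<close> would reach across one of their gaps but not the other, which is one of
  two crossing patterns.\<close>

lemma ivl_classes_coarsest:
  assumes \<tau>: "partition_on {1..N} \<tau>" and nc: "noncrossing (interleave \<sigma> \<tau>)"
  shows "refines {1..N} \<tau> (ivl_class N \<sigma> ` {1..N})"
  unfolding refines_def
proof (intro conjI ballI \<tau> ivl_classes_partition)
  fix V assume V: "V \<in> \<tau>"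
  then obtain a where a: "a \<in> V" using \<tau> by (metis ex_in_conv partition_onD3)
  have sub: "V \<subseteq> {1..N}" using V partition_onD1[OF \<tau>] by auto
  have le: "closed_ivl \<sigma> x y" if xy: "x \<in> V" "y \<in> V" "x < y" for x y
    unfolding closed_ivl_iff
  proof (intro ballI)
    fix B p q assume B: "B \<in> \<sigma>" "p \<in> B" "q \<in> B"
    have in1: "(\<lambda>i. 2 * i) ` B \<in> interleave \<sigma> \<tau>" "(\<lambda>i. 2 * i + 1) ` V \<in> interleave \<sigma> \<tau>"
      using B V by (auto simp: interleave_def)
    have ne: "(\<lambda>i. 2 * i) ` B \<noteq> (\<lambda>i. 2 * i + 1) ` V"
    proof
      assume "(\<lambda>i. 2 * i) ` B = (\<lambda>i. 2 * i + 1) ` V"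
      then have "2 * p \<in> (\<lambda>i. 2 * i + 1) ` V" using B by blast
      then obtain i where "2 * p = 2 * i + 1" by auto
      then show False by presburger
    qed
    \<comment> \<open>With even codes for plain and odd codes for barred points,
      \<open>p' \<le> x < q' \<le> y\<close> becomes the strict chain
      \<open>2 p' < 2 x + 1 < 2 q' < 2 y + 1\<close>.\<close>
    have cr1: False if "p' \<in> B" "q' \<in> B" "p' \<le> x" "x < q'" "q' \<le> y" for p' q'
      using nc[unfolded noncrossing_def, rule_format, OF in1, of "2 * p'" "2 * x + 1" "2 * q'" "2 * y + 1"] ne that xy by auto
    have cr2: False if "p' \<in> B" "q' \<in> B" "x < p'" "p' \<le> y" "y < q'" for p' q'
      using nc[unfolded noncrossing_def, rule_format, OF in1(2,1), of "2 * x + 1" "2 * p'" "2 * y + 1" "2 * q'"] ne that xy by auto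
    show "(p \<le> x \<longleftrightarrow> q \<le> x) \<longleftrightarrow> (p \<le> y \<longleftrightarrow> q \<le> y)"
      using cr1[OF B(2,3)] cr1[OF B(3,2)] cr2[OF B(2,3)] cr2[OF B(3,2)] xy(3)
      by (auto simp: not_le) (use leI in blast)+
  qed
  then have "closed_ivl \<sigma> x a" if "x \<in> V" for x
    using a that closed_ivl_sym by (metis closed_ivl_refl linorder_neqE_nat)
  then have "V \<subseteq> ivl_class N \<sigma> a" using sub by (auto simp: ivl_class_def)
  then show "\<exists>Y\<in>ivl_class N \<sigma> ` {1..N}. V \<subseteq> Y" using a sub by blast
qed

text \<open>Refinement is antisymmetric, so the description by maximality has only one
  solution.\<close>

lemma kreweras_eq:
  assumes "noncrossing \<sigma>"
  shows "kreweras N \<sigma> = ivl_class N \<sigma> ` {1..N}"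
  unfolding kreweras_def
proof (rule the_equality)
  let ?K = "ivl_class N \<sigma> ` {1..N}"
  show K: "partition_on {1..N} ?K \<and> noncrossing (interleave \<sigma> ?K) \<and>
     (\<forall>\<tau>'. partition_on {1..N} \<tau>' \<and> noncrossing (interleave \<sigma> \<tau>') \<longrightarrow> refines {1..N} \<tau>' ?K)"
    using ivl_classes_partition noncrossing_interleave_ivl_classes[OF assms] ivl_classes_coarsest by simp
  fix \<tau> assume \<tau>: "partition_on {1..N} \<tau> \<and> noncrossing (interleave \<sigma> \<tau>) \<and>
     (\<forall>\<tau>'. partition_on {1..N} \<tau>' \<and> noncrossing (interleave \<sigma> \<tau>') \<longrightarrow> refines {1..N} \<tau>' \<tau>)"
  then have "refines {1..N} \<tau> ?K" using ivl_classes_coarsest by simp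
  moreover have "refines {1..N} ?K \<tau>" using \<tau> K by simp
  ultimately show "\<tau> = ?K" by (rule refines_asym)
qed

text \<open>
  The block of the complement that contains \<open>N\<close> is the one visible from outside of \<open>\<sigma>\<close>; prescribing
  its sum makes the sums over pair partitions recursive. For \<open>N = 0\<close> that block is empty.
\<close>

definition flows :: "nat \<Rightarrow> nat set set \<Rightarrow> int \<Rightarrow> (nat \<Rightarrow> int) set" where
  "flows N \<sigma> s = {k \<in> {1..N} \<rightarrow>\<^sub>E UNIV. sum k (ivl_class N \<sigma> N) = s \<and>
     (\<forall>a\<in>{1..N}. \<not> closed_ivl \<sigma> a N \<longrightarrow> sum k (ivl_class N \<sigma> a) = 0)}"

lemma S_set_eq_flows:
  assumes "noncrossing \<sigma>" "1 \<le> N"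
  shows "S_set N \<sigma> = flows N \<sigma> 0"
proof -
  have "(\<forall>V\<in>kreweras N \<sigma>. sum k V = 0) \<longleftrightarrow> sum k (ivl_class N \<sigma> N) = 0 \<and>
     (\<forall>a\<in>{1..N}. \<not> closed_ivl \<sigma> a N \<longrightarrow> sum k (ivl_class N \<sigma> a) = 0)" for k :: "nat \<Rightarrow> int"
  proof -
    have "sum k (ivl_class N \<sigma> a) = 0"
      if "sum k (ivl_class N \<sigma> N) = 0" "\<forall>a\<in>{1..N}. \<not> closed_ivl \<sigma> a N \<longrightarrow> sum k (ivl_class N \<sigma> a) = 0" "a \<in> {1..N}" for a
      using that ivl_class_eq[of \<sigma> a N N] by (cases "closed_ivl \<sigma> a N") simp_all
    moreover have "N \<in> {1..N}" using assms(2) by simp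
    ultimately show ?thesis unfolding kreweras_eq[OF assms(1)] by blast
  qed
  then show ?thesis by (simp add: S_set_def flows_def)
qed

section \<open>Removing the pair of the first point\<close>

definition shift_blocks :: "nat \<Rightarrow> nat set set \<Rightarrow> nat set set" where
  "shift_blocks s \<sigma> = (\<lambda>B. (\<lambda>i. i + s) ` B) ` \<sigma>"

text \<open>The Catalan decomposition: the pair of 1 and \<open>b\<close> splits the remaining
  points into those it encloses and those to its right, and both parts are copies of pairings of
  initial segments.\<close>

definition join_pairs :: "nat \<Rightarrow> nat set set \<Rightarrow> nat set set \<Rightarrow> nat set set" where
  "join_pairs b \<sigma>\<^sub>1 \<sigma>\<^sub>2 = insert {1, b} (shift_blocks 1 \<sigma>\<^sub>1 \<union> shift_blocks b \<sigma>\<^sub>2)"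

lemma NC2_blockE:
  assumes "\<sigma> \<in> NC2 N" "B \<in> \<sigma>"
  obtains p q where "B = {p, q}" "p < q" "1 \<le> p" "q \<le> N"
proof -
  have "card B = 2" "B \<subseteq> {1..N}" using assms by (auto simp: NC2_def partition_on_def)
  then obtain x y where xy: "B = {x, y}" "x \<noteq> y" "x \<in> {1..N}" "y \<in> {1..N}" by (auto simp: card_2_iff)
  show ?thesis
  proof (cases "x < y")
    case True then show ?thesis using that[of x y] xy by auto
  next
    case False then show ?thesis using that[of y x] xy by (auto simp: insert_commute)
  qed
qed

lemma NC2_subset: "\<sigma> \<in> NC2 N \<Longrightarrow> B \<in> \<sigma> \<Longrightarrow> B \<subseteq> {1..N}"
  by (auto simp: NC2_def partition_on_def)

lemma NC2_disjoint: "\<sigma> \<in> NC2 N \<Longrightarrow> B \<in> \<sigma> \<Longrightarrow> C \<in> \<sigma> \<Longrightarrow> x \<in> B \<Longrightarrow> x \<in> C \<Longrightarrow> B = C"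
  unfolding NC2_def partition_on_def disjoint_def by blast

lemma NC2_finite: "finite (NC2 N)"
  by (rule finite_subset[of _ "Pow (Pow {1..N})"]) (auto simp: NC2_def partition_on_def)

lemma NC2_odd: "odd N \<Longrightarrow> NC2 N = {}"
proof (rule ccontr)
  assume N: "odd N" and "NC2 N \<noteq> {}"
  then obtain \<sigma> where \<sigma>: "partition_on {1..N} \<sigma>" "\<forall>B\<in>\<sigma>. card B = 2" by (auto simp: NC2_def)
  have "card {1..N} = (\<Sum>B\<in>\<sigma>. card B)"
    using product_partition[OF \<sigma>(1)] by (metis card_eq_0_iff \<sigma>(2) zero_neq_numeral)
  also have "\<dots> = 2 * card \<sigma>" using \<sigma>(2) by simp
  finally show False using N by simp
qed

lemma NC2_0: "NC2 0 = {{}}"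
  by (auto simp: NC2_def partition_on_empty noncrossing_def)

text \<open>Position 0 stands for the gap before the first point. Its equivalence with the gap after
  the last point determines which block of the complement receives the points 1 and \<open>b\<close>
  of a removed pair.\<close>

lemma closed_ivl_full:
  assumes "\<Union>\<sigma> = {1..N}"
  shows "closed_ivl \<sigma> 0 N"
  unfolding closed_ivl_iff
proof (intro ballI)
  fix B p q assume "B \<in> \<sigma>" "p \<in> B" "q \<in> B"
  then have "p \<in> {1..N}" "q \<in> {1..N}" using assms by blast+
  then show "((p \<le> 0) = (q \<le> 0)) = ((p \<le> N) = (q \<le> N))" by simp
qed

lemma ball_join_pairs:
  "(\<forall>B\<in>join_pairs b \<sigma>\<^sub>1 \<sigma>\<^sub>2. P B) \<longleftrightarrow> P {1, b} \<and> (\<forall>B\<in>\<sigma>\<^sub>1. P ((\<lambda>i. i + 1) ` B)) \<and> (\<forall>B\<in>\<sigma>\<^sub>2. P ((\<lambda>i. i + b) ` B))"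
  by (auto simp: join_pairs_def shift_blocks_def)

lemma join_pairs_NC2:
  assumes b: "2 \<le> b" "b \<le> N" and 1: "\<sigma>\<^sub>1 \<in> NC2 (b - 2)" and 2: "\<sigma>\<^sub>2 \<in> NC2 (N - b)"
  shows "join_pairs b \<sigma>\<^sub>1 \<sigma>\<^sub>2 \<in> NC2 N"
proof -
  let ?s = "join_pairs b \<sigma>\<^sub>1 \<sigma>\<^sub>2"
  have u: "\<Union>\<sigma>\<^sub>1 = {1..b - 2}" "\<Union>\<sigma>\<^sub>2 = {1..N - b}" using 1 2 by (auto simp: NC2_def partition_on_def)
  have u1: "\<Union>(shift_blocks 1 \<sigma>\<^sub>1) = {2..b - 1}"
  proof -
    have "\<Union>(shift_blocks 1 \<sigma>\<^sub>1) = (\<lambda>i. i + 1) ` \<Union>\<sigma>\<^sub>1" unfolding shift_blocks_def by blast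
    moreover have "b - 2 + 1 = b - 1" "1 + 1 = (2::nat)" using b by auto
    ultimately show ?thesis by (simp only: u image_add_atLeastAtMost')
  qed
  have u2: "\<Union>(shift_blocks b \<sigma>\<^sub>2) = {b + 1..N}"
  proof -
    have "\<Union>(shift_blocks b \<sigma>\<^sub>2) = (\<lambda>i. i + b) ` \<Union>\<sigma>\<^sub>2" unfolding shift_blocks_def by blast
    moreover have "N - b + b = N" "1 + b = b + 1" using b by auto
    ultimately show ?thesis by (simp only: u image_add_atLeastAtMost')
  qed
  have disj: "disjnt P Q" if P: "P \<in> shift_blocks s \<tau>" "Q \<in> shift_blocks s \<tau>" and ne: "P \<noteq> Q" and \<tau>: "\<tau> \<in> NC2 K" for P Q s \<tau> K
  proof -
    obtain P' Q' where PQ: "P' \<in> \<tau>" "Q' \<in> \<tau>" "P = (\<lambda>i. i + s) ` P'" "Q = (\<lambda>i. i + s) ` Q'"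
      using P by (auto simp: shift_blocks_def)
    then have "P' \<inter> Q' = {}" using ne NC2_disjoint[OF \<tau> PQ(1,2)] by blast
    then show ?thesis unfolding PQ disjnt_def by auto
  qed
  have part: "partition_on {1..N} ?s"
  proof (rule partition_onI)
    show "\<Union>?s = {1..N}" using b u1 u2 unfolding join_pairs_def by auto
    show "{} \<notin> ?s" using 1 2 unfolding join_pairs_def shift_blocks_def by (auto simp: NC2_def)
    fix P Q assume PQ: "P \<in> ?s" "Q \<in> ?s" "P \<noteq> Q"
    have sub: "B \<subseteq> {2..b - 1}" if "B \<in> shift_blocks 1 \<sigma>\<^sub>1" for B using u1 that by blast
    have sub2: "B \<subseteq> {b + 1..N}" if "B \<in> shift_blocks b \<sigma>\<^sub>2" for B using u2 that by blast
    have d12: "disjnt A B" if "A \<in> shift_blocks 1 \<sigma>\<^sub>1" "B \<in> shift_blocks b \<sigma>\<^sub>2" for A B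
      using sub[OF that(1)] sub2[OF that(2)] unfolding disjnt_def by fastforce
    have d1: "disjnt A {1, b}" if "A \<in> shift_blocks 1 \<sigma>\<^sub>1" for A
      using sub[OF that] b unfolding disjnt_def by fastforce
    have d2: "disjnt A {1, b}" if "A \<in> shift_blocks b \<sigma>\<^sub>2" for A
      using sub2[OF that] b unfolding disjnt_def by fastforce
    show "disjnt P Q"
      using PQ d12 d1 d2 disj[OF _ _ _ 1, of _ 1] disj[OF _ _ _ 2, of _ b] unfolding join_pairs_def
      by (metis Un_iff disjnt_sym insert_iff)
  qed
  have card: "\<forall>B\<in>?s. card B = 2"
    unfolding ball_join_pairs using 1 2 b by (auto simp: NC2_def card_image)
  have ty: "B = {1, b} \<or> (B \<subseteq> {2..b - 1} \<and> (\<exists>B'\<in>\<sigma>\<^sub>1. B = (\<lambda>i. i + 1) ` B')) \<or> (B \<subseteq> {b + 1..} \<and> (\<exists>B'\<in>\<sigma>\<^sub>2. B = (\<lambda>i. i + b) ` B'))"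
    if B: "B \<in> ?s" for B
  proof -
    consider "B = {1, b}" | "B \<in> shift_blocks 1 \<sigma>\<^sub>1" | "B \<in> shift_blocks b \<sigma>\<^sub>2" using B unfolding join_pairs_def by blast
    then show ?thesis
    proof cases
      case 2
      then have "B \<subseteq> {2..b - 1}" using u1 by blast
      then show ?thesis using 2 unfolding shift_blocks_def by blast
    next
      case 3
      then have "B \<subseteq> {b + 1..N}" using u2 by blast
      then have "B \<subseteq> {b + 1..}" by auto
      then show ?thesis using 3 unfolding shift_blocks_def by blast
    qed simp
  qed
  have nc: "noncrossing \<sigma>\<^sub>1" "noncrossing \<sigma>\<^sub>2" using 1 2 by (auto simp: NC2_def)
  have "noncrossing ?s"
    unfolding noncrossing_def
  proof (intro ballI allI impI; elim conjE)
    fix B C p q r s assume B: "B \<in> ?s" and C: "C \<in> ?s" and o: "p < q" "q < r" "r < s" and m: "p \<in> B" "r \<in> B" "q \<in> C" "s \<in> C"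
    show "B = C"
      using ty[OF B]
    proof (elim disjE conjE bexE)
      assume B1: "B = {1, b}"
      then have pr: "p = 1" "r = b" using m o by auto
      show ?thesis
        using ty[OF C]
      proof (elim disjE conjE bexE)
        assume "C \<subseteq> {2..b - 1}"
        then have "s \<in> {2..b - 1}" using m by blast
        then show ?thesis using o pr by auto
      next
        assume "C \<subseteq> {b + 1..}"
        then have "q \<in> {b + 1..}" using m by blast
        then show ?thesis using o pr by auto
      qed (simp add: B1)
    next
      fix B' assume B1: "B \<subseteq> {2..b - 1}" "B' \<in> \<sigma>\<^sub>1" "B = (\<lambda>i. i + 1) ` B'"
      then have pr: "p \<in> {2..b - 1}" "r \<in> {2..b - 1}" using m by blast+
      show ?thesis
        using ty[OF C]
      proof (elim disjE conjE bexE)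
        assume "C = {1, b}"
        then show ?thesis using m o pr by auto
      next
        assume "C \<subseteq> {b + 1..}"
        then have "q \<in> {b + 1..}" using m by blast
        then show ?thesis using o pr by auto
      next
        fix C' assume C': "C' \<in> \<sigma>\<^sub>1" "C = (\<lambda>i. i + 1) ` C'"
        obtain p' q' r' s' where e: "p = p' + 1" "q = q' + 1" "r = r' + 1" "s = s' + 1" and m': "p' \<in> B'" "r' \<in> B'" "q' \<in> C'" "s' \<in> C'"
          using m unfolding B1(3) C'(2) by blast
        have "B' = C'" by (rule noncrossingD[OF nc(1) B1(2) C'(1) m']) (use e o in auto)
        then show ?thesis using B1 C' by simp
      qed
    next
      fix B' assume B1: "B \<subseteq> {b + 1..}" "B' \<in> \<sigma>\<^sub>2" "B = (\<lambda>i. i + b) ` B'"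
      then have pr: "p \<in> {b + 1..}" "r \<in> {b + 1..}" using m by blast+
      show ?thesis
        using ty[OF C]
      proof (elim disjE conjE bexE)
        assume "C = {1, b}"
        then show ?thesis using m o pr by auto
      next
        assume "C \<subseteq> {2..b - 1}"
        then have "q \<in> {2..b - 1}" using m by blast
        then show ?thesis using o pr by auto
      next
        fix C' assume C': "C' \<in> \<sigma>\<^sub>2" "C = (\<lambda>i. i + b) ` C'"
        obtain p' q' r' s' where e: "p = p' + b" "q = q' + b" "r = r' + b" "s = s' + b" and m': "p' \<in> B'" "r' \<in> B'" "q' \<in> C'" "s' \<in> C'"
          using m unfolding B1(3) C'(2) by blast
        have "B' = C'" by (rule noncrossingD[OF nc(2) B1(2) C'(1) m']) (use e o in auto)
        then show ?thesis using B1 C' by simp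
      qed
    qed
  qed
  then show ?thesis using part card by (simp add: NC2_def)
qed

definition inner_blocks :: "nat \<Rightarrow> nat set set \<Rightarrow> nat set set" where
  "inner_blocks b \<sigma> = (\<lambda>B. (\<lambda>i. i - 1) ` B) ` {B \<in> \<sigma>. B \<subseteq> {2..b - 1}}"

definition outer_blocks :: "nat \<Rightarrow> nat set set \<Rightarrow> nat set set" where
  "outer_blocks b \<sigma> = (\<lambda>B. (\<lambda>i. i - b) ` B) ` {B \<in> \<sigma>. B \<subseteq> {b + 1..}}"

lemma image_shift_back: "(\<lambda>i. i - s) ` (\<lambda>i. i + s) ` B = B" for B :: "nat set"
  by (auto simp: image_image)

lemma image_shift_forth: "(\<And>i. i \<in> B \<Longrightarrow> s \<le> i) \<Longrightarrow> (\<lambda>i. i + s) ` (\<lambda>i. i - s) ` B = B" for B :: "nat set"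
  unfolding image_image by (rule trans[OF image_cong[OF refl] image_ident]) auto

text \<open>Brings a subfamily that fills an interval back to an initial segment; used with
  \<open>s = 1\<close> for the enclosed pairs and with \<open>s = b\<close> for those to the
  right.\<close>

lemma NC2_minus_shift:
  assumes \<sigma>: "\<sigma> \<in> NC2 N" and \<tau>: "\<tau> \<subseteq> \<sigma>" and un: "\<Union>\<tau> = {s + 1..s + K}"
  shows "(\<lambda>B. (\<lambda>i. i - s) ` B) ` \<tau> \<in> NC2 K"
proof -
  have rng: "\<And>B i. B \<in> \<tau> \<Longrightarrow> i \<in> B \<Longrightarrow> s + 1 \<le> i \<and> i \<le> s + K" using un by fastforce
  have inj: "inj_on (\<lambda>i. i - s) B" if "B \<in> \<tau>" for B
    using rng[OF that] by (force simp: inj_on_def)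
  have "\<Union>((\<lambda>B. (\<lambda>i. i - s) ` B) ` \<tau>) = (\<lambda>i. i - s) ` \<Union>\<tau>" by blast
  also have "\<dots> = {1..K}"
  proof -
    have "(\<lambda>i. i - s) ` {s + 1..s + K} = (\<lambda>i. i - s) ` (\<lambda>i. i + s) ` {1..K}"
      by (subst image_add_atLeastAtMost') (simp add: add.commute)
    then show ?thesis unfolding un image_shift_back .
  qed
  finally have u: "\<Union>((\<lambda>B. (\<lambda>i. i - s) ` B) ` \<tau>) = {1..K}" .
  have dis: "B = C" if "B \<in> \<tau>" "C \<in> \<tau>" "x \<in> B" "x \<in> C" for B C x
    using that \<tau> by (intro NC2_disjoint[OF \<sigma>]) auto
  have part: "partition_on {1..K} ((\<lambda>B. (\<lambda>i. i - s) ` B) ` \<tau>)"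
  proof (rule partition_onI[OF u])
    show "{} \<notin> (\<lambda>B. (\<lambda>i. i - s) ` B) ` \<tau>" using \<sigma> \<tau> by (auto simp: NC2_def dest!: partition_onD3)
    fix P Q assume "P \<in> (\<lambda>B. (\<lambda>i. i - s) ` B) ` \<tau>" "Q \<in> (\<lambda>B. (\<lambda>i. i - s) ` B) ` \<tau>" "P \<noteq> Q"
    then obtain P' Q' where PQ: "P' \<in> \<tau>" "Q' \<in> \<tau>" "P = (\<lambda>i. i - s) ` P'" "Q = (\<lambda>i. i - s) ` Q'" "P' \<noteq> Q'" by auto
    have "x = y" if "x \<in> P'" "y \<in> Q'" "x - s = y - s" for x y
      using rng[OF PQ(1) that(1)] rng[OF PQ(2) that(2)] that(3) by linarith
    then show "disjnt P Q" unfolding disjnt_def PQ using dis[OF PQ(1,2)] PQ(5) by blast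
  qed
  have card: "\<forall>B\<in>(\<lambda>B. (\<lambda>i. i - s) ` B) ` \<tau>. card B = 2"
    using \<sigma> \<tau> inj by (auto simp: NC2_def card_image)
  have "noncrossing \<sigma>" using \<sigma> by (simp add: NC2_def)
  have "noncrossing ((\<lambda>B. (\<lambda>i. i - s) ` B) ` \<tau>)"
    unfolding noncrossing_def
  proof (intro ballI allI impI; elim conjE imageE)
    fix B C a b c d B' C'
    assume h: "B = (\<lambda>i. i - s) ` B'" "B' \<in> \<tau>" "C = (\<lambda>i. i - s) ` C'" "C' \<in> \<tau>" "a < b" "b < c" "c < d"
      "a \<in> B" "c \<in> B" "b \<in> C" "d \<in> C"
    then obtain a' b' c' d' where e: "a = a' - s" "b = b' - s" "c = c' - s" "d = d' - s" and m: "a' \<in> B'" "c' \<in> B'" "b' \<in> C'" "d' \<in> C'" by auto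
    have lt: "a' < b'" "b' < c'" "c' < d'" using h(5-7) e by linarith+
    have "B' \<in> \<sigma>" "C' \<in> \<sigma>" using h \<tau> by auto
    then have "B' = C'" by (rule noncrossingD[OF \<open>noncrossing \<sigma>\<close> _ _ m lt])
    then show "B = C" using h by simp
  qed
  then show ?thesis using part card by (simp add: NC2_def)
qed

lemma NC2_split:
  assumes \<sigma>: "\<sigma> \<in> NC2 N" and b: "{1, b} \<in> \<sigma>"
  shows "2 \<le> b" "b \<le> N" "inner_blocks b \<sigma> \<in> NC2 (b - 2)" "outer_blocks b \<sigma> \<in> NC2 (N - b)"
    "join_pairs b (inner_blocks b \<sigma>) (outer_blocks b \<sigma>) = \<sigma>"
proof -
  have "card {1, b} = 2" using \<sigma> b by (auto simp: NC2_def)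
  moreover have "{1, b} \<subseteq> {1..N}" by (rule NC2_subset[OF \<sigma> b])
  ultimately show b2: "2 \<le> b" and bN: "b \<le> N" by (cases "b = 1"; auto)+
  have dis: "B = C" if "B \<in> \<sigma>" "C \<in> \<sigma>" "x \<in> B" "x \<in> C" for B C x
    using that by (rule NC2_disjoint[OF \<sigma>])
  have un: "\<Union>\<sigma> = {1..N}" using \<sigma> by (auto simp: NC2_def partition_on_def)
  \<comment> \<open>A pair with one point enclosed by 1 and \<open>b\<close> and the other beyond
    \<open>b\<close> would cross the pair of 1 and \<open>b\<close>.\<close>
  have cases: "B = {1, b} \<or> B \<subseteq> {2..b - 1} \<or> B \<subseteq> {b + 1..}" if B: "B \<in> \<sigma>" for B
  proof (rule ccontr)
    assume c: "\<not> ?thesis"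
    obtain p q where pq: "B = {p, q}" "p < q" "1 \<le> p" "q \<le> N" using NC2_blockE[OF \<sigma> B] .
    have "1 \<notin> B" "b \<notin> B" using dis[OF B b] c by auto
    then have lt: "1 < p" "p < b" "b < q" using c pq by auto
    have "noncrossing \<sigma>" using \<sigma> by (simp add: NC2_def)
    from noncrossingD[OF this b B, of 1 b p q] have "{1, b} = B" using pq lt by auto
    then show False using c by simp
  qed
  have ne: "B \<noteq> {}" if "B \<in> \<sigma>" for B using \<sigma> that by (auto simp: NC2_def)
  have u1: "\<Union>{B \<in> \<sigma>. B \<subseteq> {2..b - 1}} = {1 + 1..1 + (b - 2)}"
  proof
    show "{1 + 1..1 + (b - 2)} \<subseteq> \<Union>{B \<in> \<sigma>. B \<subseteq> {2..b - 1}}"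
    proof
      fix x assume x: "x \<in> {1 + 1..1 + (b - 2)}"
      then have "x \<in> \<Union>\<sigma>" using un bN by auto
      then obtain B where B: "B \<in> \<sigma>" "x \<in> B" by auto
      then show "x \<in> \<Union>{B \<in> \<sigma>. B \<subseteq> {2..b - 1}}" using cases[OF B(1)] x b2 by fastforce
    qed
  qed (use b2 in force)
  have u2: "\<Union>{B \<in> \<sigma>. B \<subseteq> {b + 1..}} = {b + 1..b + (N - b)}"
  proof
    show "{b + 1..b + (N - b)} \<subseteq> \<Union>{B \<in> \<sigma>. B \<subseteq> {b + 1..}}"
    proof
      fix x assume x: "x \<in> {b + 1..b + (N - b)}"
      then have "x \<in> \<Union>\<sigma>" using un bN by auto
      then obtain B where B: "B \<in> \<sigma>" "x \<in> B" by auto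
      then show "x \<in> \<Union>{B \<in> \<sigma>. B \<subseteq> {b + 1..}}" using cases[OF B(1)] x b2 by fastforce
    qed
    show "\<Union>{B \<in> \<sigma>. B \<subseteq> {b + 1..}} \<subseteq> {b + 1..b + (N - b)}"
    proof
      fix x assume "x \<in> \<Union>{B \<in> \<sigma>. B \<subseteq> {b + 1..}}"
      then have "x \<in> \<Union>\<sigma>" "x \<in> {b + 1..}" by blast+
      then show "x \<in> {b + 1..b + (N - b)}" using un bN by auto
    qed
  qed
  show "inner_blocks b \<sigma> \<in> NC2 (b - 2)" unfolding inner_blocks_def
    by (rule NC2_minus_shift[OF \<sigma> _ u1]) auto
  show "outer_blocks b \<sigma> \<in> NC2 (N - b)" unfolding outer_blocks_def
    by (rule NC2_minus_shift[OF \<sigma> _ u2]) auto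
  have unshift: "shift_blocks s ((\<lambda>B. (\<lambda>i. i - s) ` B) ` \<tau>) = \<tau>" if "\<And>B i. B \<in> \<tau> \<Longrightarrow> i \<in> B \<Longrightarrow> s \<le> i" for s \<tau>
  proof -
    have "shift_blocks s ((\<lambda>B. (\<lambda>i. i - s) ` B) ` \<tau>) = (\<lambda>B. (\<lambda>i. i + s) ` (\<lambda>i. i - s) ` B) ` \<tau>"
      unfolding shift_blocks_def by blast
    also have "\<dots> = (\<lambda>B. B) ` \<tau>" by (rule image_cong[OF refl]) (rule image_shift_forth, rule that)
    finally show ?thesis by simp
  qed
  have "shift_blocks 1 (inner_blocks b \<sigma>) = {B \<in> \<sigma>. B \<subseteq> {2..b - 1}}"
    unfolding inner_blocks_def by (rule unshift) fastforce
  moreover have "shift_blocks b (outer_blocks b \<sigma>) = {B \<in> \<sigma>. B \<subseteq> {b + 1..}}"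
    unfolding outer_blocks_def by (rule unshift) fastforce
  ultimately show "join_pairs b (inner_blocks b \<sigma>) (outer_blocks b \<sigma>) = \<sigma>"
    unfolding join_pairs_def using cases b by blast
qed

lemma join_pairs_split:
  assumes b: "2 \<le> b" and 1: "\<sigma>\<^sub>1 \<in> NC2 (b - 2)" and 2: "\<sigma>\<^sub>2 \<in> NC2 K"
  shows "inner_blocks b (join_pairs b \<sigma>\<^sub>1 \<sigma>\<^sub>2) = \<sigma>\<^sub>1" "outer_blocks b (join_pairs b \<sigma>\<^sub>1 \<sigma>\<^sub>2) = \<sigma>\<^sub>2"
proof -
  have r1: "(\<lambda>i. i + 1) ` B \<subseteq> {2..b - 1} \<and> \<not> (\<lambda>i. i + 1) ` B \<subseteq> {b + 1..}" if "B \<in> \<sigma>\<^sub>1" for B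
    by (rule NC2_blockE[OF 1 that]) (use b in auto)
  have r2: "\<not> (\<lambda>i. i + b) ` B \<subseteq> {2..b - 1} \<and> (\<lambda>i. i + b) ` B \<subseteq> {b + 1..}" if "B \<in> \<sigma>\<^sub>2" for B
    by (rule NC2_blockE[OF 2 that]) (use b in auto)
  have "{B \<in> join_pairs b \<sigma>\<^sub>1 \<sigma>\<^sub>2. B \<subseteq> {2..b - 1}} = shift_blocks 1 \<sigma>\<^sub>1"
    using r1 r2 unfolding join_pairs_def shift_blocks_def by auto
  then show "inner_blocks b (join_pairs b \<sigma>\<^sub>1 \<sigma>\<^sub>2) = \<sigma>\<^sub>1"
    unfolding inner_blocks_def shift_blocks_def by (simp only: image_image[of "\<lambda>B. (\<lambda>i. i - 1) ` B"] image_shift_back image_ident)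
  have "{B \<in> join_pairs b \<sigma>\<^sub>1 \<sigma>\<^sub>2. B \<subseteq> {b + 1..}} = shift_blocks b \<sigma>\<^sub>2"
    using r1 r2 unfolding join_pairs_def shift_blocks_def by auto
  then show "outer_blocks b (join_pairs b \<sigma>\<^sub>1 \<sigma>\<^sub>2) = \<sigma>\<^sub>2"
    unfolding outer_blocks_def shift_blocks_def by (simp only: image_image[of "\<lambda>B. (\<lambda>i. i - b) ` B"] image_shift_back image_ident)
qed

lemma NC2_partner:
  assumes \<sigma>: "\<sigma> \<in> NC2 N" and N: "1 \<le> N"
  shows "\<exists>!b. {1, b} \<in> \<sigma>"
proof -
  have "\<Union>\<sigma> = {1..N}" using \<sigma> by (auto simp: NC2_def partition_on_def)
  then obtain B where B: "B \<in> \<sigma>" "1 \<in> B" using N by (metis UnionE atLeastAtMost_iff order_refl)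
  obtain p q where "B = {p, q}" "p < q" "1 \<le> p" by (rule NC2_blockE[OF \<sigma> B(1)])
  then have "B = {1, q}" using B by auto
  then have ex: "{1, q} \<in> \<sigma>" using B by simp
  moreover have "b = q" if "{1, b} \<in> \<sigma>" for b
  proof -
    have "{1, b} = {1, q}" by (rule NC2_disjoint[OF \<sigma> that ex, of 1]) auto
    moreover have "card {1, b} = 2" "card {1, q} = 2" using that ex \<sigma> by (auto simp: NC2_def)
    ultimately show ?thesis by (metis doubleton_eq_iff)
  qed
  ultimately show ?thesis by blast
qed

text \<open>By \<open>NC2_split\<close> and \<open>join_pairs_split\<close>, cutting at the partner
  of 1 is a bijection with inverse \<open>join_pairs\<close>.\<close>

lemma sum_NC2_rec:
  assumes N: "1 \<le> N"
  shows "(\<Sum>\<sigma>\<in>NC2 N. f \<sigma>) = (\<Sum>b\<in>{2..N}. \<Sum>\<sigma>\<^sub>1\<in>NC2 (b - 2). \<Sum>\<sigma>\<^sub>2\<in>NC2 (N - b). f (join_pairs b \<sigma>\<^sub>1 \<sigma>\<^sub>2))"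
proof -
  define P where "P \<sigma> = (THE b. {1, b} \<in> \<sigma>)" for \<sigma> :: "nat set set"
  have P: "{1, P \<sigma>} \<in> \<sigma>" if "\<sigma> \<in> NC2 N" for \<sigma>
    unfolding P_def by (rule theI'[OF NC2_partner[OF that N]])
  have "(\<Sum>\<sigma>\<in>NC2 N. f \<sigma>) = (\<Sum>(b, \<sigma>\<^sub>1, \<sigma>\<^sub>2)\<in>(SIGMA b:{2..N}. NC2 (b - 2) \<times> NC2 (N - b)). f (join_pairs b \<sigma>\<^sub>1 \<sigma>\<^sub>2))"
  proof (rule sum.reindex_bij_witness[where i = "\<lambda>(b, \<sigma>\<^sub>1, \<sigma>\<^sub>2). join_pairs b \<sigma>\<^sub>1 \<sigma>\<^sub>2"
        and j = "\<lambda>\<sigma>. (P \<sigma>, inner_blocks (P \<sigma>) \<sigma>, outer_blocks (P \<sigma>) \<sigma>)"])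
    fix \<sigma> assume \<sigma>: "\<sigma> \<in> NC2 N"
    note s = NC2_split[OF \<sigma> P[OF \<sigma>]]
    show "(case (P \<sigma>, inner_blocks (P \<sigma>) \<sigma>, outer_blocks (P \<sigma>) \<sigma>) of (b, \<sigma>\<^sub>1, \<sigma>\<^sub>2) \<Rightarrow> join_pairs b \<sigma>\<^sub>1 \<sigma>\<^sub>2) = \<sigma>"
      using s by simp
    show "(P \<sigma>, inner_blocks (P \<sigma>) \<sigma>, outer_blocks (P \<sigma>) \<sigma>) \<in> (SIGMA b:{2..N}. NC2 (b - 2) \<times> NC2 (N - b))"
      using s by auto
    show "(case (P \<sigma>, inner_blocks (P \<sigma>) \<sigma>, outer_blocks (P \<sigma>) \<sigma>) of (b, \<sigma>\<^sub>1, \<sigma>\<^sub>2) \<Rightarrow> f (join_pairs b \<sigma>\<^sub>1 \<sigma>\<^sub>2)) = f \<sigma>"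
      using s by simp
  next
    fix x assume "x \<in> (SIGMA b:{2..N}. NC2 (b - 2) \<times> NC2 (N - b))"
    then obtain b \<sigma>\<^sub>1 \<sigma>\<^sub>2 where x: "x = (b, \<sigma>\<^sub>1, \<sigma>\<^sub>2)" and b: "2 \<le> b" "b \<le> N" and s: "\<sigma>\<^sub>1 \<in> NC2 (b - 2)" "\<sigma>\<^sub>2 \<in> NC2 (N - b)" by auto
    note j = join_pairs_NC2[OF b s]
    have "{1, b} \<in> join_pairs b \<sigma>\<^sub>1 \<sigma>\<^sub>2" by (simp add: join_pairs_def)
    then have "P (join_pairs b \<sigma>\<^sub>1 \<sigma>\<^sub>2) = b" using NC2_partner[OF j N] P[OF j] by blast
    then show "(P (case x of (b, \<sigma>\<^sub>1, \<sigma>\<^sub>2) \<Rightarrow> join_pairs b \<sigma>\<^sub>1 \<sigma>\<^sub>2), inner_blocks (P (case x of (b, \<sigma>\<^sub>1, \<sigma>\<^sub>2) \<Rightarrow> join_pairs b \<sigma>\<^sub>1 \<sigma>\<^sub>2)) (case x of (b, \<sigma>\<^sub>1, \<sigma>\<^sub>2) \<Rightarrow> join_pairs b \<sigma>\<^sub>1 \<sigma>\<^sub>2),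
      outer_blocks (P (case x of (b, \<sigma>\<^sub>1, \<sigma>\<^sub>2) \<Rightarrow> join_pairs b \<sigma>\<^sub>1 \<sigma>\<^sub>2)) (case x of (b, \<sigma>\<^sub>1, \<sigma>\<^sub>2) \<Rightarrow> join_pairs b \<sigma>\<^sub>1 \<sigma>\<^sub>2)) = x"
      using join_pairs_split[OF b(1) s] by (simp add: x)
    show "(case x of (b, \<sigma>\<^sub>1, \<sigma>\<^sub>2) \<Rightarrow> join_pairs b \<sigma>\<^sub>1 \<sigma>\<^sub>2) \<in> NC2 N" using j by (simp add: x)
  qed
  also have "\<dots> = (\<Sum>b\<in>{2..N}. \<Sum>(\<sigma>\<^sub>1, \<sigma>\<^sub>2)\<in>NC2 (b - 2) \<times> NC2 (N - b). f (join_pairs b \<sigma>\<^sub>1 \<sigma>\<^sub>2))"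
    by (rule sum.Sigma[symmetric]) (auto simp: NC2_finite)
  also have "\<dots> = (\<Sum>b\<in>{2..N}. \<Sum>\<sigma>\<^sub>1\<in>NC2 (b - 2). \<Sum>\<sigma>\<^sub>2\<in>NC2 (N - b). f (join_pairs b \<sigma>\<^sub>1 \<sigma>\<^sub>2))"
    by (intro sum.cong refl) (rule sum.cartesian_product[symmetric])
  finally show ?thesis .
qed

text \<open>The point 1 lies at or below both gaps, while \<open>b\<close> and all points of
  \<open>\<sigma>\<^sub>2\<close> lie above them, so only blocks of \<open>\<sigma>\<^sub>1\<close>
  can be separated. The gap after \<open>a\<close> is the gap after \<open>a - 1\<close> in the
  enclosed pairing.\<close>

lemma closed_ivl_join_inner:
  assumes "a \<in> {1..<b}" "c \<in> {1..<b}"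
    and r: "\<And>B p. B \<in> \<sigma>\<^sub>1 \<Longrightarrow> p \<in> B \<Longrightarrow> 1 \<le> p"
  shows "closed_ivl (join_pairs b \<sigma>\<^sub>1 \<sigma>\<^sub>2) a c \<longleftrightarrow> closed_ivl \<sigma>\<^sub>1 (a - 1) (c - 1)"
proof -
  have e: "p + 1 \<le> x \<longleftrightarrow> p \<le> x - 1" if "1 \<le> x" for p x :: nat using that by auto
  have "closed_ivl (join_pairs b \<sigma>\<^sub>1 \<sigma>\<^sub>2) a c \<longleftrightarrow> (\<forall>B\<in>\<sigma>\<^sub>1. \<forall>p\<in>B. \<forall>q\<in>B. (p + 1 \<le> a \<longleftrightarrow> q + 1 \<le> a) \<longleftrightarrow> (p + 1 \<le> c \<longleftrightarrow> q + 1 \<le> c))"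
    unfolding closed_ivl_iff ball_join_pairs ball_simps using assms(1,2) by auto
  also have "\<dots> \<longleftrightarrow> closed_ivl \<sigma>\<^sub>1 (a - 1) (c - 1)"
    unfolding closed_ivl_iff using e[of a] e[of c] assms(1,2) by simp
  finally show ?thesis .
qed

lemma closed_ivl_join_outer:
  assumes "b \<le> a" "b \<le> c" "2 \<le> b"
    and r: "\<And>B p. B \<in> \<sigma>\<^sub>1 \<Longrightarrow> p \<in> B \<Longrightarrow> p \<le> b - 2"
  shows "closed_ivl (join_pairs b \<sigma>\<^sub>1 \<sigma>\<^sub>2) a c \<longleftrightarrow> closed_ivl \<sigma>\<^sub>2 (a - b) (c - b)"
proof -
  have e: "p + b \<le> x \<longleftrightarrow> p \<le> x - b" if "b \<le> x" for p x using that by auto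
  have r': "p + 1 \<le> a" "p + 1 \<le> c" if "B \<in> \<sigma>\<^sub>1" "p \<in> B" for B p using r[OF that] assms(1-3) by auto
  have "closed_ivl (join_pairs b \<sigma>\<^sub>1 \<sigma>\<^sub>2) a c \<longleftrightarrow> (\<forall>B\<in>\<sigma>\<^sub>2. \<forall>p\<in>B. \<forall>q\<in>B. (p + b \<le> a \<longleftrightarrow> q + b \<le> a) \<longleftrightarrow> (p + b \<le> c \<longleftrightarrow> q + b \<le> c))"
    unfolding closed_ivl_iff ball_join_pairs ball_simps using assms(1-3) r' by simp
  also have "\<dots> \<longleftrightarrow> closed_ivl \<sigma>\<^sub>2 (a - b) (c - b)"
    unfolding closed_ivl_iff using e[of a] e[of c] assms(1,2) by simp
  finally show ?thesis .
qed

text \<open>The pair of 1 and \<open>b\<close> is itself separated by exactly one of the two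
  gaps.\<close>

lemma not_closed_ivl_join:
  assumes "1 \<le> a" "a < b" "b \<le> c"
  shows "\<not> closed_ivl (join_pairs b \<sigma>\<^sub>1 \<sigma>\<^sub>2) a c"
proof
  assume "closed_ivl (join_pairs b \<sigma>\<^sub>1 \<sigma>\<^sub>2) a c"
  moreover have "{1, b} \<in> join_pairs b \<sigma>\<^sub>1 \<sigma>\<^sub>2" by (simp add: join_pairs_def)
  ultimately have "\<forall>p\<in>{1, b}. \<forall>q\<in>{1, b}. (p \<le> a \<longleftrightarrow> q \<le> a) \<longleftrightarrow> (p \<le> c \<longleftrightarrow> q \<le> c)"
    unfolding closed_ivl_iff by (rule bspec)
  then have "(1 \<le> a \<longleftrightarrow> b \<le> a) \<longleftrightarrow> (1 \<le> c \<longleftrightarrow> b \<le> c)" by simp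
  then show False using assms by auto
qed

definition glue :: "nat \<Rightarrow> nat \<Rightarrow> (int \<times> int) \<times> (nat \<Rightarrow> int) \<times> (nat \<Rightarrow> int) \<Rightarrow> nat \<Rightarrow> int" where
  "glue N b = (\<lambda>((u, v), k\<^sub>1, k\<^sub>2). \<lambda>i\<in>{1..N}.
     if i = 1 then u else if i < b then k\<^sub>1 (i - 1) else if i = b then v else k\<^sub>2 (i - b))"

lemma glue_bij:
  assumes b: "2 \<le> b" "b \<le> N"
  shows "bij_betw (glue N b) (UNIV \<times> (({1..b - 2} \<rightarrow>\<^sub>E UNIV) \<times> ({1..N - b} \<rightarrow>\<^sub>E UNIV))) ({1..N} \<rightarrow>\<^sub>E UNIV)"
proof (rule bij_betw_byWitness[where f' = "\<lambda>k. ((k 1, k b), (\<lambda>i\<in>{1..b - 2}. k (i + 1)), (\<lambda>i\<in>{1..N - b}. k (i + b)))"])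
  show "\<forall>x\<in>UNIV \<times> (({1..b - 2} \<rightarrow>\<^sub>E UNIV) \<times> ({1..N - b} \<rightarrow>\<^sub>E UNIV)).
      ((glue N b x 1, glue N b x b), (\<lambda>i\<in>{1..b - 2}. glue N b x (i + 1)), (\<lambda>i\<in>{1..N - b}. glue N b x (i + b))) = x"
  proof
    fix x :: "(int \<times> int) \<times> (nat \<Rightarrow> int) \<times> (nat \<Rightarrow> int)"
    assume x: "x \<in> UNIV \<times> (({1..b - 2} \<rightarrow>\<^sub>E UNIV) \<times> ({1..N - b} \<rightarrow>\<^sub>E UNIV))"
    obtain u v k1 k2 where xe: "x = ((u, v), k1, k2)" by (cases x) auto
    have k: "k1 \<in> {1..b - 2} \<rightarrow>\<^sub>E UNIV" "k2 \<in> {1..N - b} \<rightarrow>\<^sub>E UNIV" using x xe by auto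
    have "(\<lambda>i\<in>{1..b - 2}. glue N b x (i + 1)) = k1"
      using b k(1) by (auto simp: glue_def xe fun_eq_iff PiE_def extensional_def)
    moreover have "(\<lambda>i\<in>{1..N - b}. glue N b x (i + b)) = k2"
      using b k(2) by (auto simp: glue_def xe fun_eq_iff PiE_def extensional_def)
    ultimately show "((glue N b x 1, glue N b x b), (\<lambda>i\<in>{1..b - 2}. glue N b x (i + 1)), (\<lambda>i\<in>{1..N - b}. glue N b x (i + b))) = x"
      using b by (simp add: glue_def xe)
  qed
  show "\<forall>k\<in>{1..N} \<rightarrow>\<^sub>E UNIV. glue N b ((k 1, k b), (\<lambda>i\<in>{1..b - 2}. k (i + 1)), (\<lambda>i\<in>{1..N - b}. k (i + b))) = k"
    using b by (auto simp: glue_def fun_eq_iff PiE_def extensional_def)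
  show "glue N b ` (UNIV \<times> (({1..b - 2} \<rightarrow>\<^sub>E UNIV) \<times> ({1..N - b} \<rightarrow>\<^sub>E UNIV))) \<subseteq> {1..N} \<rightarrow>\<^sub>E UNIV"
    by (auto simp: glue_def)
qed auto

definition weight :: "(int \<Rightarrow> int \<Rightarrow> real) \<Rightarrow> nat set set \<Rightarrow> (nat \<Rightarrow> int) \<Rightarrow> real" where
  "weight R \<sigma> k = (\<Prod>B\<in>\<sigma>. R (k (Min B)) (k (Max B)))"

section \<open>Weights and block sums of a joined pairing\<close>

context
  fixes b N :: nat and \<sigma>\<^sub>1 \<sigma>\<^sub>2 :: "nat set set"
  assumes b: "2 \<le> b" "b \<le> N" and \<sigma>1: "\<sigma>\<^sub>1 \<in> NC2 (b - 2)" and \<sigma>2: "\<sigma>\<^sub>2 \<in> NC2 (N - b)"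
begin

lemma join_finite: "finite \<sigma>\<^sub>1" "finite \<sigma>\<^sub>2"
  using \<sigma>1 \<sigma>2 by (auto simp: NC2_def intro: finite_elements)

lemma weight_glue:
  "weight R (join_pairs b \<sigma>\<^sub>1 \<sigma>\<^sub>2) (glue N b ((u, v), k\<^sub>1, k\<^sub>2)) = R u v * weight R \<sigma>\<^sub>1 k\<^sub>1 * weight R \<sigma>\<^sub>2 k\<^sub>2"
proof -
  let ?k = "glue N b ((u, v), k\<^sub>1, k\<^sub>2)"
  define f where "f B = R (?k (Min B)) (?k (Max B))" for B
  have inj: "inj_on (\<lambda>B. (\<lambda>i. i + s) ` B) A" for s and A :: "nat set set"
    by (intro inj_onI) (metis image_shift_back)
  have mm1: "f ((\<lambda>i. i + 1) ` B) = R (k\<^sub>1 (Min B)) (k\<^sub>1 (Max B))" if B: "B \<in> \<sigma>\<^sub>1" for B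
  proof -
    obtain p q where "B = {p, q}" "p < q" "1 \<le> p" "q \<le> b - 2" using NC2_blockE[OF \<sigma>1 B] .
    then show ?thesis using b by (auto simp: f_def glue_def)
  qed
  have mm2: "f ((\<lambda>i. i + b) ` B) = R (k\<^sub>2 (Min B)) (k\<^sub>2 (Max B))" if B: "B \<in> \<sigma>\<^sub>2" for B
  proof -
    obtain p q where "B = {p, q}" "p < q" "1 \<le> p" "q \<le> N - b" using NC2_blockE[OF \<sigma>2 B] .
    then show ?thesis using b by (auto simp: f_def glue_def)
  qed
  have b1: "B \<subseteq> {2..b - 1} \<and> B \<noteq> {}" if "B \<in> shift_blocks 1 \<sigma>\<^sub>1" for B
    using that b unfolding shift_blocks_def by (auto elim!: NC2_blockE[OF \<sigma>1])
  have b2: "B \<subseteq> {b + 1..} \<and> B \<noteq> {}" if "B \<in> shift_blocks b \<sigma>\<^sub>2" for B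
    using that b unfolding shift_blocks_def by (auto elim!: NC2_blockE[OF \<sigma>2])
  have "1 \<notin> {2..b - 1}" "1 \<notin> {b + 1..}" using b by auto
  then have n0: "{1, b} \<notin> shift_blocks 1 \<sigma>\<^sub>1 \<union> shift_blocks b \<sigma>\<^sub>2" using b1 b2 by blast
  have "{2..b - 1} \<inter> {b + 1..} = {}" by auto
  then have d: "shift_blocks 1 \<sigma>\<^sub>1 \<inter> shift_blocks b \<sigma>\<^sub>2 = {}" using b1 b2 by blast
  have fin: "finite (shift_blocks 1 \<sigma>\<^sub>1)" "finite (shift_blocks b \<sigma>\<^sub>2)"
    using join_finite by (auto simp: shift_blocks_def)
  have "weight R (join_pairs b \<sigma>\<^sub>1 \<sigma>\<^sub>2) ?k = prod f (join_pairs b \<sigma>\<^sub>1 \<sigma>\<^sub>2)" by (simp add: weight_def f_def)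
  also have "\<dots> = f {1, b} * (prod f (shift_blocks 1 \<sigma>\<^sub>1) * prod f (shift_blocks b \<sigma>\<^sub>2))"
    using n0 d fin unfolding join_pairs_def by (subst prod.insert) (auto simp: prod.union_disjoint)
  also have "f {1, b} = R u v" using b by (auto simp: f_def glue_def)
  also have "prod f (shift_blocks 1 \<sigma>\<^sub>1) = weight R \<sigma>\<^sub>1 k\<^sub>1"
    unfolding shift_blocks_def weight_def by (subst prod.reindex[OF inj]) (rule prod.cong[OF refl], unfold o_def, rule mm1)
  also have "prod f (shift_blocks b \<sigma>\<^sub>2) = weight R \<sigma>\<^sub>2 k\<^sub>2"
    unfolding shift_blocks_def weight_def by (subst prod.reindex[OF inj]) (rule prod.cong[OF refl], unfold o_def, rule mm2)
  finally show ?thesis by simp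
qed

lemma card_join_pairs: "card (join_pairs b \<sigma>\<^sub>1 \<sigma>\<^sub>2) = 1 + card \<sigma>\<^sub>1 + card \<sigma>\<^sub>2"
proof -
  have inj: "inj_on (\<lambda>B. (\<lambda>i. i + s) ` B) A" for s and A :: "nat set set"
    by (intro inj_onI) (metis image_shift_back)
  have b1: "B \<subseteq> {2..b - 1} \<and> B \<noteq> {}" if "B \<in> shift_blocks 1 \<sigma>\<^sub>1" for B
    using that b unfolding shift_blocks_def by (auto elim!: NC2_blockE[OF \<sigma>1])
  have b2: "B \<subseteq> {b + 1..} \<and> B \<noteq> {}" if "B \<in> shift_blocks b \<sigma>\<^sub>2" for B
    using that b unfolding shift_blocks_def by (auto elim!: NC2_blockE[OF \<sigma>2])
  have "1 \<notin> {2..b - 1}" "1 \<notin> {b + 1..}" using b by auto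
  then have n0: "{1, b} \<notin> shift_blocks 1 \<sigma>\<^sub>1 \<union> shift_blocks b \<sigma>\<^sub>2" using b1 b2 by blast
  have "{2..b - 1} \<inter> {b + 1..} = {}" by auto
  then have d: "shift_blocks 1 \<sigma>\<^sub>1 \<inter> shift_blocks b \<sigma>\<^sub>2 = {}" using b1 b2 by blast
  have fin: "finite (shift_blocks 1 \<sigma>\<^sub>1)" "finite (shift_blocks b \<sigma>\<^sub>2)"
    using join_finite by (auto simp: shift_blocks_def)
  have c: "card (shift_blocks 1 \<sigma>\<^sub>1) = card \<sigma>\<^sub>1" "card (shift_blocks b \<sigma>\<^sub>2) = card \<sigma>\<^sub>2"
    unfolding shift_blocks_def by (rule card_image[OF inj])+
  show ?thesis unfolding join_pairs_def using n0 d fin by (simp add: card_Un_disjoint c del: One_nat_def)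
qed

lemma join_range1: "B \<in> \<sigma>\<^sub>1 \<Longrightarrow> p \<in> B \<Longrightarrow> 1 \<le> p \<and> p \<le> b - 2"
  using NC2_subset[OF \<sigma>1] by fastforce

text \<open>The gap after the point 1 is the gap 0 of the enclosed pairing, which is equivalent to
  its last gap. Hence 1 joins the outermost class of the enclosed complement and no other.\<close>

lemma ivl_class_join_inner:
  assumes a: "a \<in> {1..<b}"
  shows "ivl_class N (join_pairs b \<sigma>\<^sub>1 \<sigma>\<^sub>2) a =
    (if closed_ivl \<sigma>\<^sub>1 (a - 1) (b - 2) then {1} else {}) \<union> (\<lambda>i. i + 1) ` ivl_class (b - 2) \<sigma>\<^sub>1 (a - 1)"
proof -
  have full: "closed_ivl \<sigma>\<^sub>1 0 (b - 2)" using \<sigma>1 by (intro closed_ivl_full) (auto simp: NC2_def partition_on_def)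
  have z: "closed_ivl \<sigma>\<^sub>1 0 (a - 1) \<longleftrightarrow> closed_ivl \<sigma>\<^sub>1 (a - 1) (b - 2)"
    using full closed_ivl_trans closed_ivl_sym by blast
  have in1: "closed_ivl (join_pairs b \<sigma>\<^sub>1 \<sigma>\<^sub>2) j a \<longleftrightarrow> closed_ivl \<sigma>\<^sub>1 (j - 1) (a - 1)" if "j \<in> {1..<b}" for j
    using join_range1 by (intro closed_ivl_join_inner that a) blast
  have out: "\<not> closed_ivl (join_pairs b \<sigma>\<^sub>1 \<sigma>\<^sub>2) j a" if "b \<le> j" for j
    using not_closed_ivl_join[of a b j] a that closed_ivl_sym by auto
  have "j \<in> ivl_class N (join_pairs b \<sigma>\<^sub>1 \<sigma>\<^sub>2) a \<longleftrightarrow>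
      j \<in> (if closed_ivl \<sigma>\<^sub>1 (a - 1) (b - 2) then {1} else {}) \<union> (\<lambda>i. i + 1) ` ivl_class (b - 2) \<sigma>\<^sub>1 (a - 1)" for j
  proof -
    consider "j = 0 \<or> b \<le> j" | "j = 1" | "2 \<le> j" "j < b" by linarith
    then show ?thesis
    proof cases
      case 1 then show ?thesis using out b by (auto simp: ivl_class_def)
    next
      case 2 then show ?thesis using in1[of 1] b z by (auto simp: ivl_class_def)
    next
      case 3
      then have "j \<in> (\<lambda>i. i + 1) ` ivl_class (b - 2) \<sigma>\<^sub>1 (a - 1) \<longleftrightarrow> j - 1 \<in> ivl_class (b - 2) \<sigma>\<^sub>1 (a - 1)"
        by (auto simp: image_iff intro: bexI[of _ "j - 1"])
      then show ?thesis using in1[of j] 3 b by (auto simp: ivl_class_def)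
    qed
  qed
  then show ?thesis by blast
qed

text \<open>Likewise the gap after \<open>b\<close> is the gap 0 of the pairing to the right, so
  \<open>b\<close> joins its outermost class, which is the class of \<open>N\<close> in the joined
  picture.\<close>

lemma ivl_class_join_outer:
  assumes a: "a \<in> {b..N}"
  shows "ivl_class N (join_pairs b \<sigma>\<^sub>1 \<sigma>\<^sub>2) a =
    (if closed_ivl \<sigma>\<^sub>2 (a - b) (N - b) then {b} else {}) \<union> (\<lambda>i. i + b) ` ivl_class (N - b) \<sigma>\<^sub>2 (a - b)"
proof -
  have full: "closed_ivl \<sigma>\<^sub>2 0 (N - b)" using \<sigma>2 by (intro closed_ivl_full) (auto simp: NC2_def partition_on_def)
  have z: "closed_ivl \<sigma>\<^sub>2 0 (a - b) \<longleftrightarrow> closed_ivl \<sigma>\<^sub>2 (a - b) (N - b)"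
    using full closed_ivl_trans closed_ivl_sym by blast
  have in1: "closed_ivl (join_pairs b \<sigma>\<^sub>1 \<sigma>\<^sub>2) j a \<longleftrightarrow> closed_ivl \<sigma>\<^sub>2 (j - b) (a - b)" if "b \<le> j" for j
    using join_range1 a b by (intro closed_ivl_join_outer that) auto
  have out: "\<not> closed_ivl (join_pairs b \<sigma>\<^sub>1 \<sigma>\<^sub>2) j a" if "1 \<le> j" "j < b" for j
    using not_closed_ivl_join[of j b a] a that by auto
  have "j \<in> ivl_class N (join_pairs b \<sigma>\<^sub>1 \<sigma>\<^sub>2) a \<longleftrightarrow>
      j \<in> (if closed_ivl \<sigma>\<^sub>2 (a - b) (N - b) then {b} else {}) \<union> (\<lambda>i. i + b) ` ivl_class (N - b) \<sigma>\<^sub>2 (a - b)" for j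
  proof -
    consider "j < b" | "j = b" | "b < j" by linarith
    then show ?thesis
    proof cases
      case 1 then show ?thesis using out[of j] b by (auto simp: ivl_class_def)
    next
      case 2 then show ?thesis using in1[of b] b z by (auto simp: ivl_class_def)
    next
      case 3
      then have "j \<in> (\<lambda>i. i + b) ` ivl_class (N - b) \<sigma>\<^sub>2 (a - b) \<longleftrightarrow> j - b \<in> ivl_class (N - b) \<sigma>\<^sub>2 (a - b)"
        by (auto simp: image_iff intro: bexI[of _ "j - b"])
      moreover have "1 \<le> j - b" "j - b \<le> N - b \<longleftrightarrow> j \<le> N" using 3 by auto
      ultimately show ?thesis using in1[of j] 3 b by (auto simp: ivl_class_def)
    qed
  qed
  then show ?thesis by blast
qed

lemma sum_glue_inner:
  assumes "a \<in> {1..<b}"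
  shows "sum (glue N b ((u, v), k\<^sub>1, k\<^sub>2)) (ivl_class N (join_pairs b \<sigma>\<^sub>1 \<sigma>\<^sub>2) a) =
    (if closed_ivl \<sigma>\<^sub>1 (a - 1) (b - 2) then u else 0) + sum k\<^sub>1 (ivl_class (b - 2) \<sigma>\<^sub>1 (a - 1))"
proof -
  let ?k = "glue N b ((u, v), k\<^sub>1, k\<^sub>2)"
  have C: "ivl_class (b - 2) \<sigma>\<^sub>1 (a - 1) \<subseteq> {1..b - 2}" by (auto simp: ivl_class_def)
  have "?k (i + 1) = k\<^sub>1 i" if "i \<in> {1..b - 2}" for i using that b by (auto simp: glue_def)
  then have "sum ?k ((\<lambda>i. i + 1) ` ivl_class (b - 2) \<sigma>\<^sub>1 (a - 1)) = sum k\<^sub>1 (ivl_class (b - 2) \<sigma>\<^sub>1 (a - 1))"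
    using C by (subst sum.reindex) (auto simp: inj_on_def intro!: sum.cong)
  moreover have "finite (ivl_class (b - 2) \<sigma>\<^sub>1 (a - 1))" using C finite_subset by blast
  moreover have "1 \<notin> (\<lambda>i. i + 1) ` ivl_class (b - 2) \<sigma>\<^sub>1 (a - 1)" using C by auto
  moreover have "?k 1 = u" using b by (simp add: glue_def)
  ultimately show ?thesis unfolding ivl_class_join_inner[OF assms] by simp
qed

lemma sum_glue_outer:
  assumes "a \<in> {b..N}"
  shows "sum (glue N b ((u, v), k\<^sub>1, k\<^sub>2)) (ivl_class N (join_pairs b \<sigma>\<^sub>1 \<sigma>\<^sub>2) a) =
    (if closed_ivl \<sigma>\<^sub>2 (a - b) (N - b) then v else 0) + sum k\<^sub>2 (ivl_class (N - b) \<sigma>\<^sub>2 (a - b))"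
proof -
  let ?k = "glue N b ((u, v), k\<^sub>1, k\<^sub>2)"
  have C: "ivl_class (N - b) \<sigma>\<^sub>2 (a - b) \<subseteq> {1..N - b}" by (auto simp: ivl_class_def)
  have "?k (i + b) = k\<^sub>2 i" if "i \<in> {1..N - b}" for i using that b by (auto simp: glue_def)
  then have "sum ?k ((\<lambda>i. i + b) ` ivl_class (N - b) \<sigma>\<^sub>2 (a - b)) = sum k\<^sub>2 (ivl_class (N - b) \<sigma>\<^sub>2 (a - b))"
    using C by (subst sum.reindex) (auto simp: inj_on_def intro!: sum.cong)
  moreover have "finite (ivl_class (N - b) \<sigma>\<^sub>2 (a - b))" using C finite_subset by blast
  moreover have "b \<notin> (\<lambda>i. i + b) ` ivl_class (N - b) \<sigma>\<^sub>2 (a - b)" using C by auto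
  moreover have "?k b = v" using b by (simp add: glue_def)
  ultimately show ?thesis unfolding ivl_class_join_outer[OF assms] by simp
qed

text \<open>The outermost class of the enclosed part becomes an ordinary block containing 1, so its
  sum together with \<open>u\<close> must vanish. The outermost class on the right gains
  \<open>v\<close> and keeps the prescribed total \<open>s\<close>. This is the origin of the
  arguments \<open>- u\<close> and \<open>s - v\<close> in the convolution.\<close>

lemma glue_in_flows:
  assumes k: "k\<^sub>1 \<in> {1..b - 2} \<rightarrow>\<^sub>E UNIV" "k\<^sub>2 \<in> {1..N - b} \<rightarrow>\<^sub>E UNIV"
  shows "glue N b ((u, v), k\<^sub>1, k\<^sub>2) \<in> flows N (join_pairs b \<sigma>\<^sub>1 \<sigma>\<^sub>2) s \<longleftrightarrow>
    k\<^sub>1 \<in> flows (b - 2) \<sigma>\<^sub>1 (- u) \<and> k\<^sub>2 \<in> flows (N - b) \<sigma>\<^sub>2 (s - v)"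
proof -
  let ?k = "glue N b ((u, v), k\<^sub>1, k\<^sub>2)" and ?J = "join_pairs b \<sigma>\<^sub>1 \<sigma>\<^sub>2"
  have kE: "?k \<in> {1..N} \<rightarrow>\<^sub>E UNIV" by (auto simp: glue_def)
  have "sum ?k (ivl_class N ?J N) = s \<longleftrightarrow> sum k\<^sub>2 (ivl_class (N - b) \<sigma>\<^sub>2 (N - b)) = s - v"
    using b sum_glue_outer[of N u v k\<^sub>1 k\<^sub>2] by auto
  moreover have "(\<forall>a\<in>{1..<b}. sum ?k (ivl_class N ?J a) = 0) \<longleftrightarrow> k\<^sub>1 \<in> flows (b - 2) \<sigma>\<^sub>1 (- u)"
  proof
    assume L: "\<forall>a\<in>{1..<b}. sum ?k (ivl_class N ?J a) = 0"
    have "sum ?k (ivl_class N ?J (b - 1)) = 0" using L b by auto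
    moreover have "b - 1 \<in> {1..<b}" "b - 1 - 1 = b - 2" using b by auto
    ultimately have "sum k\<^sub>1 (ivl_class (b - 2) \<sigma>\<^sub>1 (b - 2)) = - u"
      using sum_glue_inner[of "b - 1" u v k\<^sub>1 k\<^sub>2] by (metis closed_ivl_refl add_eq_0_iff)
    moreover have "sum k\<^sub>1 (ivl_class (b - 2) \<sigma>\<^sub>1 a) = 0" if "a \<in> {1..b - 2}" "\<not> closed_ivl \<sigma>\<^sub>1 a (b - 2)" for a
      using L[rule_format, of "a + 1"] sum_glue_inner[of "a + 1" u v k\<^sub>1 k\<^sub>2] that b by auto
    ultimately show "k\<^sub>1 \<in> flows (b - 2) \<sigma>\<^sub>1 (- u)" using k by (simp add: flows_def)
  next
    assume R: "k\<^sub>1 \<in> flows (b - 2) \<sigma>\<^sub>1 (- u)"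
    show "\<forall>a\<in>{1..<b}. sum ?k (ivl_class N ?J a) = 0"
    proof
      fix a assume a: "a \<in> {1..<b}"
      show "sum ?k (ivl_class N ?J a) = 0"
      proof (cases "closed_ivl \<sigma>\<^sub>1 (a - 1) (b - 2)")
        case True
        then show ?thesis using R sum_glue_inner[OF a, of u v k\<^sub>1 k\<^sub>2] ivl_class_eq[OF True, of "b - 2"] by (simp add: flows_def)
      next
        case False
        have full: "closed_ivl \<sigma>\<^sub>1 0 (b - 2)" using \<sigma>1 by (intro closed_ivl_full) (auto simp: NC2_def partition_on_def)
        then have "a - 1 \<noteq> 0" using False by (intro notI) simp
        then have "a - 1 \<in> {1..b - 2}" using a by auto
        then show ?thesis using R False sum_glue_inner[OF a, of u v k\<^sub>1 k\<^sub>2] by (simp add: flows_def)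
      qed
    qed
  qed
  moreover have "(\<forall>a\<in>{b..N}. \<not> closed_ivl ?J a N \<longrightarrow> sum ?k (ivl_class N ?J a) = 0) \<longleftrightarrow>
      (\<forall>a\<in>{1..N - b}. \<not> closed_ivl \<sigma>\<^sub>2 a (N - b) \<longrightarrow> sum k\<^sub>2 (ivl_class (N - b) \<sigma>\<^sub>2 a) = 0)"
  proof -
    have cl: "closed_ivl ?J a N \<longleftrightarrow> closed_ivl \<sigma>\<^sub>2 (a - b) (N - b)" if "a \<in> {b..N}" for a
      using join_range1 that b by (intro closed_ivl_join_outer) auto
    have full: "closed_ivl \<sigma>\<^sub>2 0 (N - b)" using \<sigma>2 by (intro closed_ivl_full) (auto simp: NC2_def partition_on_def)
    show ?thesis
    proof (intro iffI ballI impI)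
      fix a assume L: "\<forall>a\<in>{b..N}. \<not> closed_ivl ?J a N \<longrightarrow> sum ?k (ivl_class N ?J a) = 0"
        and a: "a \<in> {1..N - b}" "\<not> closed_ivl \<sigma>\<^sub>2 a (N - b)"
      have "a + b \<in> {b..N}" using a b by auto
      then show "sum k\<^sub>2 (ivl_class (N - b) \<sigma>\<^sub>2 a) = 0"
        using L[rule_format, of "a + b"] cl[of "a + b"] sum_glue_outer[of "a + b" u v k\<^sub>1 k\<^sub>2] a by simp
    next
      fix a assume R: "\<forall>a\<in>{1..N - b}. \<not> closed_ivl \<sigma>\<^sub>2 a (N - b) \<longrightarrow> sum k\<^sub>2 (ivl_class (N - b) \<sigma>\<^sub>2 a) = 0"
        and a: "a \<in> {b..N}" "\<not> closed_ivl ?J a N"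
      have nc: "\<not> closed_ivl \<sigma>\<^sub>2 (a - b) (N - b)" using cl a by simp
      then have "a - b \<noteq> 0" using full by (intro notI) simp
      then have "a - b \<in> {1..N - b}" using a by auto
      then show "sum ?k (ivl_class N ?J a) = 0" using R nc sum_glue_outer[OF a(1), of u v k\<^sub>1 k\<^sub>2] by simp
    qed
  qed
  moreover have "(\<forall>a\<in>{1..N}. \<not> closed_ivl ?J a N \<longrightarrow> sum ?k (ivl_class N ?J a) = 0) \<longleftrightarrow>
     (\<forall>a\<in>{1..<b}. sum ?k (ivl_class N ?J a) = 0) \<and> (\<forall>a\<in>{b..N}. \<not> closed_ivl ?J a N \<longrightarrow> sum ?k (ivl_class N ?J a) = 0)"
  proof -
    have "{1..N} = {1..<b} \<union> {b..N}" using b by auto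
    moreover have "\<not> closed_ivl ?J a N" if "a \<in> {1..<b}" for a using that b by (intro not_closed_ivl_join) auto
    ultimately show ?thesis by blast
  qed
  ultimately show ?thesis using kE k(2) by (auto simp: flows_def[of N] flows_def[of "N - b"])
qed

lemma glue_bij_flows:
  "bij_betw (glue N b) (SIGMA p:UNIV. flows (b - 2) \<sigma>\<^sub>1 (- fst p) \<times> flows (N - b) \<sigma>\<^sub>2 (s - snd p))
     (flows N (join_pairs b \<sigma>\<^sub>1 \<sigma>\<^sub>2) s)"
proof -
  let ?X = "UNIV \<times> (({1..b - 2} \<rightarrow>\<^sub>E UNIV) \<times> ({1..N - b} \<rightarrow>\<^sub>E UNIV)) :: ((int \<times> int) \<times> (nat \<Rightarrow> int) \<times> (nat \<Rightarrow> int)) set"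
  let ?S = "SIGMA p:UNIV. flows (b - 2) \<sigma>\<^sub>1 (- fst p) \<times> flows (N - b) \<sigma>\<^sub>2 (s - snd p)"
  note bij = glue_bij[OF b]
  have sub: "?S \<subseteq> ?X" by (auto simp: flows_def)
  have "glue N b ` ?S = flows N (join_pairs b \<sigma>\<^sub>1 \<sigma>\<^sub>2) s"
  proof
    show "glue N b ` ?S \<subseteq> flows N (join_pairs b \<sigma>\<^sub>1 \<sigma>\<^sub>2) s"
    proof
      fix k assume "k \<in> glue N b ` ?S"
      then obtain u v k1 k2 where k: "k = glue N b ((u, v), k1, k2)" "k1 \<in> flows (b - 2) \<sigma>\<^sub>1 (- u)" "k2 \<in> flows (N - b) \<sigma>\<^sub>2 (s - v)" by auto
      then show "k \<in> flows N (join_pairs b \<sigma>\<^sub>1 \<sigma>\<^sub>2) s" using glue_in_flows[of k1 k2 u v s] by (auto simp: flows_def)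
    qed
    show "flows N (join_pairs b \<sigma>\<^sub>1 \<sigma>\<^sub>2) s \<subseteq> glue N b ` ?S"
    proof
      fix k assume k: "k \<in> flows N (join_pairs b \<sigma>\<^sub>1 \<sigma>\<^sub>2) s"
      then have "k \<in> glue N b ` ?X" using bij by (simp add: bij_betw_def flows_def)
      then obtain u v k1 k2 where e: "k = glue N b ((u, v), k1, k2)" "k1 \<in> {1..b - 2} \<rightarrow>\<^sub>E UNIV" "k2 \<in> {1..N - b} \<rightarrow>\<^sub>E UNIV" by auto
      then have "k1 \<in> flows (b - 2) \<sigma>\<^sub>1 (- u) \<and> k2 \<in> flows (N - b) \<sigma>\<^sub>2 (s - v)" using k glue_in_flows by blast
      then show "k \<in> glue N b ` ?S" using e by (intro image_eqI[of _ _ "((u, v), k1, k2)"]) auto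
    qed
  qed
  then show ?thesis by (rule bij_betw_subset[OF bij sub])
qed

end

section \<open>The recursion for the moments of the limit law\<close>

lemma product_summable:
  fixes f :: "'a \<Rightarrow> real" and g :: "'b \<Rightarrow> real"
  assumes f: "(\<lambda>x. \<bar>f x\<bar>) summable_on A" and g: "(\<lambda>y. \<bar>g y\<bar>) summable_on B"
  shows "(\<lambda>(x, y). \<bar>f x * g y\<bar>) summable_on A \<times> B"
proof (rule summable_on_SigmaI[where g = "\<lambda>x. \<bar>f x\<bar> * (\<Sum>\<^sub>\<infinity>y\<in>B. \<bar>g y\<bar>)"])
  show "((\<lambda>y. case (x, y) of (x, y) \<Rightarrow> \<bar>f x * g y\<bar>) has_sum \<bar>f x\<bar> * (\<Sum>\<^sub>\<infinity>y\<in>B. \<bar>g y\<bar>)) B" for x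
    using has_sum_cmult_right[OF has_sum_infsum[OF g], of "\<bar>f x\<bar>"] by (simp add: abs_mult)
  show "(\<lambda>x. \<bar>f x\<bar> * (\<Sum>\<^sub>\<infinity>y\<in>B. \<bar>g y\<bar>)) summable_on A" by (rule summable_on_cmult_left[OF f])
qed auto

lemma product_infsum:
  fixes f :: "'a \<Rightarrow> real" and g :: "'b \<Rightarrow> real"
  assumes f: "(\<lambda>x. \<bar>f x\<bar>) summable_on A" and g: "(\<lambda>y. \<bar>g y\<bar>) summable_on B"
  shows "(\<Sum>\<^sub>\<infinity>(x, y)\<in>A \<times> B. f x * g y) = (\<Sum>\<^sub>\<infinity>x\<in>A. f x) * (\<Sum>\<^sub>\<infinity>y\<in>B. g y)"
proof -
  have "(\<lambda>p. norm (case p of (x, y) \<Rightarrow> f x * g y)) summable_on A \<times> B"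
    using product_summable[OF f g] by (simp add: case_prod_unfold)
  then have "(\<lambda>(x, y). f x * g y) summable_on A \<times> B" by (rule abs_summable_summable)
  then have "(\<Sum>\<^sub>\<infinity>(x, y)\<in>A \<times> B. f x * g y) = (\<Sum>\<^sub>\<infinity>x\<in>A. \<Sum>\<^sub>\<infinity>y\<in>B. f x * g y)"
    by (rule infsum_Sigma'_banach[symmetric])
  then show ?thesis by (simp add: infsum_cmult_right' infsum_cmult_left')
qed

locale summable_kernel =
  fixes R :: "int \<Rightarrow> int \<Rightarrow> real"
  assumes R_summable: "(\<lambda>(u, v). \<bar>R u v\<bar>) summable_on UNIV"
begin

definition \<rho> :: real where "\<rho> = (\<Sum>\<^sub>\<infinity>(u, v)\<in>UNIV. \<bar>R u v\<bar>)"

lemma \<rho>_nonneg: "0 \<le> \<rho>"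
  unfolding \<rho>_def by (rule infsum_nonneg) auto

definition flow_sum :: "nat \<Rightarrow> nat set set \<Rightarrow> int \<Rightarrow> real" where
  "flow_sum N \<sigma> s = (\<Sum>\<^sub>\<infinity>k\<in>flows N \<sigma> s. weight R \<sigma> k)"

text \<open>Without the constraints on block sums the sum factorizes over the pairs, one factor
  \<open>\<rho>\<close> for each. The constrained sums run over subsets, so their absolute
  convergence and a bound independent of \<open>s\<close> follow.\<close>

lemma weight_summable:
  "\<sigma> \<in> NC2 N \<Longrightarrow> (\<lambda>k. \<bar>weight R \<sigma> k\<bar>) summable_on ({1..N} \<rightarrow>\<^sub>E UNIV) \<and>
    (\<Sum>\<^sub>\<infinity>k\<in>{1..N} \<rightarrow>\<^sub>E UNIV. \<bar>weight R \<sigma> k\<bar>) = \<rho> ^ card \<sigma>"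
proof (induction N arbitrary: \<sigma> rule: less_induct)
  case (less N)
  show ?case
  proof (cases "N = 0")
    case True
    then have "\<sigma> = {}" using less.prems NC2_0 by auto
    then show ?thesis using True by (simp add: weight_def)
  next
    case False
    then obtain b where b: "{1, b} \<in> \<sigma>" using NC2_partner[OF less.prems] by auto
    define \<sigma>1 where "\<sigma>1 = inner_blocks b \<sigma>"
    define \<sigma>2 where "\<sigma>2 = outer_blocks b \<sigma>"
    note sp = NC2_split[OF less.prems b, folded \<sigma>1_def \<sigma>2_def]
    have IH1: "(\<lambda>k. \<bar>weight R \<sigma>1 k\<bar>) summable_on ({1..b - 2} \<rightarrow>\<^sub>E UNIV)"
        "(\<Sum>\<^sub>\<infinity>k\<in>{1..b - 2} \<rightarrow>\<^sub>E UNIV. \<bar>weight R \<sigma>1 k\<bar>) = \<rho> ^ card \<sigma>1"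
      using less.IH[OF _ sp(3)] sp(1,2) by auto
    have IH2: "(\<lambda>k. \<bar>weight R \<sigma>2 k\<bar>) summable_on ({1..N - b} \<rightarrow>\<^sub>E UNIV)"
        "(\<Sum>\<^sub>\<infinity>k\<in>{1..N - b} \<rightarrow>\<^sub>E UNIV. \<bar>weight R \<sigma>2 k\<bar>) = \<rho> ^ card \<sigma>2"
      using less.IH[OF _ sp(4)] sp(1,2) by auto
    let ?A = "({1..b - 2} \<rightarrow>\<^sub>E UNIV) :: (nat \<Rightarrow> int) set" and ?B = "({1..N - b} \<rightarrow>\<^sub>E UNIV) :: (nat \<Rightarrow> int) set"
    have W: "\<bar>weight R \<sigma> (glue N b x)\<bar> = (case x of (p, q) \<Rightarrow> \<bar>(case p of (u, v) \<Rightarrow> \<bar>R u v\<bar>) * (case q of (k1, k2) \<Rightarrow> \<bar>weight R \<sigma>1 k1 * weight R \<sigma>2 k2\<bar>)\<bar>)" for x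
      using weight_glue[OF sp(1,2,3,4)] by (cases x) (auto simp: sp(5) abs_mult)
    have R': "(\<lambda>p. \<bar>case p of (u, v) \<Rightarrow> \<bar>R u v\<bar>\<bar>) summable_on UNIV"
      using R_summable by (simp add: case_prod_unfold)
    have p12: "(\<lambda>q. \<bar>case q of (k1, k2) \<Rightarrow> \<bar>weight R \<sigma>1 k1 * weight R \<sigma>2 k2\<bar>\<bar>) summable_on ?A \<times> ?B"
      using product_summable[OF IH1(1) IH2(1)] by (simp add: case_prod_unfold)
    have s: "(\<lambda>x. \<bar>weight R \<sigma> (glue N b x)\<bar>) summable_on UNIV \<times> (?A \<times> ?B)"
      unfolding W by (rule product_summable[OF R' p12])
    have 1: "(\<lambda>k. \<bar>weight R \<sigma> k\<bar>) summable_on ({1..N} \<rightarrow>\<^sub>E UNIV)"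
      using s summable_on_reindex_bij_betw[OF glue_bij[OF sp(1,2)], of "\<lambda>k. \<bar>weight R \<sigma> k\<bar>"] by simp
    have "(\<Sum>\<^sub>\<infinity>k\<in>{1..N} \<rightarrow>\<^sub>E UNIV. \<bar>weight R \<sigma> k\<bar>) = (\<Sum>\<^sub>\<infinity>x\<in>UNIV \<times> (?A \<times> ?B). \<bar>weight R \<sigma> (glue N b x)\<bar>)"
      by (rule infsum_reindex_bij_betw[OF glue_bij[OF sp(1,2)], symmetric])
    also have "\<dots> = (\<Sum>\<^sub>\<infinity>(p, q)\<in>UNIV \<times> (?A \<times> ?B). (case p of (u, v) \<Rightarrow> \<bar>R u v\<bar>) * (case q of (k1, k2) \<Rightarrow> \<bar>weight R \<sigma>1 k1 * weight R \<sigma>2 k2\<bar>))"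
      unfolding W by (rule infsum_cong) (auto simp: abs_mult)
    also have "\<dots> = \<rho> * (\<Sum>\<^sub>\<infinity>(k1, k2)\<in>?A \<times> ?B. \<bar>weight R \<sigma>1 k1 * weight R \<sigma>2 k2\<bar>)"
      unfolding \<rho>_def by (rule product_infsum[OF R' p12])
    also have "(\<Sum>\<^sub>\<infinity>(k1, k2)\<in>?A \<times> ?B. \<bar>weight R \<sigma>1 k1 * weight R \<sigma>2 k2\<bar>) = \<rho> ^ card \<sigma>1 * \<rho> ^ card \<sigma>2"
      using product_infsum[of "\<lambda>k. \<bar>weight R \<sigma>1 k\<bar>" ?A "\<lambda>k. \<bar>weight R \<sigma>2 k\<bar>" ?B] IH1 IH2 by (simp add: abs_mult)
    also have "\<rho> * (\<rho> ^ card \<sigma>1 * \<rho> ^ card \<sigma>2) = \<rho> ^ card \<sigma>"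
      using card_join_pairs[OF sp(1-4)] by (simp add: sp(5) power_add)
    finally show ?thesis using 1 by simp
  qed
qed

lemma flow_sum_summable: "\<sigma> \<in> NC2 N \<Longrightarrow> (\<lambda>k. \<bar>weight R \<sigma> k\<bar>) summable_on flows N \<sigma> s"
  using weight_summable[of \<sigma> N] by (auto intro: summable_on_subset_banach simp: flows_def)

lemma flow_sum_bound:
  assumes "\<sigma> \<in> NC2 N"
  shows "\<bar>flow_sum N \<sigma> s\<bar> \<le> \<rho> ^ card \<sigma>"
proof -
  have "\<bar>flow_sum N \<sigma> s\<bar> \<le> (\<Sum>\<^sub>\<infinity>k\<in>flows N \<sigma> s. \<bar>weight R \<sigma> k\<bar>)"
    unfolding flow_sum_def using norm_infsum_bound[of "weight R \<sigma>" "flows N \<sigma> s"] flow_sum_summable[OF assms] by simp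
  also have "\<dots> \<le> (\<Sum>\<^sub>\<infinity>k\<in>{1..N} \<rightarrow>\<^sub>E UNIV. \<bar>weight R \<sigma> k\<bar>)"
    using weight_summable[OF assms] flow_sum_summable[OF assms] by (intro infsum_mono2) (auto simp: flows_def)
  finally show ?thesis using weight_summable[OF assms] by simp
qed

text \<open>Once the labels of 1 and \<open>b\<close> are fixed, the constraints on the two parts
  decouple, and Fubini splits the remaining sum into a product.\<close>

lemma flow_sum_join:
  assumes b: "2 \<le> b" "b \<le> N" and \<sigma>: "\<sigma>1 \<in> NC2 (b - 2)" "\<sigma>2 \<in> NC2 (N - b)"
  shows "flow_sum N (join_pairs b \<sigma>1 \<sigma>2) s = (\<Sum>\<^sub>\<infinity>(u, v)\<in>UNIV. R u v * flow_sum (b - 2) \<sigma>1 (- u) * flow_sum (N - b) \<sigma>2 (s - v))"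
    and "(\<lambda>(u, v). R u v * flow_sum (b - 2) \<sigma>1 (- u) * flow_sum (N - b) \<sigma>2 (s - v)) summable_on UNIV"
proof -
  let ?J = "join_pairs b \<sigma>1 \<sigma>2"
  let ?S = "\<lambda>p. flows (b - 2) \<sigma>1 (- fst p) \<times> flows (N - b) \<sigma>2 (s - snd p)"
  note J = join_pairs_NC2[OF b \<sigma>]
  note bij = glue_bij_flows[OF b \<sigma>, of s]
  have e: "weight R ?J (glue N b (p, q)) = R (fst p) (snd p) * (case q of (k1, k2) \<Rightarrow> weight R \<sigma>1 k1 * weight R \<sigma>2 k2)" for p q
    by (cases p; cases q) (simp add: weight_glue[OF b \<sigma>])
  have "(\<lambda>x. \<bar>weight R ?J (glue N b x)\<bar>) summable_on Sigma UNIV ?S"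
    using flow_sum_summable[OF J, of s] summable_on_reindex_bij_betw[OF bij, of "\<lambda>k. \<bar>weight R ?J k\<bar>"] by simp
  then have "(\<lambda>x. weight R ?J (glue N b x)) summable_on Sigma UNIV ?S"
    using abs_summable_summable[of "\<lambda>x. weight R ?J (glue N b x)" "Sigma UNIV ?S"] by simp
  then have s: "(\<lambda>(p, q). R (fst p) (snd p) * (case q of (k1, k2) \<Rightarrow> weight R \<sigma>1 k1 * weight R \<sigma>2 k2)) summable_on Sigma UNIV ?S"
  proof -
    have "(\<lambda>(p, q). R (fst p) (snd p) * (case q of (k1, k2) \<Rightarrow> weight R \<sigma>1 k1 * weight R \<sigma>2 k2)) = (\<lambda>x. weight R ?J (glue N b x))"
      by (rule ext) (simp only: split_paired_all case_prod_conv e)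
    then show ?thesis using \<open>(\<lambda>x. weight R ?J (glue N b x)) summable_on Sigma UNIV ?S\<close> by simp
  qed
  have inner: "(\<Sum>\<^sub>\<infinity>q\<in>?S p. R (fst p) (snd p) * (case q of (k1, k2) \<Rightarrow> weight R \<sigma>1 k1 * weight R \<sigma>2 k2)) =
      (case p of (u, v) \<Rightarrow> R u v * flow_sum (b - 2) \<sigma>1 (- u) * flow_sum (N - b) \<sigma>2 (s - v))" for p
    unfolding infsum_cmult_right' flow_sum_def
    by (subst product_infsum[OF flow_sum_summable[OF \<sigma>(1)] flow_sum_summable[OF \<sigma>(2)]]) (simp add: case_prod_unfold)
  have "flow_sum N ?J s = (\<Sum>\<^sub>\<infinity>x\<in>Sigma UNIV ?S. weight R ?J (glue N b x))"
    unfolding flow_sum_def by (rule infsum_reindex_bij_betw[OF bij, symmetric])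
  also have "\<dots> = (\<Sum>\<^sub>\<infinity>(p, q)\<in>Sigma UNIV ?S. R (fst p) (snd p) * (case q of (k1, k2) \<Rightarrow> weight R \<sigma>1 k1 * weight R \<sigma>2 k2))"
    by (rule infsum_cong) (auto simp: e)
  also have "\<dots> = (\<Sum>\<^sub>\<infinity>p\<in>UNIV. \<Sum>\<^sub>\<infinity>q\<in>?S p. R (fst p) (snd p) * (case q of (k1, k2) \<Rightarrow> weight R \<sigma>1 k1 * weight R \<sigma>2 k2))"
    by (rule infsum_Sigma'_banach[OF s, symmetric])
  finally show "flow_sum N ?J s = (\<Sum>\<^sub>\<infinity>(u, v)\<in>UNIV. R u v * flow_sum (b - 2) \<sigma>1 (- u) * flow_sum (N - b) \<sigma>2 (s - v))"
    unfolding inner .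
  show "(\<lambda>(u, v). R u v * flow_sum (b - 2) \<sigma>1 (- u) * flow_sum (N - b) \<sigma>2 (s - v)) summable_on UNIV"
    using summable_on_Sigma_banach[OF s] unfolding inner .
qed

text \<open>Only \<open>s = 0\<close> yields moments of the law; the other values are carried along
  because the recursion refers to them.\<close>

definition moment :: "nat \<Rightarrow> int \<Rightarrow> real" where
  "moment N s = (\<Sum>\<sigma>\<in>NC2 N. flow_sum N \<sigma> s)"

text \<open>A majorant independent of \<open>s\<close> that obeys the Catalan recursion with weight
  \<open>\<rho>\<close>.\<close>

definition moment_bound :: "nat \<Rightarrow> real" where
  "moment_bound N = (\<Sum>\<sigma>\<in>NC2 N. \<rho> ^ card \<sigma>)"

lemma moment_bound_nonneg: "0 \<le> moment_bound N"
  unfolding moment_bound_def by (intro sum_nonneg zero_le_power \<rho>_nonneg)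

lemma moment_le: "\<bar>moment N s\<bar> \<le> moment_bound N"
  unfolding moment_def moment_bound_def
  by (rule order_trans[OF sum_abs]) (intro sum_mono flow_sum_bound)

lemma moment_0: "moment 0 s = (if s = 0 then 1 else 0)"
  by (simp add: moment_def NC2_0 flow_sum_def flows_def weight_def ivl_class_def)

lemma moment_bound_0: "moment_bound 0 = 1"
  by (simp add: moment_bound_def NC2_0)

lemma moment_odd: "odd N \<Longrightarrow> moment N s = 0"
  by (simp add: moment_def NC2_odd)

lemma beta_eq_moment: "1 \<le> m \<Longrightarrow> beta R m = moment (2 * m) 0"
  unfolding beta_def moment_def flow_sum_def weight_def
  by (intro sum.cong refl) (simp add: S_set_eq_flows NC2_def)

lemma moment_bound_rec:
  assumes "1 \<le> N"
  shows "moment_bound N = (\<Sum>b\<in>{2..N}. \<rho> * moment_bound (b - 2) * moment_bound (N - b))"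
  unfolding moment_bound_def sum_NC2_rec[OF assms]
proof (rule sum.cong[OF refl])
  fix b assume b: "b \<in> {2..N}"
  have "(\<Sum>\<sigma>1\<in>NC2 (b - 2). \<Sum>\<sigma>2\<in>NC2 (N - b). \<rho> ^ card (join_pairs b \<sigma>1 \<sigma>2)) =
      (\<Sum>\<sigma>1\<in>NC2 (b - 2). \<Sum>\<sigma>2\<in>NC2 (N - b). \<rho> * \<rho> ^ card \<sigma>1 * \<rho> ^ card \<sigma>2)"
    using b by (intro sum.cong refl) (simp add: card_join_pairs[of b N] power_add)
  then show "(\<Sum>\<sigma>1\<in>NC2 (b - 2). \<Sum>\<sigma>2\<in>NC2 (N - b). \<rho> ^ card (join_pairs b \<sigma>1 \<sigma>2)) =
      \<rho> * (\<Sum>\<sigma>\<in>NC2 (b - 2). \<rho> ^ card \<sigma>) * (\<Sum>\<sigma>\<in>NC2 (N - b). \<rho> ^ card \<sigma>)"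
    by (simp add: sum_distrib_left sum_distrib_right mult_ac)
qed

lemma infsum_finite_sum:
  fixes f :: "'i \<Rightarrow> 'x \<Rightarrow> 'c :: banach"
  assumes "finite I" "\<And>i. i \<in> I \<Longrightarrow> f i summable_on A"
  shows "(\<Sum>\<^sub>\<infinity>x\<in>A. \<Sum>i\<in>I. f i x) = (\<Sum>i\<in>I. \<Sum>\<^sub>\<infinity>x\<in>A. f i x)" "(\<lambda>x. \<Sum>i\<in>I. f i x) summable_on A"
proof -
  have "((\<lambda>x. \<Sum>i\<in>I. f i x) has_sum (\<Sum>i\<in>I. \<Sum>\<^sub>\<infinity>x\<in>A. f i x)) A"
    using assms by (induction I rule: finite_induct) (auto intro!: has_sum_add has_sum_0)
  then show "(\<Sum>\<^sub>\<infinity>x\<in>A. \<Sum>i\<in>I. f i x) = (\<Sum>i\<in>I. \<Sum>\<^sub>\<infinity>x\<in>A. f i x)" "(\<lambda>x. \<Sum>i\<in>I. f i x) summable_on A"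
    by (auto intro: infsumI simp: summable_on_def)
qed

lemma moment_rec:
  assumes N: "1 \<le> N"
  shows "moment N s = (\<Sum>b\<in>{2..N}. \<Sum>\<^sub>\<infinity>(u, v)\<in>UNIV. R u v * moment (b - 2) (- u) * moment (N - b) (s - v))"
  unfolding moment_def sum_NC2_rec[OF N]
proof (rule sum.cong[OF refl])
  fix b assume "b \<in> {2..N}"
  then have b: "2 \<le> b" "b \<le> N" by auto
  let ?f = "\<lambda>(\<sigma>1, \<sigma>2). \<lambda>p. R (fst p) (snd p) * flow_sum (b - 2) \<sigma>1 (- fst p) * flow_sum (N - b) \<sigma>2 (s - snd p)"
  have "(\<Sum>\<sigma>1\<in>NC2 (b - 2). \<Sum>\<sigma>2\<in>NC2 (N - b). flow_sum N (join_pairs b \<sigma>1 \<sigma>2) s) =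
    (\<Sum>x\<in>NC2 (b - 2) \<times> NC2 (N - b). \<Sum>\<^sub>\<infinity>p\<in>UNIV. ?f x p)"
    unfolding sum.cartesian_product by (rule sum.cong) (auto simp: flow_sum_join(1)[OF b] case_prod_unfold)
  also have "\<dots> = (\<Sum>\<^sub>\<infinity>p\<in>UNIV. \<Sum>x\<in>NC2 (b - 2) \<times> NC2 (N - b). ?f x p)"
    using flow_sum_join(2)[OF b] by (intro infsum_finite_sum(1)[symmetric]) (auto simp: NC2_finite case_prod_unfold)
  also have "\<dots> = (\<Sum>\<^sub>\<infinity>(u, v)\<in>UNIV. R u v * (\<Sum>\<sigma>\<in>NC2 (b - 2). flow_sum (b - 2) \<sigma> (- u)) * (\<Sum>\<sigma>\<in>NC2 (N - b). flow_sum (N - b) \<sigma> (s - v)))"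
  proof (rule infsum_cong)
    fix p :: "int \<times> int"
    have "(\<Sum>x\<in>NC2 (b - 2) \<times> NC2 (N - b). ?f x p) = (\<Sum>\<sigma>1\<in>NC2 (b - 2). \<Sum>\<sigma>2\<in>NC2 (N - b). ?f (\<sigma>1, \<sigma>2) p)"
      unfolding sum.cartesian_product by (rule sum.cong) auto
    then show "(\<Sum>x\<in>NC2 (b - 2) \<times> NC2 (N - b). ?f x p) =
        (case p of (u, v) \<Rightarrow> R u v * (\<Sum>\<sigma>\<in>NC2 (b - 2). flow_sum (b - 2) \<sigma> (- u)) * (\<Sum>\<sigma>\<in>NC2 (N - b). flow_sum (N - b) \<sigma> (s - v)))"
    proof -
      assume e: "(\<Sum>x\<in>NC2 (b - 2) \<times> NC2 (N - b). ?f x p) = (\<Sum>\<sigma>1\<in>NC2 (b - 2). \<Sum>\<sigma>2\<in>NC2 (N - b). ?f (\<sigma>1, \<sigma>2) p)"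
      show ?thesis
        unfolding e unfolding case_prod_unfold fst_conv snd_conv unfolding mult.assoc unfolding sum_product
        unfolding sum_distrib_left ..
    qed
  qed
  finally show "(\<Sum>\<sigma>1\<in>NC2 (b - 2). \<Sum>\<sigma>2\<in>NC2 (N - b). flow_sum N (join_pairs b \<sigma>1 \<sigma>2) s) =
    (\<Sum>\<^sub>\<infinity>(u, v)\<in>UNIV. R u v * (\<Sum>\<sigma>\<in>NC2 (b - 2). flow_sum (b - 2) \<sigma> (- u)) * (\<Sum>\<sigma>\<in>NC2 (N - b). flow_sum (N - b) \<sigma> (s - v)))" .
qed

lemma moment_1: "moment 1 s = 0"
  by (rule moment_odd) simp

lemma moment_bound_1: "moment_bound 1 = 0"
  by (simp add: moment_bound_def NC2_odd)

lemma sum_shift_2: "(\<Sum>b\<in>{2..M + 2}. f (b - 2) (M + 2 - b)) = (\<Sum>q\<le>M. f q (M - q))" for M :: nat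
  by (rule sum.reindex_bij_witness[of _ "\<lambda>q. q + 2" "\<lambda>b. b - 2"]) auto

lemma moment_rec':
  "moment (M + 2) s = (\<Sum>q\<le>M. \<Sum>\<^sub>\<infinity>(u, v)\<in>UNIV. R u v * moment q (- u) * moment (M - q) (s - v))"
  using moment_rec[of "M + 2" s] sum_shift_2[of "\<lambda>q r. \<Sum>\<^sub>\<infinity>(u, v)\<in>UNIV. R u v * moment q (- u) * moment r (s - v)" M] by simp

lemma moment_bound_rec': "moment_bound (M + 2) = (\<Sum>q\<le>M. \<rho> * moment_bound q * moment_bound (M - q))"
  using moment_bound_rec[of "M + 2"] sum_shift_2[of "\<lambda>q r. \<rho> * moment_bound q * moment_bound r" M] by simp

text \<open>Formally the generating function satisfies
  \<open>f = 1 + \<rho> t\<^sup>2 f\<^sup>2\<close>. For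
  \<open>\<rho> * t\<^sup>2 \<le> 1 / 4\<close> the bound 2 reproduces itself, as
  \<open>1 + 2\<^sup>2 / 4 = 2\<close>. The induction runs on partial sums because convergence is
  not yet known.\<close>

lemma moment_bound_partial_sum:
  assumes t: "0 \<le> t" "\<rho> * t\<^sup>2 \<le> 1 / 4"
  shows "(\<Sum>p\<le>N. moment_bound p * t ^ p) \<le> 2"
proof (induction N rule: less_induct)
  case (less N)
  define x where "x p = moment_bound p * t ^ p" for p
  have x0: "x p \<ge> 0" for p unfolding x_def using moment_bound_nonneg t by simp
  consider "N = 0" | "N = 1" | M where "N = M + 2" by (metis One_nat_def add_2_eq_Suc' not0_implies_Suc)
  then show ?case
  proof cases
    case 1 then show ?thesis by (simp add: moment_bound_0)
  next
    case 2 then show ?thesis using moment_bound_1 by (simp add: moment_bound_0)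
  next
    case 3
    have xr: "x (m + 2) = \<rho> * t\<^sup>2 * (\<Sum>q\<le>m. x q * x (m - q))" for m
    proof -
      have "\<rho> * moment_bound q * moment_bound (m - q) * t ^ (m + 2) = \<rho> * t\<^sup>2 * (x q * x (m - q))" if "q \<le> m" for q
      proof -
        have "t ^ (m + 2) = t ^ q * t ^ (m - q) * t\<^sup>2" using that by (simp add: power_add[symmetric] del: power_add)
        then show ?thesis by (simp add: x_def)
      qed
      then show ?thesis unfolding x_def[of "m + 2"] moment_bound_rec' sum_distrib_right sum_distrib_left by (intro sum.cong) auto
    qed
    have "(\<Sum>p\<le>N. x p) = x 0 + x 1 + (\<Sum>m\<le>M. x (m + 2))"
      using 3 sum.atMost_Suc_shift[of x "Suc M"] sum.atMost_Suc_shift[of "\<lambda>i. x (Suc i)" M] by (simp add: numeral_2_eq_2)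
    also have "x 0 = 1" by (simp add: x_def moment_bound_0)
    also have "x 1 = 0" unfolding x_def moment_bound_1 by simp
    also have "1 + 0 + (\<Sum>m\<le>M. x (m + 2)) = 1 + \<rho> * t\<^sup>2 * (\<Sum>m\<le>M. \<Sum>q\<le>m. x q * x (m - q))"
      unfolding xr sum_distrib_left by simp
    also have "(\<Sum>m\<le>M. \<Sum>q\<le>m. x q * x (m - q)) = (\<Sum>(i, j)\<in>{(i, j). i + j \<le> M}. x i * x j)"
      by (rule sum.triangle_reindex_eq[symmetric])
    also have "\<dots> \<le> (\<Sum>(i, j)\<in>{..M} \<times> {..M}. x i * x j)"
      by (rule sum_mono2) (auto intro!: mult_nonneg_nonneg x0)
    also have "\<dots> = (\<Sum>p\<le>M. x p) * (\<Sum>p\<le>M. x p)" by (simp add: sum_product sum.cartesian_product)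
    also have "\<dots> \<le> 2 * 2"
    proof (rule mult_mono)
      show "(\<Sum>p\<le>M. x p) \<le> 2" using less.IH[of M] 3 by (simp add: x_def)
      then show "(\<Sum>p\<le>M. x p) \<le> 2" .
    qed (auto intro: sum_nonneg x0)
    finally have "(\<Sum>p\<le>N. x p) \<le> 1 + \<rho> * t\<^sup>2 * (2 * 2)"
      using \<rho>_nonneg by (simp add: mult_left_mono)
    then show ?thesis using t(2) unfolding x_def by argo
  qed
qed

lemma moment_bound_series:
  assumes t: "0 \<le> t" "\<rho> * t\<^sup>2 \<le> 1 / 4"
  shows "summable (\<lambda>p. moment_bound p * t ^ p)" "(\<Sum>p. moment_bound p * t ^ p) \<le> 2"
proof -
  have le: "(\<Sum>p<n. moment_bound p * t ^ p) \<le> 2" for n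
  proof -
    have "(\<Sum>p<n. moment_bound p * t ^ p) \<le> (\<Sum>p\<le>n. moment_bound p * t ^ p)"
      using moment_bound_nonneg t by (intro sum_mono2) auto
    then show ?thesis using moment_bound_partial_sum[OF t, of n] by simp
  qed
  show "summable (\<lambda>p. moment_bound p * t ^ p)"
    by (rule summableI_nonneg_bounded[OF _ le]) (use moment_bound_nonneg t in simp)
  then show "(\<Sum>p. moment_bound p * t ^ p) \<le> 2" using le by (intro suminf_le_const) auto
qed

lemma moment_growth: "0 < t \<Longrightarrow> \<rho> * t\<^sup>2 \<le> 1 / 4 \<Longrightarrow> \<bar>moment p s\<bar> \<le> 2 * (1 / t) ^ p"
proof -
  assume t: "0 < t" "\<rho> * t\<^sup>2 \<le> 1 / 4"
  have "\<bar>moment p s\<bar> * t ^ p \<le> moment_bound p * t ^ p" using t moment_le by (intro mult_right_mono) auto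
  also have "\<dots> \<le> (\<Sum>p\<le>p. moment_bound p * t ^ p)"
    using moment_bound_nonneg t by (intro member_le_sum) auto
  also have "\<dots> \<le> 2" using moment_bound_partial_sum t by simp
  finally show ?thesis using t by (simp add: power_one_over field_simps)
qed

text \<open>The resolvent side of the limit: \<open>green y s\<close> is the limit of the averaged \<open>s\<close>-th off-diagonal of the resolvent at \<open>\<i> y\<close>.\<close>

definition green :: "real \<Rightarrow> int \<Rightarrow> complex" where
  "green y s = - (\<Sum>p. of_real (moment p s) * (1 / (\<i> * of_real y)) ^ (p + 1))"

section \<open>The generating series of the moments and its quadratic equation\<close>

context
  fixes y :: real assumes y: "0 < y" "\<rho> * (1 / y)\<^sup>2 \<le> 1 / 4"
begin

lemma moment_series_norm:
  "norm (of_real (moment p s) * (1 / (\<i> * complex_of_real y)) ^ p) \<le> moment_bound p * (1 / y) ^ p"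
  using y moment_le[of p s] by (simp add: norm_mult norm_power norm_divide power_divide divide_right_mono)

lemma moment_series_summable:
  "summable (\<lambda>p. norm (of_real (moment p s) * (1 / (\<i> * complex_of_real y)) ^ p))"
  by (rule summable_comparison_test'[OF moment_bound_series(1)[of "1 / y"], of 0]) (use y moment_series_norm in auto)

lemma green_eq: "green y s = - (1 / (\<i> * of_real y)) * (\<Sum>p. of_real (moment p s) * (1 / (\<i> * complex_of_real y)) ^ p)"
proof -
  have "(\<Sum>p. of_real (moment p s) * (1 / (\<i> * complex_of_real y)) ^ (p + 1)) =
      (\<Sum>p. (1 / (\<i> * of_real y)) * (of_real (moment p s) * (1 / (\<i> * complex_of_real y)) ^ p))"
    by (simp add: mult_ac)
  also have "\<dots> = (1 / (\<i> * of_real y)) * (\<Sum>p. of_real (moment p s) * (1 / (\<i> * complex_of_real y)) ^ p)"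
    by (rule suminf_mult[OF summable_norm_cancel[OF moment_series_summable]])
  finally show ?thesis by (simp add: green_def)
qed

lemma green_bound: "cmod (green y s) \<le> 2 / y"
proof -
  have "cmod (\<Sum>p. of_real (moment p s) * (1 / (\<i> * complex_of_real y)) ^ p) \<le> (\<Sum>p. moment_bound p * (1 / y) ^ p)"
    by (rule norm_suminf_le[OF moment_series_norm]) (use moment_bound_series[of "1 / y"] y in auto)
  also have "\<dots> \<le> 2" using moment_bound_series[of "1 / y"] y by auto
  finally show ?thesis using y unfolding green_eq by (simp add: norm_mult norm_divide divide_right_mono)
qed

text \<open>Multiplying the moment recursion by powers of \<open>1 / (\<i> y)\<close> turns the sum
  over the split point into a Cauchy product, and summing over the order gives a quadratic equation.
  Orders 0 and 1 stand apart: order 0 contributes the delta and order 1 vanishes.\<close>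

lemma green_fixed_point:
  "\<i> * of_real y * green y s = - (if s = 0 then 1 else 0) - (\<Sum>\<^sub>\<infinity>(u, v)\<in>UNIV. of_real (R u v) * (green y (- u) * green y (s - v)))"
proof -
  define w where "w = 1 / (\<i> * complex_of_real y)"
  define a where "a p s = of_real (moment p s) * w ^ p" for p s
  define A where "A s = (\<Sum>p. a p s)" for s
  define x where "x p = moment_bound p * (1 / y) ^ p" for p
  have w0: "w \<noteq> 0" using y by (simp add: w_def)
  have an: "norm (a p s) \<le> x p" for p s unfolding a_def w_def x_def by (rule moment_series_norm)
  have asum: "summable (\<lambda>p. norm (a p s))" for s unfolding a_def w_def by (rule moment_series_summable)
  have x0: "0 \<le> x p" for p using an norm_ge_zero order_trans by blast
  have xs: "summable (\<lambda>p. norm (x p))" using moment_bound_series(1)[of "1 / y"] y x0 by (simp add: x_def)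
  have gA: "green y s = - w * A s" for s unfolding green_eq A_def a_def w_def by simp
  \<comment> \<open>The coefficient of order \<open>M\<close> in the product of the two series, for
    fixed labels \<open>p = (u, v)\<close>.\<close>
  define cc where "cc M p = (\<Sum>q\<le>M. a q (- fst p) * a (M - q) (s - snd p))" for M and p :: "int \<times> int"
  have cn: "norm (cc M p) \<le> (\<Sum>q\<le>M. x q * x (M - q))" for M p
    unfolding cc_def by (rule sum_norm_le) (auto simp: norm_mult intro!: mult_mono an x0)
  have Rn: "(\<lambda>p. \<bar>R (fst p) (snd p)\<bar>) summable_on UNIV" using R_summable by (simp add: case_prod_unfold)
  have step: "a (M + 2) s = w\<^sup>2 * (\<Sum>\<^sub>\<infinity>p\<in>UNIV. of_real (R (fst p) (snd p)) * cc M p)" for M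
  proof -
    have su: "(\<lambda>p. of_real (R (fst p) (snd p)) * (a q (- fst p) * a (M - q) (s - snd p))) summable_on UNIV" for q
    proof (rule abs_summable_summable, rule Infinite_Sum.abs_summable_on_comparison_test'[where g = "\<lambda>p. \<bar>R (fst p) (snd p)\<bar> * (x q * x (M - q))"])
      show "(\<lambda>p. \<bar>R (fst p) (snd p)\<bar> * (x q * x (M - q))) summable_on UNIV" by (rule summable_on_cmult_left[OF Rn])
      show "norm (of_real (R (fst p) (snd p)) * (a q (- fst p) * a (M - q) (s - snd p))) \<le> \<bar>R (fst p) (snd p)\<bar> * (x q * x (M - q))" for p
        unfolding norm_mult by (intro mult_mono an x0) (auto intro: x0)
    qed
    have "of_real (moment (M + 2) s) * w ^ M = (\<Sum>q\<le>M. \<Sum>\<^sub>\<infinity>p\<in>UNIV. of_real (R (fst p) (snd p)) * (a q (- fst p) * a (M - q) (s - snd p)))"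
      unfolding moment_rec' of_real_sum sum_distrib_right
    proof (rule sum.cong[OF refl])
      fix q assume q: "q \<in> {..M}"
      have "of_real (\<Sum>\<^sub>\<infinity>(u, v)\<in>UNIV. R u v * moment q (- u) * moment (M - q) (s - v)) * w ^ M =
          (\<Sum>\<^sub>\<infinity>p\<in>UNIV. of_real (R (fst p) (snd p) * moment q (- fst p) * moment (M - q) (s - snd p)) * w ^ M)"
      proof -
        have "(\<lambda>p. R (fst p) (snd p) * moment q (- fst p) * moment (M - q) (s - snd p)) summable_on UNIV"
        proof (rule abs_summable_summable, rule Infinite_Sum.abs_summable_on_comparison_test'[where g = "\<lambda>p. \<bar>R (fst p) (snd p)\<bar> * (moment_bound q * moment_bound (M - q))"])
          show "(\<lambda>p. \<bar>R (fst p) (snd p)\<bar> * (moment_bound q * moment_bound (M - q))) summable_on UNIV" by (rule summable_on_cmult_left[OF Rn])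
          show "norm (R (fst p) (snd p) * moment q (- fst p) * moment (M - q) (s - snd p)) \<le> \<bar>R (fst p) (snd p)\<bar> * (moment_bound q * moment_bound (M - q))" for p
            unfolding real_norm_def abs_mult mult.assoc by (intro mult_mono moment_le mult_nonneg_nonneg moment_bound_nonneg) auto
        qed
        from infsumI[OF has_sum_of_real[OF has_sum_infsum[OF this], where 'a = complex]]
        show ?thesis unfolding infsum_cmult_left' case_prod_unfold by simp
      qed
      also have "\<dots> = (\<Sum>\<^sub>\<infinity>p\<in>UNIV. of_real (R (fst p) (snd p)) * (a q (- fst p) * a (M - q) (s - snd p)))"
      proof (rule infsum_cong)
        fix p :: "int \<times> int"
        have "w ^ M = w ^ q * w ^ (M - q)" using q by (simp add: power_add[symmetric])
        then show "of_real (R (fst p) (snd p) * moment q (- fst p) * moment (M - q) (s - snd p)) * w ^ M =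
          of_real (R (fst p) (snd p)) * (a q (- fst p) * a (M - q) (s - snd p))" by (simp add: a_def)
      qed
      finally show "of_real (\<Sum>\<^sub>\<infinity>(u, v)\<in>UNIV. R u v * moment q (- u) * moment (M - q) (s - v)) * w ^ M = \<dots>" .
    qed
    also have "\<dots> = (\<Sum>\<^sub>\<infinity>p\<in>UNIV. \<Sum>q\<le>M. of_real (R (fst p) (snd p)) * (a q (- fst p) * a (M - q) (s - snd p)))"
      by (rule infsum_finite_sum(1)[symmetric]) (use su in auto)
    finally have "of_real (moment (M + 2) s) * w ^ M = (\<Sum>\<^sub>\<infinity>p\<in>UNIV. of_real (R (fst p) (snd p)) * cc M p)"
      by (simp only: cc_def sum_distrib_left)
    moreover have "a (M + 2) s = w\<^sup>2 * (of_real (moment (M + 2) s) * w ^ M)" by (simp only: a_def power_add mult_ac)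
    ultimately show ?thesis by simp
  qed
  have xx: "summable (\<lambda>M. \<Sum>q\<le>M. x q * x (M - q))" by (rule summable_Cauchy_product[OF xs xs])
  \<comment> \<open>Joint absolute summability in labels and order, with the Cauchy product of the
    majorants as bound, licenses the exchange of the two sums below.\<close>
  have prod: "(\<lambda>(p, M). of_real (R (fst p) (snd p)) * cc M p) summable_on UNIV \<times> UNIV"
  proof (rule abs_summable_summable, rule Infinite_Sum.abs_summable_on_comparison_test'[where g = "\<lambda>(p, M). \<bar>R (fst p) (snd p) * (\<Sum>q\<le>M. x q * x (M - q))\<bar>"])
    have "(\<lambda>M. \<bar>\<Sum>q\<le>M. x q * x (M - q)\<bar>) summable_on UNIV"
      using xx x0 by (intro summable_nonneg_imp_summable_on) (auto simp: sum_nonneg)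
    from product_summable[OF Rn this]
    show "(\<lambda>(p, M). \<bar>R (fst p) (snd p) * (\<Sum>q\<le>M. x q * x (M - q))\<bar>) summable_on UNIV \<times> UNIV" .
    have "0 \<le> (\<Sum>q\<le>M. x q * x (M - q))" for M by (intro sum_nonneg mult_nonneg_nonneg x0)
    then show "norm (case z of (p, M) \<Rightarrow> of_real (R (fst p) (snd p)) * cc M p) \<le> (case z of (p, M) \<Rightarrow> \<bar>R (fst p) (snd p) * (\<Sum>q\<le>M. x q * x (M - q))\<bar>)" for z
      using cn by (auto simp: norm_mult abs_mult split: prod.split intro!: mult_left_mono)
  qed
  have ccs: "(\<Sum>\<^sub>\<infinity>M\<in>UNIV. cc M p) = A (- fst p) * A (s - snd p)" for p
  proof -
    have "(\<lambda>M. cc M p) sums (A (- fst p) * A (s - snd p))"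
      unfolding cc_def A_def by (rule Cauchy_product_sums[OF asum asum])
    moreover have "summable (\<lambda>M. norm (cc M p))" by (rule summable_comparison_test'[OF xx, of 0]) (use cn in simp)
    ultimately have "((\<lambda>M. cc M p) has_sum (A (- fst p) * A (s - snd p))) UNIV" by (rule norm_summable_imp_has_sum[rotated])
    then show ?thesis by (rule infsumI)
  qed
  have "A s = a 0 s + (a 1 s + (\<Sum>M. a (M + 2) s))"
  proof -
    have s1: "summable (\<lambda>p. a p s)" by (rule summable_norm_cancel[OF asum])
    then have s2: "summable (\<lambda>p. a (Suc p) s)" by (subst summable_Suc_iff)
    show ?thesis unfolding A_def using suminf_split_head[OF s1] suminf_split_head[OF s2] by simp
  qed
  also have "(\<Sum>M. a (M + 2) s) = (\<Sum>\<^sub>\<infinity>M\<in>UNIV. a (M + 2) s)"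
  proof -
    have "summable (\<lambda>M. norm (a (M + 2) s))" using summable_ignore_initial_segment[OF asum, of 2] by simp
    from norm_summable_imp_has_sum[OF this summable_sums[OF summable_norm_cancel[OF this]]]
    show ?thesis by (rule infsumI[symmetric])
  qed
  also have "\<dots> = w\<^sup>2 * (\<Sum>\<^sub>\<infinity>M\<in>UNIV. \<Sum>\<^sub>\<infinity>p\<in>UNIV. of_real (R (fst p) (snd p)) * cc M p)"
    unfolding step by (rule infsum_cmult_right')
  also have "(\<Sum>\<^sub>\<infinity>M\<in>UNIV. \<Sum>\<^sub>\<infinity>p\<in>UNIV. of_real (R (fst p) (snd p)) * cc M p) = (\<Sum>\<^sub>\<infinity>p\<in>UNIV. \<Sum>\<^sub>\<infinity>M\<in>UNIV. of_real (R (fst p) (snd p)) * cc M p)"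
    by (rule infsum_swap_banach[OF prod, symmetric])
  also have "\<dots> = (\<Sum>\<^sub>\<infinity>p\<in>UNIV. of_real (R (fst p) (snd p)) * (A (- fst p) * A (s - snd p)))"
    unfolding infsum_cmult_right' ccs ..
  also have "w\<^sup>2 * \<dots> = (\<Sum>\<^sub>\<infinity>p\<in>UNIV. of_real (R (fst p) (snd p)) * (green y (- fst p) * green y (s - snd p)))"
    unfolding infsum_cmult_right'[symmetric] gA by (rule infsum_cong) (simp add: power2_eq_square)
  also have "a 0 s = (if s = 0 then 1 else 0)" by (simp add: a_def moment_0)
  also have "a 1 s = 0" by (simp only: a_def moment_1) simp
  finally have "A s = (if s = 0 then 1 else 0) + (\<Sum>\<^sub>\<infinity>p\<in>UNIV. of_real (R (fst p) (snd p)) * (green y (- fst p) * green y (s - snd p)))" by simp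
  moreover have "\<i> * of_real y * green y s = - A s" unfolding gA using y by (simp add: w_def field_simps)
  ultimately show ?thesis by (simp add: case_prod_unfold)
qed

text \<open>Odd moments vanish and \<open>(1 / (\<i> y)) ^ (2 j)\<close> is real of sign
  \<open>(-1) ^ j\<close>, so the value is purely imaginary and has the series form required by
  \<open>mass_part_expansion\<close>.\<close>

lemma green_moments:
  "y * Im (green y 0) = (\<Sum>j. (-1) ^ j * moment (2 * j) 0 / y ^ (2 * j))" "Re (green y 0) = 0"
proof -
  define a where "a p = of_real (moment p 0) * (1 / (\<i> * complex_of_real y)) ^ p" for p
  have s: "summable a" unfolding a_def by (rule summable_norm_cancel[OF moment_series_summable])
  have ev: "a (2 * j) = of_real ((-1) ^ j * moment (2 * j) 0 / y ^ (2 * j))" for j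
  proof -
    have "(1 / (\<i> * complex_of_real y))\<^sup>2 = of_real (- 1 / y\<^sup>2)" by (simp add: power_divide power_mult_distrib)
    moreover have "(- 1 / y\<^sup>2) ^ j = (-1) ^ j / y ^ (2 * j)" by (simp only: power_divide power_mult)
    ultimately have "(1 / (\<i> * complex_of_real y)) ^ (2 * j) = of_real ((-1) ^ j / y ^ (2 * j))"
      unfolding power_mult of_real_power[symmetric] by (metis of_real_power power_mult)
    then show ?thesis unfolding a_def by (simp only: of_real_mult[symmetric]) (simp add: mult.commute)
  qed
  have od: "a n = 0" if "n \<notin> range (\<lambda>j. 2 * j)" for n
  proof -
    have "odd n" using that by (auto elim!: evenE)
    then show ?thesis by (simp add: a_def moment_odd)
  qed
  have "a sums (\<Sum>p. a p)" using s by (rule summable_sums)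
  moreover have "strict_mono (\<lambda>j::nat. 2 * j)" by (simp add: strict_mono_def)
  ultimately have "(\<lambda>j. a (2 * j)) sums (\<Sum>p. a p)" using sums_mono_reindex[of "\<lambda>j. 2 * j" a] od by blast
  then have *: "(\<lambda>j. complex_of_real ((-1) ^ j * moment (2 * j) 0 / y ^ (2 * j))) sums (\<Sum>p. a p)" unfolding ev .
  have "(\<lambda>j. (-1) ^ j * moment (2 * j) 0 / y ^ (2 * j)) sums Re (\<Sum>p. a p)" using sums_Re[OF *] by simp
  then have re: "Re (\<Sum>p. a p) = (\<Sum>j. (-1) ^ j * moment (2 * j) 0 / y ^ (2 * j))" by (rule sums_unique)
  have "(\<lambda>j. 0) sums Im (\<Sum>p. a p)" using sums_Im[OF *] by simp
  then have im: "Im (\<Sum>p. a p) = 0" using sums_unique2 sums_zero by blast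
  have "green y 0 = \<i> / of_real y * (\<Sum>p. a p)" unfolding green_eq a_def using y by (simp add: field_simps)
  then show "y * Im (green y 0) = (\<Sum>j. (-1) ^ j * moment (2 * j) 0 / y ^ (2 * j))" "Re (green y 0) = 0"
    using re im y by (simp_all add: Re_divide_of_real Im_divide_of_real)
qed

end

end

section \<open>A cyclic matrix model\<close>

lemma sum_periodic_shift:
  fixes f :: "int \<Rightarrow> 'b :: comm_monoid_add"
  assumes "0 < n" "\<And>i. f (i mod int n) = f i"
  shows "(\<Sum>i\<in>{0..<int n}. f (i + k)) = (\<Sum>i\<in>{0..<int n}. f i)"
proof (rule sum.reindex_bij_witness[where i = "\<lambda>i. (i - k) mod int n" and j = "\<lambda>i. (i + k) mod int n"])
  fix a assume "a \<in> {0..<int n}"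
  then show "((a + k) mod int n - k) mod int n = a" "((a - k) mod int n + k) mod int n = a" by (auto simp: mod_simps)
qed (use assms in auto)

text \<open>Rows and columns are numbered from 0 and noise sites from 1, hence the shifts by one.\<close>

definition wigner :: "nat \<Rightarrow> (int \<times> int \<Rightarrow> real) \<Rightarrow> int \<Rightarrow> int \<Rightarrow> real" where
  "wigner n x p q = (if p mod int n = q mod int n then 0
     else x (min (p mod int n) (q mod int n) + 1, max (p mod int n) (q mod int n) + 1))"

lemma wigner_sym: "wigner n x p q = wigner n x q p"
  by (simp add: wigner_def min.commute max.commute)

lemma wigner_periodic [simp]: "wigner n x (p mod int n) q = wigner n x p q" "wigner n x p (q mod int n) = wigner n x p q"
  by (simp_all add: wigner_def)

lemma wigner_periodic_diff [simp]:
  "wigner n x (p mod int n - k) q = wigner n x (p - k) q" "wigner n x p (q mod int n - k) = wigner n x p (q - k)"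
  by (simp_all only: wigner_def mod_diff_left_eq)

definition cyclic_matrix :: "nat \<Rightarrow> (int \<times> int) set \<Rightarrow> (int \<Rightarrow> int \<Rightarrow> real) \<Rightarrow> (int \<times> int \<Rightarrow> real) \<Rightarrow> int \<Rightarrow> int \<Rightarrow> real" where
  "cyclic_matrix n F c x i j = (\<Sum>(k, l)\<in>F. c k l * wigner n x (i - k) (j - l))"

locale cyclic_model =
  fixes n :: nat and F :: "(int \<times> int) set" and c :: "int \<Rightarrow> int \<Rightarrow> real" and y :: real
  assumes n: "0 < n" and F: "finite F" and F_swap: "\<And>k l. (k, l) \<in> F \<Longrightarrow> (l, k) \<in> F"
    and c_sym: "\<And>k l. c k l = c l k" and y: "0 < y"
begin

abbreviation I :: "int set" where "I \<equiv> {0..<int n}"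
definition h :: real where "h = 1 / sqrt (real n)"
definition C :: real where "C = (\<Sum>(k, l)\<in>F. \<bar>c k l\<bar>)"
definition H :: "(int \<times> int \<Rightarrow> real) \<Rightarrow> int \<Rightarrow> int \<Rightarrow> real" where "H x i j = h * cyclic_matrix n F c x i j"
definition G :: "(int \<times> int \<Rightarrow> real) \<Rightarrow> int \<Rightarrow> int \<Rightarrow> complex" where "G x = resolvent n (H x) y"

text \<open>The derivative of the matrix in the entry at \<open>(p, q)\<close>, as a bilinear form.\<close>

definition D :: "int \<Rightarrow> int \<Rightarrow> (int \<Rightarrow> complex) \<Rightarrow> (int \<Rightarrow> complex) \<Rightarrow> complex" where
  "D p q L M = (\<Sum>(k, l)\<in>F. of_real (c k l) * (L (p + k) * M (q + l) + L (q + k) * M (p + l)))"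

lemma h_pos: "0 < h" and h_le_1: "h \<le> 1" and h_sq: "h\<^sup>2 = 1 / real n"
  using n by (auto simp: h_def power_divide)

lemma C_nonneg: "0 \<le> C"
  unfolding C_def by (intro sum_nonneg) auto

lemma sum_F_swap: "(\<Sum>(k, l)\<in>F. f k l) = (\<Sum>(k, l)\<in>F. f l k)"
  by (rule sum.reindex_bij_witness[of _ "\<lambda>(k, l). (l, k)" "\<lambda>(k, l). (l, k)"]) (auto intro: F_swap)

lemma cyclic_matrix_sym: "cyclic_matrix n F c x i j = cyclic_matrix n F c x j i"
proof -
  have "c l k * wigner n x (i - l) (j - k) = c k l * wigner n x (j - k) (i - l)" for k l
    by (subst c_sym, subst wigner_sym, rule refl)
  then show ?thesis unfolding cyclic_matrix_def by (subst sum_F_swap) simp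
qed

lemma H_sym: "sym_on n (H x)"
  unfolding sym_on_def H_def using cyclic_matrix_sym by metis

lemma G_periodic [simp]: "G x (i mod int n) j = G x i j" "G x i (j mod int n) = G x i j"
  by (simp_all add: G_def)

lemma G_sym: "G x i j = G x j i"
  unfolding G_def by (rule resolvent_sym[OF H_sym y n])

lemma G_bound: "cmod (G x i j) \<le> 1 / y"
  unfolding G_def by (rule resolvent_entry_bound[OF H_sym y n])

lemma G_row: "(\<Sum>j\<in>I. (cmod (G x i (j + k)))\<^sup>2) \<le> 1 / y\<^sup>2"
  using resolvent_row_bound[OF H_sym y n, of x i] sum_periodic_shift[OF n, of "\<lambda>j. (cmod (G x i j))\<^sup>2" k]
  by (simp add: G_def)

lemma G_col: "(\<Sum>i\<in>I. (cmod (G x (i + k) j))\<^sup>2) \<le> 1 / y\<^sup>2"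
  using G_row[of x j k] by (simp add: G_sym[of x j])

text \<open>Cauchy-Schwarz for two columns: the sum over all \<open>n\<close> indices stays of order
  one, which saves a factor \<open>n\<close> over the entrywise bound.\<close>

lemma G_col_col: "cmod (\<Sum>i\<in>I. G x (i + k) a * G x' (i + l) b) \<le> 1 / y\<^sup>2"
proof -
  have "(cmod (\<Sum>i\<in>I. G x (i + k) a * G x' (i + l) b))\<^sup>2 \<le> (1 / y\<^sup>2) * (1 / y\<^sup>2)"
    by (rule order_trans[OF sum_Cauchy_Schwarz]) (intro mult_mono G_col sum_nonneg, auto)
  also have "\<dots> = (1 / y\<^sup>2)\<^sup>2" by (simp add: power2_eq_square)
  finally show ?thesis using y by (simp add: power2_le_iff_abs_le)
qed

lemma D_sym: "D p q L M = D q p L M"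
  unfolding D_def by (rule sum.cong) auto

lemma D_bound:
  assumes L: "\<And>i. cmod (L i) \<le> b" and M: "\<And>i. cmod (M i) \<le> b'"
  shows "cmod (D p q L M) \<le> 2 * C * b * b'"
proof -
  have b: "0 \<le> b" using L[of 0] norm_ge_zero order_trans by blast
  have "cmod (D p q L M) \<le> (\<Sum>(k, l)\<in>F. \<bar>c k l\<bar> * (2 * b * b'))"
    unfolding D_def
  proof (rule sum_norm_le)
    fix z assume "z \<in> F"
    obtain k l where z: "z = (k, l)" by (cases z)
    have 1: "cmod (L i * M j) \<le> b * b'" for i j unfolding norm_mult by (intro mult_mono L M b) auto
    have "cmod (L (p + k) * M (q + l) + L (q + k) * M (p + l)) \<le> b * b' + b * b'"
      by (rule order_trans[OF norm_triangle_ineq]) (intro add_mono 1)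
    then show "cmod (case z of (k, l) \<Rightarrow> of_real (c k l) * (L (p + k) * M (q + l) + L (q + k) * M (p + l)))
        \<le> (case z of (k, l) \<Rightarrow> \<bar>c k l\<bar> * (2 * b * b'))"
      by (simp add: z norm_mult mult_left_mono)
  qed
  also have "\<dots> = 2 * C * b * b'" by (simp add: C_def sum_distrib_right[symmetric] case_prod_unfold)
  finally show ?thesis .
qed

lemma D_diff: "D p q L M - D p q L' M' = D p q (\<lambda>i. L i - L' i) M + D p q L' (\<lambda>i. M i - M' i)"
  unfolding D_def sum_subtractf[symmetric] sum.distrib[symmetric] by (rule sum.cong) (auto simp: algebra_simps)

text \<open>The noise array is symmetric with zero diagonal, so one noise variable sits at exactly
  the two positions \<open>(p, q)\<close> and \<open>(q, p)\<close>. The filter copies these along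
  \<open>F\<close>, and periodicity of \<open>L\<close> and \<open>M\<close> absorbs the
  wrap-around.\<close>

lemma H_update:
  assumes pq: "0 \<le> p" "p < q" "q < int n"
    and L: "\<And>i. L (i mod int n) = L i" and M: "\<And>i. M (i mod int n) = M i"
  shows "(\<Sum>b\<in>I. \<Sum>c'\<in>I. L b * of_real (H x b c' - H (x((p + 1, q + 1) := t)) b c') * M c') =
    of_real (h * (x (p + 1, q + 1) - t)) * D p q L M"
proof -
  let ?x' = "x((p + 1, q + 1) := t)" and ?\<xi> = "x (p + 1, q + 1) - t"
  define e :: "int \<Rightarrow> int \<Rightarrow> real" where "e i j = (if i mod int n = p \<and> j mod int n = q then 1 else 0) + (if i mod int n = q \<and> j mod int n = p then 1 else 0)" for i j
  have W: "wigner n x i j - wigner n ?x' i j = ?\<xi> * e i j" for i j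
    using pq by (auto simp: wigner_def e_def min_def max_def)
  have Hd: "H x b c' - H ?x' b c' = h * ?\<xi> * (\<Sum>(k, l)\<in>F. c k l * e (b - k) (c' - l))" for b c'
  proof -
    have "H x b c' - H ?x' b c' = h * (\<Sum>(k, l)\<in>F. c k l * (wigner n x (b - k) (c' - l) - wigner n ?x' (b - k) (c' - l)))"
      by (simp only: H_def cyclic_matrix_def right_diff_distrib sum_subtractf case_prod_unfold)
    then show ?thesis unfolding W by (simp add: sum_distrib_left case_prod_unfold mult_ac)
  qed
  have inner: "(\<Sum>b\<in>I. \<Sum>c'\<in>I. L b * of_real (e (b - k) (c' - l)) * M c') = L (p + k) * M (q + l) + L (q + k) * M (p + l)" for k l
  proof -
    have ee: "e (i mod int n - k) j = e (i - k) j" "e i (j mod int n - l) = e i (j - l)" for i j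
      by (simp_all add: e_def mod_simps)
    have "(\<Sum>b\<in>I. \<Sum>c'\<in>I. L b * of_real (e (b - k) (c' - l)) * M c') = (\<Sum>b\<in>I. \<Sum>c'\<in>I. L b * of_real (e (b - k) (c' + l - l)) * M (c' + l))"
      by (rule sum.cong[OF refl], rule sum_periodic_shift[OF n, symmetric]) (simp add: ee M)
    also have "\<dots> = (\<Sum>b\<in>I. \<Sum>c'\<in>I. L (b + k) * of_real (e (b + k - k) (c' + l - l)) * M (c' + l))"
      by (rule sum_periodic_shift[OF n, symmetric]) (simp add: ee L)
    also have "\<dots> = (\<Sum>b\<in>I. \<Sum>c'\<in>I. (if b = p then (if c' = q then L (b + k) * M (c' + l) else 0) else 0) + (if b = q then (if c' = p then L (b + k) * M (c' + l) else 0) else 0))"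
      by (intro sum.cong refl) (auto simp: e_def)
    also have "\<dots> = L (p + k) * M (q + l) + L (q + k) * M (p + l)"
    proof -
      have one: "(\<Sum>b\<in>I. \<Sum>c'\<in>I. (if b = p' then (if c' = q' then L (b + k) * M (c' + l) else 0) else 0)) = L (p' + k) * M (q' + l)"
        if "p' \<in> I" "q' \<in> I" for p' q'
      proof -
        have "(\<Sum>b\<in>I. \<Sum>c'\<in>I. (if b = p' then (if c' = q' then L (b + k) * M (c' + l) else 0) else 0)) =
            (\<Sum>b\<in>I. if b = p' then (\<Sum>c'\<in>I. if c' = q' then L (b + k) * M (c' + l) else 0) else 0)"
          by (rule sum.cong) auto
        then show ?thesis using that by simp
      qed
      show ?thesis using pq by (simp add: sum.distrib one)
    qed
    finally show ?thesis .
  qed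
  have "(\<Sum>b\<in>I. \<Sum>c'\<in>I. L b * of_real (H x b c' - H ?x' b c') * M c') =
     (\<Sum>b\<in>I. \<Sum>c'\<in>I. \<Sum>z\<in>F. of_real (h * ?\<xi>) * (of_real (c (fst z) (snd z)) * (L b * of_real (e (b - fst z) (c' - snd z)) * M c')))"
    unfolding Hd by (intro sum.cong refl) (simp add: sum_distrib_left sum_distrib_right case_prod_unfold mult_ac)
  also have "\<dots> = (\<Sum>b\<in>I. \<Sum>z\<in>F. \<Sum>c'\<in>I. of_real (h * ?\<xi>) * (of_real (c (fst z) (snd z)) * (L b * of_real (e (b - fst z) (c' - snd z)) * M c')))"
    by (rule sum.cong[OF refl], rule sum.swap)
  also have "\<dots> = (\<Sum>z\<in>F. \<Sum>b\<in>I. \<Sum>c'\<in>I. of_real (h * ?\<xi>) * (of_real (c (fst z) (snd z)) * (L b * of_real (e (b - fst z) (c' - snd z)) * M c')))"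
    by (rule sum.swap)
  also have "\<dots> = (\<Sum>z\<in>F. of_real (h * ?\<xi>) * (of_real (c (fst z) (snd z)) * (L (p + fst z) * M (q + snd z) + L (q + fst z) * M (p + snd z))))"
    by (rule sum.cong[OF refl]) (simp only: sum_distrib_left[symmetric] inner)
  also have "\<dots> = of_real (h * ?\<xi>) * D p q L M"
    unfolding D_def sum_distrib_left by (rule sum.cong) auto
  finally show ?thesis .
qed

section \<open>Effect of one noise variable on the resolvent\<close>

context
  fixes p q :: int and x x\<^sub>0 :: "int \<times> int \<Rightarrow> real" and \<xi> :: real
  assumes pq: "0 \<le> p" "p < q" "q < int n"
  defines "x\<^sub>0 \<equiv> x((p + 1, q + 1) := 0)" and "\<xi> \<equiv> x (p + 1, q + 1)"
begin

lemma G_update: "G x a j - G x\<^sub>0 a j = - of_real (h * \<xi>) * D p q (G x a) (\<lambda>i. G x\<^sub>0 i j)"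
proof -
  have "G x a j - G x\<^sub>0 a j = - (\<Sum>b\<in>I. \<Sum>c'\<in>I. G x a b * of_real (H x b c' - H x\<^sub>0 b c') * G x\<^sub>0 c' j)"
    unfolding G_def by (rule resolvent_difference[OF H_sym y H_sym n])
  also have "(\<Sum>b\<in>I. \<Sum>c'\<in>I. G x a b * of_real (H x b c' - H x\<^sub>0 b c') * G x\<^sub>0 c' j) = of_real (h * \<xi>) * D p q (G x a) (\<lambda>i. G x\<^sub>0 i j)"
    using H_update[OF pq, of "G x a" "\<lambda>i. G x\<^sub>0 i j" x 0] by (simp add: x\<^sub>0_def \<xi>_def)
  finally show ?thesis by simp
qed

lemma G_update_bound: "cmod (G x a j - G x\<^sub>0 a j) \<le> 2 * C / y\<^sup>2 * (h * \<bar>\<xi>\<bar>)"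
proof -
  have "cmod (D p q (G x a) (\<lambda>i. G x\<^sub>0 i j)) \<le> 2 * C * (1 / y) * (1 / y)" by (intro D_bound G_bound)
  then have "h * \<bar>\<xi>\<bar> * cmod (D p q (G x a) (\<lambda>i. G x\<^sub>0 i j)) \<le> h * \<bar>\<xi>\<bar> * (2 * C * (1 / y) * (1 / y))"
    using h_pos by (intro mult_left_mono) auto
  then show ?thesis unfolding G_update using h_pos by (simp add: norm_mult power2_eq_square mult_ac)
qed

text \<open>Replacing \<open>G x\<close> by \<open>G x\<^sub>0\<close> in the exact formula leaves a
  difference that is bounded both by a constant and by a multiple of
  \<open>h * \<bar>\<xi>\<bar>\<close>. Keeping the minimum leaves the remainder integrable after
  multiplication by a further \<open>\<xi>\<close>, with second moments alone.\<close>

lemma G_expansion: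
  "cmod (G x a j - G x\<^sub>0 a j + of_real (h * \<xi>) * D p q (G x\<^sub>0 a) (\<lambda>i. G x\<^sub>0 i j))
    \<le> 4 * C / y\<^sup>2 * (1 + C / y) * (h * \<bar>\<xi>\<bar> * min 1 (h * \<bar>\<xi>\<bar>))"
proof -
  let ?M = "\<lambda>i. G x\<^sub>0 i j"
  define m where "m = min (2 / y) (2 * C / y\<^sup>2 * (h * \<bar>\<xi>\<bar>))"
  have d: "cmod (G x a i - G x\<^sub>0 a i) \<le> m" for i
    unfolding m_def using G_update_bound[of a i] norm_triangle_ineq4[of "G x a i" "G x\<^sub>0 a i"] G_bound[of x a i] G_bound[of x\<^sub>0 a i]
    by simp
  have "G x a j - G x\<^sub>0 a j + of_real (h * \<xi>) * D p q (G x\<^sub>0 a) ?M = - of_real (h * \<xi>) * (D p q (G x a) ?M - D p q (G x\<^sub>0 a) ?M)"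
    unfolding G_update by (simp add: algebra_simps)
  also have "D p q (G x a) ?M - D p q (G x\<^sub>0 a) ?M = D p q (\<lambda>i. G x a i - G x\<^sub>0 a i) ?M"
    unfolding D_diff by (simp add: D_def)
  also have "cmod (- of_real (h * \<xi>) * \<dots>) \<le> h * \<bar>\<xi>\<bar> * (2 * C * m * (1 / y))"
    unfolding norm_mult norm_minus_cancel norm_of_real abs_mult using h_pos
    by (intro mult_mono D_bound d G_bound) auto
  also have "\<dots> \<le> h * \<bar>\<xi>\<bar> * (2 * C * (2 / y * (1 + C / y) * min 1 (h * \<bar>\<xi>\<bar>)) * (1 / y))"
  proof -
    have h0: "0 \<le> h * \<bar>\<xi>\<bar>" using h_pos by simp
    have c0: "0 \<le> C / y" using C_nonneg y by simp
    \<comment> \<open>\<open>1 + C / y\<close> dominates the coefficients 1 and \<open>C / y\<close>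
      of the two alternatives at once.\<close>
    have "m \<le> 2 / y * (1 + C / y) * min 1 (h * \<bar>\<xi>\<bar>)"
    proof (cases "1 \<le> h * \<bar>\<xi>\<bar>")
      case True
      have "m \<le> 2 / y * 1" by (simp add: m_def)
      also have "\<dots> \<le> 2 / y * (1 + C / y)" using c0 y by (intro mult_left_mono) auto
      finally show ?thesis using True by simp
    next
      case False
      have "m \<le> 2 / y * (C / y) * (h * \<bar>\<xi>\<bar>)" unfolding m_def by (rule min.coboundedI2) (simp add: power2_eq_square)
      also have "\<dots> \<le> 2 / y * (1 + C / y) * (h * \<bar>\<xi>\<bar>)" using c0 y h0 by (intro mult_right_mono mult_left_mono) auto
      finally show ?thesis using False by simp
    qed
    then show ?thesis using h0 C_nonneg y by (intro mult_left_mono mult_right_mono) auto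
  qed
  also have "\<dots> = 4 * C / y\<^sup>2 * (1 + C / y) * (h * \<bar>\<xi>\<bar> * min 1 (h * \<bar>\<xi>\<bar>))" by (simp add: power2_eq_square mult_ac)
  finally show ?thesis .
qed

lemma D_update_bound:
  "cmod (D p q (G x a) (\<lambda>i. G x i j) - D p q (G x\<^sub>0 a) (\<lambda>i. G x\<^sub>0 i j)) \<le> 8 * C\<^sup>2 / y ^ 3 * (h * \<bar>\<xi>\<bar>)"
proof -
  let ?m = "2 * C / y\<^sup>2 * (h * \<bar>\<xi>\<bar>)"
  have "cmod (D p q (G x a) (\<lambda>i. G x i j) - D p q (G x\<^sub>0 a) (\<lambda>i. G x\<^sub>0 i j)) \<le> 2 * C * ?m * (1 / y) + 2 * C * (1 / y) * ?m"
    unfolding D_diff by (rule order_trans[OF norm_triangle_ineq]) (intro add_mono D_bound G_bound G_update_bound)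
  also have "\<dots> = 8 * C\<^sup>2 / y ^ 3 * (h * \<bar>\<xi>\<bar>)" by (simp add: power2_eq_square power3_eq_cube field_simps)
  finally show ?thesis .
qed

end

definition g :: "(int \<times> int \<Rightarrow> real) \<Rightarrow> int \<Rightarrow> complex" where
  "g x k = of_real (h\<^sup>2) * (\<Sum>i\<in>I. G x i (i + k))"

lemma g_bound: "cmod (g x k) \<le> 1 / y"
proof -
  have "cmod (\<Sum>i\<in>I. G x i (i + k)) \<le> (\<Sum>i\<in>I. 1 / y)" by (intro sum_norm_le G_bound)
  also have "\<dots> = n / y" by simp
  finally have "h\<^sup>2 * cmod (\<Sum>i\<in>I. G x i (i + k)) \<le> h\<^sup>2 * (n / y)" by (intro mult_left_mono) auto
  moreover have "cmod (g x k) = h\<^sup>2 * cmod (\<Sum>i\<in>I. G x i (i + k))" unfolding g_def norm_mult norm_of_real by simp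
  ultimately show ?thesis using n by (simp add: h_sq)
qed

lemma g_shift: "of_real (h\<^sup>2) * (\<Sum>i\<in>I. G x (i + a) (i + b)) = g x (b - a)"
proof -
  have "(\<Sum>i\<in>I. G x (i + a) (i + a + (b - a))) = (\<Sum>i\<in>I. G x i (i + (b - a)))"
  proof (rule sum_periodic_shift[OF n])
    fix i
    have "G x (i mod int n) (i mod int n + (b - a)) = G x i ((i mod int n + (b - a)) mod int n)" by simp
    also have "(i mod int n + (b - a)) mod int n = (i + (b - a)) mod int n" by (simp add: mod_simps)
    finally show "G x (i mod int n) (i mod int n + (b - a)) = G x i (i + (b - a))" by simp
  qed
  then show ?thesis by (simp add: g_def)
qed

text \<open>The normalization gives \<open>h\<^sup>2\<close> and the noise entry one more
  \<open>h\<close>; summing the products of two resolvent columns over \<open>i\<close> costs only a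
  constant, by \<open>G_col_col\<close>.\<close>

lemma g_update_bound:
  assumes pq: "0 \<le> p" "p < q" "q < int n"
  shows "cmod (g x k - g (x((p + 1, q + 1) := 0)) k) \<le> 2 * C / y\<^sup>2 * (h ^ 3 * \<bar>x (p + 1, q + 1)\<bar>)"
proof -
  let ?x0 = "x((p + 1, q + 1) := 0)" and ?\<xi> = "x (p + 1, q + 1)"
  have "(\<Sum>i\<in>I. G x i (i + k)) - (\<Sum>i\<in>I. G ?x0 i (i + k)) = - of_real (h * ?\<xi>) * (\<Sum>i\<in>I. D p q (G x i) (\<lambda>j. G ?x0 j (i + k)))"
    unfolding sum_subtractf[symmetric] G_update[OF pq] sum_distrib_left ..
  also have "(\<Sum>i\<in>I. D p q (G x i) (\<lambda>j. G ?x0 j (i + k))) = (\<Sum>(k', l)\<in>F. of_real (c k' l) *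
      ((\<Sum>i\<in>I. G x (i + 0) (p + k') * G ?x0 (i + k) (q + l)) + (\<Sum>i\<in>I. G x (i + 0) (q + k') * G ?x0 (i + k) (p + l))))"
    unfolding D_def by (subst sum.swap)
      (simp add: sum_distrib_left sum.distrib[symmetric] case_prod_unfold G_sym[of ?x0 _ "_ + k"])
  also have "cmod (- of_real (h * ?\<xi>) * \<dots>) \<le> h * \<bar>?\<xi>\<bar> * (2 * C / y\<^sup>2)"
    unfolding norm_mult norm_minus_cancel norm_of_real abs_mult
  proof (intro mult_mono)
    have "cmod (\<Sum>(k', l)\<in>F. of_real (c k' l) *
      ((\<Sum>i\<in>I. G x (i + 0) (p + k') * G ?x0 (i + k) (q + l)) + (\<Sum>i\<in>I. G x (i + 0) (q + k') * G ?x0 (i + k) (p + l)))) \<le> (\<Sum>(k', l)\<in>F. \<bar>c k' l\<bar> * (2 / y\<^sup>2))"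
    proof (rule sum_norm_le)
      fix z assume "z \<in> F"
      obtain k' l where z: "z = (k', l)" by (cases z)
      have "cmod ((\<Sum>i\<in>I. G x (i + 0) (p + k') * G ?x0 (i + k) (q + l)) + (\<Sum>i\<in>I. G x (i + 0) (q + k') * G ?x0 (i + k) (p + l))) \<le> 1 / y\<^sup>2 + 1 / y\<^sup>2"
        by (rule order_trans[OF norm_triangle_ineq]) (intro add_mono G_col_col)
      then show "cmod (case z of (k', l) \<Rightarrow> of_real (c k' l) *
        ((\<Sum>i\<in>I. G x (i + 0) (p + k') * G ?x0 (i + k) (q + l)) + (\<Sum>i\<in>I. G x (i + 0) (q + k') * G ?x0 (i + k) (p + l)))) \<le> (case z of (k', l) \<Rightarrow> \<bar>c k' l\<bar> * (2 / y\<^sup>2))"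
        unfolding z case_prod_conv norm_mult norm_of_real by (intro mult_left_mono) auto
    qed
    also have "\<dots> = C * (2 / y\<^sup>2)" unfolding C_def sum_distrib_right by (simp only: case_prod_unfold)
    also have "\<dots> = 2 * C / y\<^sup>2" by simp
    finally show "cmod (\<Sum>(k', l)\<in>F. of_real (c k' l) *
      ((\<Sum>i\<in>I. G x (i + 0) (p + k') * G ?x0 (i + k) (q + l)) + (\<Sum>i\<in>I. G x (i + 0) (q + k') * G ?x0 (i + k) (p + l)))) \<le> 2 * C / y\<^sup>2" .
  qed (use h_pos in auto)
  finally have "h\<^sup>2 * cmod ((\<Sum>i\<in>I. G x i (i + k)) - (\<Sum>i\<in>I. G ?x0 i (i + k))) \<le> h\<^sup>2 * (h * \<bar>?\<xi>\<bar> * (2 * C / y\<^sup>2))"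
    by (rule mult_left_mono) simp
  moreover have "cmod (g x k - g ?x0 k) = h\<^sup>2 * cmod ((\<Sum>i\<in>I. G x i (i + k)) - (\<Sum>i\<in>I. G ?x0 i (i + k)))"
    unfolding g_def right_diff_distrib[symmetric] norm_mult norm_of_real by simp
  moreover have "h\<^sup>2 * (h * \<bar>?\<xi>\<bar> * (2 * C / y\<^sup>2)) = 2 * C / y\<^sup>2 * (h ^ 3 * \<bar>?\<xi>\<bar>)"
    by (simp add: power2_eq_square power3_eq_cube mult_ac)
  ultimately show ?thesis by linarith
qed

section \<open>The approximate fixed point equation\<close>

text \<open>The quadratic term for the truncated filter, before correlations are formed: with
  \<open>u = a - a'\<close> and \<open>v = b' - b\<close> it becomes a sum of terms
  \<open>R u v * g (- u) * g (k - v)\<close>.\<close>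

definition Q :: "(int \<times> int \<Rightarrow> real) \<Rightarrow> int \<Rightarrow> complex" where
  "Q x k = (\<Sum>(a, b)\<in>F. \<Sum>(a', b')\<in>F. of_real (c a b * c a' b') * (g x (a' - a) * g x (k - (b' - b))))"

text \<open>The delta is taken modulo \<open>n\<close> because the resolvent entries are
  periodic.\<close>

definition Res :: "(int \<times> int \<Rightarrow> real) \<Rightarrow> int \<Rightarrow> complex" where
  "Res x k = \<i> * of_real y * g x k + (if k mod int n = 0 then 1 else 0) + Q x k"

lemma double_sum_bound:
  assumes "\<And>a b a' b'. cmod (f a b a' b') \<le> B"
  shows "cmod (\<Sum>(a, b)\<in>F. \<Sum>(a', b')\<in>F. of_real (c a b * c a' b') * f a b a' b') \<le> C\<^sup>2 * B"
proof -
  have "cmod (\<Sum>(a, b)\<in>F. \<Sum>(a', b')\<in>F. of_real (c a b * c a' b') * f a b a' b') \<le> (\<Sum>(a, b)\<in>F. \<Sum>(a', b')\<in>F. \<bar>c a b\<bar> * \<bar>c a' b'\<bar> * B)"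
    using assms by (intro sum_norm_le, clarsimp, intro sum_norm_le) (auto simp: norm_mult abs_mult intro!: mult_left_mono)
  also have "\<dots> = C\<^sup>2 * B"
    unfolding C_def power2_eq_square unfolding case_prod_unfold unfolding sum_product unfolding sum_distrib_right ..
  finally show ?thesis .
qed

lemma Res_bound: "cmod (Res x k) \<le> 2 + C\<^sup>2 / y\<^sup>2"
proof -
  have "cmod (\<i> * of_real y * g x k) \<le> y * (1 / y)" unfolding norm_mult using y by (simp add: g_bound pos_divide_le_eq[symmetric] mult.commute[of y] pos_le_divide_eq[symmetric])
  then have 1: "cmod (\<i> * of_real y * g x k) \<le> 1" using y by simp
  have "cmod (Q x k) \<le> C\<^sup>2 * (1 / y * (1 / y))"
    unfolding Q_def by (rule double_sum_bound) (auto simp only: norm_mult intro!: mult_mono g_bound norm_ge_zero divide_nonneg_pos zero_le_one y)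
  then have 2: "cmod (Q x k) \<le> C\<^sup>2 / y\<^sup>2" by (simp add: power2_eq_square)
  have "cmod (Res x k) \<le> cmod (\<i> * of_real y * g x k) + cmod (if k mod int n = 0 then 1 else 0 :: complex) + cmod (Q x k)"
    unfolding Res_def by (intro order_trans[OF norm_triangle_ineq] add_mono norm_triangle_ineq order_refl)
  also have "\<dots> \<le> 1 + 1 + C\<^sup>2 / y\<^sup>2" using 1 2 by (intro add_mono) auto
  finally show ?thesis by simp
qed

lemma Res_update_bound:
  assumes pq: "0 \<le> p" "p < q" "q < int n"
  shows "cmod (Res x k - Res (x((p + 1, q + 1) := 0)) k) \<le> (y + 2 * C\<^sup>2 / y) * (2 * C / y\<^sup>2) * (h ^ 3 * \<bar>x (p + 1, q + 1)\<bar>)"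
proof -
  let ?x0 = "x((p + 1, q + 1) := 0)" and ?m = "2 * C / y\<^sup>2 * (h ^ 3 * \<bar>x (p + 1, q + 1)\<bar>)"
  note gd = g_update_bound[OF pq, of x]
  have 1: "cmod (\<i> * of_real y * (g x k - g ?x0 k)) \<le> y * ?m"
    using mult_left_mono[OF gd[of k], of y] y by (simp only: norm_mult norm_ii norm_of_real) simp
  have Qd: "Q x k - Q ?x0 k = (\<Sum>(a, b)\<in>F. \<Sum>(a', b')\<in>F. of_real (c a b * c a' b') *
      ((g x (a' - a) - g ?x0 (a' - a)) * g x (k - (b' - b)) + g ?x0 (a' - a) * (g x (k - (b' - b)) - g ?x0 (k - (b' - b)))))"
    unfolding Q_def by (simp add: sum_subtractf[symmetric] case_prod_unfold) (simp add: algebra_simps)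
  have 2: "cmod (Q x k - Q ?x0 k) \<le> C\<^sup>2 * (?m * (1 / y) + 1 / y * ?m)"
    unfolding Qd
  proof (rule double_sum_bound, rule order_trans[OF norm_triangle_ineq], unfold norm_mult, rule add_mono)
    have m0: "0 \<le> ?m" using gd norm_ge_zero order_trans by blast
    fix a b a' b'
    show "cmod (g x (a' - a) - g ?x0 (a' - a)) * cmod (g x (k - (b' - b))) \<le> ?m * (1 / y)"
      using m0 by (intro mult_mono gd g_bound) auto
    show "cmod (g ?x0 (a' - a)) * cmod (g x (k - (b' - b)) - g ?x0 (k - (b' - b))) \<le> 1 / y * ?m"
      using y by (intro mult_mono gd g_bound) auto
  qed
  have "Res x k - Res ?x0 k = \<i> * of_real y * (g x k - g ?x0 k) + (Q x k - Q ?x0 k)"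
  proof -
    have "(a + d + b) - (a' + d + b') = (a - a') + (b - b')" for a a' d b b' :: complex by simp
    then show ?thesis unfolding Res_def right_diff_distrib .
  qed
  also have "cmod \<dots> \<le> y * ?m + C\<^sup>2 * (?m * (1 / y) + 1 / y * ?m)"
    by (rule order_trans[OF norm_triangle_ineq]) (intro add_mono 1 2)
  also have "\<dots> = (y + 2 * C\<^sup>2 / y) * ?m"
  proof -
    have "y * m + C\<^sup>2 * (m * (1 / y) + 1 / y * m) = (y + 2 * C\<^sup>2 / y) * m" for m by (simp add: algebra_simps)
    then show ?thesis .
  qed
  finally show ?thesis by (simp only: mult.assoc)
qed

text \<open>Row \<open>i\<close> of the resolvent equation at column \<open>i + k\<close> is
  averaged over \<open>i\<close>. Shifting the cyclic indices moves the filter from the noise to the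
  resolvent and leaves bare noise entries.\<close>

lemma g_resolvent_identity:
  "\<i> * of_real y * g x k + (if k mod int n = 0 then 1 else 0) =
    of_real (h ^ 3) * (\<Sum>(a, b)\<in>F. of_real (c a b) * (\<Sum>p\<in>I. \<Sum>q\<in>I. of_real (wigner n x p q) * G x (q + b) (p + a + k)))"
proof -
  have diag: "(\<Sum>b\<in>I. of_real (H x i b) * G x b (i + k)) = \<i> * of_real y * G x i (i + k) + (if k mod int n = 0 then 1 else 0)"
    if i: "i \<in> I" for i
  proof -
    have j: "(i + k) mod int n \<in> I" using n by simp
    have "(\<Sum>b\<in>I. shifted (H x) y i b * G x b ((i + k) mod int n)) = (if i = (i + k) mod int n then 1 else 0)"
      unfolding G_def by (rule resolvent_eq[OF H_sym y i j])
    moreover have "(\<Sum>b\<in>I. shifted (H x) y i b * G x b ((i + k) mod int n)) =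
        (\<Sum>b\<in>I. of_real (H x i b) * G x b (i + k)) - (\<Sum>b\<in>I. if i = b then \<i> * of_real y * G x b (i + k) else 0)"
      unfolding shifted_def sum_subtractf[symmetric] by (intro sum.cong refl) (auto simp: algebra_simps)
    moreover have "(i = (i + k) mod int n) = (k mod int n = 0)"
    proof
      assume "i = (i + k) mod int n"
      then have "i mod int n = (i + k) mod int n" by (metis mod_mod_trivial)
      then have "int n dvd (i + k) - i" by (metis mod_eq_dvd_iff)
      then show "k mod int n = 0" by simp
    next
      assume "k mod int n = 0"
      then have "(i + k) mod int n = i mod int n" by (metis add.right_neutral mod_add_right_eq)
      then show "i = (i + k) mod int n" using i by simp
    qed
    ultimately show ?thesis using i by (simp add: diff_eq_eq)
  qed
  have tr: "(\<Sum>i\<in>I. \<Sum>j\<in>I. of_real (wigner n x (i - a) (j - b)) * G x j (i + k)) =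
      (\<Sum>p\<in>I. \<Sum>q\<in>I. of_real (wigner n x p q) * G x (q + b) (p + a + k))" for a b
  proof -
    have Gp: "G x j (i mod int n + k) = G x j (i + k)" for i j
      using G_periodic(2)[of x j "i mod int n + k"] G_periodic(2)[of x j "i + k"] by (simp add: mod_simps)
    have "(\<Sum>i\<in>I. \<Sum>j\<in>I. of_real (wigner n x (i - a) (j - b)) * G x j (i + k)) =
        (\<Sum>i\<in>I. \<Sum>j\<in>I. of_real (wigner n x (i - a) (j + b - b)) * G x (j + b) (i + k))"
      by (rule sum.cong[OF refl], rule sum_periodic_shift[OF n, symmetric]) simp
    also have "\<dots> = (\<Sum>i\<in>I. \<Sum>j\<in>I. of_real (wigner n x (i + a - a) (j + b - b)) * G x (j + b) (i + a + k))"
      by (rule sum_periodic_shift[OF n, symmetric]) (simp add: Gp)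
    finally show ?thesis by simp
  qed
  have "of_real (h\<^sup>2) * (\<Sum>i\<in>I. \<Sum>b\<in>I. of_real (H x i b) * G x b (i + k)) = \<i> * of_real y * g x k + (if k mod int n = 0 then 1 else 0)"
    using n by (simp add: diag sum.distrib sum_distrib_left[symmetric] g_def algebra_simps h_sq)
  moreover have "(\<Sum>i\<in>I. \<Sum>j\<in>I. of_real (H x i j) * G x j (i + k)) =
      of_real h * (\<Sum>(a, b)\<in>F. of_real (c a b) * (\<Sum>i\<in>I. \<Sum>j\<in>I. of_real (wigner n x (i - a) (j - b)) * G x j (i + k)))"
  proof -
    have "(\<Sum>i\<in>I. \<Sum>j\<in>I. of_real (H x i j) * G x j (i + k)) =
       (\<Sum>i\<in>I. \<Sum>j\<in>I. \<Sum>z\<in>F. of_real h * (of_real (c (fst z) (snd z)) * (of_real (wigner n x (i - fst z) (j - snd z)) * G x j (i + k))))"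
      by (simp add: H_def cyclic_matrix_def sum_distrib_left sum_distrib_right case_prod_unfold mult_ac)
    also have "\<dots> = (\<Sum>i\<in>I. \<Sum>z\<in>F. \<Sum>j\<in>I. of_real h * (of_real (c (fst z) (snd z)) * (of_real (wigner n x (i - fst z) (j - snd z)) * G x j (i + k))))"
      by (rule sum.cong[OF refl], rule sum.swap)
    also have "\<dots> = (\<Sum>z\<in>F. \<Sum>i\<in>I. \<Sum>j\<in>I. of_real h * (of_real (c (fst z) (snd z)) * (of_real (wigner n x (i - fst z) (j - snd z)) * G x j (i + k))))"
      by (rule sum.swap)
    finally show ?thesis by (simp only: sum_distrib_left case_prod_unfold)
  qed
  ultimately show ?thesis unfolding tr by (simp add: power3_eq_cube power2_eq_square mult_ac)
qed

text \<open>\<open>D\<close> has two terms. In one, each resolvent factor involves only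
  \<open>p\<close> or only \<open>q\<close>; it factorizes into two averages and forms
  \<open>Q\<close>, after a swap that uses the symmetry of \<open>c\<close>. In the other, both
  factors couple \<open>p\<close> with \<open>q\<close>, and \<open>G_col_col\<close> leaves a sum
  of order \<open>n\<close> instead of \<open>n\<^sup>2\<close>.\<close>

lemma Q_identity:
  "cmod (of_real (h ^ 4) * (\<Sum>(a, b)\<in>F. of_real (c a b) * (\<Sum>p\<in>I. \<Sum>q\<in>I. D p q (G x (q + b)) (\<lambda>i. G x i (p + a + k)))) - Q x k) \<le> C\<^sup>2 * (h\<^sup>2 / y\<^sup>2)"
proof -
  define e where "e a b a' b' = (\<Sum>p\<in>I. \<Sum>q\<in>I. G x (q + b) (p + a') * G x (q + b') (p + a + k))" for a b a' b'
  have main: "of_real (h ^ 4) * (\<Sum>p\<in>I. \<Sum>q\<in>I. D p q (G x (q + b)) (\<lambda>i. G x i (p + a + k))) =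
      (\<Sum>(a', b')\<in>F. of_real (c a' b') * (of_real (h ^ 4) * e a b a' b' + g x (a' - b) * g x (k - (b' - a))))" for a b
  proof -
    have "(\<Sum>p\<in>I. \<Sum>q\<in>I. D p q (G x (q + b)) (\<lambda>i. G x i (p + a + k))) =
      (\<Sum>p\<in>I. \<Sum>q\<in>I. \<Sum>z\<in>F. of_real (c (fst z) (snd z)) * (G x (q + b) (p + fst z) * G x (q + snd z) (p + a + k) + G x (p + snd z) (p + a + k) * G x (q + b) (q + fst z)))"
      by (simp add: D_def case_prod_unfold mult_ac)
    also have "\<dots> = (\<Sum>p\<in>I. \<Sum>z\<in>F. \<Sum>q\<in>I. of_real (c (fst z) (snd z)) * (G x (q + b) (p + fst z) * G x (q + snd z) (p + a + k) + G x (p + snd z) (p + a + k) * G x (q + b) (q + fst z)))"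
      by (rule sum.cong[OF refl], rule sum.swap)
    also have "\<dots> = (\<Sum>z\<in>F. \<Sum>p\<in>I. \<Sum>q\<in>I. of_real (c (fst z) (snd z)) * (G x (q + b) (p + fst z) * G x (q + snd z) (p + a + k) + G x (p + snd z) (p + a + k) * G x (q + b) (q + fst z)))"
      by (rule sum.swap)
    also have "\<dots> = (\<Sum>z\<in>F. of_real (c (fst z) (snd z)) * (e a b (fst z) (snd z) + (\<Sum>p\<in>I. G x (p + snd z) (p + (a + k))) * (\<Sum>q\<in>I. G x (q + b) (q + fst z))))"
      by (simp only: sum_distrib_left[symmetric] sum.distrib e_def sum_product add.assoc)
    finally have "of_real (h ^ 4) * (\<Sum>p\<in>I. \<Sum>q\<in>I. D p q (G x (q + b)) (\<lambda>i. G x i (p + a + k))) =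
      (\<Sum>z\<in>F. of_real (c (fst z) (snd z)) * (of_real (h ^ 4) * e a b (fst z) (snd z) +
        (of_real (h\<^sup>2) * (\<Sum>p\<in>I. G x (p + snd z) (p + (a + k)))) * (of_real (h\<^sup>2) * (\<Sum>q\<in>I. G x (q + b) (q + fst z)))))"
      by (simp add: sum_distrib_left algebra_simps power4_eq_xxxx power2_eq_square)
    then show ?thesis unfolding g_shift by (simp add: case_prod_unfold algebra_simps)
  qed
  have "Q x k = (\<Sum>(a, b)\<in>F. \<Sum>(a', b')\<in>F. of_real (c a b * c a' b') * (g x (a' - b) * g x (k - (b' - a))))"
    unfolding Q_def by (subst sum_F_swap) (simp add: c_sym[of _ _] case_prod_unfold)
  moreover have "of_real (h ^ 4) * (\<Sum>(a, b)\<in>F. of_real (c a b) * (\<Sum>p\<in>I. \<Sum>q\<in>I. D p q (G x (q + b)) (\<lambda>i. G x i (p + a + k)))) =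
      (\<Sum>(a, b)\<in>F. of_real (c a b) * (\<Sum>(a', b')\<in>F. of_real (c a' b') * (of_real (h ^ 4) * e a b a' b' + g x (a' - b) * g x (k - (b' - a)))))"
    unfolding main[symmetric] by (simp add: sum_distrib_left case_prod_unfold mult_ac)
  ultimately have "of_real (h ^ 4) * (\<Sum>(a, b)\<in>F. of_real (c a b) * (\<Sum>p\<in>I. \<Sum>q\<in>I. D p q (G x (q + b)) (\<lambda>i. G x i (p + a + k)))) - Q x k =
      (\<Sum>(a, b)\<in>F. \<Sum>(a', b')\<in>F. of_real (c a b * c a' b') * (of_real (h ^ 4) * e a b a' b'))"
    by (simp add: sum_subtractf[symmetric] sum_distrib_left case_prod_unfold algebra_simps)
  also have "cmod \<dots> \<le> C\<^sup>2 * (h\<^sup>2 / y\<^sup>2)"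
  proof (rule double_sum_bound)
    fix a b a' b'
    have "cmod (e a b a' b') \<le> (\<Sum>p\<in>I. 1 / y\<^sup>2)"
      unfolding e_def by (intro sum_norm_le G_col_col)
    also have "\<dots> = n / y\<^sup>2" by simp
    finally have "h ^ 4 * cmod (e a b a' b') \<le> h ^ 4 * (n / y\<^sup>2)" by (intro mult_left_mono) auto
    moreover have "h ^ 4 * (n / y\<^sup>2) = h\<^sup>2 / y\<^sup>2" using n h_sq by (simp add: power4_eq_xxxx power2_eq_square)
    moreover have "cmod (of_real (h ^ 4) * e a b a' b') = h ^ 4 * cmod (e a b a' b')" unfolding norm_mult norm_of_real by simp
    ultimately show "cmod (of_real (h ^ 4) * e a b a' b') \<le> h\<^sup>2 / y\<^sup>2" by linarith
  qed
  finally show ?thesis .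
qed

end

section \<open>Continuity and measurability of resolvents\<close>

lemma resolvent_tendsto:
  assumes H: "\<And>t. sym_on n (H t)" and H': "sym_on n H'" and y: "0 < y" and n: "0 < n"
    and lim: "\<And>b c. ((\<lambda>t. H t b c) \<longlongrightarrow> H' b c) \<F>"
  shows "((\<lambda>t. resolvent n (H t) y a j) \<longlongrightarrow> resolvent n H' y a j) \<F>"
proof -
  have "((\<lambda>t. (\<Sum>b\<in>{0..<int n}. \<Sum>c\<in>{0..<int n}. \<bar>H t b c - H' b c\<bar>) / y\<^sup>2) \<longlongrightarrow> (\<Sum>b\<in>{0..<int n}. \<Sum>c\<in>{0..<int n}. \<bar>H' b c - H' b c\<bar>) / y\<^sup>2) \<F>"
    using y by (intro tendsto_intros lim) auto
  then have "((\<lambda>t. (\<Sum>b\<in>{0..<int n}. \<Sum>c\<in>{0..<int n}. \<bar>H t b c - H' b c\<bar>) / y\<^sup>2) \<longlongrightarrow> 0) \<F>" by simp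
  then have "((\<lambda>t. resolvent n (H t) y a j - resolvent n H' y a j) \<longlongrightarrow> 0) \<F>"
    by (rule Lim_null_comparison[rotated]) (use resolvent_entry_difference[OF H y H' n] in simp)
  then show ?thesis by (simp add: LIM_zero_iff)
qed

lemma resolvent_continuous:
  fixes H :: "('i :: countable \<Rightarrow> real) \<Rightarrow> int \<Rightarrow> int \<Rightarrow> real"
  assumes H: "\<And>x. sym_on n (H x)" and y: "0 < y" and n: "0 < n"
    and cont: "\<And>b c. continuous_on UNIV (\<lambda>x. H x b c)"
  shows "continuous_on UNIV (\<lambda>x. resolvent n (H x) y a j)"
  unfolding continuous_on_def
proof
  fix x :: "'i \<Rightarrow> real" assume "x \<in> UNIV"
  show "((\<lambda>x. resolvent n (H x) y a j) \<longlongrightarrow> resolvent n (H x) y a j) (at x within UNIV)"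
    by (rule resolvent_tendsto[OF H H y n]) (use cont in \<open>auto simp: continuous_on_def\<close>)
qed

section \<open>Integration by parts for independent noise\<close>

locale noise = prob_space M for M :: "'a measure" +
  fixes X :: "int \<times> int \<Rightarrow> 'a \<Rightarrow> real"
  assumes indep: "indep_vars (\<lambda>_. borel) X UNIV"
    and X_int: "\<And>s. integrable M (X s)" and X_mean: "\<And>s. expectation (X s) = 0"
    and X_sq_int: "\<And>s. integrable M (\<lambda>\<omega>. (X s \<omega>)\<^sup>2)" and X_var: "\<And>s. expectation (\<lambda>\<omega>. (X s \<omega>)\<^sup>2) = 1"
begin

text \<open>The noise as one random point of the product space: deleting a variable becomes a
  function update, and resolvent entries become Borel functions of the point.\<close>

definition pt :: "'a \<Rightarrow> int \<times> int \<Rightarrow> real" where "pt \<omega> s = X s \<omega>"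

lemma X_meas [measurable]: "X s \<in> borel_measurable M"
  using X_int by (rule borel_measurable_integrable)

lemma pt_meas: "pt \<in> M \<rightarrow>\<^sub>M borel"
  by (rule measurable_coordinatewise_then_product) (simp add: pt_def)

lemma pt_zero_meas: "(\<lambda>\<omega>. (pt \<omega>)(s := 0)) \<in> M \<rightarrow>\<^sub>M borel"
proof (rule measurable_coordinatewise_then_product)
  show "(\<lambda>\<omega>. ((pt \<omega>)(s := 0)) t) \<in> borel_measurable M" for t
    by (cases "t = s") (simp_all add: pt_def)
qed

lemma integrable_bounded_mult:
  fixes g :: "'a \<Rightarrow> complex"
  assumes f: "integrable M (f :: 'a \<Rightarrow> real)" and g: "g \<in> borel_measurable M" and b: "\<And>\<omega>. cmod (g \<omega>) \<le> B"
  shows "integrable M (\<lambda>\<omega>. of_real (f \<omega>) * g \<omega>)"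
proof (rule Bochner_Integration.integrable_bound[where f = "\<lambda>\<omega>. B * f \<omega>"])
  have "0 \<le> B" using b norm_ge_zero order_trans by blast
  then show "AE \<omega> in M. norm (of_real (f \<omega>) * g \<omega>) \<le> norm (B * f \<omega>)"
    using b by (intro AE_I2) (auto simp: norm_mult abs_mult mult.commute[of B] intro!: mult_left_mono)
qed (use f g in auto)

lemma integrable_bounded:
  fixes g :: "'a \<Rightarrow> complex"
  assumes "g \<in> borel_measurable M" "\<And>\<omega>. cmod (g \<omega>) \<le> B"
  shows "integrable M g"
  using assms by (intro integrable_const_bound[of _ B]) auto

text \<open>The updated point reads only the coordinates other than \<open>s\<close>, so it is
  independent of \<open>X s\<close>.\<close>

lemma expectation_independent:
  fixes f :: "(int \<times> int \<Rightarrow> real) \<Rightarrow> complex" and \<phi> :: "real \<Rightarrow> real"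
  assumes f: "f \<in> borel_measurable borel" and b: "\<And>x. cmod (f x) \<le> B"
    and \<phi>: "\<phi> \<in> borel_measurable borel" and i: "integrable M (\<lambda>\<omega>. \<phi> (X s \<omega>))"
  shows "(\<integral>\<omega>. of_real (\<phi> (X s \<omega>)) * f ((pt \<omega>)(s := 0)) \<partial>M) = of_real (expectation (\<lambda>\<omega>. \<phi> (X s \<omega>))) * (\<integral>\<omega>. f ((pt \<omega>)(s := 0)) \<partial>M)"
proof -
  let ?A = "{s}" and ?B = "UNIV - {s}"
  have ind: "indep_var (PiM ?A (\<lambda>_. borel)) (\<lambda>\<omega>. restrict (\<lambda>i. X i \<omega>) ?A) (PiM ?B (\<lambda>_. borel)) (\<lambda>\<omega>. restrict (\<lambda>i. X i \<omega>) ?B)"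
    by (rule indep_var_restrict[OF indep]) auto
  define Y1 where "Y1 r = complex_of_real (\<phi> (r s))" for r :: "int \<times> int \<Rightarrow> real"
  define Y2 where "Y2 r = f (\<lambda>t. if t = s then 0 else r t)" for r :: "int \<times> int \<Rightarrow> real"
  have m1: "Y1 \<in> PiM ?A (\<lambda>_. borel) \<rightarrow>\<^sub>M borel"
  proof -
    have "(\<lambda>r. \<phi> (r s)) \<in> PiM ?A (\<lambda>_. borel) \<rightarrow>\<^sub>M borel"
      by (rule measurable_compose[OF measurable_component_singleton[of s ?A "\<lambda>_. borel"] \<phi>]) auto
    from measurable_compose[OF this borel_measurable_of_real] show ?thesis unfolding Y1_def .
  qed
  have m2: "Y2 \<in> PiM ?B (\<lambda>_. borel) \<rightarrow>\<^sub>M borel"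
    unfolding Y2_def
  proof (rule measurable_compose[OF _ f], rule measurable_coordinatewise_then_product)
    fix t
    show "(\<lambda>r. if t = s then 0 else r t) \<in> PiM ?B (\<lambda>_. borel) \<rightarrow>\<^sub>M (borel :: real measure)"
      by (cases "t = s") (auto intro: measurable_component_singleton)
  qed
  have iv: "indep_var borel (Y1 \<circ> (\<lambda>\<omega>. restrict (\<lambda>i. X i \<omega>) ?A)) borel (Y2 \<circ> (\<lambda>\<omega>. restrict (\<lambda>i. X i \<omega>) ?B))"
    by (rule indep_var_compose[OF ind m1 m2])
  have e1: "Y1 \<circ> (\<lambda>\<omega>. restrict (\<lambda>i. X i \<omega>) ?A) = (\<lambda>\<omega>. of_real (\<phi> (X s \<omega>)))" by (auto simp: Y1_def)
  have e2: "Y2 \<circ> (\<lambda>\<omega>. restrict (\<lambda>i. X i \<omega>) ?B) = (\<lambda>\<omega>. f ((pt \<omega>)(s := 0)))"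
    by (auto simp: Y2_def pt_def fun_eq_iff intro!: arg_cong[of _ _ f])
  have i2: "integrable M (\<lambda>\<omega>. f ((pt \<omega>)(s := 0)))"
    by (rule integrable_bounded[OF measurable_compose[OF pt_zero_meas f] b])
  have i1: "integrable M (\<lambda>\<omega>. complex_of_real (\<phi> (X s \<omega>)))" using i by (rule integrable_of_real)
  show ?thesis using indep_var_lebesgue_integral[OF iv[unfolded e1 e2] i1 i2] by simp
qed

lemma X_abs_le: "expectation (\<lambda>\<omega>. \<bar>X s \<omega>\<bar>) \<le> 1"
proof -
  have "expectation (\<lambda>\<omega>. \<bar>X s \<omega>\<bar>) \<le> expectation (\<lambda>\<omega>. (1 + (X s \<omega>)\<^sup>2) / 2)"
  proof (rule integral_mono)
    show "\<bar>X s \<omega>\<bar> \<le> (1 + (X s \<omega>)\<^sup>2) / 2" for \<omega>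
      using zero_le_power2[of "\<bar>X s \<omega>\<bar> - 1"] by (simp add: power2_diff)
  qed (use X_int X_sq_int in auto)
  also have "\<dots> = 1" using X_sq_int[of s] X_var[of s] by (simp add: prob_space)
  finally show ?thesis .
qed

end

locale noisy_model = noise M X + cyclic_model n F c y
  for M :: "'a measure" and X n F c y
begin

lemma wigner_continuous: "continuous_on UNIV (\<lambda>x. wigner n x i j)"
  unfolding wigner_def by (cases "i mod int n = j mod int n") simp_all

lemma H_continuous: "continuous_on UNIV (\<lambda>x. H x b c')"
  unfolding H_def cyclic_matrix_def case_prod_unfold
  by (intro continuous_intros wigner_continuous)

lemma G_meas: "(\<lambda>x. G x a j) \<in> borel_measurable borel"
  unfolding G_def by (intro borel_measurable_continuous_onI resolvent_continuous H_sym y n H_continuous)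

lemma D_meas:
  assumes "\<And>i. (\<lambda>x. L x i) \<in> borel_measurable borel" "\<And>i. (\<lambda>x. L' x i) \<in> borel_measurable borel"
  shows "(\<lambda>x. D p q (L x) (L' x)) \<in> borel_measurable (borel :: (int \<times> int \<Rightarrow> real) measure)"
  unfolding D_def case_prod_unfold by (intro borel_measurable_sum borel_measurable_times borel_measurable_add borel_measurable_const assms)

lemma g_meas: "(\<lambda>x. g x k) \<in> borel_measurable borel"
  unfolding g_def by (intro borel_measurable_sum borel_measurable_times borel_measurable_const G_meas)

lemma Res_meas: "(\<lambda>x. Res x k) \<in> borel_measurable borel"
  unfolding Res_def Q_def case_prod_unfold
  by (intro borel_measurable_sum borel_measurable_times borel_measurable_add borel_measurable_const g_meas)

text \<open>One summand for each of the four pieces of the remainder \<open>T3\<close> in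
  \<open>site_expectation\<close>, in the same order.\<close>

definition site_const :: "real \<Rightarrow> real \<Rightarrow> real" where
  "site_const B B' = B * (4 * C / y\<^sup>2 * (1 + C / y)) + B' / y + 8 * C\<^sup>2 / y ^ 3 * B + 2 * C / y\<^sup>2 * B'"

text \<open>
  Removing the entry \<open>X s\<close> from the matrix makes the leading terms independent of \<open>X s\<close>. The
  remainder is at most of order \<open>min (h \<bar>X s\<bar>) ((h X s)\<^sup>2)\<close>, which is
  what Lindeberg's argument needs.
\<close>

lemma site_expectation:
  assumes pq: "0 \<le> p" "p < q" "q < int n"
    and P: "P \<in> borel_measurable borel" "\<And>x. cmod (P x) \<le> B"
      "\<And>x. cmod (P x - P (x((p + 1, q + 1) := 0))) \<le> B' * (h ^ 3 * \<bar>x (p + 1, q + 1)\<bar>)" and B': "0 \<le> B'"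
  shows "cmod (\<integral>\<omega>. (of_real (X (p + 1, q + 1) \<omega>) * G (pt \<omega>) a j + of_real h * D p q (G (pt \<omega>) a) (\<lambda>i. G (pt \<omega>) i j)) * P (pt \<omega>) \<partial>M)
    \<le> h * site_const B B' * (expectation (\<lambda>\<omega>. (X (p + 1, q + 1) \<omega>)\<^sup>2 * min 1 (h * \<bar>X (p + 1, q + 1) \<omega>\<bar>)) + h)"
proof -
  let ?s = "(p + 1, q + 1)"
  define x0 where "x0 \<omega> = (pt \<omega>)(?s := 0)" for \<omega>
  define \<xi> where "\<xi> \<omega> = X ?s \<omega>" for \<omega>
  define DD where "DD x = D p q (G x a) (\<lambda>i. G x i j)" for x
  define rem where "rem \<omega> = G (pt \<omega>) a j - G (x0 \<omega>) a j + of_real (h * \<xi> \<omega>) * DD (x0 \<omega>)" for \<omega>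
  \<comment> \<open>Mean zero removes \<open>T1\<close>. The first order term of the expansion
    produces \<open>- h \<xi>\<^sup>2 DD\<close>, which together with \<open>h DD\<close> makes up
    \<open>T2\<close> and vanishes because the variance is one. All else is collected in
    \<open>T3\<close>.\<close>
  define T1 where "T1 \<omega> = of_real (\<xi> \<omega>) * (G (x0 \<omega>) a j * P (x0 \<omega>))" for \<omega>
  define T2 where "T2 \<omega> = of_real (1 - (\<xi> \<omega>)\<^sup>2) * (of_real h * DD (x0 \<omega>) * P (x0 \<omega>))" for \<omega>
  define T3 where "T3 \<omega> = of_real (\<xi> \<omega>) * rem \<omega> * P (x0 \<omega>) + of_real (\<xi> \<omega>) * G (pt \<omega>) a j * (P (pt \<omega>) - P (x0 \<omega>))
     + of_real h * ((DD (pt \<omega>) - DD (x0 \<omega>)) * P (pt \<omega>) + DD (x0 \<omega>) * (P (pt \<omega>) - P (x0 \<omega>)))" for \<omega>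
  have B: "0 \<le> B" using P(2) norm_ge_zero order_trans by blast
  have \<xi>pt: "pt \<omega> ?s = \<xi> \<omega>" for \<omega> by (simp add: pt_def \<xi>_def)
  have split: "(of_real (\<xi> \<omega>) * G (pt \<omega>) a j + of_real h * DD (pt \<omega>)) * P (pt \<omega>) = T1 \<omega> + T2 \<omega> + T3 \<omega>" for \<omega>
    unfolding T1_def T2_def T3_def rem_def by (simp add: power2_eq_square algebra_simps)
  have DDm: "DD \<in> borel_measurable borel" unfolding DD_def by (intro D_meas G_meas)
  have DDb: "cmod (DD x) \<le> 2 * C / y\<^sup>2" for x
  proof -
    have "cmod (DD x) \<le> 2 * C * (1 / y) * (1 / y)" unfolding DD_def by (intro D_bound G_bound)
    then show ?thesis by (simp add: power2_eq_square)
  qed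
  have ptm: "(\<lambda>\<omega>. f (pt \<omega>)) \<in> borel_measurable M" "(\<lambda>\<omega>. f (x0 \<omega>)) \<in> borel_measurable M"
    if "f \<in> borel_measurable borel" for f :: "(int \<times> int \<Rightarrow> real) \<Rightarrow> complex"
    unfolding x0_def by (intro measurable_compose[OF pt_meas that] measurable_compose[OF pt_zero_meas that])+
  have GP: "(\<lambda>x. G x a j * P x) \<in> borel_measurable borel" "cmod (G x a j * P x) \<le> 1 / y * B" for x
  proof -
    show "(\<lambda>x. G x a j * P x) \<in> borel_measurable borel" by (intro borel_measurable_times G_meas P)
    show "cmod (G x a j * P x) \<le> 1 / y * B" unfolding norm_mult using y by (intro mult_mono G_bound P) auto
  qed
  have DP: "(\<lambda>x. of_real h * DD x * P x) \<in> borel_measurable borel" "cmod (of_real h * DD x * P x) \<le> h * (2 * C / y\<^sup>2) * B" for x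
  proof -
    show "(\<lambda>x. of_real h * DD x * P x) \<in> borel_measurable borel" by (intro borel_measurable_times borel_measurable_const DDm P)
    show "cmod (of_real h * DD x * P x) \<le> h * (2 * C / y\<^sup>2) * B"
      unfolding norm_mult norm_of_real abs_of_pos[OF h_pos] using h_pos C_nonneg
      by (intro mult_mono mult_left_mono DDb P) auto
  qed
  have i1: "integrable M T1" unfolding T1_def \<xi>_def
    by (rule integrable_bounded_mult[OF X_int ptm(2)[OF GP(1)] GP(2)])
  have isq: "integrable M (\<lambda>\<omega>. 1 - (\<xi> \<omega>)\<^sup>2)" unfolding \<xi>_def using X_sq_int by auto
  have i2: "integrable M T2" unfolding T2_def
    by (rule integrable_bounded_mult[OF isq ptm(2)[OF DP(1)] DP(2)])
  have e1: "(\<integral>\<omega>. T1 \<omega> \<partial>M) = 0"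
    unfolding T1_def \<xi>_def x0_def
    using expectation_independent[of "\<lambda>x. G x a j * P x" "1 / y * B" "\<lambda>t. t" ?s] GP X_int X_mean by simp
  have e2: "(\<integral>\<omega>. T2 \<omega> \<partial>M) = 0"
    unfolding T2_def \<xi>_def x0_def
    using expectation_independent[of "\<lambda>x. of_real h * DD x * P x" "h * (2 * C / y\<^sup>2) * B" "\<lambda>t. 1 - t\<^sup>2" ?s] DP isq X_sq_int X_var
    by (simp add: \<xi>_def prob_space)
  define bd where "bd \<omega> = h * (B * (4 * C / y\<^sup>2 * (1 + C / y))) * ((\<xi> \<omega>)\<^sup>2 * min 1 (h * \<bar>\<xi> \<omega>\<bar>)) + B' / y * h ^ 3 * (\<xi> \<omega>)\<^sup>2
     + h * (8 * C\<^sup>2 / y ^ 3 * B * h + 2 * C / y\<^sup>2 * B' * h ^ 3) * \<bar>\<xi> \<omega>\<bar>" for \<omega>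
  have T3b: "cmod (T3 \<omega>) \<le> bd \<omega>" for \<omega>
  proof -
    note st = G_expansion[OF pq, of "pt \<omega>" a j, folded x0_def DD_def, unfolded \<xi>pt, folded rem_def]
    note du = D_update_bound[OF pq, of "pt \<omega>" a j, folded x0_def DD_def, unfolded \<xi>pt]
    note pd = P(3)[of "pt \<omega>", folded x0_def, unfolded \<xi>pt]
    have 1: "cmod (of_real (\<xi> \<omega>) * rem \<omega> * P (x0 \<omega>)) \<le> \<bar>\<xi> \<omega>\<bar> * (4 * C / y\<^sup>2 * (1 + C / y) * (h * \<bar>\<xi> \<omega>\<bar> * min 1 (h * \<bar>\<xi> \<omega>\<bar>))) * B"
      unfolding norm_mult norm_of_real using C_nonneg y h_pos by (intro mult_mono st P) auto
    have 2: "cmod (of_real (\<xi> \<omega>) * G (pt \<omega>) a j * (P (pt \<omega>) - P (x0 \<omega>))) \<le> \<bar>\<xi> \<omega>\<bar> * (1 / y) * (B' * (h ^ 3 * \<bar>\<xi> \<omega>\<bar>))"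
      unfolding norm_mult norm_of_real using y by (intro mult_mono pd G_bound) auto
    have 3: "cmod ((DD (pt \<omega>) - DD (x0 \<omega>)) * P (pt \<omega>)) \<le> 8 * C\<^sup>2 / y ^ 3 * (h * \<bar>\<xi> \<omega>\<bar>) * B"
      unfolding norm_mult using C_nonneg y h_pos by (intro mult_mono du P) auto
    have 4: "cmod (DD (x0 \<omega>) * (P (pt \<omega>) - P (x0 \<omega>))) \<le> 2 * C / y\<^sup>2 * (B' * (h ^ 3 * \<bar>\<xi> \<omega>\<bar>))"
      unfolding norm_mult using C_nonneg y by (intro mult_mono pd DDb) auto
    have 5: "cmod (of_real h * ((DD (pt \<omega>) - DD (x0 \<omega>)) * P (pt \<omega>) + DD (x0 \<omega>) * (P (pt \<omega>) - P (x0 \<omega>))))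
        \<le> h * (8 * C\<^sup>2 / y ^ 3 * (h * \<bar>\<xi> \<omega>\<bar>) * B + 2 * C / y\<^sup>2 * (B' * (h ^ 3 * \<bar>\<xi> \<omega>\<bar>)))"
      unfolding norm_mult norm_of_real abs_of_pos[OF h_pos] using h_pos
      by (intro mult_left_mono order_trans[OF norm_triangle_ineq] add_mono 3 4) auto
    have "cmod (T3 \<omega>) \<le> \<bar>\<xi> \<omega>\<bar> * (4 * C / y\<^sup>2 * (1 + C / y) * (h * \<bar>\<xi> \<omega>\<bar> * min 1 (h * \<bar>\<xi> \<omega>\<bar>))) * B
       + \<bar>\<xi> \<omega>\<bar> * (1 / y) * (B' * (h ^ 3 * \<bar>\<xi> \<omega>\<bar>)) + h * (8 * C\<^sup>2 / y ^ 3 * (h * \<bar>\<xi> \<omega>\<bar>) * B + 2 * C / y\<^sup>2 * (B' * (h ^ 3 * \<bar>\<xi> \<omega>\<bar>)))"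
      unfolding T3_def by (intro order_trans[OF norm_triangle_ineq] add_mono 1 2 5)
    also have "\<dots> = bd \<omega>"
    proof -
      have sq: "(\<xi> \<omega>)\<^sup>2 = \<bar>\<xi> \<omega>\<bar> * \<bar>\<xi> \<omega>\<bar>" by (simp add: power2_eq_square)
      have "t * (4 * C / y\<^sup>2 * (1 + C / y) * (h * t * m)) * B + t * (1 / y) * (B' * (h ^ 3 * t)) + h * (8 * C\<^sup>2 / y ^ 3 * (h * t) * B + 2 * C / y\<^sup>2 * (B' * (h ^ 3 * t)))
        = h * (B * (4 * C / y\<^sup>2 * (1 + C / y))) * (t * t * m) + B' / y * h ^ 3 * (t * t) + h * (8 * C\<^sup>2 / y ^ 3 * B * h + 2 * C / y\<^sup>2 * B' * h ^ 3) * t" for t m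
        by (simp add: algebra_simps)
      then show ?thesis unfolding bd_def sq .
    qed
    finally show ?thesis .
  qed
  have im: "integrable M (\<lambda>\<omega>. (\<xi> \<omega>)\<^sup>2 * min 1 (h * \<bar>\<xi> \<omega>\<bar>))"
  proof (rule Bochner_Integration.integrable_bound[OF X_sq_int[of ?s]])
    show "(\<lambda>\<omega>. (\<xi> \<omega>)\<^sup>2 * min 1 (h * \<bar>\<xi> \<omega>\<bar>)) \<in> borel_measurable M" unfolding \<xi>_def by measurable
    show "AE \<omega> in M. norm ((\<xi> \<omega>)\<^sup>2 * min 1 (h * \<bar>\<xi> \<omega>\<bar>)) \<le> norm ((X ?s \<omega>)\<^sup>2)"
      using h_pos by (intro AE_I2) (auto simp: \<xi>_def abs_mult intro!: mult_left_le)
  qed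
  have i\<xi>: "integrable M (\<lambda>\<omega>. \<bar>\<xi> \<omega>\<bar>)" "integrable M (\<lambda>\<omega>. (\<xi> \<omega>)\<^sup>2)" unfolding \<xi>_def using X_int X_sq_int by auto
  have ibd: "integrable M bd" unfolding bd_def
    by (intro Bochner_Integration.integrable_add integrable_mult_right im i\<xi>)
  have Xc: "(\<lambda>\<omega>. complex_of_real (X ?s \<omega>)) \<in> borel_measurable M" "(\<lambda>\<omega>. complex_of_real (h * X ?s \<omega>)) \<in> borel_measurable M"
    by measurable
  have T3m: "T3 \<in> borel_measurable M"
    unfolding T3_def rem_def \<xi>_def
    by (intro borel_measurable_add borel_measurable_times borel_measurable_diff borel_measurable_const Xc ptm DDm P(1) G_meas)
  have i3: "integrable M T3"
    by (rule Bochner_Integration.integrable_bound[OF ibd T3m]) (use T3b in \<open>auto intro!: AE_I2 intro: order_trans[OF _ abs_ge_self]\<close>)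
  let ?m = "expectation (\<lambda>\<omega>. (\<xi> \<omega>)\<^sup>2 * min 1 (h * \<bar>\<xi> \<omega>\<bar>))"
  have m0: "0 \<le> ?m" using h_pos by (intro integral_nonneg_AE AE_I2) auto
  have "cmod (\<integral>\<omega>. T3 \<omega> \<partial>M) \<le> expectation bd"
    by (rule order_trans[OF integral_norm_bound]) (intro integral_mono integrable_norm i3 ibd T3b)
  also have "\<dots> = h * (B * (4 * C / y\<^sup>2 * (1 + C / y))) * ?m + B' / y * h ^ 3 * 1
     + h * (8 * C\<^sup>2 / y ^ 3 * B * h + 2 * C / y\<^sup>2 * B' * h ^ 3) * expectation (\<lambda>\<omega>. \<bar>\<xi> \<omega>\<bar>)"
    unfolding bd_def using im i\<xi> X_var[of ?s, folded \<xi>_def] by simp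
  also have "\<dots> \<le> h * (B * (4 * C / y\<^sup>2 * (1 + C / y))) * ?m + B' / y * h ^ 3 * 1
     + h * (8 * C\<^sup>2 / y ^ 3 * B * h + 2 * C / y\<^sup>2 * B' * h ^ 3) * 1"
    using X_abs_le[of ?s, folded \<xi>_def] h_pos B B' C_nonneg y
    by (intro add_left_mono mult_left_mono mult_nonneg_nonneg add_nonneg_nonneg) auto
  also have "\<dots> = h * (B * (4 * C / y\<^sup>2 * (1 + C / y)) * ?m + (B' / y * h + 8 * C\<^sup>2 / y ^ 3 * B + 2 * C / y\<^sup>2 * B' * (h * h)) * h)"
    by (simp add: algebra_simps power3_eq_cube)
  also have "\<dots> \<le> h * (site_const B B' * ?m + site_const B B' * h)"
  proof -
    have p1: "0 \<le> B * (4 * C / y\<^sup>2 * (1 + C / y))" "0 \<le> B' / y" "0 \<le> 8 * C\<^sup>2 / y ^ 3 * B" "0 \<le> 2 * C / y\<^sup>2 * B'"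
      using B B' C_nonneg y by auto
    have "B * (4 * C / y\<^sup>2 * (1 + C / y)) \<le> site_const B B'" unfolding site_const_def using p1 by linarith
    moreover have "B' / y * h + 8 * C\<^sup>2 / y ^ 3 * B + 2 * C / y\<^sup>2 * B' * (h * h) \<le> site_const B B'"
    proof -
      have "B' / y * h \<le> B' / y" using p1(2) h_le_1 h_pos by (intro mult_left_le) auto
      moreover have "2 * C / y\<^sup>2 * B' * (h * h) \<le> 2 * C / y\<^sup>2 * B'"
        using p1(4) h_le_1 h_pos by (intro mult_left_le mult_le_one) auto
      ultimately show ?thesis unfolding site_const_def using p1(1) by linarith
    qed
    ultimately show ?thesis using h_pos m0 by (intro mult_left_mono add_mono mult_right_mono) auto
  qed
  also have "\<dots> = h * site_const B B' * (?m + h)" by (simp add: algebra_simps)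
  finally have fin: "cmod (\<integral>\<omega>. T3 \<omega> \<partial>M) \<le> h * site_const B B' * (?m + h)" .
  have "(\<integral>\<omega>. (of_real (\<xi> \<omega>) * G (pt \<omega>) a j + of_real h * DD (pt \<omega>)) * P (pt \<omega>) \<partial>M) = (\<integral>\<omega>. T3 \<omega> \<partial>M)"
    unfolding split using i1 i2 i3 e1 e2 by simp
  then show ?thesis using fin unfolding \<xi>_def DD_def by simp
qed

definition lindeberg :: "int \<Rightarrow> int \<Rightarrow> real" where
  "lindeberg p q = expectation (\<lambda>\<omega>. (wigner n (pt \<omega>) p q)\<^sup>2 * min 1 (h * \<bar>wigner n (pt \<omega>) p q\<bar>))"

lemma lindeberg_nonneg: "0 \<le> lindeberg p q"
  unfolding lindeberg_def using h_pos by (intro integral_nonneg_AE AE_I2) auto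

text \<open>Symmetry of \<open>D\<close> reduces \<open>q < p\<close> to \<open>p < q\<close>. On
  the diagonal there is no noise to cancel the derivative term, which survives, but only for
  \<open>n\<close> of the \<open>n\<^sup>2\<close> pairs.\<close>

lemma pair_expectation:
  assumes pq: "p \<in> I" "q \<in> I"
    and P: "P \<in> borel_measurable borel" "\<And>x. cmod (P x) \<le> B"
      "\<And>x p q. 0 \<le> p \<Longrightarrow> p < q \<Longrightarrow> q < int n \<Longrightarrow> cmod (P x - P (x((p + 1, q + 1) := 0))) \<le> B' * (h ^ 3 * \<bar>x (p + 1, q + 1)\<bar>)"
    and B': "0 \<le> B'"
  shows "cmod (\<integral>\<omega>. (of_real (wigner n (pt \<omega>) p q) * G (pt \<omega>) a j + of_real h * D p q (G (pt \<omega>) a) (\<lambda>i. G (pt \<omega>) i j)) * P (pt \<omega>) \<partial>M)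
    \<le> h * site_const B B' * (lindeberg p q + h) + (if p = q then h * (2 * C / y\<^sup>2) * B else 0)"
proof -
  have B: "0 \<le> B" using P(2) norm_ge_zero order_trans by blast
  have sc: "0 \<le> site_const B B'" unfolding site_const_def using B B' C_nonneg y by simp
  consider "p < q" | "q < p" | "p = q" by linarith
  then show ?thesis
  proof cases
    case 1
    have "wigner n (pt \<omega>) p q = X (p + 1, q + 1) \<omega>" for \<omega> using 1 pq by (simp add: wigner_def pt_def)
    then show ?thesis using site_expectation[of p q P B B' a j] 1 pq P B' by (simp add: lindeberg_def)
  next
    case 2
    have "wigner n (pt \<omega>) p q = X (q + 1, p + 1) \<omega>" for \<omega> using 2 pq by (simp add: wigner_def pt_def)
    then show ?thesis using site_expectation[of q p P B B' a j] 2 pq P B' by (simp add: lindeberg_def D_sym[of p q])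
  next
    case 3
    have w: "wigner n (pt \<omega>) p q = 0" for \<omega> using 3 by (simp add: wigner_def)
    have b: "cmod (of_real h * D p q (G (pt \<omega>) a) (\<lambda>i. G (pt \<omega>) i j) * P (pt \<omega>)) \<le> h * (2 * C / y\<^sup>2) * B" for \<omega>
    proof -
      have "cmod (D p q (G (pt \<omega>) a) (\<lambda>i. G (pt \<omega>) i j)) \<le> 2 * C * (1 / y) * (1 / y)" by (intro D_bound G_bound)
      then show ?thesis unfolding norm_mult norm_of_real abs_of_pos[OF h_pos] using h_pos C_nonneg
        by (intro mult_mono mult_left_mono P) (auto simp: power2_eq_square)
    qed
    have m: "(\<lambda>\<omega>. of_real h * D p q (G (pt \<omega>) a) (\<lambda>i. G (pt \<omega>) i j) * P (pt \<omega>)) \<in> borel_measurable M"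
      by (intro measurable_compose[OF pt_meas] borel_measurable_times borel_measurable_const D_meas G_meas P)
    have "cmod (\<integral>\<omega>. of_real h * D p q (G (pt \<omega>) a) (\<lambda>i. G (pt \<omega>) i j) * P (pt \<omega>) \<partial>M) \<le> (\<integral>\<omega>. h * (2 * C / y\<^sup>2) * B \<partial>M)"
      by (rule order_trans[OF integral_norm_bound]) (intro integral_mono integrable_norm integrable_bounded[OF m b] b integrable_const)
    also have "\<dots> = h * (2 * C / y\<^sup>2) * B" by (simp add: prob_space)
    finally have le: "cmod (\<integral>\<omega>. of_real h * D p q (G (pt \<omega>) a) (\<lambda>i. G (pt \<omega>) i j) * P (pt \<omega>) \<partial>M) \<le> h * (2 * C / y\<^sup>2) * B" .
    moreover have "0 \<le> h * site_const B B' * (lindeberg p q + h)" using sc h_pos lindeberg_nonneg[of p q] by simp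
    ultimately show ?thesis using 3 unfolding w of_real_0 mult_zero_left add_0_left by simp
  qed
qed

definition \<Lambda> :: real where "\<Lambda> = h ^ 4 * (\<Sum>p\<in>I. \<Sum>q\<in>I. lindeberg p q)"

definition Res_const :: real where
  "Res_const = C * site_const (2 + C\<^sup>2 / y\<^sup>2) ((y + 2 * C\<^sup>2 / y) * (2 * C / y\<^sup>2)) + 3 * C\<^sup>2 / y\<^sup>2 * (2 + C\<^sup>2 / y\<^sup>2)"

lemma \<Lambda>_nonneg: "0 \<le> \<Lambda>"
  unfolding \<Lambda>_def by (intro mult_nonneg_nonneg sum_nonneg lindeberg_nonneg) simp

text \<open>The squared modulus is \<open>Res\<close> times its conjugate. One factor is expanded by
  the resolvent identity; the conjugate is the test function \<open>P\<close>, which a single noise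
  variable moves only at order \<open>h ^ 3\<close>.\<close>

theorem Res_second_moment: "expectation (\<lambda>\<omega>. (cmod (Res (pt \<omega>) k))\<^sup>2) \<le> Res_const * (\<Lambda> + h)"
proof -
  define B where "B = 2 + C\<^sup>2 / y\<^sup>2"
  define B' where "B' = (y + 2 * C\<^sup>2 / y) * (2 * C / y\<^sup>2)"
  define P where "P x = cnj (Res x k)" for x
  have B0: "0 \<le> B" and B'0: "0 \<le> B'" unfolding B_def B'_def using C_nonneg y by auto
  have "(cnj :: complex \<Rightarrow> complex) \<in> borel_measurable borel"
    by (intro borel_measurable_continuous_onI continuous_intros)
  from measurable_compose[OF Res_meas this] have Pm: "P \<in> borel_measurable borel" unfolding P_def .
  have Pb: "cmod (P x) \<le> B" for x unfolding P_def B_def using Res_bound by simp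
  have Pd: "cmod (P x - P (x((p + 1, q + 1) := 0))) \<le> B' * (h ^ 3 * \<bar>x (p + 1, q + 1)\<bar>)"
    if "0 \<le> p" "p < q" "q < int n" for x p q
    unfolding P_def B'_def using Res_update_bound[OF that, of x k] by (simp only: complex_cnj_diff[symmetric] complex_mod_cnj)
  define \<Psi> where "\<Psi> z p q \<omega> = (of_real (wigner n (pt \<omega>) p q) * G (pt \<omega>) (q + snd z) (p + fst z + k)
      + of_real h * D p q (G (pt \<omega>) (q + snd z)) (\<lambda>i. G (pt \<omega>) i (p + fst z + k))) * P (pt \<omega>)" for z p q \<omega>
  define Err where "Err x = of_real (h ^ 4) * (\<Sum>z\<in>F. of_real (c (fst z) (snd z)) * (\<Sum>p\<in>I. \<Sum>q\<in>I. D p q (G x (q + snd z)) (\<lambda>i. G x i (p + fst z + k)))) - Q x k" for x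
  \<comment> \<open>Adding and subtracting the derivative term pairs every noise entry with its
    counterterm; \<open>Err\<close> is the defect left over by \<open>Q_identity\<close>.\<close>
  have eq: "Res (pt \<omega>) k * P (pt \<omega>) = of_real (h ^ 3) * (\<Sum>z\<in>F. of_real (c (fst z) (snd z)) * (\<Sum>p\<in>I. \<Sum>q\<in>I. \<Psi> z p q \<omega>)) - Err (pt \<omega>) * P (pt \<omega>)" for \<omega>
  proof -
    let ?x = "pt \<omega>"
    have "Res ?x k = of_real (h ^ 3) * (\<Sum>z\<in>F. of_real (c (fst z) (snd z)) * (\<Sum>p\<in>I. \<Sum>q\<in>I. of_real (wigner n ?x p q) * G ?x (q + snd z) (p + fst z + k))) + Q ?x k"
      unfolding Res_def g_resolvent_identity by (simp add: case_prod_unfold)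
    also have "\<dots> = of_real (h ^ 3) * (\<Sum>z\<in>F. of_real (c (fst z) (snd z)) * (\<Sum>p\<in>I. \<Sum>q\<in>I. (of_real (wigner n ?x p q) * G ?x (q + snd z) (p + fst z + k)
      + of_real h * D p q (G ?x (q + snd z)) (\<lambda>i. G ?x i (p + fst z + k))))) - Err ?x"
    proof -
      have h4: "of_real (h ^ 4) = of_real (h ^ 3) * complex_of_real h" by (simp add: power4_eq_xxxx power3_eq_cube)
      show ?thesis unfolding Err_def h4 sum.distrib sum_distrib_left[symmetric, of "of_real h"] distrib_left
        by (simp add: sum_distrib_left sum.distrib mult_ac)
    qed
    finally show ?thesis by (simp add: \<Psi>_def left_diff_distrib sum_distrib_right mult.assoc)
  qed
  have \<Psi>i: "integrable M (\<Psi> z p q)" for z p q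
  proof -
    have wi: "integrable M (\<lambda>\<omega>. wigner n (pt \<omega>) p q)"
      unfolding wigner_def pt_def by (cases "p mod int n = q mod int n") (auto simp: X_int)
    have 1: "integrable M (\<lambda>\<omega>. of_real (wigner n (pt \<omega>) p q) * (G (pt \<omega>) (q + snd z) (p + fst z + k) * P (pt \<omega>)))"
    proof (rule integrable_bounded_mult[OF wi])
      show "(\<lambda>\<omega>. G (pt \<omega>) (q + snd z) (p + fst z + k) * P (pt \<omega>)) \<in> borel_measurable M"
        by (intro borel_measurable_times measurable_compose[OF pt_meas] G_meas Pm)
      show "cmod (G (pt \<omega>) (q + snd z) (p + fst z + k) * P (pt \<omega>)) \<le> 1 / y * B" for \<omega>
        unfolding norm_mult using y by (intro mult_mono G_bound Pb) auto
    qed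
    have 2: "integrable M (\<lambda>\<omega>. of_real h * D p q (G (pt \<omega>) (q + snd z)) (\<lambda>i. G (pt \<omega>) i (p + fst z + k)) * P (pt \<omega>))"
    proof (rule integrable_bounded[where B = "h * (2 * C * (1 / y) * (1 / y)) * B"])
      show "(\<lambda>\<omega>. of_real h * D p q (G (pt \<omega>) (q + snd z)) (\<lambda>i. G (pt \<omega>) i (p + fst z + k)) * P (pt \<omega>)) \<in> borel_measurable M"
        by (intro measurable_compose[OF pt_meas] borel_measurable_times borel_measurable_const D_meas G_meas Pm)
      show "cmod (of_real h * D p q (G (pt \<omega>) (q + snd z)) (\<lambda>i. G (pt \<omega>) i (p + fst z + k)) * P (pt \<omega>)) \<le> h * (2 * C * (1 / y) * (1 / y)) * B" for \<omega>
        unfolding norm_mult norm_of_real abs_of_pos[OF h_pos] using h_pos C_nonneg y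
        by (intro mult_mono mult_left_mono D_bound G_bound Pb) auto
    qed
    show ?thesis unfolding \<Psi>_def using Bochner_Integration.integrable_add[OF 1 2] by (simp add: distrib_right mult.assoc)
  qed
  have Errb: "cmod (Err x * P x) \<le> C\<^sup>2 * (h\<^sup>2 / y\<^sup>2) * B" for x
    unfolding norm_mult using Q_identity[of x k] by (intro mult_mono Pb) (auto simp: Err_def case_prod_unfold)
  have Errm: "(\<lambda>\<omega>. Err (pt \<omega>) * P (pt \<omega>)) \<in> borel_measurable M"
    unfolding Err_def Q_def case_prod_unfold
    by (intro measurable_compose[OF pt_meas] borel_measurable_times borel_measurable_diff borel_measurable_sum borel_measurable_const D_meas G_meas g_meas Pm)
  have Erri: "integrable M (\<lambda>\<omega>. Err (pt \<omega>) * P (pt \<omega>))" by (rule integrable_bounded[OF Errm Errb])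
  have i1: "integrable M (\<lambda>\<omega>. of_real (h ^ 3) * (\<Sum>z\<in>F. of_real (c (fst z) (snd z)) * (\<Sum>p\<in>I. \<Sum>q\<in>I. \<Psi> z p q \<omega>)))"
    by (intro integrable_mult_right Bochner_Integration.integrable_sum \<Psi>i)
  have tri: "\<bar>r\<bar> \<le> cmod a + cmod b" if "complex_of_real r = a - b" for r a b
    using norm_triangle_ineq4[of a b] that[symmetric] by simp
  have "of_real (expectation (\<lambda>\<omega>. (cmod (Res (pt \<omega>) k))\<^sup>2)) = (\<integral>\<omega>. complex_of_real ((cmod (Res (pt \<omega>) k))\<^sup>2) \<partial>M)"
    by (rule integral_complex_of_real[symmetric])
  also have "\<dots> = (\<integral>\<omega>. Res (pt \<omega>) k * P (pt \<omega>) \<partial>M)"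
    unfolding P_def complex_norm_square ..
  also have "\<dots> = (\<integral>\<omega>. of_real (h ^ 3) * (\<Sum>z\<in>F. of_real (c (fst z) (snd z)) * (\<Sum>p\<in>I. \<Sum>q\<in>I. \<Psi> z p q \<omega>)) \<partial>M) - (\<integral>\<omega>. Err (pt \<omega>) * P (pt \<omega>) \<partial>M)"
    unfolding eq by (rule Bochner_Integration.integral_diff[OF i1 Erri])
  also have "(\<integral>\<omega>. of_real (h ^ 3) * (\<Sum>z\<in>F. of_real (c (fst z) (snd z)) * (\<Sum>p\<in>I. \<Sum>q\<in>I. \<Psi> z p q \<omega>)) \<partial>M) =
      of_real (h ^ 3) * (\<Sum>z\<in>F. of_real (c (fst z) (snd z)) * (\<Sum>p\<in>I. \<Sum>q\<in>I. \<integral>\<omega>. \<Psi> z p q \<omega> \<partial>M))"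
    by (simp add: \<Psi>i Bochner_Integration.integral_sum Bochner_Integration.integrable_sum)
  finally have "\<bar>expectation (\<lambda>\<omega>. (cmod (Res (pt \<omega>) k))\<^sup>2)\<bar> \<le>
      cmod (of_real (h ^ 3) * (\<Sum>z\<in>F. of_real (c (fst z) (snd z)) * (\<Sum>p\<in>I. \<Sum>q\<in>I. \<integral>\<omega>. \<Psi> z p q \<omega> \<partial>M))) + cmod (\<integral>\<omega>. Err (pt \<omega>) * P (pt \<omega>) \<partial>M)"
    by (rule tri)
  also have "\<dots> \<le> (C * site_const B B' * (\<Lambda> + h) + 2 * C\<^sup>2 / y\<^sup>2 * B * h\<^sup>2) + C\<^sup>2 / y\<^sup>2 * B * h\<^sup>2"
  proof (rule add_mono)
    let ?sc = "site_const B B'"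
    have "cmod (\<Sum>z\<in>F. of_real (c (fst z) (snd z)) * (\<Sum>p\<in>I. \<Sum>q\<in>I. \<integral>\<omega>. \<Psi> z p q \<omega> \<partial>M)) \<le>
       (\<Sum>z\<in>F. \<bar>c (fst z) (snd z)\<bar> * (\<Sum>p\<in>I. \<Sum>q\<in>I. h * ?sc * (lindeberg p q + h) + (if p = q then h * (2 * C / y\<^sup>2) * B else 0)))"
    proof (rule sum_norm_le)
      fix z assume "z \<in> F"
      have "cmod (\<Sum>p\<in>I. \<Sum>q\<in>I. \<integral>\<omega>. \<Psi> z p q \<omega> \<partial>M) \<le> (\<Sum>p\<in>I. \<Sum>q\<in>I. h * ?sc * (lindeberg p q + h) + (if p = q then h * (2 * C / y\<^sup>2) * B else 0))"
        unfolding \<Psi>_def by (intro sum_norm_le pair_expectation Pm Pb Pd B'0)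
      then show "cmod (of_real (c (fst z) (snd z)) * (\<Sum>p\<in>I. \<Sum>q\<in>I. \<integral>\<omega>. \<Psi> z p q \<omega> \<partial>M)) \<le> \<bar>c (fst z) (snd z)\<bar> * (\<Sum>p\<in>I. \<Sum>q\<in>I. h * ?sc * (lindeberg p q + h) + (if p = q then h * (2 * C / y\<^sup>2) * B else 0))"
        unfolding norm_mult norm_of_real by (rule mult_left_mono) simp
    qed
    also have "\<dots> = C * (\<Sum>p\<in>I. \<Sum>q\<in>I. h * ?sc * (lindeberg p q + h) + (if p = q then h * (2 * C / y\<^sup>2) * B else 0))"
      unfolding C_def case_prod_unfold sum_distrib_right ..
    also have "(\<Sum>p\<in>I. \<Sum>q\<in>I. h * ?sc * (lindeberg p q + h) + (if p = q then h * (2 * C / y\<^sup>2) * B else 0)) =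
        h * ?sc * ((\<Sum>p\<in>I. \<Sum>q\<in>I. lindeberg p q) + n * (n * h)) + n * (h * (2 * C / y\<^sup>2) * B)"
      by (simp add: sum.distrib sum_distrib_left[symmetric])
    finally have "h ^ 3 * cmod (\<Sum>z\<in>F. of_real (c (fst z) (snd z)) * (\<Sum>p\<in>I. \<Sum>q\<in>I. \<integral>\<omega>. \<Psi> z p q \<omega> \<partial>M)) \<le>
        h ^ 3 * (C * (h * ?sc * ((\<Sum>p\<in>I. \<Sum>q\<in>I. lindeberg p q) + n * (n * h)) + n * (h * (2 * C / y\<^sup>2) * B)))"
      using h_pos by (intro mult_left_mono) auto
    also have "\<dots> = C * ?sc * (h ^ 4 * (\<Sum>p\<in>I. \<Sum>q\<in>I. lindeberg p q) + (h\<^sup>2 * n) * (h\<^sup>2 * n) * h) + 2 * C\<^sup>2 / y\<^sup>2 * B * ((h\<^sup>2 * n) * h\<^sup>2)"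
      by (simp add: algebra_simps power4_eq_xxxx power3_eq_cube power2_eq_square)
    also have "h\<^sup>2 * n = 1" using n by (simp add: h_sq)
    finally show "cmod (of_real (h ^ 3) * (\<Sum>z\<in>F. of_real (c (fst z) (snd z)) * (\<Sum>p\<in>I. \<Sum>q\<in>I. \<integral>\<omega>. \<Psi> z p q \<omega> \<partial>M)))
        \<le> C * ?sc * (\<Lambda> + h) + 2 * C\<^sup>2 / y\<^sup>2 * B * h\<^sup>2"
      unfolding norm_mult norm_of_real \<Lambda>_def using h_pos by simp
    have "cmod (\<integral>\<omega>. Err (pt \<omega>) * P (pt \<omega>) \<partial>M) \<le> (\<integral>\<omega>. C\<^sup>2 * (h\<^sup>2 / y\<^sup>2) * B \<partial>M)"
      by (rule order_trans[OF integral_norm_bound]) (intro integral_mono integrable_norm Erri Errb integrable_const)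
    then show "cmod (\<integral>\<omega>. Err (pt \<omega>) * P (pt \<omega>) \<partial>M) \<le> C\<^sup>2 / y\<^sup>2 * B * h\<^sup>2" by (simp add: prob_space mult_ac)
  qed
  also have "\<dots> = C * site_const B B' * (\<Lambda> + h) + 3 * C\<^sup>2 / y\<^sup>2 * B * h\<^sup>2" by (simp add: algebra_simps)
  also have "\<dots> \<le> C * site_const B B' * (\<Lambda> + h) + 3 * C\<^sup>2 / y\<^sup>2 * B * (\<Lambda> + h)"
  proof -
    have "h\<^sup>2 \<le> h" using h_pos h_le_1 by (simp add: power2_eq_square mult_left_le)
    then have "h\<^sup>2 \<le> \<Lambda> + h" using \<Lambda>_nonneg by linarith
    then show ?thesis using B0 C_nonneg by (intro add_left_mono mult_left_mono) auto
  qed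
  also have "\<dots> = Res_const * (\<Lambda> + h)" unfolding Res_const_def B_def B'_def by (rule distrib_right[symmetric])
  finally show ?thesis by (rule order_trans[OF abs_ge_self])
qed

lemma Res_first_moment: "expectation (\<lambda>\<omega>. cmod (Res (pt \<omega>) k)) \<le> sqrt (Res_const * (\<Lambda> + h))"
proof (rule real_le_rsqrt)
  have m: "(\<lambda>\<omega>. cmod (Res (pt \<omega>) k)) \<in> borel_measurable M"
    by (rule measurable_compose[OF measurable_compose[OF pt_meas Res_meas] borel_measurable_norm])
  have i1: "integrable M (\<lambda>\<omega>. cmod (Res (pt \<omega>) k))"
    by (rule integrable_const_bound[of _ "2 + C\<^sup>2 / y\<^sup>2"]) (use m Res_bound in auto)
  have i2: "integrable M (\<lambda>\<omega>. (cmod (Res (pt \<omega>) k))\<^sup>2)"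
    by (rule integrable_const_bound[of _ "(2 + C\<^sup>2 / y\<^sup>2)\<^sup>2"]) (use m Res_bound in \<open>auto intro!: power_mono\<close>)
  show "(expectation (\<lambda>\<omega>. cmod (Res (pt \<omega>) k)))\<^sup>2 \<le> Res_const * (\<Lambda> + h)"
    using variance_eq[OF i1 i2] variance_positive[of "\<lambda>\<omega>. cmod (Res (pt \<omega>) k)"] Res_second_moment[of k] by linarith
qed

end

section \<open>Correlations of a summable filter\<close>

locale summable_filter =
  fixes c :: "int \<Rightarrow> int \<Rightarrow> real"
  assumes c_summable: "(\<lambda>(k, l). \<bar>c k l\<bar>) summable_on UNIV"
begin

definition mass :: real where "mass = (\<Sum>\<^sub>\<infinity>(k, l)\<in>UNIV. \<bar>c k l\<bar>)"

definition w :: "int \<times> int \<Rightarrow> real" where "w z = c (fst z) (snd z)"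

lemma w_summable: "(\<lambda>z. \<bar>w z\<bar>) summable_on UNIV" and mass_w: "mass = (\<Sum>\<^sub>\<infinity>z\<in>UNIV. \<bar>w z\<bar>)"
  using c_summable by (simp_all add: mass_def w_def case_prod_unfold)

lemma finite_mass: "finite F \<Longrightarrow> (\<Sum>z\<in>F. \<bar>w z\<bar>) \<le> mass"
  unfolding mass_w by (rule finite_sum_le_infsum[OF w_summable]) auto

lemma mass_nonneg: "0 \<le> mass"
  using finite_mass[of "{}"] by simp

text \<open>Square boxes are invariant under exchange of the coordinates and have bounded indices,
  as the cyclic model and the contraction require of \<open>F\<close>.\<close>

lemma mass_box:
  assumes "0 < e"
  obtains K :: nat where "mass - e < (\<Sum>z\<in>{- int K..int K} \<times> {- int K..int K}. \<bar>w z\<bar>)"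
proof -
  have "(sum (\<lambda>z. \<bar>w z\<bar>) \<longlongrightarrow> mass) (finite_subsets_at_top UNIV)"
    unfolding mass_w by (rule infsum_tendsto[OF w_summable])
  then have "\<forall>\<^sub>F A in finite_subsets_at_top UNIV. mass - e < (\<Sum>z\<in>A. \<bar>w z\<bar>)"
    using assms by (intro order_tendstoD) auto
  then obtain A where A: "finite A" "mass - e < (\<Sum>z\<in>A. \<bar>w z\<bar>)"
    unfolding eventually_finite_subsets_at_top by blast
  define K where "K = nat (\<Sum>z\<in>A. \<bar>fst z\<bar> + \<bar>snd z\<bar>)"
  have "A \<subseteq> {- int K..int K} \<times> {- int K..int K}"
  proof
    fix z assume z: "z \<in> A"
    have "\<bar>fst z\<bar> + \<bar>snd z\<bar> \<le> (\<Sum>z\<in>A. \<bar>fst z\<bar> + \<bar>snd z\<bar>)"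
      by (rule member_le_sum[OF z]) (use A in auto)
    then have "\<bar>fst z\<bar> \<le> int K" "\<bar>snd z\<bar> \<le> int K" unfolding K_def by linarith+
    then show "z \<in> {- int K..int K} \<times> {- int K..int K}" by (cases z) auto
  qed
  then have "(\<Sum>z\<in>A. \<bar>w z\<bar>) \<le> (\<Sum>z\<in>{- int K..int K} \<times> {- int K..int K}. \<bar>w z\<bar>)"
    by (intro sum_mono2) auto
  with A show ?thesis by (intro that[of K]) linarith
qed

lemma pair_summable: "(\<lambda>(z, z'). \<bar>w z * w z'\<bar>) summable_on UNIV \<times> UNIV"
  by (rule product_summable[OF w_summable w_summable])

lemma pair_mass: "(\<Sum>\<^sub>\<infinity>(z, z')\<in>UNIV \<times> UNIV. \<bar>w z * w z'\<bar>) = mass\<^sup>2"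
  using product_infsum[of "\<lambda>z. \<bar>w z\<bar>" UNIV "\<lambda>z. \<bar>w z\<bar>" UNIV] w_summable
  by (simp add: abs_mult mass_w power2_eq_square)

lemma pair_norm_summable:
  fixes f :: "int \<Rightarrow> int \<Rightarrow> complex"
  assumes "\<And>u v. cmod (f u v) \<le> B"
  shows "(\<lambda>p. norm (case p of (z, z') \<Rightarrow> of_real (w z * w z') * f (fst z - fst z') (snd z' - snd z))) summable_on UNIV \<times> UNIV"
proof (rule Infinite_Sum.abs_summable_on_comparison_test'[of "\<lambda>p. B * (case p of (z, z') \<Rightarrow> \<bar>w z * w z'\<bar>)"])
  show "(\<lambda>p. B * (case p of (z, z') \<Rightarrow> \<bar>w z * w z'\<bar>)) summable_on UNIV \<times> UNIV"
    by (rule summable_on_cmult_right[OF pair_summable])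
  show "norm (case p of (z, z') \<Rightarrow> of_real (w z * w z') * f (fst z - fst z') (snd z' - snd z)) \<le> B * (case p of (z, z') \<Rightarrow> \<bar>w z * w z'\<bar>)" for p
    using assms by (auto simp: norm_mult abs_mult mult.commute[of B] intro!: mult_left_mono split: prod.split)
qed

text \<open>The change of variables \<open>u = k - k'\<close>, \<open>v = l' - l\<close> in the defining sum of the correlations.\<close>

lemma pair_reindex: "bij_betw (\<lambda>(d, z). (z, (fst z - fst d, snd z + snd d))) (UNIV \<times> UNIV) (UNIV \<times> UNIV :: ((int \<times> int) \<times> (int \<times> int)) set)"
  by (rule bij_betw_byWitness[where f' = "\<lambda>(z, z'). ((fst z - fst z', snd z' - snd z), z)"]) auto

text \<open>Sums of correlations against a bounded function become double sums over the filter. The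
  constant 1 yields summability of the correlations, a sign function yields
  \<open>corr_mass\<close>, and products of Green functions lead to the truncation error.\<close>

lemma corr_expansion:
  fixes f :: "int \<Rightarrow> int \<Rightarrow> complex"
  assumes b: "\<And>u v. cmod (f u v) \<le> B"
  shows "(\<Sum>\<^sub>\<infinity>(u, v)\<in>UNIV. of_real (corr c u v) * f u v) =
      (\<Sum>\<^sub>\<infinity>(z, z')\<in>UNIV \<times> UNIV. of_real (w z * w z') * f (fst z - fst z') (snd z' - snd z))"
    and "(\<lambda>(u, v). norm (of_real (corr c u v) * f u v)) summable_on UNIV"
proof -
  let ?\<phi> = "\<lambda>(d, z). (z, (fst z - fst d, snd z + snd d)) :: (int \<times> int) \<times> (int \<times> int)"
  let ?f = "\<lambda>p. case p of (z, z') \<Rightarrow> of_real (w z * w z') * f (fst z - fst z') (snd z' - snd z)"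
  let ?g = "\<lambda>d z. of_real (w z * w (fst z - fst d, snd z + snd d)) * f (fst d) (snd d)"
  have fg: "?f (?\<phi> (d, z)) = ?g d z" for d z by simp
  have s: "(\<lambda>p. norm (?f (?\<phi> p))) summable_on UNIV \<times> UNIV"
    using summable_on_reindex_bij_betw[OF pair_reindex, of "\<lambda>p. norm (?f p)"] pair_norm_summable[of f, OF b] by simp
  then have s': "(\<lambda>(d, z). norm (?g d z)) summable_on UNIV \<times> UNIV" by (simp add: case_prod_unfold)
  then have s2: "(\<lambda>(d, z). ?g d z) summable_on UNIV \<times> UNIV"
    using abs_summable_summable[of "\<lambda>(d, z). ?g d z" "UNIV \<times> UNIV"] unfolding case_prod_unfold by blast
  have inner: "(\<Sum>\<^sub>\<infinity>z\<in>UNIV. ?g d z) = of_real (corr c (fst d) (snd d)) * f (fst d) (snd d)" for d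
  proof -
    have "(\<lambda>p. norm (case p of (d, z) \<Rightarrow> w z * w (fst z - fst d, snd z + snd d))) summable_on UNIV \<times> UNIV"
      using summable_on_reindex_bij_betw[OF pair_reindex, of "\<lambda>p. case p of (z, z') \<Rightarrow> \<bar>w z * w z'\<bar>"] pair_summable
      by (simp add: case_prod_unfold)
    from Infinite_Sum.abs_summable_on_Sigma_iff[THEN iffD1, OF this]
    have "(\<lambda>z. norm (case (d, z) of (d, z) \<Rightarrow> w z * w (fst z - fst d, snd z + snd d))) summable_on UNIV" by blast
    from abs_summable_summable[OF this] have S: "(\<lambda>z. w z * w (fst z - fst d, snd z + snd d)) summable_on UNIV" by simp
    have "(\<Sum>\<^sub>\<infinity>z\<in>UNIV. complex_of_real (w z * w (fst z - fst d, snd z + snd d))) = of_real (\<Sum>\<^sub>\<infinity>z\<in>UNIV. w z * w (fst z - fst d, snd z + snd d))"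
      by (rule infsumI[OF has_sum_of_real[OF has_sum_infsum[OF S]]])
    then show ?thesis unfolding infsum_cmult_left' corr_def w_def by (simp add: case_prod_unfold)
  qed
  have "(\<Sum>\<^sub>\<infinity>p\<in>UNIV \<times> UNIV. ?f p) = (\<Sum>\<^sub>\<infinity>p\<in>UNIV \<times> UNIV. ?f (?\<phi> p))"
    by (rule infsum_reindex_bij_betw[OF pair_reindex, symmetric])
  also have "\<dots> = (\<Sum>\<^sub>\<infinity>(d, z)\<in>UNIV \<times> UNIV. ?g d z)" by (intro infsum_cong) auto
  also have "\<dots> = (\<Sum>\<^sub>\<infinity>d\<in>UNIV. \<Sum>\<^sub>\<infinity>z\<in>UNIV. ?g d z)"
    by (rule infsum_Sigma'_banach[OF s2, symmetric])
  finally show "(\<Sum>\<^sub>\<infinity>(u, v)\<in>UNIV. of_real (corr c u v) * f u v) = (\<Sum>\<^sub>\<infinity>p\<in>UNIV \<times> UNIV. ?f p)"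
    unfolding inner by (simp add: case_prod_unfold)
  have sig: "(\<lambda>z. norm (?g d z)) summable_on UNIV" "(\<lambda>d. \<Sum>\<^sub>\<infinity>z\<in>UNIV. norm (?g d z)) summable_on UNIV" for d
  proof -
    have "(\<lambda>p. norm (case p of (d, z) \<Rightarrow> ?g d z)) summable_on UNIV \<times> UNIV" using s' by (simp only: case_prod_unfold)
    note * = Infinite_Sum.abs_summable_on_Sigma_iff[THEN iffD1, OF this]
    have "(\<lambda>z. norm (case (d, z) of (d, z) \<Rightarrow> ?g d z)) summable_on UNIV" using * by blast
    then show "(\<lambda>z. norm (?g d z)) summable_on UNIV" by simp
    show "(\<lambda>d. \<Sum>\<^sub>\<infinity>z\<in>UNIV. norm (?g d z)) summable_on UNIV"
      using *[THEN conjunct2] by (simp add: infsum_nonneg)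
  qed
  have "(\<lambda>d. \<Sum>\<^sub>\<infinity>z\<in>UNIV. norm (?g d z)) summable_on UNIV" by (rule sig)
  moreover have "norm (of_real (corr c (fst d) (snd d)) * f (fst d) (snd d)) \<le> (\<Sum>\<^sub>\<infinity>z\<in>UNIV. norm (?g d z))" for d
    unfolding inner[symmetric]
    by (rule norm_infsum_bound[OF sig(1)])
  ultimately show "(\<lambda>(u, v). norm (of_real (corr c u v) * f u v)) summable_on UNIV"
    unfolding case_prod_unfold by (rule summable_on_comparison_test) auto
qed

lemma corr_summable: "summable_kernel (corr c)"
proof
  show "(\<lambda>(u, v). \<bar>corr c u v\<bar>) summable_on UNIV"
    using corr_expansion(2)[of "\<lambda>_ _. 1" 1] by simp
qed

sublocale summable_kernel "corr c" by (rule corr_summable)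

lemma corr_mass: "\<rho> \<le> mass\<^sup>2"
proof -
  define f :: "int \<Rightarrow> int \<Rightarrow> complex" where "f u v = of_real (sgn (corr c u v))" for u v
  have b: "cmod (f u v) \<le> 1" for u v by (simp add: f_def sgn_real_def)
  have "of_real \<rho> = (\<Sum>\<^sub>\<infinity>(u, v)\<in>UNIV. of_real (corr c u v) * f u v)"
  proof -
    have "complex_of_real \<rho> = (\<Sum>\<^sub>\<infinity>(u, v)\<in>UNIV. complex_of_real \<bar>corr c u v\<bar>)"
      unfolding \<rho>_def using has_sum_of_real[OF has_sum_infsum[OF R_summable], where 'a = complex]
      by (intro infsumI[symmetric]) (simp add: case_prod_unfold)
    also have "\<dots> = (\<Sum>\<^sub>\<infinity>(u, v)\<in>UNIV. of_real (corr c u v) * f u v)"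
      by (intro infsum_cong) (auto simp: f_def abs_sgn mult.commute)
    finally show ?thesis .
  qed
  also have "\<dots> = (\<Sum>\<^sub>\<infinity>(z, z')\<in>UNIV \<times> UNIV. of_real (w z * w z') * f (fst z - fst z') (snd z' - snd z))"
    by (rule corr_expansion(1)[of f, OF b])
  finally have e: "complex_of_real \<rho> = \<dots>" .
  have "\<rho> = cmod (complex_of_real \<rho>)" using \<rho>_nonneg by simp
  also have "\<dots> \<le> (\<Sum>\<^sub>\<infinity>(z, z')\<in>UNIV \<times> UNIV. \<bar>w z * w z'\<bar>)"
    unfolding e
  proof (rule norm_infsum_le[OF has_sum_infsum[OF abs_summable_summable[OF pair_norm_summable[of f, OF b]]] has_sum_infsum[OF pair_summable]])
    show "norm (case p of (z, z') \<Rightarrow> of_real (w z * w z') * f (fst z - fst z') (snd z' - snd z)) \<le> (case p of (z, z') \<Rightarrow> \<bar>w z * w z'\<bar>)" for p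
      using b by (auto simp: norm_mult abs_mult intro!: mult_left_le split: prod.split)
  qed
  finally show ?thesis unfolding pair_mass .
qed

text \<open>The discrepancy consists of the filter pairs outside \<open>F \<times> F\<close>, whose
  total absolute weight is the difference of squares.\<close>

lemma corr_truncation:
  fixes f :: "int \<Rightarrow> int \<Rightarrow> complex"
  assumes b: "\<And>u v. cmod (f u v) \<le> B" and F: "finite F"
  shows "cmod ((\<Sum>\<^sub>\<infinity>(u, v)\<in>UNIV. of_real (corr c u v) * f u v) -
      (\<Sum>(a, b)\<in>F. \<Sum>(a', b')\<in>F. of_real (c a b * c a' b') * f (a - a') (b' - b))) \<le> B * (mass\<^sup>2 - (\<Sum>z\<in>F. \<bar>w z\<bar>)\<^sup>2)"
proof -
  let ?f = "\<lambda>p. case p of (z, z') \<Rightarrow> of_real (w z * w z') * f (fst z - fst z') (snd z' - snd z)"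
  let ?v = "\<lambda>p. case p of (z, z') \<Rightarrow> \<bar>w z * w z'\<bar>"
  have S: "UNIV \<times> UNIV - F \<times> F \<subseteq> UNIV \<times> UNIV" by auto
  have sf: "?f summable_on UNIV \<times> UNIV" by (rule abs_summable_summable[OF pair_norm_summable[of f, OF b]])
  have fin: "finite (F \<times> F)" using F by simp
  have 1: "(\<Sum>(a, b)\<in>F. \<Sum>(a', b')\<in>F. of_real (c a b * c a' b') * f (a - a') (b' - b)) = infsum ?f (F \<times> F)"
    using F by (simp add: sum.cartesian_product w_def case_prod_unfold)
  have 2: "infsum ?f (UNIV \<times> UNIV) - infsum ?f (F \<times> F) = infsum ?f (UNIV \<times> UNIV - F \<times> F)"
    by (rule infsum_Diff[OF sf _ , symmetric]) (use fin in auto)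
  have 3: "infsum ?v (UNIV \<times> UNIV) - infsum ?v (F \<times> F) = infsum ?v (UNIV \<times> UNIV - F \<times> F)"
    by (rule infsum_Diff[OF pair_summable, symmetric]) (use fin in auto)
  have 4: "infsum ?v (F \<times> F) = (\<Sum>z\<in>F. \<bar>w z\<bar>)\<^sup>2"
    using F by (simp add: sum.cartesian_product[symmetric] power2_eq_square sum_product abs_mult)
  have "cmod (infsum ?f (UNIV \<times> UNIV - F \<times> F)) \<le> infsum (\<lambda>p. B * ?v p) (UNIV \<times> UNIV - F \<times> F)"
  proof (rule norm_infsum_le[OF has_sum_infsum[OF summable_on_subset_banach[OF sf S]] has_sum_infsum[OF summable_on_cmult_right[OF summable_on_subset_banach[OF pair_summable S]]]])
    show "norm (?f p) \<le> B * ?v p" for p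
      using b by (auto simp: norm_mult abs_mult mult.commute[of B] intro!: mult_left_mono split: prod.split)
  qed
  also have "\<dots> = B * infsum ?v (UNIV \<times> UNIV - F \<times> F)" by (rule infsum_cmult_right')
  finally show ?thesis unfolding corr_expansion(1)[of f, OF b] 1 2 3[symmetric] 4 pair_mass .
qed

end

section \<open>Contraction towards the Green function\<close>

text \<open>The bound on \<open>y\<close> makes the fixed point equation a contraction with factor 1/2.\<close>

locale noisy_comparison = noisy_model M X n F c y + summable_filter c
  for M :: "'a measure" and X n F c y +
  fixes K :: nat
  assumes F_box: "\<And>a b. (a, b) \<in> F \<Longrightarrow> \<bar>a\<bar> \<le> int K \<and> \<bar>b\<bar> \<le> int K"
    and y_large: "6 * mass\<^sup>2 \<le> y\<^sup>2"
begin

lemma C_w: "C = (\<Sum>z\<in>F. \<bar>w z\<bar>)"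
  by (simp add: C_def w_def case_prod_unfold)

lemma C_le_mass: "C \<le> mass"
  unfolding C_w by (rule finite_mass[OF F])

lemma C_sq_le: "C\<^sup>2 \<le> mass\<^sup>2"
  using C_le_mass C_nonneg by (intro power_mono)

lemma \<rho>_small: "\<rho> * (1 / y)\<^sup>2 \<le> 1 / 4"
proof -
  have "4 * \<rho> \<le> y\<^sup>2" using corr_mass y_large \<rho>_nonneg by linarith
  then show ?thesis using y by (simp add: field_simps)
qed

definition err :: "(int \<times> int \<Rightarrow> real) \<Rightarrow> int \<Rightarrow> real" where
  "err x k = cmod (g x k - green y k)"

lemma err_bound: "err x k \<le> 3 / y"
proof -
  have "err x k \<le> cmod (g x k) + cmod (green y k)" unfolding err_def by (rule norm_triangle_ineq4)
  also have "\<dots> \<le> 1 / y + 2 / y" by (intro add_mono g_bound green_bound[OF y \<rho>_small])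
  finally show ?thesis by simp
qed

text \<open>The two quadratic equations are subtracted and the difference of products is split, with
  \<open>1 / y\<close> bounding the factor from the resolvent and \<open>2 / y\<close> the factor
  from the Green function. The range of \<open>k\<close> identifies the periodic delta with the
  plain one.\<close>

lemma err_step:
  assumes k: "\<bar>k\<bar> < int n"
  shows "y * err x k \<le> cmod (Res x k) + 4 / y\<^sup>2 * (mass\<^sup>2 - C\<^sup>2)
    + (\<Sum>(a, b)\<in>F. \<Sum>(a', b')\<in>F. \<bar>c a b * c a' b'\<bar> * (1 / y * err x (a' - a) + 2 / y * err x (k - (b' - b))))"
proof -
  let ?\<gamma> = "green y"
  define f where "f u v = ?\<gamma> (- u) * ?\<gamma> (k - v)" for u v
  define T where "T = (\<Sum>\<^sub>\<infinity>(u, v)\<in>UNIV. of_real (corr c u v) * f u v)"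
  define QF where "QF = (\<Sum>(a, b)\<in>F. \<Sum>(a', b')\<in>F. of_real (c a b * c a' b') * (?\<gamma> (a' - a) * ?\<gamma> (k - (b' - b))))"
  have fb: "cmod (f u v) \<le> 4 / y\<^sup>2" for u v
  proof -
    have "cmod (f u v) \<le> 2 / y * (2 / y)" unfolding f_def norm_mult
      using y by (intro mult_mono green_bound[OF y \<rho>_small]) auto
    then show ?thesis by (simp add: power2_eq_square)
  qed
  have tr: "cmod (T - QF) \<le> 4 / y\<^sup>2 * (mass\<^sup>2 - C\<^sup>2)"
    using corr_truncation[of f, OF fb F] by (simp add: T_def QF_def f_def C_w)
  have \<delta>: "(if k mod int n = 0 then 1 else 0) = (if k = 0 then 1 else (0 :: complex))"
  proof -
    have "k = 0" if "k mod int n = 0"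
    proof (rule ccontr)
      assume "k \<noteq> 0"
      moreover have "int n dvd k" using that by (rule mod_0_imp_dvd)
      ultimately have "\<bar>int n\<bar> \<le> \<bar>k\<bar>" by (rule dvd_imp_le_int)
      with k show False by simp
    qed
    then show ?thesis by (cases "k = 0") auto
  qed
  have fp: "\<i> * of_real y * ?\<gamma> k = - (if k = 0 then 1 else 0) - T"
    unfolding T_def f_def by (rule green_fixed_point[OF y \<rho>_small])
  have "\<i> * of_real y * (g x k - ?\<gamma> k) = Res x k - (Q x k - QF) + (T - QF)"
    unfolding right_diff_distrib fp Res_def \<delta> by simp
  then have "y * err x k = cmod (Res x k - (Q x k - QF) + (T - QF))"
    using y by (metis (no_types, lifting) abs_of_pos err_def mult_1 norm_ii norm_mult norm_of_real)
  also have "\<dots> \<le> cmod (Res x k) + cmod (Q x k - QF) + cmod (T - QF)"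
    by (intro order_trans[OF norm_triangle_ineq] add_mono norm_triangle_ineq4 order_refl)
  also have "cmod (Q x k - QF) \<le> (\<Sum>(a, b)\<in>F. \<Sum>(a', b')\<in>F. \<bar>c a b * c a' b'\<bar> * (1 / y * err x (a' - a) + 2 / y * err x (k - (b' - b))))"
    unfolding Q_def QF_def sum_subtractf[symmetric] case_prod_unfold right_diff_distrib[symmetric]
  proof (intro sum_norm_le)
    fix z z'
    let ?g = "g x (fst z' - fst z)" and ?g' = "g x (k - (snd z' - snd z))"
    let ?m = "?\<gamma> (fst z' - fst z)" and ?m' = "?\<gamma> (k - (snd z' - snd z))"
    have "?g * ?g' - ?m * ?m' = (?g - ?m) * ?g' + ?m * (?g' - ?m')" by (simp add: algebra_simps)
    then have "cmod (?g * ?g' - ?m * ?m') \<le> err x (fst z' - fst z) * cmod ?g' + cmod ?m * err x (k - (snd z' - snd z))"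
      unfolding err_def norm_mult[symmetric] by (simp only: norm_triangle_ineq)
    also have "\<dots> \<le> err x (fst z' - fst z) * (1 / y) + 2 / y * err x (k - (snd z' - snd z))"
      by (intro add_mono mult_left_mono mult_right_mono g_bound green_bound[OF y \<rho>_small]) (auto simp: err_def)
    finally show "cmod (of_real (c (fst z) (snd z) * c (fst z') (snd z')) * (?g * ?g' - ?m * ?m')) \<le>
      \<bar>c (fst z) (snd z) * c (fst z') (snd z')\<bar> * (1 / y * err x (fst z' - fst z) + 2 / y * err x (k - (snd z' - snd z)))"
      unfolding norm_mult[of "of_real _"] norm_of_real by (intro mult_left_mono) (auto simp: mult.commute)
  qed
  finally show ?thesis using tr by linarith
qed

definition dev :: "int \<Rightarrow> real" where "dev k = expectation (\<lambda>\<omega>. err (pt \<omega>) k)"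

lemma err_integrable: "integrable M (\<lambda>\<omega>. err (pt \<omega>) k)"
proof (rule integrable_const_bound[of _ "3 / y"])
  have "(\<lambda>x. err x k) \<in> borel_measurable borel" unfolding err_def by (intro borel_measurable_norm borel_measurable_diff borel_measurable_const measurable_compose[OF _ borel_measurable_norm] g_meas)
  from measurable_compose[OF pt_meas this] show "(\<lambda>\<omega>. err (pt \<omega>) k) \<in> borel_measurable M" .
qed (use err_bound in \<open>auto simp: err_def\<close>)

lemma dev_bound: "dev k \<le> 3 / y"
proof -
  have "dev k \<le> expectation (\<lambda>\<omega>. 3 / y)"
    unfolding dev_def by (intro integral_mono err_integrable err_bound) simp
  then show ?thesis by (simp add: prob_space)
qed

definition step_err :: real where
  "step_err = (sqrt (Res_const * (\<Lambda> + h)) + 4 / y\<^sup>2 * (mass\<^sup>2 - C\<^sup>2)) / y"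

lemma dev_step:
  assumes k: "\<bar>k\<bar> < int n"
  shows "y * dev k \<le> y * step_err
    + (\<Sum>(a, b)\<in>F. \<Sum>(a', b')\<in>F. \<bar>c a b * c a' b'\<bar> * (1 / y * dev (a' - a) + 2 / y * dev (k - (b' - b))))"
proof -
  let ?S = "\<lambda>\<omega>. \<Sum>z\<in>F. \<Sum>z'\<in>F. \<bar>c (fst z) (snd z) * c (fst z') (snd z')\<bar> * (1 / y * err (pt \<omega>) (fst z' - fst z) + 2 / y * err (pt \<omega>) (k - (snd z' - snd z)))"
  have Ri: "integrable M (\<lambda>\<omega>. cmod (Res (pt \<omega>) k))"
    by (rule integrable_const_bound[of _ "2 + C\<^sup>2 / y\<^sup>2"])
      (use Res_bound measurable_compose[OF measurable_compose[OF pt_meas Res_meas] borel_measurable_norm] in auto)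
  have Si: "integrable M ?S"
    by (intro Bochner_Integration.integrable_sum integrable_mult_right Bochner_Integration.integrable_add err_integrable)
  have "y * dev k = expectation (\<lambda>\<omega>. y * err (pt \<omega>) k)" unfolding dev_def by simp
  also have "\<dots> \<le> expectation (\<lambda>\<omega>. cmod (Res (pt \<omega>) k) + 4 / y\<^sup>2 * (mass\<^sup>2 - C\<^sup>2) + ?S \<omega>)"
  proof (rule integral_mono)
    show "y * err (pt \<omega>) k \<le> cmod (Res (pt \<omega>) k) + 4 / y\<^sup>2 * (mass\<^sup>2 - C\<^sup>2) + ?S \<omega>" for \<omega>
      using err_step[OF k, of "pt \<omega>"] by (simp only: case_prod_unfold)
  qed (intro Bochner_Integration.integrable_add Ri Si integrable_const integrable_mult_right err_integrable)+
  also have "\<dots> = expectation (\<lambda>\<omega>. cmod (Res (pt \<omega>) k)) + 4 / y\<^sup>2 * (mass\<^sup>2 - C\<^sup>2) + expectation ?S"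
    using Ri Si by (simp add: prob_space)
  also have "expectation ?S = (\<Sum>z\<in>F. \<Sum>z'\<in>F. \<bar>c (fst z) (snd z) * c (fst z') (snd z')\<bar> * (1 / y * dev (fst z' - fst z) + 2 / y * dev (k - (snd z' - snd z))))"
    unfolding dev_def by (simp add: err_integrable)
  also have "expectation (\<lambda>\<omega>. cmod (Res (pt \<omega>) k)) \<le> sqrt (Res_const * (\<Lambda> + h))" by (rule Res_first_moment)
  finally show ?thesis using y by (simp add: step_err_def case_prod_unfold)
qed

text \<open>Starting from the trivial bound \<open>3 / y\<close>, each use of
  \<open>dev_step\<close> contracts by \<open>(1 + 2) * C\<^sup>2 / y\<^sup>2 \<le> 1 / 2\<close>
  and moves the index by at most \<open>2 K\<close>; hence the reserve \<open>2 K J\<close> below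
  \<open>n\<close>. The additive errors sum to at most \<open>2 * step_err\<close>.\<close>

lemma dev_contract:
  assumes "\<bar>k\<bar> + 2 * int K * int J < int n"
  shows "dev k \<le> 2 * step_err + 3 / y * (1 / 2) ^ J"
  using assms
proof (induction J arbitrary: k)
  case 0
  have "0 \<le> y * step_err"
    using C_sq_le y \<Lambda>_nonneg real_sqrt_ge_zero[of "Res_const * (\<Lambda> + h)"] order_trans[OF _ Res_second_moment[of 0]]
    by (simp add: step_err_def)
  then have "0 \<le> step_err" using y by (simp add: zero_le_mult_iff)
  then show ?case using dev_bound[of k] by simp
next
  case (Suc J)
  let ?E = "2 * step_err + 3 / y * (1 / 2) ^ J"
  have p: "\<bar>k\<bar> + 2 * int K + 2 * int K * int J < int n" using Suc.prems by (simp add: algebra_simps)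
  have KJ: "0 \<le> 2 * int K * int J" by simp
  have "y * dev k \<le> y * step_err + (\<Sum>(a, b)\<in>F. \<Sum>(a', b')\<in>F. \<bar>c a b * c a' b'\<bar> * (1 / y * dev (a' - a) + 2 / y * dev (k - (b' - b))))"
    by (rule dev_step) (use p KJ in linarith)
  also have "\<dots> \<le> y * step_err + (\<Sum>(a, b)\<in>F. \<Sum>(a', b')\<in>F. \<bar>c a b * c a' b'\<bar> * (1 / y * ?E + 2 / y * ?E))"
    unfolding case_prod_unfold
  proof (intro add_left_mono sum_mono mult_left_mono add_mono)
    fix z z' assume z: "z \<in> F" "z' \<in> F"
    have bz: "\<bar>fst z\<bar> \<le> int K" "\<bar>snd z\<bar> \<le> int K" "\<bar>fst z'\<bar> \<le> int K" "\<bar>snd z'\<bar> \<le> int K"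
      using F_box[of "fst z" "snd z"] F_box[of "fst z'" "snd z'"] z by auto
    show "dev (fst z' - fst z) \<le> ?E" using bz p by (intro Suc.IH) linarith
    show "dev (k - (snd z' - snd z)) \<le> ?E" using bz p by (intro Suc.IH) linarith
  qed (use y in auto)
  also have "(\<Sum>(a, b)\<in>F. \<Sum>(a', b')\<in>F. \<bar>c a b * c a' b'\<bar> * (1 / y * ?E + 2 / y * ?E)) = C\<^sup>2 * (3 / y * ?E)"
  proof -
    have "(1 / y * ?E + 2 / y * ?E) = 3 / y * ?E" by (simp add: add_divide_distrib algebra_simps)
    then show ?thesis unfolding C_def case_prod_unfold power2_eq_square sum_product abs_mult
      by (simp only: sum_distrib_right)
  qed
  finally have le: "y * dev k \<le> y * step_err + C\<^sup>2 * (3 / y * ?E)" .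
  have E0: "0 \<le> ?E"
  proof -
    have "0 \<le> dev 0" unfolding dev_def by (intro integral_nonneg_AE) (simp add: err_def)
    also have "\<dots> \<le> ?E" by (rule Suc.IH) (use p in simp)
    finally show ?thesis .
  qed
  have "C\<^sup>2 * (3 / y * ?E) = (3 * C\<^sup>2) * (?E / y)" by simp
  also have "\<dots> \<le> (y\<^sup>2 / 2) * (?E / y)"
    using C_sq_le y_large E0 y by (intro mult_right_mono divide_nonneg_pos) auto
  also have "\<dots> = y * (?E / 2)" using y by (simp add: power2_eq_square)
  finally have "y * dev k \<le> y * (step_err + ?E / 2)" using le by (simp only: distrib_left)
  then have "dev k \<le> step_err + ?E / 2" using y by simp
  moreover have "?E / 2 = step_err + 3 / y * (1 / 2) ^ Suc J" by (simp add: add_divide_distrib)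
  ultimately show ?case by linarith
qed

end

section \<open>The Lindeberg sum\<close>

lemma sum_int_shift: "(\<Sum>p\<in>{0..<int n}. f (p + 1)) = (\<Sum>i = 1..int n. f i)"
  by (rule sum.reindex_bij_witness[of _ "\<lambda>i. i - 1" "\<lambda>p. p + 1"]) auto

context noisy_model
begin

definition tail :: "real \<Rightarrow> int \<Rightarrow> int \<Rightarrow> real" where
  "tail \<tau> i j = expectation (\<lambda>\<omega>. (X (i, j) \<omega>)\<^sup>2 * indicator {\<omega>. \<tau> * sqrt (real n) < \<bar>X (i, j) \<omega>\<bar>} \<omega>)"

lemma tail_integrable: "integrable M (\<lambda>\<omega>. (X (i, j) \<omega>)\<^sup>2 * indicator {\<omega>. \<tau> * sqrt (real n) < \<bar>X (i, j) \<omega>\<bar>} \<omega>)"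
proof (rule Bochner_Integration.integrable_bound[OF X_sq_int[of "(i, j)"]])
  have "(\<lambda>\<omega>. if \<tau> * sqrt (real n) < \<bar>X (i, j) \<omega>\<bar> then (X (i, j) \<omega>)\<^sup>2 else 0) \<in> borel_measurable M" by measurable
  also have "(\<lambda>\<omega>. if \<tau> * sqrt (real n) < \<bar>X (i, j) \<omega>\<bar> then (X (i, j) \<omega>)\<^sup>2 else 0) = (\<lambda>\<omega>. (X (i, j) \<omega>)\<^sup>2 * indicator {\<omega>. \<tau> * sqrt (real n) < \<bar>X (i, j) \<omega>\<bar>} \<omega>)"
    by (auto simp: indicator_def)
  finally show "(\<lambda>\<omega>. (X (i, j) \<omega>)\<^sup>2 * indicator {\<omega>. \<tau> * sqrt (real n) < \<bar>X (i, j) \<omega>\<bar>} \<omega>) \<in> borel_measurable M" .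
qed (auto simp: indicator_def)

lemma tail_nonneg: "0 \<le> tail \<tau> i j"
  unfolding tail_def by (intro integral_nonneg_AE AE_I2) (auto simp: indicator_def)

text \<open>Up to the cutoff \<open>\<tau> * sqrt n\<close> the minimum is at most
  \<open>\<tau>\<close>, beyond it at most 1. \<open>wigner\<close> reads only one of the two sites;
  adding the tails of both avoids distinguishing the triangles.\<close>

lemma lindeberg_le:
  assumes "0 \<le> \<tau>" "p \<in> I" "q \<in> I"
  shows "lindeberg p q \<le> \<tau> + (tail \<tau> (p + 1) (q + 1) + tail \<tau> (q + 1) (p + 1))"
proof (cases "p = q")
  case True
  then show ?thesis using assms(1) tail_nonneg[of \<tau> "p + 1" "q + 1"] by (simp add: lindeberg_def wigner_def)
next
  case False
  let ?i = "min p q + 1" and ?j = "max p q + 1"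
  let ?ind = "\<lambda>\<omega>. indicator {\<omega>. \<tau> * sqrt (real n) < \<bar>X (?i, ?j) \<omega>\<bar>} \<omega> :: real"
  have w: "wigner n (pt \<omega>) p q = X (?i, ?j) \<omega>" for \<omega> using False assms by (simp add: wigner_def pt_def)
  have pw: "(X (?i, ?j) \<omega>)\<^sup>2 * min 1 (h * \<bar>X (?i, ?j) \<omega>\<bar>) \<le> \<tau> * (X (?i, ?j) \<omega>)\<^sup>2 + (X (?i, ?j) \<omega>)\<^sup>2 * ?ind \<omega>" for \<omega>
  proof -
    have "min 1 (h * \<bar>X (?i, ?j) \<omega>\<bar>) \<le> \<tau> + ?ind \<omega>"
    proof (cases "\<tau> * sqrt (real n) < \<bar>X (?i, ?j) \<omega>\<bar>")
      case False
      then have "h * \<bar>X (?i, ?j) \<omega>\<bar> \<le> h * (\<tau> * sqrt (real n))" using h_pos by (intro mult_left_mono) auto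
      also have "\<dots> = \<tau>" using n by (simp add: h_def)
      finally show ?thesis using False by (auto simp: min_le_iff_disj)
    qed (use assms(1) in simp)
    from mult_left_mono[OF this zero_le_power2[of "X (?i, ?j) \<omega>"]] show ?thesis by (simp add: algebra_simps)
  qed
  have "lindeberg p q \<le> expectation (\<lambda>\<omega>. \<tau> * (X (?i, ?j) \<omega>)\<^sup>2 + (X (?i, ?j) \<omega>)\<^sup>2 * ?ind \<omega>)"
    unfolding lindeberg_def w
  proof (rule integral_mono)
    show "integrable M (\<lambda>\<omega>. (X (?i, ?j) \<omega>)\<^sup>2 * min 1 (h * \<bar>X (?i, ?j) \<omega>\<bar>))"
      using h_pos by (intro Bochner_Integration.integrable_bound[OF X_sq_int[of "(?i, ?j)"]]) (auto intro!: mult_left_le simp: abs_mult)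
  qed (intro Bochner_Integration.integrable_add integrable_mult_right X_sq_int tail_integrable pw)+
  also have "\<dots> = \<tau> + tail \<tau> ?i ?j" unfolding tail_def using X_sq_int X_var tail_integrable by simp
  also have "\<dots> \<le> \<tau> + (tail \<tau> (p + 1) (q + 1) + tail \<tau> (q + 1) (p + 1))"
    using tail_nonneg[of \<tau> "p + 1" "q + 1"] tail_nonneg[of \<tau> "q + 1" "p + 1"] by (cases "p \<le> q") (auto simp: min_def max_def)
  finally show ?thesis .
qed

lemma \<Lambda>_le:
  assumes "0 \<le> \<tau>"
  shows "\<Lambda> \<le> \<tau> + 2 * (1 / (real n)\<^sup>2 * (\<Sum>i = 1..int n. \<Sum>j = 1..int n. tail \<tau> i j))"
proof -
  let ?T = "\<Sum>i = 1..int n. \<Sum>j = 1..int n. tail \<tau> i j"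
  have T: "(\<Sum>p\<in>I. \<Sum>q\<in>I. tail \<tau> (p + 1) (q + 1)) = ?T"
    using sum_int_shift[of "\<lambda>i. \<Sum>q\<in>I. tail \<tau> i (q + 1)" n] sum_int_shift[of "tail \<tau> _" n] by simp
  have "(\<Sum>p\<in>I. \<Sum>q\<in>I. lindeberg p q) \<le> (\<Sum>p\<in>I. \<Sum>q\<in>I. \<tau> + (tail \<tau> (p + 1) (q + 1) + tail \<tau> (q + 1) (p + 1)))"
    using assms by (intro sum_mono lindeberg_le)
  also have "\<dots> = (real n)\<^sup>2 * \<tau> + (?T + ?T)"
    unfolding sum.distrib T sum.swap[of "\<lambda>p q. tail \<tau> (q + 1) (p + 1)"] by (simp add: power2_eq_square)
  finally have "\<Lambda> \<le> h ^ 4 * ((real n)\<^sup>2 * \<tau> + (?T + ?T))" unfolding \<Lambda>_def by (intro mult_left_mono) auto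
  also have "h ^ 4 = 1 / (real n)\<^sup>2"
  proof -
    have "h ^ 4 = (h\<^sup>2)\<^sup>2" by simp
    then show ?thesis by (simp only: h_sq power_one_over)
  qed
  finally show ?thesis using n by (simp add: field_simps)
qed

end

section \<open>Mean square estimates\<close>

context prob_space
begin

text \<open>The nonnegative integral matches \<open>has_L2_sum\<close> and makes square
  integrability a consequence rather than a premise.\<close>

definition mean_square_le :: "('a \<Rightarrow> real) \<Rightarrow> real \<Rightarrow> bool" where
  "mean_square_le f B \<longleftrightarrow> f \<in> borel_measurable M \<and> (\<integral>\<^sup>+\<omega>. ennreal ((f \<omega>)\<^sup>2) \<partial>M) \<le> ennreal B"

lemma mean_square_le_mono: "mean_square_le f B \<Longrightarrow> B \<le> B' \<Longrightarrow> mean_square_le f B'"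
  unfolding mean_square_le_def by (meson ennreal_leI order_trans)

lemma mean_square_le_expectation:
  assumes "mean_square_le f B" "0 \<le> B"
  shows "integrable M (\<lambda>\<omega>. (f \<omega>)\<^sup>2)" "expectation (\<lambda>\<omega>. (f \<omega>)\<^sup>2) \<le> B"
proof -
  have m: "(\<lambda>\<omega>. (f \<omega>)\<^sup>2) \<in> borel_measurable M" and le: "(\<integral>\<^sup>+\<omega>. ennreal ((f \<omega>)\<^sup>2) \<partial>M) \<le> ennreal B"
    using assms by (auto simp: mean_square_le_def)
  show i: "integrable M (\<lambda>\<omega>. (f \<omega>)\<^sup>2)"
    by (rule integrableI_bounded[OF m]) (use le in \<open>auto intro: le_less_trans\<close>)
  have "ennreal (expectation (\<lambda>\<omega>. (f \<omega>)\<^sup>2)) \<le> ennreal B"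
    using le nn_integral_eq_integral[OF i] by simp
  then show "expectation (\<lambda>\<omega>. (f \<omega>)\<^sup>2) \<le> B" using assms(2) by simp
qed

lemma mean_square_leI:
  assumes "f \<in> borel_measurable M" "integrable M (\<lambda>\<omega>. (f \<omega>)\<^sup>2)" "expectation (\<lambda>\<omega>. (f \<omega>)\<^sup>2) \<le> B"
  shows "mean_square_le f B"
  unfolding mean_square_le_def using assms nn_integral_eq_integral[OF assms(2)] by (auto intro: ennreal_leI)

lemma nn_mean_square_add:
  fixes f g :: "'a \<Rightarrow> real"
  assumes f: "f \<in> borel_measurable M" and g: "g \<in> borel_measurable M"
  shows "(\<integral>\<^sup>+\<omega>. ennreal ((f \<omega> + g \<omega>)\<^sup>2) \<partial>M) \<le> 2 * (\<integral>\<^sup>+\<omega>. ennreal ((f \<omega>)\<^sup>2) \<partial>M) + 2 * (\<integral>\<^sup>+\<omega>. ennreal ((g \<omega>)\<^sup>2) \<partial>M)"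
proof -
  have "(\<integral>\<^sup>+\<omega>. ennreal ((f \<omega> + g \<omega>)\<^sup>2) \<partial>M) \<le> (\<integral>\<^sup>+\<omega>. 2 * ennreal ((f \<omega>)\<^sup>2) + 2 * ennreal ((g \<omega>)\<^sup>2) \<partial>M)"
  proof (rule nn_integral_mono)
    fix \<omega>
    have "(f \<omega> + g \<omega>)\<^sup>2 \<le> 2 * (f \<omega>)\<^sup>2 + 2 * (g \<omega>)\<^sup>2"
      using zero_le_power2[of "f \<omega> - g \<omega>"] by (simp add: power2_sum power2_diff)
    then have "ennreal ((f \<omega> + g \<omega>)\<^sup>2) \<le> ennreal (2 * (f \<omega>)\<^sup>2 + 2 * (g \<omega>)\<^sup>2)" by (rule ennreal_leI)
    also have "\<dots> = 2 * ennreal ((f \<omega>)\<^sup>2) + 2 * ennreal ((g \<omega>)\<^sup>2)"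
      by (simp add: ennreal_mult)
    finally show "ennreal ((f \<omega> + g \<omega>)\<^sup>2) \<le> 2 * ennreal ((f \<omega>)\<^sup>2) + 2 * ennreal ((g \<omega>)\<^sup>2)" .
  qed
  also have "\<dots> = 2 * (\<integral>\<^sup>+\<omega>. ennreal ((f \<omega>)\<^sup>2) \<partial>M) + 2 * (\<integral>\<^sup>+\<omega>. ennreal ((g \<omega>)\<^sup>2) \<partial>M)"
    using f g by (simp add: nn_integral_add nn_integral_cmult)
  finally show ?thesis .
qed

lemma mean_square_le_diff:
  assumes "mean_square_le f B" "mean_square_le g B'" "0 \<le> B" "0 \<le> B'"
  shows "mean_square_le (\<lambda>\<omega>. f \<omega> - g \<omega>) (2 * B + 2 * B')"
  unfolding mean_square_le_def
proof
  have m: "f \<in> borel_measurable M" "(\<lambda>\<omega>. - g \<omega>) \<in> borel_measurable M"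
    using assms by (auto simp: mean_square_le_def)
  then show "(\<lambda>\<omega>. f \<omega> - g \<omega>) \<in> borel_measurable M" using assms by (auto simp: mean_square_le_def)
  have "(\<integral>\<^sup>+\<omega>. ennreal ((f \<omega> - g \<omega>)\<^sup>2) \<partial>M) \<le> 2 * (\<integral>\<^sup>+\<omega>. ennreal ((f \<omega>)\<^sup>2) \<partial>M) + 2 * (\<integral>\<^sup>+\<omega>. ennreal ((g \<omega>)\<^sup>2) \<partial>M)"
    using nn_mean_square_add[OF m] by simp
  also have "\<dots> \<le> 2 * ennreal B + 2 * ennreal B'"
    using assms by (intro add_mono mult_left_mono) (auto simp: mean_square_le_def)
  also have "\<dots> = ennreal (2 * B + 2 * B')" using assms by (simp add: ennreal_mult)
  finally show "(\<integral>\<^sup>+\<omega>. ennreal ((f \<omega> - g \<omega>)\<^sup>2) \<partial>M) \<le> ennreal (2 * B + 2 * B')" .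
qed

text \<open>Cauchy-Schwarz with weights \<open>\<bar>w z\<bar>\<close>, in effect Minkowski's
  inequality. It applies to dependent summands as well; in a cyclic entry the same noise variable
  may occur twice.\<close>

lemma mean_square_le_sum:
  fixes w :: "'i \<Rightarrow> real"
  assumes fin: "finite A" and Y: "\<And>z. mean_square_le (Y z) 1"
  shows "mean_square_le (\<lambda>\<omega>. \<Sum>z\<in>A. w z * Y z \<omega>) ((\<Sum>z\<in>A. \<bar>w z\<bar>)\<^sup>2)"
proof (rule mean_square_leI)
  let ?W = "\<Sum>z\<in>A. \<bar>w z\<bar>"
  have Ym: "Y z \<in> borel_measurable M" and Yi: "integrable M (\<lambda>\<omega>. (Y z \<omega>)\<^sup>2)" and Ye: "expectation (\<lambda>\<omega>. (Y z \<omega>)\<^sup>2) \<le> 1" for z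
    using Y[of z] mean_square_le_expectation[OF Y, of z] by (auto simp: mean_square_le_def)
  show m: "(\<lambda>\<omega>. \<Sum>z\<in>A. w z * Y z \<omega>) \<in> borel_measurable M" using Ym by simp
  have pw: "(\<Sum>z\<in>A. w z * Y z \<omega>)\<^sup>2 \<le> ?W * (\<Sum>z\<in>A. \<bar>w z\<bar> * (Y z \<omega>)\<^sup>2)" for \<omega>
  proof -
    \<comment> \<open>Writing the weight as a product of two square roots, with the sign on one
      side, puts the plain inequality into weighted form.\<close>
    have 1: "w z * Y z \<omega> = sqrt \<bar>w z\<bar> * (sgn (w z) * sqrt \<bar>w z\<bar> * Y z \<omega>)" for z
    proof -
      have "sqrt \<bar>w z\<bar> * (sgn (w z) * sqrt \<bar>w z\<bar> * Y z \<omega>) = sgn (w z) * (sqrt \<bar>w z\<bar> * sqrt \<bar>w z\<bar>) * Y z \<omega>" by (simp only: mult_ac)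
      also have "\<dots> = w z * Y z \<omega>" by (simp add: sgn_mult_abs)
      finally show ?thesis ..
    qed
    have 2: "(sgn (w z) * sqrt \<bar>w z\<bar> * Y z \<omega>)\<^sup>2 = \<bar>w z\<bar> * (Y z \<omega>)\<^sup>2" for z
      by (simp add: power_mult_distrib sgn_if)
    have "(\<Sum>z\<in>A. w z * Y z \<omega>)\<^sup>2 \<le> (\<Sum>z\<in>A. (sqrt \<bar>w z\<bar>)\<^sup>2) * (\<Sum>z\<in>A. (sgn (w z) * sqrt \<bar>w z\<bar> * Y z \<omega>)\<^sup>2)"
      unfolding 1 by (rule Cauchy_Schwarz_ineq_sum)
    then show ?thesis unfolding 2 by simp
  qed
  have i: "integrable M (\<lambda>\<omega>. ?W * (\<Sum>z\<in>A. \<bar>w z\<bar> * (Y z \<omega>)\<^sup>2))"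
    by (intro integrable_mult_right Bochner_Integration.integrable_sum Yi)
  show i': "integrable M (\<lambda>\<omega>. (\<Sum>z\<in>A. w z * Y z \<omega>)\<^sup>2)"
    using order_trans[OF pw abs_ge_self] m by (intro Bochner_Integration.integrable_bound[OF i]) auto
  have "expectation (\<lambda>\<omega>. (\<Sum>z\<in>A. w z * Y z \<omega>)\<^sup>2) \<le> expectation (\<lambda>\<omega>. ?W * (\<Sum>z\<in>A. \<bar>w z\<bar> * (Y z \<omega>)\<^sup>2))"
    by (rule integral_mono[OF i' i pw])
  also have "\<dots> = ?W * (\<Sum>z\<in>A. \<bar>w z\<bar> * expectation (\<lambda>\<omega>. (Y z \<omega>)\<^sup>2))"
    using Yi by simp
  also have "\<dots> \<le> ?W * (\<Sum>z\<in>A. \<bar>w z\<bar> * 1)"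
    by (intro mult_left_mono sum_mono Ye sum_nonneg) auto
  finally show "expectation (\<lambda>\<omega>. (\<Sum>z\<in>A. w z * Y z \<omega>)\<^sup>2) \<le> ?W\<^sup>2" by (simp add: power2_eq_square)
qed

end

section \<open>Filtered noise\<close>

locale filtered_noise = noise M X + summable_filter c for M :: "'a measure" and X c +
  fixes Z :: "int \<Rightarrow> int \<Rightarrow> 'a \<Rightarrow> real"
  assumes c_sym: "\<And>k l. c k l = c l k"
    and pastur: "\<And>\<eta>. 0 < \<eta> \<Longrightarrow>
      (\<lambda>n. 1 / (real n)\<^sup>2 * (\<Sum>i = 1..int n. \<Sum>j = 1..int n.
        expectation (\<lambda>\<omega>. (X (i, j) \<omega>)\<^sup>2 * indicator {\<omega>. \<eta> * sqrt (real n) < \<bar>X (i, j) \<omega>\<bar>} \<omega>))) \<longlonglongrightarrow> 0"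
    and Z_sum: "\<And>i j. has_L2_sum M (\<lambda>(k, l) \<omega>. c k l * X (i - k, j - l) \<omega>) (Z i j)"
begin

lemma Z_meas [measurable]: "Z i j \<in> borel_measurable M"
  using Z_sum[of i j] by (simp add: has_L2_sum_def)

lemma X_mean_square: "mean_square_le (X s) 1"
  using X_sq_int X_var by (intro mean_square_leI) auto

text \<open>A larger finite sum over \<open>A\<close> is put in between: its distance to
  \<open>Z\<close> tends to 0, and its distance to the sum over \<open>F\<close> is at most the
  filter mass outside \<open>F\<close>. The factor 2 comes from squaring a sum of two terms.\<close>

lemma Z_partial_sum:
  assumes F: "finite F"
  shows "mean_square_le (\<lambda>\<omega>. Z i j \<omega> - (\<Sum>z\<in>F. w z * X (i - fst z, j - snd z) \<omega>)) (2 * (mass - (\<Sum>z\<in>F. \<bar>w z\<bar>))\<^sup>2)"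
  unfolding mean_square_le_def
proof
  let ?S = "\<lambda>A \<omega>. \<Sum>z\<in>A. w z * X (i - fst z, j - snd z) \<omega>"
  let ?t = "mass - (\<Sum>z\<in>F. \<bar>w z\<bar>)"
  let ?d = "\<lambda>A. \<integral>\<^sup>+\<omega>. ennreal ((Z i j \<omega> - ?S A \<omega>)\<^sup>2) \<partial>M"
  show "(\<lambda>\<omega>. Z i j \<omega> - ?S F \<omega>) \<in> borel_measurable M" by simp
  have lim: "(?d \<longlongrightarrow> 0) (finite_subsets_at_top UNIV)"
    using Z_sum[of i j] by (simp add: has_L2_sum_def w_def case_prod_unfold)
  have "((\<lambda>A. 2 * ?d A + ennreal (2 * ?t\<^sup>2)) \<longlongrightarrow> 2 * 0 + ennreal (2 * ?t\<^sup>2)) (finite_subsets_at_top UNIV)"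
    by (intro tendsto_add tendsto_const ennreal_tendsto_cmult lim) auto
  then have lim': "((\<lambda>A. 2 * ?d A + ennreal (2 * ?t\<^sup>2)) \<longlongrightarrow> ennreal (2 * ?t\<^sup>2)) (finite_subsets_at_top UNIV)" by simp
  have "\<forall>\<^sub>F A in finite_subsets_at_top UNIV. ?d F \<le> 2 * ?d A + ennreal (2 * ?t\<^sup>2)"
    unfolding eventually_finite_subsets_at_top
  proof (intro exI[of _ F] conjI allI impI)
    fix A assume A: "finite A \<and> F \<subseteq> A \<and> A \<subseteq> (UNIV :: (int \<times> int) set)"
    have S: "?S A \<omega> = ?S F \<omega> + ?S (A - F) \<omega>" for \<omega>
      using A sum.subset_diff[of F A "\<lambda>z. w z * X (i - fst z, j - snd z) \<omega>"] by simp
    have "(\<Sum>z\<in>A - F. \<bar>w z\<bar>) = (\<Sum>z\<in>A. \<bar>w z\<bar>) - (\<Sum>z\<in>F. \<bar>w z\<bar>)" using A F by (simp add: sum_diff)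
    then have t: "(\<Sum>z\<in>A - F. \<bar>w z\<bar>) \<le> ?t" using finite_mass[of A] A by simp
    have "mean_square_le (?S (A - F)) ((\<Sum>z\<in>A - F. \<bar>w z\<bar>)\<^sup>2)"
      using A by (intro mean_square_le_sum X_mean_square) auto
    then have "mean_square_le (?S (A - F)) (?t\<^sup>2)"
      by (rule mean_square_le_mono) (intro power_mono t sum_nonneg, simp)
    then have le: "(\<integral>\<^sup>+\<omega>. ennreal ((?S (A - F) \<omega>)\<^sup>2) \<partial>M) \<le> ennreal (?t\<^sup>2)" by (simp add: mean_square_le_def)
    have "?d F = (\<integral>\<^sup>+\<omega>. ennreal ((Z i j \<omega> - ?S A \<omega> + ?S (A - F) \<omega>)\<^sup>2) \<partial>M)" unfolding S by simp
    also have "\<dots> \<le> 2 * ?d A + 2 * (\<integral>\<^sup>+\<omega>. ennreal ((?S (A - F) \<omega>)\<^sup>2) \<partial>M)" by (rule nn_mean_square_add) simp_all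
    also have "\<dots> \<le> 2 * ?d A + 2 * ennreal (?t\<^sup>2)" using le by (intro add_left_mono mult_left_mono) auto
    finally show "?d F \<le> 2 * ?d A + ennreal (2 * ?t\<^sup>2)" by (simp add: ennreal_mult)
  qed (use F in auto)
  from tendsto_lowerbound[OF lim' this] show "?d F \<le> ennreal (2 * ?t\<^sup>2)" by simp
qed

end

section \<open>Comparison with the filtered matrix\<close>

definition stieltjes :: "nat \<Rightarrow> (int \<times> int \<Rightarrow> real) \<Rightarrow> real \<Rightarrow> complex" where
  "stieltjes n x y = of_real (1 / n) * (\<Sum>a\<in>{0..<int n}. resolvent n (\<lambda>p q. x (min p q + 1, max p q + 1) / sqrt n) y a a)"

lemma sym_on_min_max: "sym_on n (\<lambda>p q. f (min p q) (max p q))"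
  by (simp add: sym_on_def min.commute max.commute)

lemma stieltjes_continuous:
  assumes "0 < y" "0 < n"
  shows "continuous_on UNIV (\<lambda>x. stieltjes n x y)"
  unfolding stieltjes_def
  by (intro continuous_on_mult continuous_on_const continuous_on_sum
    resolvent_continuous[OF sym_on_min_max[of n "\<lambda>p q. _ (p + 1, q + 1) / sqrt n"] assms])
    (use assms in \<open>auto intro!: continuous_on_divide\<close>)

lemma stieltjes_bound:
  assumes "0 < y" "0 < n"
  shows "cmod (stieltjes n x y) \<le> 1 / y"
proof -
  have "cmod (\<Sum>a\<in>{0..<int n}. resolvent n (\<lambda>p q. x (min p q + 1, max p q + 1) / sqrt n) y a a) \<le> (\<Sum>a\<in>{0..<int n}. 1 / y)"
    by (intro sum_norm_le resolvent_entry_bound[OF sym_on_min_max[of n "\<lambda>p q. x (p + 1, q + 1) / sqrt n"] assms])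
  then have "1 / n * cmod (\<Sum>a\<in>{0..<int n}. resolvent n (\<lambda>p q. x (min p q + 1, max p q + 1) / sqrt n) y a a) \<le> 1 / n * (n * (1 / y))"
    by (intro mult_left_mono) auto
  then show ?thesis using assms by (simp add: stieltjes_def norm_mult norm_divide)
qed

lemma (in prob_space) expectation_sq_le:
  assumes "integrable M f" "integrable M (\<lambda>\<omega>. (f \<omega>)\<^sup>2)" "expectation (\<lambda>\<omega>. (f \<omega>)\<^sup>2) \<le> B"
  shows "expectation f \<le> sqrt B"
proof (rule real_le_rsqrt)
  show "(expectation f)\<^sup>2 \<le> B" using variance_eq[OF assms(1,2)] variance_positive[of f] assms(3) by linarith
qed

lemma sum_of_bool_interval:
  assumes "{p \<in> {0..<int n}. P p} \<subseteq> {a..<a + int m}"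
  shows "(\<Sum>p\<in>{0..<int n}. of_bool (P p)) \<le> real m"
proof -
  have "(\<Sum>p\<in>{0..<int n}. of_bool (P p)) = real (card {p \<in> {0..<int n}. P p})"
    by (simp add: of_bool_def sum.If_cases Int_def)
  also have "card {p \<in> {0..<int n}. P p} \<le> m" using card_mono[OF _ assms] by simp
  finally show ?thesis by simp
qed

locale filtered_model = filtered_noise M X c Z + noisy_comparison M X n F c y K
  for M :: "'a measure" and X c Z n F y K
begin

definition gap :: "int \<Rightarrow> int \<Rightarrow> 'a \<Rightarrow> real" where
  "gap p q \<omega> = Z (min p q + 1) (max p q + 1) \<omega> - cyclic_matrix n F c (pt \<omega>) p q"

lemma cyclic_matrix_w: "cyclic_matrix n F c x p q = (\<Sum>z\<in>F. w z * wigner n x (p - fst z) (q - snd z))"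
  by (simp add: cyclic_matrix_def w_def case_prod_unfold)

lemma wigner_mean_square: "mean_square_le (\<lambda>\<omega>. wigner n (pt \<omega>) p q) 1"
proof (cases "p mod int n = q mod int n")
  case True
  then show ?thesis by (simp add: wigner_def mean_square_le_def)
next
  case False
  then show ?thesis unfolding wigner_def pt_def by (simp add: X_mean_square)
qed

text \<open>A crude bound valid for all entries, with \<open>6 * mass\<^sup>2\<close> arising as
  \<open>2 * (2 * mass\<^sup>2) + 2 * mass\<^sup>2\<close>.\<close>

lemma gap_le: "mean_square_le (gap p q) (6 * mass\<^sup>2)"
proof -
  have 1: "mean_square_le (Z (min p q + 1) (max p q + 1)) (2 * mass\<^sup>2)"
    using Z_partial_sum[of "{}"] by simp
  have "mean_square_le (\<lambda>\<omega>. cyclic_matrix n F c (pt \<omega>) p q) (C\<^sup>2)"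
    unfolding cyclic_matrix_w C_w by (rule mean_square_le_sum[OF F wigner_mean_square])
  then have 2: "mean_square_le (\<lambda>\<omega>. cyclic_matrix n F c (pt \<omega>) p q) (mass\<^sup>2)"
    using C_sq_le by (rule mean_square_le_mono)
  show ?thesis using mean_square_le_diff[OF 1 2] by (simp add: gap_def[abs_def])
qed

text \<open>Away from the border no index wraps around, and at distance more than \<open>2 K\<close>
  from the diagonal the shifted indices keep their order, so folding by \<open>min\<close> and
  \<open>max\<close> has no effect. The cyclic entry is then a partial sum of the series for
  \<open>Z\<close>.\<close>

lemma gap_le_inner:
  assumes pq: "int K \<le> min p q" "max p q + int K < int n" "2 * int K < max p q - min p q"
  shows "mean_square_le (gap p q) (2 * (mass - C)\<^sup>2)"
proof -
  define p' where "p' = min p q"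
  define q' where "q' = max p q"
  have e: "cyclic_matrix n F c x p q = cyclic_matrix n F c x p' q'" for x
    unfolding p'_def q'_def by (cases "p \<le> q") (simp_all add: cyclic_matrix_sym[of x p q])
  have "wigner n (pt \<omega>) (p' - fst z) (q' - snd z) = X (p' + 1 - fst z, q' + 1 - snd z) \<omega>" if "z \<in> F" for z \<omega>
  proof -
    have b: "\<bar>fst z\<bar> \<le> int K" "\<bar>snd z\<bar> \<le> int K" using F_box[of "fst z" "snd z"] that by auto
    then have r: "(p' - fst z) mod int n = p' - fst z" "(q' - snd z) mod int n = q' - snd z"
      using pq unfolding p'_def[symmetric] q'_def[symmetric] by (auto intro!: mod_pos_pos_trivial)
    have "p' - fst z < q' - snd z" using b pq unfolding p'_def[symmetric] q'_def[symmetric] by linarith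
    then show ?thesis unfolding wigner_def r pt_def by (simp add: algebra_simps)
  qed
  then have "gap p q = (\<lambda>\<omega>. Z (p' + 1) (q' + 1) \<omega> - (\<Sum>z\<in>F. w z * X (p' + 1 - fst z, q' + 1 - snd z) \<omega>))"
    unfolding gap_def[abs_def] e unfolding cyclic_matrix_w p'_def[symmetric] q'_def[symmetric] by (intro ext) simp
  then show ?thesis using Z_partial_sum[OF F, of "p' + 1" "q' + 1"] by (simp add: C_w)
qed

lemma gap_expectation:
  assumes "p \<in> I" "q \<in> I"
  shows "expectation (\<lambda>\<omega>. (gap p q \<omega>)\<^sup>2) \<le> 2 * (mass - C)\<^sup>2 + 6 * mass\<^sup>2 *
    (of_bool (p < int K) + of_bool (q < int K) + of_bool (int n \<le> p + int K) + of_bool (int n \<le> q + int K) + of_bool (\<bar>p - q\<bar> \<le> 2 * int K))"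
proof (cases "int K \<le> min p q \<and> max p q + int K < int n \<and> 2 * int K < max p q - min p q")
  case True
  then have "expectation (\<lambda>\<omega>. (gap p q \<omega>)\<^sup>2) \<le> 2 * (mass - C)\<^sup>2"
    by (intro mean_square_le_expectation(2) gap_le_inner) auto
  then show ?thesis by (rule order_trans) simp
next
  case False
  then have "1 \<le> of_bool (p < int K) + of_bool (q < int K) + of_bool (int n \<le> p + int K) + of_bool (int n \<le> q + int K) + (of_bool (\<bar>p - q\<bar> \<le> 2 * int K) :: real)"
    by (cases "p \<le> q") (auto simp: not_le not_less)
  from mult_left_mono[OF this, of "6 * mass\<^sup>2"] have "6 * mass\<^sup>2 \<le> 6 * mass\<^sup>2 *
    (of_bool (p < int K) + of_bool (q < int K) + of_bool (int n \<le> p + int K) + of_bool (int n \<le> q + int K) + of_bool (\<bar>p - q\<bar> \<le> 2 * int K))" by simp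
  moreover have "expectation (\<lambda>\<omega>. (gap p q \<omega>)\<^sup>2) \<le> 6 * mass\<^sup>2"
    by (intro mean_square_le_expectation(2) gap_le) simp
  ultimately show ?thesis using zero_le_power2[of "mass - C"] by linarith
qed

text \<open>Four border strips of width \<open>K\<close> and a diagonal band of width
  \<open>4 K + 1\<close> add up to \<open>8 K + 1\<close> exceptional entries per row on average,
  which is negligible against \<open>n\<close>.\<close>

lemma gap_sum: "(\<Sum>p\<in>I. \<Sum>q\<in>I. expectation (\<lambda>\<omega>. (gap p q \<omega>)\<^sup>2)) \<le> (real n)\<^sup>2 * (2 * (mass - C)\<^sup>2 + 6 * mass\<^sup>2 * (8 * real K + 1) / n)"
proof -
  have 1: "(\<Sum>p\<in>I. of_bool (p < int K)) \<le> real K" by (rule sum_of_bool_interval[of _ _ 0]) auto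
  have 2: "(\<Sum>p\<in>I. of_bool (int n \<le> p + int K)) \<le> real K" by (rule sum_of_bool_interval[of _ _ "int n - int K"]) auto
  have 3: "(\<Sum>q\<in>I. of_bool (\<bar>p - q\<bar> \<le> 2 * int K)) \<le> real (4 * K + 1)" for p
    by (rule sum_of_bool_interval[of _ _ "p - 2 * int K"]) auto
  have "(\<Sum>p\<in>I. \<Sum>q\<in>I. expectation (\<lambda>\<omega>. (gap p q \<omega>)\<^sup>2)) \<le> (\<Sum>p\<in>I. \<Sum>q\<in>I. 2 * (mass - C)\<^sup>2 + 6 * mass\<^sup>2 *
    (of_bool (p < int K) + of_bool (q < int K) + of_bool (int n \<le> p + int K) + of_bool (int n \<le> q + int K) + of_bool (\<bar>p - q\<bar> \<le> 2 * int K)))"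
    by (intro sum_mono gap_expectation)
  also have "\<dots> = (real n)\<^sup>2 * (2 * (mass - C)\<^sup>2) + 6 * mass\<^sup>2 * (real n * (\<Sum>p\<in>I. of_bool (p < int K)) + real n * (\<Sum>q\<in>I. of_bool (q < int K))
      + real n * (\<Sum>p\<in>I. of_bool (int n \<le> p + int K)) + real n * (\<Sum>q\<in>I. of_bool (int n \<le> q + int K)) + (\<Sum>p\<in>I. \<Sum>q\<in>I. of_bool (\<bar>p - q\<bar> \<le> 2 * int K)))"
    unfolding sum.distrib sum_distrib_left[symmetric] by (simp add: power2_eq_square sum_distrib_left[symmetric])
  also have "\<dots> \<le> (real n)\<^sup>2 * (2 * (mass - C)\<^sup>2) + 6 * mass\<^sup>2 * (real n * real K + real n * real K + real n * real K + real n * real K + (\<Sum>p\<in>I. real (4 * K + 1)))"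
    by (intro add_mono mult_left_mono sum_mono order_refl 1 2 3) auto
  also have "\<dots> = (real n)\<^sup>2 * (2 * (mass - C)\<^sup>2 + 6 * mass\<^sup>2 * (8 * real K + 1) / n)"
    using n by (simp add: field_simps power2_eq_square)
  finally show ?thesis .
qed

lemma stieltjes_difference:
  "(cmod (stieltjes n (\<lambda>(i, j). Z i j \<omega>) y - g (pt \<omega>) 0))\<^sup>2 \<le> 1 / ((real n)\<^sup>2 * y ^ 4) * (\<Sum>p\<in>I. \<Sum>q\<in>I. (gap p q \<omega>)\<^sup>2)"
proof -
  let ?H = "\<lambda>p q. Z (min p q + 1) (max p q + 1) \<omega> / sqrt n"
  let ?t = "\<Sum>a\<in>I. resolvent n ?H y a a" and ?t' = "\<Sum>a\<in>I. resolvent n (H (pt \<omega>)) y a a"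
  have "stieltjes n (\<lambda>(i, j). Z i j \<omega>) y - g (pt \<omega>) 0 = of_real (1 / n) * (?t - ?t')"
    by (simp add: stieltjes_def g_def G_def h_sq right_diff_distrib)
  then have "(cmod (stieltjes n (\<lambda>(i, j). Z i j \<omega>) y - g (pt \<omega>) 0))\<^sup>2 = 1 / (real n)\<^sup>2 * (cmod (?t - ?t'))\<^sup>2"
    by (simp add: norm_mult norm_divide power_mult_distrib power_divide)
  also have "\<dots> \<le> 1 / (real n)\<^sup>2 * (n / y ^ 4 * (\<Sum>p\<in>I. \<Sum>q\<in>I. (?H p q - H (pt \<omega>) p q)\<^sup>2))"
    by (intro mult_left_mono resolvent_trace_difference[OF sym_on_min_max[of n "\<lambda>p q. Z (p + 1) (q + 1) \<omega> / sqrt n"] y H_sym n]) simp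
  also have "(\<Sum>p\<in>I. \<Sum>q\<in>I. (?H p q - H (pt \<omega>) p q)\<^sup>2) = (\<Sum>p\<in>I. \<Sum>q\<in>I. 1 / n * (gap p q \<omega>)\<^sup>2)"
  proof (intro sum.cong refl)
    fix p q
    have "?H p q - H (pt \<omega>) p q = h * gap p q \<omega>" by (simp add: H_def h_def gap_def right_diff_distrib)
    then show "(?H p q - H (pt \<omega>) p q)\<^sup>2 = 1 / n * (gap p q \<omega>)\<^sup>2" by (simp only: power_mult_distrib h_sq)
  qed
  also have "\<dots> = 1 / n * (\<Sum>p\<in>I. \<Sum>q\<in>I. (gap p q \<omega>)\<^sup>2)" by (simp only: sum_distrib_left)
  also have "1 / (real n)\<^sup>2 * (n / y ^ 4 * (1 / n * (\<Sum>p\<in>I. \<Sum>q\<in>I. (gap p q \<omega>)\<^sup>2))) = 1 / ((real n)\<^sup>2 * y ^ 4) * (\<Sum>p\<in>I. \<Sum>q\<in>I. (gap p q \<omega>)\<^sup>2)"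
    using n by simp
  finally show ?thesis .
qed

lemma Z_point_meas: "(\<lambda>\<omega>. (\<lambda>(i, j). Z i j \<omega>)) \<in> M \<rightarrow>\<^sub>M (borel :: (int \<times> int \<Rightarrow> real) measure)"
  by (rule measurable_coordinatewise_then_product) (simp add: case_prod_unfold)

lemma stieltjes_meas: "(\<lambda>\<omega>. stieltjes n (\<lambda>(i, j). Z i j \<omega>) y) \<in> borel_measurable M"
  by (rule measurable_compose[OF Z_point_meas borel_measurable_continuous_onI[OF stieltjes_continuous[OF y n]]])

lemma gn_meas: "(\<lambda>\<omega>. g (pt \<omega>) k) \<in> borel_measurable M"
  by (rule measurable_compose[OF pt_meas g_meas])

lemma stieltjes_comparison:
  "expectation (\<lambda>\<omega>. cmod (stieltjes n (\<lambda>(i, j). Z i j \<omega>) y - g (pt \<omega>) 0)) \<le> sqrt (1 / y ^ 4 * (2 * (mass - C)\<^sup>2 + 6 * mass\<^sup>2 * (8 * real K + 1) / n))"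
proof (rule expectation_sq_le)
  let ?f = "\<lambda>\<omega>. cmod (stieltjes n (\<lambda>(i, j). Z i j \<omega>) y - g (pt \<omega>) 0)"
  have m: "?f \<in> borel_measurable M" using stieltjes_meas gn_meas by simp
  have b: "?f \<omega> \<le> 2 / y" for \<omega>
    using norm_triangle_ineq4[of "stieltjes n (\<lambda>(i, j). Z i j \<omega>) y" "g (pt \<omega>) 0"] stieltjes_bound[OF y n] g_bound[of "pt \<omega>" 0]
    by (smt (verit) add_divide_distrib)
  show "integrable M ?f" by (rule integrable_const_bound[of _ "2 / y"]) (use m b in auto)
  show i: "integrable M (\<lambda>\<omega>. (?f \<omega>)\<^sup>2)" by (rule integrable_const_bound[of _ "(2 / y)\<^sup>2"]) (use m b in \<open>auto intro!: power_mono\<close>)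
  have gi: "integrable M (\<lambda>\<omega>. (gap p q \<omega>)\<^sup>2)" for p q by (rule mean_square_le_expectation(1)[OF gap_le]) simp
  have "expectation (\<lambda>\<omega>. (?f \<omega>)\<^sup>2) \<le> expectation (\<lambda>\<omega>. 1 / ((real n)\<^sup>2 * y ^ 4) * (\<Sum>p\<in>I. \<Sum>q\<in>I. (gap p q \<omega>)\<^sup>2))"
    by (intro integral_mono i stieltjes_difference integrable_mult_right Bochner_Integration.integrable_sum gi)
  also have "\<dots> = 1 / ((real n)\<^sup>2 * y ^ 4) * (\<Sum>p\<in>I. \<Sum>q\<in>I. expectation (\<lambda>\<omega>. (gap p q \<omega>)\<^sup>2))"
    using gi by simp
  also have "\<dots> \<le> 1 / ((real n)\<^sup>2 * y ^ 4) * ((real n)\<^sup>2 * (2 * (mass - C)\<^sup>2 + 6 * mass\<^sup>2 * (8 * real K + 1) / n))"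
    by (intro mult_left_mono gap_sum) auto
  also have "\<dots> = 1 / y ^ 4 * (2 * (mass - C)\<^sup>2 + 6 * mass\<^sup>2 * (8 * real K + 1) / n)" using n by simp
  finally show "expectation (\<lambda>\<omega>. (?f \<omega>)\<^sup>2) \<le> 1 / y ^ 4 * (2 * (mass - C)\<^sup>2 + 6 * mass\<^sup>2 * (8 * real K + 1) / n)" .
qed

lemma stieltjes_deviation:
  assumes "2 * int K * int J < int n"
  shows "expectation (\<lambda>\<omega>. cmod (stieltjes n (\<lambda>(i, j). Z i j \<omega>) y - green y 0)) \<le>
    sqrt (1 / y ^ 4 * (2 * (mass - C)\<^sup>2 + 6 * mass\<^sup>2 * (8 * real K + 1) / n)) + (2 * step_err + 3 / y * (1 / 2) ^ J)"
proof -
  let ?s = "\<lambda>\<omega>. stieltjes n (\<lambda>(i, j). Z i j \<omega>) y"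
  have i1: "integrable M (\<lambda>\<omega>. cmod (?s \<omega> - g (pt \<omega>) 0))"
  proof (rule integrable_const_bound[of _ "1 / y + 1 / y"])
    show "AE \<omega> in M. norm (cmod (?s \<omega> - g (pt \<omega>) 0)) \<le> 1 / y + 1 / y"
      by (intro AE_I2) (simp only: real_norm_def abs_norm_cancel, intro order_trans[OF norm_triangle_ineq4] add_mono stieltjes_bound[OF y n] g_bound)
  qed (use stieltjes_meas gn_meas in simp)
  have i2: "integrable M (\<lambda>\<omega>. cmod (?s \<omega> - green y 0))"
  proof (rule integrable_const_bound[of _ "1 / y + 2 / y"])
    show "AE \<omega> in M. norm (cmod (?s \<omega> - green y 0)) \<le> 1 / y + 2 / y"
      by (intro AE_I2) (simp only: real_norm_def abs_norm_cancel, intro order_trans[OF norm_triangle_ineq4] add_mono stieltjes_bound[OF y n] green_bound[OF y \<rho>_small])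
  qed (use stieltjes_meas in simp)
  have "expectation (\<lambda>\<omega>. cmod (?s \<omega> - green y 0)) \<le> expectation (\<lambda>\<omega>. cmod (?s \<omega> - g (pt \<omega>) 0) + err (pt \<omega>) 0)"
  proof (intro integral_mono i2 Bochner_Integration.integrable_add i1 err_integrable)
    show "cmod (?s \<omega> - green y 0) \<le> cmod (?s \<omega> - g (pt \<omega>) 0) + err (pt \<omega>) 0" for \<omega>
      using norm_triangle_ineq[of "?s \<omega> - g (pt \<omega>) 0" "g (pt \<omega>) 0 - green y 0"] by (simp add: err_def)
  qed
  also have "\<dots> = expectation (\<lambda>\<omega>. cmod (?s \<omega> - g (pt \<omega>) 0)) + dev 0"
    unfolding dev_def by (rule Bochner_Integration.integral_add[OF i1 err_integrable])
  also have "\<dots> \<le> sqrt (1 / y ^ 4 * (2 * (mass - C)\<^sup>2 + 6 * mass\<^sup>2 * (8 * real K + 1) / n)) + (2 * step_err + 3 / y * (1 / 2) ^ J)"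
    by (intro add_mono stieltjes_comparison dev_contract) (use assms in simp)
  finally show ?thesis .
qed

end

context filtered_noise
begin

text \<open>The box size \<open>K\<close> makes the truncation terms small and \<open>J\<close> the
  contraction term; with both fixed, the Lindeberg sum and the terms that decay in \<open>n\<close>
  tend to 0.\<close>

theorem stieltjes_convergence:
  assumes y: "0 < y" "6 * mass\<^sup>2 \<le> y\<^sup>2"
  shows "(\<lambda>n. expectation (\<lambda>\<omega>. cmod (stieltjes n (\<lambda>(i, j). Z i j \<omega>) y - green y 0))) \<longlonglongrightarrow> 0"
proof (rule order_tendstoI)
  fix a :: real assume "a < 0"
  then show "\<forall>\<^sub>F n in sequentially. a < expectation (\<lambda>\<omega>. cmod (stieltjes n (\<lambda>(i, j). Z i j \<omega>) y - green y 0))"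
    by (intro always_eventually allI less_le_trans[OF _ integral_nonneg_AE]) auto
next
  fix e :: real assume e: "0 < e"
  \<comment> \<open>\<open>L\<close> collects the coefficients of \<open>mass - C0\<close> in the
    final estimate: \<open>2 / y\<^sup>2\<close> from the matrix comparison and
    \<open>16 * mass / y ^ 3\<close> from the truncated correlations. Adding 1 keeps it
    positive.\<close>
  define L where "L = 2 / y\<^sup>2 + 16 * mass / y ^ 3 + 1"
  have L: "0 < L" unfolding L_def using y mass_nonneg by (intro add_nonneg_pos add_nonneg_nonneg divide_nonneg_pos) auto
  obtain K :: nat where K: "mass - e / (4 * L) < (\<Sum>z\<in>{- int K..int K} \<times> {- int K..int K}. \<bar>w z\<bar>)"
    using mass_box[of "e / (4 * L)"] e L by auto
  define F0 where "F0 = {- int K..int K} \<times> {- int K..int K}"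
  \<comment> \<open>Outside their locales the constants \<open>C\<close> and
    \<open>Res_const\<close> visibly take no argument \<open>n\<close>, so they stay fixed in the
    limit; only \<open>Lam\<close> varies with \<open>n\<close>.\<close>
  define C0 where "C0 = cyclic_model.C F0 c"
  define Rc where "Rc = noisy_model.Res_const F0 c y"
  define Lam where "Lam n = noisy_model.\<Lambda> M X n" for n
  have model: "filtered_model M X c Z n F0 y K" if "0 < n" for n
    by unfold_locales (use that y c_sym in \<open>auto simp: F0_def\<close>)
  have Cw: "C0 = (\<Sum>z\<in>F0. \<bar>w z\<bar>)"
  proof -
    interpret filtered_model M X c Z 1 F0 y K by (rule model) simp
    show ?thesis unfolding C0_def by (rule C_w)
  qed
  have C_le: "C0 \<le> mass" and C_nonneg: "0 \<le> C0" unfolding Cw using finite_mass[of F0] by (auto simp: F0_def intro: sum_nonneg)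
  have gap: "mass - C0 < e / (4 * L)" using K unfolding Cw F0_def by simp
  obtain J where J: "(1 / 2 :: real) ^ J < e * y / 12"
    using real_arch_pow_inv[of "e * y / 12" "1 / 2"] e y by auto
  have Lam_nonneg: "0 \<le> Lam n" if "0 < n" for n
  proof -
    interpret filtered_model M X c Z n F0 y K by (rule model[OF that])
    show ?thesis unfolding Lam_def by (rule \<Lambda>_nonneg)
  qed
  have Lam: "Lam \<longlonglongrightarrow> 0"
  proof (rule order_tendstoI)
    fix a :: real assume a: "a < 0"
    show "\<forall>\<^sub>F n in sequentially. a < Lam n"
      by (rule eventually_mono[OF eventually_gt_at_top[of 0]]) (rule less_le_trans[OF a Lam_nonneg])
  next
    fix a :: real assume a: "0 < a"
    let ?T = "\<lambda>n. 1 / (real n)\<^sup>2 * (\<Sum>i = 1..int n. \<Sum>j = 1..int n. noisy_model.tail M X n (a / 2) i j)"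
    have "?T \<longlonglongrightarrow> 0"
    proof (rule Lim_transform_eventually[OF pastur[of "a / 2"]])
      show "\<forall>\<^sub>F n in sequentially. 1 / (real n)\<^sup>2 * (\<Sum>i = 1..int n. \<Sum>j = 1..int n.
          expectation (\<lambda>\<omega>. (X (i, j) \<omega>)\<^sup>2 * indicator {\<omega>. a / 2 * sqrt (real n) < \<bar>X (i, j) \<omega>\<bar>} \<omega>)) = ?T n"
        using eventually_gt_at_top[of 0]
      proof eventually_elim
        case (elim n)
        interpret filtered_model M X c Z n F0 y K by (rule model[OF elim])
        show ?case unfolding tail_def ..
      qed
    qed (use a in simp)
    then have "\<forall>\<^sub>F n in sequentially. ?T n < a / 4" using a by (intro order_tendstoD) auto
    then show "\<forall>\<^sub>F n in sequentially. Lam n < a"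
      using eventually_gt_at_top[of 0]
    proof eventually_elim
      case (elim n)
      interpret filtered_model M X c Z n F0 y K by (rule model[OF elim(2)])
      show ?case using \<Lambda>_le[of "a / 2"] elim(1) a unfolding Lam_def by linarith
    qed
  qed
  let ?B = "\<lambda>n. sqrt (1 / y ^ 4 * (2 * (mass - C0)\<^sup>2 + 6 * mass\<^sup>2 * (8 * real K + 1) / real n)) +
    (2 * ((sqrt (Rc * (Lam n + 1 / sqrt (real n))) + 4 / y\<^sup>2 * (mass\<^sup>2 - C0\<^sup>2)) / y) + 3 / y * (1 / 2) ^ J)"
  have l1: "(\<lambda>n. 6 * mass\<^sup>2 * (8 * real K + 1) / real n) \<longlonglongrightarrow> 0" by (rule lim_const_over_n)
  have l2: "(\<lambda>n. 1 / sqrt (real n)) \<longlonglongrightarrow> 0" by real_asymp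
  have y0: "y \<noteq> 0" using y by simp
  have "?B \<longlonglongrightarrow> sqrt (1 / y ^ 4 * (2 * (mass - C0)\<^sup>2 + 0)) +
    (2 * ((sqrt (Rc * (0 + 0)) + 4 / y\<^sup>2 * (mass\<^sup>2 - C0\<^sup>2)) / y) + 3 / y * (1 / 2) ^ J)"
    by (rule tendsto_add[OF tendsto_real_sqrt[OF tendsto_mult[OF tendsto_const tendsto_add[OF tendsto_const l1]]]
      tendsto_add[OF tendsto_mult[OF tendsto_const tendsto_divide[OF tendsto_add[OF tendsto_real_sqrt[OF tendsto_mult[OF tendsto_const tendsto_add[OF Lam l2]]] tendsto_const] tendsto_const y0]] tendsto_const]])
  moreover have "sqrt (1 / y ^ 4 * (2 * (mass - C0)\<^sup>2 + 0)) +
    (2 * ((sqrt (Rc * (0 + 0)) + 4 / y\<^sup>2 * (mass\<^sup>2 - C0\<^sup>2)) / y) + 3 / y * (1 / 2) ^ J) < e"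
  proof -
    have "sqrt (1 / y ^ 4 * (2 * (mass - C0)\<^sup>2 + 0)) \<le> sqrt ((2 / y\<^sup>2 * (mass - C0))\<^sup>2)"
    proof (rule real_sqrt_le_mono)
      have "1 / y ^ 4 * (2 * (mass - C0)\<^sup>2 + 0) \<le> 1 / y ^ 4 * (4 * (mass - C0)\<^sup>2)" by (intro mult_left_mono) auto
      also have "\<dots> = (2 / y\<^sup>2 * (mass - C0))\<^sup>2" by (simp only: power_mult_distrib power_divide power_mult[symmetric]) simp
      finally show "1 / y ^ 4 * (2 * (mass - C0)\<^sup>2 + 0) \<le> (2 / y\<^sup>2 * (mass - C0))\<^sup>2" .
    qed
    also have "\<dots> = 2 / y\<^sup>2 * (mass - C0)" using C_le y by simp
    finally have 1: "sqrt (1 / y ^ 4 * (2 * (mass - C0)\<^sup>2 + 0)) \<le> 2 / y\<^sup>2 * (mass - C0)" .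
    have "mass\<^sup>2 - C0\<^sup>2 = (mass + C0) * (mass - C0)" by (simp add: power2_eq_square algebra_simps)
    also have "\<dots> \<le> (2 * mass) * (mass - C0)" using C_le by (intro mult_right_mono) auto
    finally have "8 / y ^ 3 * (mass\<^sup>2 - C0\<^sup>2) \<le> 8 / y ^ 3 * (2 * mass * (mass - C0))" using y by (intro mult_left_mono) auto
    then have 2: "8 / y ^ 3 * (mass\<^sup>2 - C0\<^sup>2) \<le> 16 * mass / y ^ 3 * (mass - C0)" by (simp add: mult_ac)
    have "2 / y\<^sup>2 * (mass - C0) + 16 * mass / y ^ 3 * (mass - C0) \<le> L * (mass - C0)"
      unfolding L_def distrib_right using C_le by simp
    also have "\<dots> \<le> L * (e / (4 * L))" using gap L by (intro mult_left_mono) auto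
    also have "\<dots> = e / 4" using L by simp
    finally have 3: "2 / y\<^sup>2 * (mass - C0) + 16 * mass / y ^ 3 * (mass - C0) \<le> e / 4" .
    have "3 / y * (1 / 2) ^ J \<le> 3 / y * (e * y / 12)" using J y by (intro mult_left_mono) auto
    also have "\<dots> = e / 4" using y by simp
    finally have 4: "3 / y * (1 / 2) ^ J \<le> e / 4" .
    have "2 * ((sqrt (Rc * (0 + 0)) + 4 / y\<^sup>2 * (mass\<^sup>2 - C0\<^sup>2)) / y) = 8 / y ^ 3 * (mass\<^sup>2 - C0\<^sup>2)"
      by (simp add: power3_eq_cube power2_eq_square)
    with 1 2 3 4 e show ?thesis by linarith
  qed
  ultimately have "\<forall>\<^sub>F n in sequentially. ?B n < e" by (rule order_tendstoD)
  then show "\<forall>\<^sub>F n in sequentially. expectation (\<lambda>\<omega>. cmod (stieltjes n (\<lambda>(i, j). Z i j \<omega>) y - green y 0)) < e"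
    using eventually_gt_at_top[of "2 * K * J"]
  proof eventually_elim
    case (elim n)
    then interpret filtered_model M X c Z n F0 y K by (intro model) simp
    have "2 * int K * int J < int n" using elim(2) by (metis of_nat_less_iff of_nat_mult of_nat_numeral)
    from stieltjes_deviation[OF this] elim(1) show ?case
      unfolding step_err_def h_def C0_def Rc_def Lam_def by linarith
  qed
qed

end

section \<open>Empirical spectral distributions\<close>

definition esd :: "nat \<Rightarrow> (int \<times> int \<Rightarrow> real) \<Rightarrow> real measure" where
  "esd n x = scaled_esd (sym_matrix (\<lambda>i j. x (i, j)) n)"

definition spectrum :: "nat \<Rightarrow> (int \<times> int \<Rightarrow> real) \<Rightarrow> nat \<Rightarrow> real" where
  "spectrum n x i = eigenvalue_list (sym_matrix (\<lambda>i j. x (i, j)) n) ! i / sqrt (real n)"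

lemma esd_eq: "esd n x = distr (uniform_count_measure {..<n}) borel (spectrum n x)"
  by (simp add: esd_def scaled_esd_def spectrum_def[abs_def] sym_matrix_def Let_def)

lemma esd_real_distribution: "0 < n \<Longrightarrow> real_distribution (esd n x)"
  unfolding esd_eq by (rule prob_space.real_distribution_distr[OF prob_space_uniform_count_measure]) (auto simp: measurable_def sets_uniform_count_measure space_uniform_count_measure)

lemma spectrum_meas: "spectrum n x \<in> uniform_count_measure {..<n} \<rightarrow>\<^sub>M borel"
  by (auto simp: measurable_def sets_uniform_count_measure space_uniform_count_measure)

lemma esd_integral:
  fixes f :: "real \<Rightarrow> real"
  assumes "f \<in> borel_measurable borel"
  shows "(\<integral>t. f t \<partial>esd n x) = (\<Sum>i<n. f (spectrum n x i)) / n" "integrable (esd n x) f"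
proof -
  show "(\<integral>t. f t \<partial>esd n x) = (\<Sum>i<n. f (spectrum n x i)) / n"
    unfolding esd_eq integral_distr[OF spectrum_meas assms] by (subst integral_uniform_count_measure) auto
  show "integrable (esd n x) f"
    unfolding esd_eq integrable_distr_eq[OF spectrum_meas assms] unfolding uniform_count_measure_def
    by (rule integrable_point_measure_finite) simp
qed

text \<open>\<open>H / s - \<i> y\<close> equals \<open>(H - \<i> y s) / s\<close>, so its inverse
  is \<open>s\<close> times the resolvent at the rescaled height. This links the scaled matrix in
  \<open>stieltjes\<close> with the unscaled one whose eigenvalues enter
  \<open>scaled_esd\<close>.\<close>

lemma resolvent_scale:
  assumes H: "sym_on n H" and s: "0 < s" and y: "0 < y" and ab: "a \<in> {0..<int n}" "b \<in> {0..<int n}"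
  shows "resolvent n (\<lambda>p q. H p q / s) y a b = of_real s * resolvent n H (y * s) a b"
proof (rule is_resolvent_unique[OF _ resolvent_is_resolvent _ ab])
  show sym: "sym_on n (\<lambda>p q. H p q / s)" using H by (simp add: sym_on_def)
  then show "sym_on n (\<lambda>p q. H p q / s)" .
  have e: "shifted (\<lambda>p q. H p q / s) y a b * (of_real s * r) = shifted H (y * s) a b * r" for a b r
    using s by (simp add: shifted_def field_simps)
  show "is_resolvent n (\<lambda>p q. H p q / s) y (\<lambda>a b. of_real s * resolvent n H (y * s) a b)"
    unfolding is_resolvent_def e using resolvent_is_resolvent[OF H, of "y * s"] s y by (simp add: is_resolvent_def)
qed (use y in simp)

lemma stieltjes_spectrum:
  assumes n: "0 < n" and y: "0 < y"
  shows "stieltjes n x y = of_real (1 / n) * (\<Sum>i<n. 1 / (of_real (spectrum n x i) - \<i> * of_real y))"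
proof -
  let ?A = "sym_matrix (\<lambda>i j. x (i, j)) n" and ?H = "\<lambda>p q. x (min p q + 1, max p q + 1)"
  let ?s = "sqrt (real n)"
  have s: "0 < ?s" using n by simp
  have H: "sym_on n ?H" using sym_on_min_max[of n "\<lambda>p q. x (p + 1, q + 1)"] .
  have "(\<Sum>a\<in>{0..<int n}. resolvent n (\<lambda>p q. ?H p q / ?s) y a a) = (\<Sum>a\<in>{0..<int n}. of_real ?s * resolvent n ?H (y * ?s) a a)"
    by (intro sum.cong refl resolvent_scale H s y)
  also have "\<dots> = of_real ?s * (\<Sum>i<n. 1 / (of_real (eigenvalue_list ?A ! i) - \<i> * of_real (y * ?s)))"
    unfolding sum_distrib_left[symmetric]
  proof (rule arg_cong[OF resolvent_trace_eigenvalues[OF _ H _ _ n]])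
    show "?A $$ (i, j) = ?H (int i) (int j)" if "i < n" "j < n" for i j
      using that by (simp add: sym_matrix_def min_def max_def add.commute)
  qed (use s y in \<open>auto simp: sym_matrix_def\<close>)
  also have "\<dots> = (\<Sum>i<n. 1 / (of_real (spectrum n x i) - \<i> * of_real y))"
    unfolding sum_distrib_left
  proof (intro sum.cong refl)
    fix i
    have s0: "complex_of_real ?s \<noteq> 0" using s by simp
    have "of_real (eigenvalue_list ?A ! i) - \<i> * of_real (y * ?s) = of_real ?s * (of_real (spectrum n x i) - \<i> * of_real y)"
      using s0 by (simp add: spectrum_def algebra_simps)
    then show "of_real ?s * (1 / (of_real (eigenvalue_list ?A ! i) - \<i> * of_real (y * ?s))) = 1 / (of_real (spectrum n x i) - \<i> * of_real y)"
      using s0 by simp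
  qed
  finally show ?thesis by (simp add: stieltjes_def)
qed

text \<open>Imaginary and real part of \<open>1 / (t - \<i> y)\<close> are
  \<open>y / (t\<^sup>2 + y\<^sup>2)\<close> and \<open>t / (t\<^sup>2 + y\<^sup>2)\<close>, hence
  the different powers of \<open>y\<close>.\<close>

lemma mass_part_stieltjes:
  assumes n: "0 < n" and y: "0 < y"
  shows "mass_part (esd n x) 0 y = y * Im (stieltjes n x y)" "mass_part (esd n x) 1 y = y\<^sup>2 * Re (stieltjes n x y)"
proof -
  have e: "Im (1 / (of_real t - \<i> * of_real y)) = y / (t\<^sup>2 + y\<^sup>2)" "Re (1 / (of_real t - \<i> * of_real y)) = t / (t\<^sup>2 + y\<^sup>2)" for t :: real
    by (simp_all add: Im_divide Re_divide power2_eq_square)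
  have im: "Im (stieltjes n x y) = 1 / n * (\<Sum>i<n. y / ((spectrum n x i)\<^sup>2 + y\<^sup>2))"
    and re: "Re (stieltjes n x y) = 1 / n * (\<Sum>i<n. spectrum n x i / ((spectrum n x i)\<^sup>2 + y\<^sup>2))"
    unfolding stieltjes_spectrum[OF n y]
    by (simp_all only: times_complex.sel Re_complex_of_real Im_complex_of_real Im_sum Re_sum e mult_zero_left add_0_right diff_zero)
  have "mass_part (esd n x) 0 y = (\<Sum>i<n. y * (y / ((spectrum n x i)\<^sup>2 + y\<^sup>2))) / n"
    unfolding mass_part_def by (subst esd_integral) (auto simp: power2_eq_square)
  then show "mass_part (esd n x) 0 y = y * Im (stieltjes n x y)"
    unfolding im sum_distrib_left[symmetric] by simp
  have "mass_part (esd n x) 1 y = (\<Sum>i<n. y\<^sup>2 * (spectrum n x i / ((spectrum n x i)\<^sup>2 + y\<^sup>2))) / n"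
    unfolding mass_part_def by (subst esd_integral) (auto simp: mult_ac)
  then show "mass_part (esd n x) 1 y = y\<^sup>2 * Re (stieltjes n x y)"
    unfolding re sum_distrib_left[symmetric] by simp
qed

lemma geometric_kernel:
  fixes t N :: real
  assumes "\<bar>t\<bar> < N"
  shows "(\<lambda>j. (-1) ^ j * t ^ (q + 2 * j) / N ^ (2 * j)) sums (t ^ q * (N\<^sup>2 / (t\<^sup>2 + N\<^sup>2)))"
proof -
  have N: "0 < N" using assms by linarith
  have "t\<^sup>2 < N\<^sup>2" using assms N by (metis abs_ge_zero power2_abs power_strict_mono zero_less_numeral)
  then have r: "norm (- (t\<^sup>2 / N\<^sup>2)) < 1" using N by simp
  have S: "(\<lambda>j. t ^ q * (- (t\<^sup>2 / N\<^sup>2)) ^ j) sums (t ^ q * (1 / (1 - (- (t\<^sup>2 / N\<^sup>2)))))"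
    by (intro sums_mult geometric_sums r)
  have e1: "t ^ q * (- (t\<^sup>2 / N\<^sup>2)) ^ j = (-1) ^ j * t ^ (q + 2 * j) / N ^ (2 * j)" for j
    by (simp add: power_minus[of "t\<^sup>2 / N\<^sup>2"] power_divide power_add power_mult)
  have e2: "1 / (1 - (- (t\<^sup>2 / N\<^sup>2))) = N\<^sup>2 / (t\<^sup>2 + N\<^sup>2)"
    using N by (simp add: field_simps)
  show ?thesis using S unfolding e1 e2 .
qed

text \<open>A spectral distribution has compact support, so its moments determine the limit.\<close>

lemma esd_weak_conv:
  assumes n: "0 < n" and lim: "\<And>y. 0 < y \<Longrightarrow> (\<lambda>k. stieltjes n (u k) y) \<longlonglongrightarrow> stieltjes n x y"
  shows "weak_conv_m (\<lambda>k. esd n (u k)) (esd n x)"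
proof -
  define C where "C = (\<Sum>i<n. \<bar>spectrum n x i\<bar>)"
  define d where "d p = (\<Sum>i<n. spectrum n x i ^ p) / n" for p
  have sp: "\<bar>spectrum n x i\<bar> \<le> C" if "i < n" for i
    unfolding C_def by (rule member_le_sum) (use that in auto)
  have C: "0 \<le> C" unfolding C_def by (intro sum_nonneg) simp
  obtain N0 :: nat where N0: "C < real N0" using reals_Archimedean2 by blast
  have moments: "integrable (esd n x) (\<lambda>t. t ^ p)" "(\<integral>t. t ^ p \<partial>esd n x) = d p" for p
    unfolding d_def by (intro esd_integral, simp)+
  have db: "\<bar>d p\<bar> \<le> 1 * C ^ p" for p
  proof -
    have "\<bar>\<Sum>i<n. spectrum n x i ^ p\<bar> \<le> (\<Sum>i<n. C ^ p)"
      by (intro order_trans[OF sum_abs] sum_mono) (auto simp: power_abs intro!: power_mono sp)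
    then show ?thesis using n by (simp add: d_def field_simps)
  qed
  have d0: "d 0 = 1" using n by (simp add: d_def)
  have "(\<lambda>k. mass_part (esd n (u k)) q (real N)) \<longlonglongrightarrow> (\<Sum>j. (-1) ^ j * d (q + 2 * j) / real N ^ (2 * j))"
    if N: "N0 \<le> N" and q: "q \<le> 1" for N q
  proof -
    have CN: "C < real N" using N N0 by (meson less_le_trans of_nat_le_iff)
    then have y: "0 < real N" using C by linarith
    have "(\<lambda>k. mass_part (esd n (u k)) q (real N)) \<longlonglongrightarrow> mass_part (esd n x) q (real N)"
    proof (cases "q = 0")
      case True
      then show ?thesis unfolding True mass_part_stieltjes(1)[OF n y] by (intro tendsto_intros lim y)
    next
      case False
      then have q1: "q = 1" using q by simp
      show ?thesis unfolding q1 mass_part_stieltjes(2)[OF n y] by (intro tendsto_intros lim y)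
    qed
    moreover have "(\<lambda>j. (-1) ^ j * d (q + 2 * j) / real N ^ (2 * j)) sums mass_part (esd n x) q (real N)"
    proof -
      have "(\<lambda>j. (\<Sum>i<n. (-1) ^ j * spectrum n x i ^ (q + 2 * j) / real N ^ (2 * j)) / n) sums
          ((\<Sum>i<n. spectrum n x i ^ q * ((real N)\<^sup>2 / ((spectrum n x i)\<^sup>2 + (real N)\<^sup>2))) / n)"
        by (intro sums_divide sums_sum geometric_kernel) (use sp CN in force)
      moreover have "mass_part (esd n x) q (real N) = (\<Sum>i<n. spectrum n x i ^ q * ((real N)\<^sup>2 / ((spectrum n x i)\<^sup>2 + (real N)\<^sup>2))) / n"
        unfolding mass_part_def by (rule esd_integral) measurable
      moreover have "(\<Sum>i<n. (-1) ^ j * spectrum n x i ^ (q + 2 * j) / real N ^ (2 * j)) / n = (-1) ^ j * d (q + 2 * j) / real N ^ (2 * j)" for j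
        by (simp add: d_def sum_distrib_left sum_divide_distrib mult_ac)
      ultimately show ?thesis by simp
    qed
    ultimately show ?thesis by (simp add: sums_iff)
  qed
  from mass_part_moment_problem(4)[OF esd_real_distribution[OF n] db d0 C N0 this esd_real_distribution[OF n] moments]
  show ?thesis by blast
qed

text \<open>Continuity in the entries, without following individual eigenvalues: convergent entries
  give convergent Stieltjes transforms, hence weak convergence and small Levy distance, and the
  triangle inequality passes this on to the distance from \<open>\<mu>\<close>.\<close>

lemma levy_dist_esd_meas:
  assumes \<mu>: "real_distribution \<mu>"
  shows "(\<lambda>x. levy_dist (esd n x) \<mu>) \<in> borel_measurable borel"
proof (cases "n = 0")
  \<comment> \<open>For \<open>n = 0\<close> the measure is not a probability measure, but the
    matrix is empty and the function is constant.\<close>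
  case True
  have "esd n x = esd n (\<lambda>_. 0)" for x
  proof -
    have "sym_matrix (\<lambda>i j. x (i, j)) n = sym_matrix (\<lambda>i j. 0) n"
      by (rule eq_matI) (auto simp: sym_matrix_def True)
    then show ?thesis by (simp add: esd_def)
  qed
  then have "(\<lambda>x. levy_dist (esd n x) \<mu>) = (\<lambda>x. levy_dist (esd n (\<lambda>_. 0)) \<mu>)" by metis
  then show ?thesis by (metis borel_measurable_const)
next
  case False
  then have n: "0 < n" by simp
  note rd = esd_real_distribution[OF n]
  have "continuous_on UNIV (\<lambda>x. levy_dist (esd n x) \<mu>)"
  proof (rule continuous_on_sequentiallyI)
    fix u :: "nat \<Rightarrow> int \<times> int \<Rightarrow> real" and x assume u: "u \<longlonglongrightarrow> x"
    have "weak_conv_m (\<lambda>k. esd n (u k)) (esd n x)"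
      using continuous_on_tendsto_compose[OF stieltjes_continuous[OF _ n] u] by (intro esd_weak_conv n) auto
    from weak_conv_imp_levy_dist[OF rd rd this] have lim: "(\<lambda>k. levy_dist (esd n (u k)) (esd n x)) \<longlonglongrightarrow> 0" .
    have "\<bar>levy_dist (esd n (u k)) \<mu> - levy_dist (esd n x) \<mu>\<bar> \<le> levy_dist (esd n (u k)) (esd n x)" for k
      using levy_dist_triangle[OF rd rd \<mu>, of "u k" x] levy_dist_triangle[OF rd rd \<mu>, of x "u k"]
        levy_dist_sym[of "esd n (u k)" "esd n x"] by linarith
    then have "(\<lambda>k. levy_dist (esd n (u k)) \<mu> - levy_dist (esd n x) \<mu>) \<longlonglongrightarrow> 0"
      by (intro Lim_null_comparison[OF _ lim]) simp
    then show "(\<lambda>k. levy_dist (esd n (u k)) \<mu>) \<longlonglongrightarrow> levy_dist (esd n x) \<mu>" by (simp add: LIM_zero_iff)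
  qed
  then show ?thesis by (rule borel_measurable_continuous_onI)
qed

section \<open>Convergence to the limit law\<close>

context summable_filter
begin

text \<open>Large enough for \<open>4 * \<rho> \<le> growth\<^sup>2\<close>, which admits
  \<open>t = 1 / growth\<close> in \<open>moment_growth\<close>; the summand 1 makes it
  positive.\<close>

definition "growth = 2 * mass + 1"

text \<open>Integer heights from here on exceed \<open>growth\<close>, as the moment problem
  demands, and satisfy \<open>6 * mass\<^sup>2 \<le> N\<^sup>2\<close>, as the contraction
  demands.\<close>

definition threshold :: nat where "threshold = nat \<lceil>3 * mass + 2\<rceil>"

lemma threshold: "3 * mass + 1 < real threshold"
  unfolding threshold_def using mass_nonneg by linarith

lemma growth_less: "growth < real threshold"
  using threshold mass_nonneg by (simp add: growth_def)

lemma threshold_le: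
  assumes "threshold \<le> N"
  shows "0 < real N" "6 * mass\<^sup>2 \<le> (real N)\<^sup>2" "\<rho> * (1 / real N)\<^sup>2 \<le> 1 / 4"
proof -
  have N: "3 * mass \<le> real N" "0 < real N" using assms threshold mass_nonneg by linarith+
  show "0 < real N" by (rule N)
  have "(3 * mass)\<^sup>2 \<le> (real N)\<^sup>2" using N mass_nonneg by (intro power_mono) auto
  then have s: "9 * mass\<^sup>2 \<le> (real N)\<^sup>2" by (simp add: power_mult_distrib)
  then show "6 * mass\<^sup>2 \<le> (real N)\<^sup>2" using zero_le_power2[of mass] by linarith
  have "4 * \<rho> \<le> (real N)\<^sup>2" using s corr_mass \<rho>_nonneg by linarith
  then show "\<rho> * (1 / real N)\<^sup>2 \<le> 1 / 4" using N by (simp add: field_simps)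
qed

lemma moment_bound_growth: "\<bar>moment p 0\<bar> \<le> 2 * growth ^ p"
proof -
  have g: "0 < growth" using mass_nonneg by (simp add: growth_def)
  have "(2 * mass)\<^sup>2 \<le> growth\<^sup>2" using mass_nonneg by (intro power_mono) (auto simp: growth_def)
  then have "4 * \<rho> \<le> growth\<^sup>2" using corr_mass by (simp add: power_mult_distrib)
  then have "\<rho> * (1 / growth)\<^sup>2 \<le> 1 / 4" using g by (simp add: field_simps)
  from moment_growth[OF _ this, of p 0] show ?thesis using g by simp
qed

lemma moment_0_0: "moment 0 0 = 1"
  by (simp add: moment_0)

lemma limit_law_iff:
  "is_limit_law (corr c) \<mu> \<longleftrightarrow> real_distribution \<mu> \<and> (\<forall>p. integrable \<mu> (\<lambda>x. x ^ p)) \<and> (\<forall>p. (\<integral>x. x ^ p \<partial>\<mu>) = moment p 0)"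
proof
  assume L: "is_limit_law (corr c) \<mu>"
  interpret prob_space \<mu> using L by (simp add: is_limit_law_def)
  have "real_distribution \<mu>" using L by unfold_locales (simp add: is_limit_law_def)
  moreover have "(\<integral>x. x ^ p \<partial>\<mu>) = moment p 0" for p
  proof (cases "p = 0")
    case True
    then show ?thesis by (simp add: prob_space moment_0)
  next
    case False
    show ?thesis
    proof (cases "even p")
      case True
      then obtain m where "p = 2 * m" by (elim evenE)
      then show ?thesis using L False beta_eq_moment[of m] by (simp add: is_limit_law_def)
    next
      case False
      then show ?thesis using L by (simp add: is_limit_law_def moment_odd)
    qed
  qed
  ultimately show "real_distribution \<mu> \<and> (\<forall>p. integrable \<mu> (\<lambda>x. x ^ p)) \<and> (\<forall>p. (\<integral>x. x ^ p \<partial>\<mu>) = moment p 0)"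
    using L by (simp add: is_limit_law_def)
next
  assume R: "real_distribution \<mu> \<and> (\<forall>p. integrable \<mu> (\<lambda>x. x ^ p)) \<and> (\<forall>p. (\<integral>x. x ^ p \<partial>\<mu>) = moment p 0)"
  then interpret real_distribution \<mu> by simp
  show "is_limit_law (corr c) \<mu>"
    using R prob_space_axioms by (simp add: is_limit_law_def moment_odd beta_eq_moment)
qed

lemma limit_law_unique: "is_limit_law (corr c) \<mu> \<Longrightarrow> is_limit_law (corr c) \<mu>' \<Longrightarrow> \<mu> = \<mu>'"
  unfolding limit_law_iff using moments_unique[of \<mu> \<mu>' "\<lambda>p. moment p 0" 2 growth] moment_bound_growth by blast

text \<open>The factor \<open>N + N\<^sup>2\<close> serves both orders: order 0 uses
  \<open>N\<close> with the imaginary part, order 1 uses \<open>N\<^sup>2\<close> with the real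
  part.\<close>

lemma mass_part_close:
  assumes N: "threshold \<le> N" and q: "q \<le> 1" and n: "0 < n"
  shows "\<bar>mass_part (esd n x) q (real N) - (\<Sum>j. (-1) ^ j * moment (q + 2 * j) 0 / real N ^ (2 * j))\<bar>
    \<le> (real N + (real N)\<^sup>2) * cmod (stieltjes n x (real N) - green (real N) 0)"
proof -
  let ?d = "stieltjes n x (real N) - green (real N) 0"
  note y = threshold_le[OF N]
  note gm = green_moments[OF y(1,3)]
  show ?thesis
  proof (cases "q = 0")
    case True
    have "mass_part (esd n x) 0 (real N) - (\<Sum>j. (-1) ^ j * moment (0 + 2 * j) 0 / real N ^ (2 * j)) = real N * Im ?d"
      using gm(1) unfolding mass_part_stieltjes(1)[OF n y(1)] by (simp add: right_diff_distrib)
    then have "\<bar>mass_part (esd n x) 0 (real N) - (\<Sum>j. (-1) ^ j * moment (0 + 2 * j) 0 / real N ^ (2 * j))\<bar> = real N * \<bar>Im ?d\<bar>"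
      by (simp only: abs_mult abs_of_nat)
    also have "\<dots> \<le> (real N + (real N)\<^sup>2) * cmod ?d"
      by (intro mult_mono abs_Im_le_cmod) auto
    finally show ?thesis unfolding True .
  next
    case False
    then have q1: "q = 1" using q by simp
    have z: "(\<Sum>j. (-1) ^ j * moment (1 + 2 * j) 0 / real N ^ (2 * j)) = 0" by (simp add: moment_odd)
    have "mass_part (esd n x) 1 (real N) - (\<Sum>j. (-1) ^ j * moment (1 + 2 * j) 0 / real N ^ (2 * j)) = (real N)\<^sup>2 * Re ?d"
      unfolding z mass_part_stieltjes(2)[OF n y(1)] using gm(2) by simp
    then have "\<bar>mass_part (esd n x) 1 (real N) - (\<Sum>j. (-1) ^ j * moment (1 + 2 * j) 0 / real N ^ (2 * j))\<bar> = (real N)\<^sup>2 * \<bar>Re ?d\<bar>"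
      by (simp only: abs_mult abs_power2)
    also have "\<dots> \<le> (real N + (real N)\<^sup>2) * cmod ?d"
      by (intro mult_mono abs_Re_le_cmod) auto
    finally show ?thesis unfolding q1 .
  qed
qed

text \<open>Finitely many heights can be controlled in expectation simultaneously; as
  \<open>j\<close> grows they exhaust all integers from \<open>threshold\<close> on while the
  tolerance shrinks.\<close>

definition close_at :: "nat \<Rightarrow> nat \<Rightarrow> (int \<times> int \<Rightarrow> real) \<Rightarrow> bool" where
  "close_at j n x \<longleftrightarrow> (\<forall>N\<in>{threshold..threshold + j}. cmod (stieltjes n x (real N) - green (real N) 0) < 1 / real (Suc j))"

lemma close_mass_part_tendsto:
  assumes n: "\<And>j. 0 < n j" and close: "\<And>j. close_at j (n j) (x j)" and N: "threshold \<le> N" and q: "q \<le> 1"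
  shows "(\<lambda>j. mass_part (esd (n j) (x j)) q (real N)) \<longlonglongrightarrow> (\<Sum>j. (-1) ^ j * moment (q + 2 * j) 0 / real N ^ (2 * j))"
proof -
  let ?B = "real N + (real N)\<^sup>2" and ?t = "\<Sum>j. (-1) ^ j * moment (q + 2 * j) 0 / real N ^ (2 * j)"
  have "(\<lambda>j. mass_part (esd (n j) (x j)) q (real N) - ?t) \<longlonglongrightarrow> 0"
  proof (rule Lim_null_comparison)
    show "(\<lambda>j. ?B * (1 / real (Suc j))) \<longlonglongrightarrow> 0"
      using tendsto_mult_right_zero[OF LIMSEQ_inverse_real_of_nat, of ?B] by (simp add: inverse_eq_divide)
    show "\<forall>\<^sub>F j in sequentially. norm (mass_part (esd (n j) (x j)) q (real N) - ?t) \<le> ?B * (1 / real (Suc j))"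
      using eventually_ge_at_top[of "N"]
    proof eventually_elim
      case (elim j)
      have "cmod (stieltjes (n j) (x j) (real N) - green (real N) 0) \<le> 1 / real (Suc j)"
        using close[of j] N elim by (auto simp: close_at_def intro!: less_imp_le)
      then have "?B * cmod (stieltjes (n j) (x j) (real N) - green (real N) 0) \<le> ?B * (1 / real (Suc j))"
        by (intro mult_left_mono) auto
      then show ?case using mass_part_close[OF N q n[of j], of "x j"] by simp
    qed
  qed
  then show ?thesis by (simp add: LIM_zero_iff)
qed

lemma growth_nonneg: "0 \<le> growth"
  using mass_nonneg by (simp add: growth_def)

lemma limit_law_exists:
  assumes "\<And>j. \<exists>n x. 0 < n \<and> close_at j n x"
  shows "\<exists>\<mu>. is_limit_law (corr c) \<mu>"
proof -
  obtain n x where n: "\<And>j. 0 < n j" and cl: "\<And>j. close_at j (n j) (x j)" using assms by metis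
  from mass_part_moment_problem(3)[OF esd_real_distribution[OF n] moment_bound_growth moment_0_0 growth_nonneg growth_less close_mass_part_tendsto[OF n cl]]
  show ?thesis unfolding limit_law_iff by blast
qed

text \<open>A compactness argument free of probability: counterexamples for every \<open>j\<close>
  would form a sequence that converges weakly to \<open>\<mu>\<close> by the moment problem.
  Smallness of the Levy distance is thus reduced to finitely many Stieltjes transforms.\<close>

lemma close_imp_levy_small:
  assumes \<mu>: "is_limit_law (corr c) \<mu>" and \<delta>: "0 < \<delta>"
  shows "\<exists>j. \<forall>n x. 0 < n \<longrightarrow> close_at j n x \<longrightarrow> levy_dist (esd n x) \<mu> < \<delta>"
proof (rule ccontr)
  assume "\<not> ?thesis"
  then have "\<forall>j. \<exists>n x. 0 < n \<and> close_at j n x \<and> \<delta> \<le> levy_dist (esd n x) \<mu>" by (meson not_less)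
  then obtain n x where n: "\<And>j. 0 < n j" and cl: "\<And>j. close_at j (n j) (x j)"
    and far: "\<And>j. \<delta> \<le> levy_dist (esd (n j) (x j)) \<mu>" by metis
  have R: "real_distribution \<mu>" "\<And>p. integrable \<mu> (\<lambda>x. x ^ p)" "\<And>p. (\<integral>x. x ^ p \<partial>\<mu>) = moment p 0"
    using \<mu> unfolding limit_law_iff by auto
  have "weak_conv_m (\<lambda>j. esd (n j) (x j)) \<mu>"
    by (rule mass_part_moment_problem(4)[OF esd_real_distribution[OF n] moment_bound_growth moment_0_0 growth_nonneg growth_less close_mass_part_tendsto[OF n cl] R])
  from weak_conv_imp_levy_dist[OF esd_real_distribution[OF n] R(1) this]
  have "\<forall>\<^sub>F j in sequentially. levy_dist (esd (n j) (x j)) \<mu> < \<delta>" using \<delta> by (rule order_tendstoD)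
  then obtain j where "levy_dist (esd (n j) (x j)) \<mu> < \<delta>" by (auto simp: eventually_sequentially)
  with far[of j] show False by simp
qed

end

section \<open>From mean deviations to convergence in probability\<close>

context filtered_noise
begin

definition entries :: "'a \<Rightarrow> int \<times> int \<Rightarrow> real" where "entries \<omega> = (\<lambda>(i, j). Z i j \<omega>)"

definition total_dev :: "nat \<Rightarrow> nat \<Rightarrow> 'a \<Rightarrow> real" where
  "total_dev j n \<omega> = (\<Sum>N\<in>{threshold..threshold + j}. cmod (stieltjes n (entries \<omega>) (real N) - green (real N) 0))"

lemma entries_meas: "entries \<in> M \<rightarrow>\<^sub>M borel"
  unfolding entries_def[abs_def] by (rule measurable_coordinatewise_then_product) (simp add: case_prod_unfold)

lemma close_if_total_dev: "total_dev j n \<omega> < 1 / real (Suc j) \<Longrightarrow> close_at j n (entries \<omega>)"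
  unfolding close_at_def total_dev_def
proof
  fix N assume s: "(\<Sum>N\<in>{threshold..threshold + j}. cmod (stieltjes n (entries \<omega>) (real N) - green (real N) 0)) < 1 / real (Suc j)"
    and N: "N \<in> {threshold..threshold + j}"
  show "cmod (stieltjes n (entries \<omega>) (real N) - green (real N) 0) < 1 / real (Suc j)"
    by (rule le_less_trans[OF member_le_sum[OF N] s]) auto
qed

lemma dev_integrable:
  assumes N: "threshold \<le> N" and n: "0 < n"
  shows "integrable M (\<lambda>\<omega>. cmod (stieltjes n (entries \<omega>) (real N) - green (real N) 0))"
proof (rule integrable_const_bound[of _ "1 / real N + 2 / real N"])
  note y = threshold_le[OF N]
  show "AE \<omega> in M. norm (cmod (stieltjes n (entries \<omega>) (real N) - green (real N) 0)) \<le> 1 / real N + 2 / real N"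
    by (intro AE_I2) (simp only: real_norm_def abs_norm_cancel, intro order_trans[OF norm_triangle_ineq4] add_mono stieltjes_bound[OF y(1) n] green_bound[OF y(1,3)])
  have "(\<lambda>\<omega>. stieltjes n (entries \<omega>) (real N)) \<in> borel_measurable M"
    by (rule measurable_compose[OF entries_meas borel_measurable_continuous_onI[OF stieltjes_continuous[OF y(1) n]]])
  then show "(\<lambda>\<omega>. cmod (stieltjes n (entries \<omega>) (real N) - green (real N) 0)) \<in> borel_measurable M" by simp
qed

lemma total_dev_integrable: "0 < n \<Longrightarrow> integrable M (total_dev j n)"
  unfolding total_dev_def[abs_def] by (intro Bochner_Integration.integrable_sum dev_integrable) auto

lemma total_dev_tendsto: "(\<lambda>n. expectation (total_dev j n)) \<longlonglongrightarrow> 0"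
proof (rule Lim_transform_eventually)
  show "(\<lambda>n. \<Sum>N\<in>{threshold..threshold + j}. expectation (\<lambda>\<omega>. cmod (stieltjes n (entries \<omega>) (real N) - green (real N) 0))) \<longlonglongrightarrow> 0"
    unfolding entries_def by (intro tendsto_null_sum stieltjes_convergence threshold_le) auto
  show "\<forall>\<^sub>F n in sequentially. (\<Sum>N\<in>{threshold..threshold + j}. expectation (\<lambda>\<omega>. cmod (stieltjes n (entries \<omega>) (real N) - green (real N) 0))) = expectation (total_dev j n)"
    using eventually_gt_at_top[of 0]
  proof eventually_elim
    case (elim n)
    show ?case unfolding total_dev_def
      by (rule Bochner_Integration.integral_sum[symmetric]) (intro dev_integrable elim, simp)
  qed
qed

text \<open>
  The limit law is obtained by sampling: realisations of ever larger matrices whose Stieltjes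
  transforms are close to the Green function form a tight sequence.
\<close>

lemma sample_exists: "\<exists>n x. 0 < n \<and> close_at j n x"
proof -
  have "\<forall>\<^sub>F n in sequentially. expectation (total_dev j n) < 1 / real (Suc j)"
    using total_dev_tendsto by (rule order_tendstoD) simp
  then have "\<forall>\<^sub>F n in sequentially. 0 < n \<and> expectation (total_dev j n) < 1 / real (Suc j)"
    using eventually_gt_at_top[of 0] by eventually_elim simp
  then obtain n where n: "0 < n" "expectation (total_dev j n) < 1 / real (Suc j)"
    by (auto simp: eventually_sequentially)
  have "\<exists>\<omega>. total_dev j n \<omega> < 1 / real (Suc j)"
  proof (rule ccontr)
    assume "\<not> ?thesis"
    then have "expectation (\<lambda>\<omega>. 1 / real (Suc j)) \<le> expectation (total_dev j n)"
      by (intro integral_mono total_dev_integrable n) (auto simp: not_less)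
    then show False using n(2) by (simp add: prob_space)
  qed
  then show ?thesis using n close_if_total_dev by blast
qed

text \<open>Unless \<open>total_dev\<close> reaches \<open>1 / (j + 1)\<close>, the Levy distance is
  below \<open>\<delta>\<close>; Markov's inequality bounds the probability of that event for the
  fixed \<open>j\<close>.\<close>

theorem esd_convergence:
  assumes \<mu>: "is_limit_law (corr c) \<mu>"
  shows "weakly_converges_in_prob M (\<lambda>n \<omega>. esd n (entries \<omega>)) \<mu>"
  unfolding weakly_converges_in_prob_def converges_in_prob_def
proof (intro conjI allI impI)
  have R: "real_distribution \<mu>" using \<mu> unfolding limit_law_iff by simp
  show "(\<lambda>\<omega>. levy_dist (esd n (entries \<omega>)) \<mu>) \<in> borel_measurable M" for n
    by (rule measurable_compose[OF entries_meas levy_dist_esd_meas[OF R]])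
  fix \<delta> :: real assume "0 < \<delta>"
  from close_imp_levy_small[OF \<mu> this] obtain j where
    j: "\<And>n x. 0 < n \<Longrightarrow> close_at j n x \<Longrightarrow> levy_dist (esd n x) \<mu> < \<delta>" by blast
  let ?e = "1 / real (Suc j)"
  show "(\<lambda>n. measure M {\<omega> \<in> space M. \<delta> < \<bar>levy_dist (esd n (entries \<omega>)) \<mu> - 0\<bar>}) \<longlonglongrightarrow> 0"
  proof (rule tendsto_sandwich[OF _ _ tendsto_const])
    show "(\<lambda>n. expectation (total_dev j n) / ?e) \<longlonglongrightarrow> 0"
      using tendsto_divide[OF total_dev_tendsto tendsto_const, of ?e] by simp
    show "\<forall>\<^sub>F n in sequentially. measure M {\<omega> \<in> space M. \<delta> < \<bar>levy_dist (esd n (entries \<omega>)) \<mu> - 0\<bar>} \<le> expectation (total_dev j n) / ?e"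
      using eventually_gt_at_top[of 0]
    proof eventually_elim
      case (elim n)
      note ti = total_dev_integrable[OF elim, of j]
      have "{\<omega> \<in> space M. \<delta> < \<bar>levy_dist (esd n (entries \<omega>)) \<mu> - 0\<bar>} \<subseteq> {\<omega> \<in> space M. ?e \<le> total_dev j n \<omega>}"
      proof safe
        fix \<omega> assume far: "\<delta> < \<bar>levy_dist (esd n (entries \<omega>)) \<mu> - 0\<bar>"
        show "?e \<le> total_dev j n \<omega>"
        proof (rule ccontr)
          assume "\<not> ?e \<le> total_dev j n \<omega>"
          then have "levy_dist (esd n (entries \<omega>)) \<mu> < \<delta>" by (intro j elim close_if_total_dev) simp
          with far levy_dist_nonneg[OF esd_real_distribution[OF elim] R, of "entries \<omega>"] show False by simp
        qed
      qed
      then have "measure M {\<omega> \<in> space M. \<delta> < \<bar>levy_dist (esd n (entries \<omega>)) \<mu> - 0\<bar>} \<le> measure M {\<omega> \<in> space M. ?e \<le> total_dev j n \<omega>}"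
        using borel_measurable_integrable[OF ti] by (intro finite_measure_mono) measurable
      also have "\<dots> \<le> expectation (total_dev j n) / ?e"
        by (rule integral_Markov_inequality_measure[OF ti sets.empty_sets]) (auto simp: total_dev_def intro!: AE_I2 sum_nonneg)
      finally show ?case .
    qed
  qed auto
qed

end

theorem theorem5p1:
  fixes M :: "'a measure"
    and \<epsilon> :: "int \<Rightarrow> int \<Rightarrow> 'a \<Rightarrow> real"
    and c :: "int \<Rightarrow> int \<Rightarrow> real"
    and Z :: "int \<Rightarrow> int \<Rightarrow> 'a \<Rightarrow> real"
  assumes "prob_space M"
    and "prob_space.indep_vars M (\<lambda>_. borel) (\<lambda>(i, j). \<epsilon> i j) (UNIV :: (int \<times> int) set)"
    and "\<And>i j. integrable M (\<epsilon> i j) \<and> prob_space.expectation M (\<epsilon> i j) = 0"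
    and "\<And>i j. integrable M (\<lambda>\<omega>. (\<epsilon> i j \<omega>)\<^sup>2) \<and> prob_space.variance M (\<epsilon> i j) = 1"
    and "\<And>\<eta>. 0 < \<eta> \<Longrightarrow>
      (\<lambda>n. 1 / (real n)\<^sup>2 * (\<Sum>i = 1..int n. \<Sum>j = 1..int n.
        prob_space.expectation M
          (\<lambda>\<omega>. (\<epsilon> i j \<omega>)\<^sup>2 * indicator {\<omega>. \<eta> * sqrt (real n) < \<bar>\<epsilon> i j \<omega>\<bar>} \<omega>)))
      \<longlonglongrightarrow> 0"
    and "(\<lambda>(k, l). \<bar>c k l\<bar>) summable_on UNIV"
    and "0 < (\<Sum>\<^sub>\<infinity>(k, l)\<in>UNIV. \<bar>c k l\<bar>)"
    and "\<And>k l. c k l = c l k"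
    and "\<And>i j. has_L2_sum M (\<lambda>(k, l) \<omega>. c k l * \<epsilon> (i - k) (j - l) \<omega>) (Z i j)"
  shows "(\<exists>!\<mu>. is_limit_law (corr c) \<mu>) \<and>
    (\<forall>\<mu>. is_limit_law (corr c) \<mu> \<longrightarrow>
      weakly_converges_in_prob M
        (\<lambda>n \<omega>. scaled_esd (sym_matrix (\<lambda>i j. Z i j \<omega>) n)) \<mu>)"
proof -
  interpret prob_space M by (rule assms(1))
  interpret filtered_noise M "\<lambda>(i, j). \<epsilon> i j" c Z
  proof unfold_locales
    show "indep_vars (\<lambda>_. borel) (\<lambda>(i, j). \<epsilon> i j) UNIV" by (rule assms(2))
    \<comment> \<open>The variance is centred at the mean, which is 0, so it is the plain second
      moment required here.\<close>
    show "integrable M ((\<lambda>(i, j). \<epsilon> i j) s)" "expectation ((\<lambda>(i, j). \<epsilon> i j) s) = 0"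
      "integrable M (\<lambda>\<omega>. ((\<lambda>(i, j). \<epsilon> i j) s \<omega>)\<^sup>2)" "expectation (\<lambda>\<omega>. ((\<lambda>(i, j). \<epsilon> i j) s \<omega>)\<^sup>2) = 1" for s
      using assms(3)[of "fst s" "snd s"] assms(4)[of "fst s" "snd s"] by (simp_all add: case_prod_unfold)
  qed (use assms(5,6,8,9) in simp_all)
  have eq: "scaled_esd (sym_matrix (\<lambda>i j. Z i j \<omega>) n) = esd n (entries \<omega>)" for n \<omega>
    by (simp add: esd_def entries_def)
  show ?thesis
    unfolding eq using limit_law_exists[OF sample_exists] limit_law_unique esd_convergence by blast
qed

end
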